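(* Let $v$ be a prime of $F$ and $n$ a positive integer. Let $\phi$ be a Drinfeld $\mathbb{F}_q[t]$-module of rank $2$ over $K$ with $j$-invariant $\boldsymbol{j}$. Let $\pi\in\mathbb{F}_q[t]$ be a polynomial of degree $1$ such that $v\nmid\pi$. Assume - if $v$ is infinite: $p\nmid v(\boldsymbol{j})$ and $v(\boldsymbol{j})<v(\pi)q$; - if $v$ is finite: $q\neq 2$, $p\nmid v(\boldsymbol{j})$ and $v(\boldsymbol{j})<0$. Then there exists an $\mathbb{F}_q$-basis $\{\xi_{-n},\ldots,\xi_{-1},\xi_n,\ldots,\xi_1\}$ of $\phi[\pi^n]$ such that - $\xi_{-1}$ and $\xi_1$ are nonzero roots of $\phi_\pi(X)$ with $v(\xi_{-1})>v(\xi_1)$; - for $i\ge 2$, $\xi_{-i}$ (resp. $\xi_i$) is a root of $\phi_\pi(X)-\xi_{-(i-1)}$ (resp. $\phi_\pi(X)-\xi_{i-1}$) whose valuation is the largest among the valuations of all roots of that polynomial. With respect to such bases the following hold. (1) Assume $v$ is infinite. Let $m$ be the integer such that $v(\boldsymbol{j})\in(v(\pi)q^{m+1},v(\pi)q^m)$. For $n\ge m$, the wild ramification subgroup of $K(\phi[\pi^n])/K$ is identified with that of $K(\phi[\pi^m])/K$ and is isomorphic to $(\mathbb{Z}/p\mathbb{Z})^{sm}$. It is generated by elements $\sigma_{l,u}$ for $l=1,\ldots,m$ and $u\in\mathbb{F}_q$ such that each $\sigma_{l,u}$ acts on the basis $\{\xi_{-m},\ldots,\xi_{-1},\xi_m,\ldots,\xi_1\}$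 of $\phi[\pi^m]$ via the matrix with coefficients in $\mathbb{F}_q$ $$\begin{pmatrix} I_m & 0\\ u\cdot A_{m,l} & I_m\end{pmatrix}.$$ (2) Assume $v$ is finite. For any $n$, the wild ramification subgroup of $K(\phi[\pi^n])/K$ is isomorphic to $(\mathbb{Z}/p\mathbb{Z})^{sn}$. It is generated by elements $\sigma_{l,u}$ for $l=1,\ldots,n$ and $u\in\mathbb{F}_q$ such that each $\sigma_{l,u}$ acts on the basis $\{\xi_{-n},\ldots,\xi_{-1},\xi_n,\ldots,\xi_1\}$ of $\phi[\pi^n]$ via the matrix $$\begin{pmatrix} I_n & 0\\ u\cdot A_{n,l} & I_n\end{pmatrix}.$$ Here $I_k$ is the $k\times k$ identity matrix and $A_{k,l}$ is the $k\times k$ matrix $(\delta_{i,j-l+1})_{ij}$ with $\delta$ the Kronecker delta. The matrices act on the column vector of the ordered basis, so $\sigma_{l,u}$ fixes every $\xi_{-i}$, fixes $\xi_i$ for $i<l$, and sends $\xi_i$ to $\xi_i+u\,\xi_{-(i-l+1)}$ for $i\ge l$.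
   Context: $p$ is a prime, $q=p^s$, and $F$ is a finite extension of $\mathbb{F}_q(t)$. A prime $v$ of $F$ is infinite if it lies above the prime $(1/t)$ of $\mathbb{F}_q(t)$, and finite otherwise. $v$ also denotes the associated valuation normalized by $v(F^\times)=\mathbb{Z}$. $K$ is the completion of $F$ at $v$, and $v$ is extended uniquely to a fixed separable closure $K^{\mathrm{sep}}$. $v\nmid\pi$ means that $v$ does not lie above the prime $(\pi)$ of $\mathbb{F}_q[t]$ (automatic if $v$ is infinite). A rank $2$ Drinfeld $\mathbb{F}_q[t]$-module $\phi$ over $K$ is given by $\phi_t(X)=tX+a_1X^q+a_2X^{q^2}\in K[X]$ with $a_2\ne0$. This determines $\phi_a(X)$ for all $a\in\mathbb{F}_q[t]$ through the $\mathbb{F}_q$-algebra homomorphism $a\mapsto\phi_a$ to $\mathbb{F}_q$-linear polynomials (with composition as multiplication). $\phi[a]\subset K^{\mathrm{sep}}$ is the set of roots of $\phi_a(X)$, and $\boldsymbol{j}=a_1^{q+1}/a_2$ (with $v(0)=+\infty$). The wild ramification subgroup of a finite Galois extension $L/K$ is the first lower ramification subgroup $G(L/K)_1$ of its Galois group $G(L/K)$. *)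

theory Defs
  imports
    Complex_Main
    "HOL-Library.Extended_Real"
    "HOL-Algebra.Algebraic_Closure_Type"
    "HOL-Algebra.Finite_Extensions"
    "HOL-Algebra.Generated_Fields"
    "HOL-Algebra.Bij"
    "HOL-Algebra.Elementary_Groups"
    "HOL-Algebra.Product_Groups"
    "Jordan_Normal_Form.Matrix"
begin

text \<open>
  The whole type \<open>'a\<close> plays the role of the separable closure of \<open>K\<close>; the fields
  \<open>\<bbbF>\<^sub>q \<subseteq> \<bbbF>\<^sub>q(t) \<subseteq> F \<subseteq> K\<close> are subsets of it.
\<close>

abbreviation Ksep :: "'a::field ring"
  where "Ksep \<equiv> ring_of_type_algebra"

text \<open>The polynomial ring \<open>\<bbbF>\<^sub>q[x]\<close> as a subring of \<open>'a\<close>, for \<open>x\<close> transcendental.\<close>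

definition poly_subring :: "'a::field set \<Rightarrow> 'a \<Rightarrow> 'a set"
  where "poly_subring k x = {poly f x | f. set (coeffs f) \<subseteq> k}"

definition degree_one_in :: "'a::field set \<Rightarrow> 'a \<Rightarrow> 'a \<Rightarrow> bool"
  where "degree_one_in k x a \<longleftrightarrow>
    (\<exists>f. set (coeffs f) \<subseteq> k \<and> Polynomial.degree f = 1 \<and> a = poly f x)"

definition function_field :: "'a::field set \<Rightarrow> 'a \<Rightarrow> 'a set \<Rightarrow> bool"
  where "function_field k t F \<longleftrightarrow>
    subfield k Ksep \<and> subfield F Ksep \<and>
    ring.transcendental Ksep k t \<and>
    generate_field Ksep (insert t k) \<subseteq> F \<and>
    ring.finite_dimension Ksep (generate_field Ksep (insert t k)) F"

definition valuation :: "('a::field \<Rightarrow> ereal) \<Rightarrow> bool"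
  where "valuation v \<longleftrightarrow>
    (\<forall>x. v x \<noteq> -\<infinity>) \<and> (\<forall>x. v x = \<infinity> \<longleftrightarrow> x = 0) \<and>
    (\<forall>x y. v (x * y) = v x + v y) \<and>
    (\<forall>x y. min (v x) (v y) \<le> v (x + y))"

text \<open>A prime of \<open>F\<close> is given by its valuation, normalized to have value group \<open>\<int>\<close> on \<open>F\<close>.\<close>

definition normalized_on :: "('a::field \<Rightarrow> ereal) \<Rightarrow> 'a set \<Rightarrow> bool"
  where "normalized_on v F \<longleftrightarrow> v ` (F - {0}) = range (\<lambda>k::int. ereal (of_int k))"

definition is_completion :: "('a::field \<Rightarrow> ereal) \<Rightarrow> 'a set \<Rightarrow> 'a set \<Rightarrow> bool"
  where "is_completion v F K \<longleftrightarrow>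
    subfield K Ksep \<and> F \<subseteq> K \<and>
    (\<forall>x\<in>K. \<forall>N::real. \<exists>y\<in>F. v (x - y) > ereal N) \<and>
    (\<forall>c::nat \<Rightarrow> 'a.
       (\<forall>i. c i \<in> K) \<and> (\<forall>N::real. \<exists>M. \<forall>i\<ge>M. \<forall>j\<ge>M. v (c i - c j) > ereal N)
       \<longrightarrow> (\<exists>x\<in>K. \<forall>N::real. \<exists>M. \<forall>i\<ge>M. v (c i - x) > ereal N))"

definition separable_poly :: "'a::field poly \<Rightarrow> bool"
  where "separable_poly f \<longleftrightarrow> coprime f (pderiv f)"

definition UNIV_is_separable_closure_of :: "'a::field set \<Rightarrow> bool"
  where "UNIV_is_separable_closure_of K \<longleftrightarrow>
    (\<forall>x::'a. \<exists>f. set (coeffs f) \<subseteq> K \<and> separable_poly f \<and> poly f x = 0) \<and>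
    (\<forall>f::'a poly. separable_poly f \<and> Polynomial.degree f > 0 \<longrightarrow> (\<exists>x. poly f x = 0))"

text \<open>
  The prime of \<open>v\<close> lies above the prime ideal of the subring \<open>A\<close> generated by \<open>w\<close>.
\<close>

definition lies_above :: "('a::field \<Rightarrow> ereal) \<Rightarrow> 'a set \<Rightarrow> 'a \<Rightarrow> bool"
  where "lies_above v A w \<longleftrightarrow>
    (\<forall>a\<in>A. 0 \<le> v a) \<and> {a \<in> A. 0 < v a} = (\<lambda>a. w * a) ` A"

definition infinite_prime :: "('a::field \<Rightarrow> ereal) \<Rightarrow> 'a set \<Rightarrow> 'a \<Rightarrow> bool"
  where "infinite_prime v k t \<longleftrightarrow> lies_above v (poly_subring k (1 / t)) (1 / t)"

text \<open>
  \<open>\<phi>\<close> sends \<open>a \<in> \<bbbF>\<^sub>q[t]\<close> to \<open>\<phi>\<^sub>a(X)\<close>; its values outside \<open>\<bbbF>\<^sub>q[t]\<close> are irrelevant.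
\<close>

definition drinfeld_module_rank2 ::
    "'a::field set \<Rightarrow> 'a \<Rightarrow> 'a set \<Rightarrow> 'a \<Rightarrow> 'a \<Rightarrow> ('a \<Rightarrow> 'a poly) \<Rightarrow> bool"
  where "drinfeld_module_rank2 k t K a1 a2 \<phi> \<longleftrightarrow>
    a1 \<in> K \<and> a2 \<in> K \<and> a2 \<noteq> 0 \<and>
    \<phi> t = Polynomial.monom t 1 + Polynomial.monom a1 (card k) + Polynomial.monom a2 ((card k)\<^sup>2) \<and>
    (\<forall>c\<in>k. \<phi> c = Polynomial.monom c 1) \<and>
    (\<forall>a\<in>poly_subring k t. \<forall>b\<in>poly_subring k t.
       \<phi> (a + b) = \<phi> a + \<phi> b \<and> \<phi> (a * b) = pcompose (\<phi> a) (\<phi> b))"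

definition torsion :: "('a::field \<Rightarrow> 'a poly) \<Rightarrow> 'a \<Rightarrow> 'a set"
  where "torsion \<phi> a = {x. poly (\<phi> a) x = 0}"

definition adjoin :: "'a::field set \<Rightarrow> 'a set \<Rightarrow> 'a set"
  where "adjoin K S = generate_field Ksep (K \<union> S)"

text \<open>
  Automorphisms of \<open>L\<close> over \<open>K\<close>, as functions that are \<open>undefined\<close> outside \<open>L\<close>.
\<close>

definition galois_group :: "'a::field set \<Rightarrow> 'a set \<Rightarrow> ('a \<Rightarrow> 'a) monoid"
  where "galois_group L K = BijGroup L \<lparr>carrier :=
    {\<sigma> \<in> Bij L. \<sigma> \<in> Ring.ring_hom (Ksep\<lparr>carrier := L\<rparr>) (Ksep\<lparr>carrier := L\<rparr>) \<and> (\<forall>x\<in>K. \<sigma> x = x)}\<rparr>"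

text \<open>
  If \<open>v\<close> has value group \<open>\<int>\<close> on \<open>K\<close> and \<open>L/K\<close> is finite, then \<open>v(L\<^sup>\<times>) = (1/e)\<int>\<close>, so that
  \<open>e \<cdot> v\<close> is the normalized valuation of \<open>L\<close>.
\<close>

definition ramification_index :: "('a::field \<Rightarrow> ereal) \<Rightarrow> 'a set \<Rightarrow> nat"
  where "ramification_index v L =
    (THE e. 0 < e \<and> normalized_on (\<lambda>x. ereal (real e) * v x) L)"

definition ramification_subgroup ::
    "('a::field \<Rightarrow> ereal) \<Rightarrow> 'a set \<Rightarrow> 'a set \<Rightarrow> nat \<Rightarrow> ('a \<Rightarrow> 'a) set"
  where "ramification_subgroup v L K i =
    {\<sigma> \<in> carrier (galois_group L K). \<forall>x\<in>L. 0 \<le> v x \<longrightarrow>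
       ereal (real i + 1) \<le> ereal (real (ramification_index v L)) * v (\<sigma> x - x)}"

definition wild_group :: "('a::field \<Rightarrow> ereal) \<Rightarrow> 'a set \<Rightarrow> 'a set \<Rightarrow> ('a \<Rightarrow> 'a) monoid"
  where "wild_group v L K = galois_group L K \<lparr>carrier := ramification_subgroup v L K 1\<rparr>"

text \<open>The list \<open>\<xi>\<^sub>-\<^sub>n, \<dots>, \<xi>\<^sub>-\<^sub>1, \<xi>\<^sub>n, \<dots>, \<xi>\<^sub>1\<close>.\<close>

definition xi_list :: "nat \<Rightarrow> (int \<Rightarrow> 'a) \<Rightarrow> 'a list"
  where "xi_list n \<xi> = map \<xi> ([- int n..-1] @ rev [1..int n])"

definition largest_root :: "('a::field \<Rightarrow> ereal) \<Rightarrow> 'a poly \<Rightarrow> 'a \<Rightarrow> bool"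
  where "largest_root v f x \<longleftrightarrow> poly f x = 0 \<and> (\<forall>y. poly f y = 0 \<longrightarrow> v y \<le> v x)"

definition adapted_basis ::
    "'a::field set \<Rightarrow> ('a \<Rightarrow> ereal) \<Rightarrow> ('a \<Rightarrow> 'a poly) \<Rightarrow> 'a \<Rightarrow> nat \<Rightarrow> (int \<Rightarrow> 'a) \<Rightarrow> bool"
  where "adapted_basis k v \<phi> \<pi> n \<xi> \<longleftrightarrow>
    ring.independent Ksep k (xi_list n \<xi>) \<and>
    ring.Span Ksep k (xi_list n \<xi>) = torsion \<phi> (\<pi> ^ n) \<and>
    \<xi> (-1) \<noteq> 0 \<and> \<xi> 1 \<noteq> 0 \<and>
    poly (\<phi> \<pi>) (\<xi> (-1)) = 0 \<and> poly (\<phi> \<pi>) (\<xi> 1) = 0 \<and> v (\<xi> (-1)) > v (\<xi> 1) \<and>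
    (\<forall>i\<in>{2..int n}.
       largest_root v (\<phi> \<pi> - [:\<xi> (- (i - 1)):]) (\<xi> (- i)) \<and>
       largest_root v (\<phi> \<pi> - [:\<xi> (i - 1):]) (\<xi> i))"

text \<open>
  \<open>A\<^bsub>k,l\<^esub> = (\<delta>\<^bsub>i,j-l+1\<^esub>)\<close> with \<open>1 \<le> i, j \<le> k\<close>; matrix indices start at \<open>0\<close> below, which turns
  \<open>i = j - l + 1\<close> into \<open>i + l = j + 1\<close>.
\<close>

definition A_mat :: "nat \<Rightarrow> nat \<Rightarrow> 'a::field mat"
  where "A_mat k l = mat k k (\<lambda>(i, j). if i + l = j + 1 then 1 else 0)"

definition sigma_mat :: "nat \<Rightarrow> nat \<Rightarrow> 'a \<Rightarrow> 'a::field mat"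
  where "sigma_mat k l u =
    four_block_mat (1\<^sub>m k) (0\<^sub>m k k) (u \<cdot>\<^sub>m A_mat k l) (1\<^sub>m k)"

definition acts_via :: "('a::field \<Rightarrow> 'a) \<Rightarrow> 'a list \<Rightarrow> 'a mat \<Rightarrow> bool"
  where "acts_via \<sigma> bs M \<longleftrightarrow> vec_of_list (map \<sigma> bs) = M *\<^sub>v vec_of_list bs"

definition generated_by_sigmas ::
    "'a::field set \<Rightarrow> ('a \<Rightarrow> ereal) \<Rightarrow> 'a set \<Rightarrow> 'a set \<Rightarrow> nat \<Rightarrow> (int \<Rightarrow> 'a) \<Rightarrow> bool"
  where "generated_by_sigmas k v L K r \<xi> \<longleftrightarrow>
    (\<exists>\<sigma>. (\<forall>l\<in>{1..r}. \<forall>u\<in>k. \<sigma> l u \<in> carrier (wild_group v L K) \<and>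
                             acts_via (\<sigma> l u) (xi_list r \<xi>) (sigma_mat r l u)) \<and>
         generate (galois_group L K) {\<sigma> l u | l u. l \<in> {1..r} \<and> u \<in> k}
           = carrier (wild_group v L K))"

text \<open>The group \<open>(\<int>/p\<int>)\<^sup>d\<close>.\<close>

definition elementary_abelian :: "nat \<Rightarrow> nat \<Rightarrow> (nat \<Rightarrow> int) monoid"
  where "elementary_abelian p d = product_group {..<d} (\<lambda>_. integer_mod_group p)"

definition int_val_coprime :: "nat \<Rightarrow> ereal \<Rightarrow> bool"
  where "int_val_coprime p r \<longleftrightarrow> (\<exists>k::int. r = ereal (of_int k) \<and> \<not> int p dvd k)"

end

theory Submission
  imports Defs
begin

text \<open>
  Write \<open>\<phi>\<^sub>\<pi> = \<pi>X + b\<^sub>1X\<^bsup>q\<^esup> + b\<^sub>2X\<^bsup>q\<^sup>2\<^esup>\<close>. Since \<open>v(j) < q v(\<pi>)\<close>, its nonzero roots have exactly two valuations,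
  and the maximality conditions determine all \<open>v(\<xi>\<^bsub>\<plusminus>i\<^esub>)\<close>. A wild automorphism \<open>\<sigma>\<close> satisfies
  \<open>v(\<sigma>x - x) > v(x)\<close>; with these valuations this forces it to fix each \<open>\<xi>\<^bsub>-i\<^esub>\<close> and to act on the \<open>\<xi>\<^sub>i\<close> by a
  combination of the \<open>A\<^sub>l\<close>, where only \<open>l \<le> r\<close> occur (\<open>r = m\<close> for infinite and \<open>r = n\<close> for finite \<open>v\<close>).
  Conversely, there is an extension \<open>T\<close> of \<open>K\<close> all of whose automorphisms are wild and whose value group
  has denominators prime to \<open>p\<close>. From \<open>(q - 1) v(\<xi>\<^sub>r) = - v(b\<^sub>1) + v(j) / q\<^bsup>r\<^esup>\<close> and \<open>p \<nmid> v(j)\<close>, the element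
  \<open>\<xi>\<^sub>r\<close> has at least \<open>q\<^bsup>r\<^esup>\<close> conjugates over \<open>T\<close>, so all \<open>q\<^bsup>r\<^esup>\<close> combinations are realized.
\<close>

section \<open>Subfields of a field type\<close>

text \<open>Only the restriction of \<open>v\<close> to \<open>F\<close> is tied to a prime, so even
  its invariance under automorphisms has to be derived: completeness of \<open>K\<close> makes
  coordinates in finite extensions bounded functions, and this forces uniqueness of the extension.
  Matching wildness with the first ramification group needs a residue field that is algebraic over a
  finite field, so that units are \<open>p\<close>-th powers modulo the maximal ideal; this comes
  from \<open>F\<close> being algebraic over \<open>k(t)\<close>. In equal characteristic
  Teichmueller representatives form a field, so residues are handled by elements of the separable
  closure itself. The field \<open>T\<close> contains these representatives and an
  \<open>N\<close>-th root of a uniformizer, where \<open>N\<close> is the prime-to-\<open>p\<close>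
  part of the ramification index of \<open>L\<close>; over it nothing but \<open>p\<close>-power
  behaviour is left in \<open>L\<close>. Newton polygons are replaced by the factorization of
  \<open>f\<close> over its roots: evaluated at one element of large valuation it counts the roots
  of each valuation, and at a root of maximal valuation of \<open>f X = y\<close> it expresses v(y)
  through a strictly increasing function, which is then inverted along the tower.\<close>

lemma Ksep_simps [simp]:
  "carrier (Ksep :: 'a::field ring) = UNIV" "\<one>\<^bsub>(Ksep :: 'a ring)\<^esub> = 1" "\<zero>\<^bsub>(Ksep :: 'a ring)\<^esub> = 0"
  "x \<otimes>\<^bsub>(Ksep :: 'a ring)\<^esub> y = x * y" "x \<oplus>\<^bsub>(Ksep :: 'a ring)\<^esub> y = x + y"
  by (simp_all add: ring_of_type_algebra_def)

lemma field_Ksep: "field (Ksep :: 'a::field ring)"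
  by (rule field_from_type_algebra)

lemma ring_Ksep: "ring (Ksep :: 'a::field ring)"
  by (rule ring_from_type_algebra)

lemma Ksep_a_inv [simp]: "\<ominus>\<^bsub>(Ksep :: 'a::field ring)\<^esub> x = - x"
proof -
  interpret field "Ksep :: 'a ring" by (rule field_Ksep)
  show ?thesis using minus_equality[of "- x" x] by simp
qed

lemma Ksep_m_inv [simp]: "x \<noteq> 0 \<Longrightarrow> inv\<^bsub>(Ksep :: 'a::field ring)\<^esub> x = inverse x"
proof -
  assume "x \<noteq> 0"
  interpret field "Ksep :: 'a ring" by (rule field_Ksep)
  show ?thesis using comm_inv_char[of x "inverse x"] \<open>x \<noteq> 0\<close> by simp
qed

lemma subfieldD:
  assumes s: "subfield E (Ksep :: 'a::field ring)"
  shows "1 \<in> E" "0 \<in> E" "x \<in> E \<Longrightarrow> y \<in> E \<Longrightarrow> x + y \<in> E" "x \<in> E \<Longrightarrow> y \<in> E \<Longrightarrow> x * y \<in> E"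
    "x \<in> E \<Longrightarrow> - x \<in> E" "x \<in> E \<Longrightarrow> inverse x \<in> E" "x \<in> E \<Longrightarrow> y \<in> E \<Longrightarrow> x - y \<in> E"
    "x \<in> E \<Longrightarrow> y \<in> E \<Longrightarrow> x / y \<in> E" "x \<in> E \<Longrightarrow> x ^ n \<in> E"
proof -
  note r = subfieldE(1)[OF s]
  have a: "1 \<in> E" "0 \<in> E" using subringE(3,2)[OF r] by (simp_all only: Ksep_simps)
  have b: "x + y \<in> E" "x * y \<in> E" if "x \<in> E" "y \<in> E" for x y
    using subringE(7,6)[OF r that] by (simp_all only: Ksep_simps)
  have c: "- x \<in> E" if "x \<in> E" for x
    using subringE(5)[OF r that] by (simp only: Ksep_a_inv)
  note * = a b c
  have i: "inverse x \<in> E" if "x \<in> E" for x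
  proof (cases "x = 0")
    case False
    then show ?thesis using ring.subfield_m_inv(1)[OF ring_Ksep s, of x] that by simp
  qed (use that in simp)
  show "1 \<in> E" "0 \<in> E" by (rule *(1,2))+
  show "x \<in> E \<Longrightarrow> y \<in> E \<Longrightarrow> x + y \<in> E" by (rule *(3))
  show "x \<in> E \<Longrightarrow> y \<in> E \<Longrightarrow> x * y \<in> E" by (rule *(4))
  show "x \<in> E \<Longrightarrow> - x \<in> E" by (rule *(5))
  show "x \<in> E \<Longrightarrow> inverse x \<in> E" by (rule i)
  show "x \<in> E \<Longrightarrow> y \<in> E \<Longrightarrow> x - y \<in> E" using *(3)[OF _ *(5), of x y] by simp
  show "x \<in> E \<Longrightarrow> y \<in> E \<Longrightarrow> x / y \<in> E" using *(4)[OF _ i, of x y] by (simp add: divide_inverse)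
  show "x \<in> E \<Longrightarrow> x ^ n \<in> E" by (induction n) (simp_all add: *(1) *(4))
qed

lemma subfield_KsepI:
  assumes "1 \<in> E" "\<And>x y. x \<in> E \<Longrightarrow> y \<in> E \<Longrightarrow> x + y \<in> E" "\<And>x y. x \<in> E \<Longrightarrow> y \<in> E \<Longrightarrow> x * y \<in> E"
    "\<And>x. x \<in> E \<Longrightarrow> - x \<in> E" "\<And>x. x \<in> E \<Longrightarrow> x \<noteq> 0 \<Longrightarrow> inverse x \<in> E"
  shows "subfield E (Ksep :: 'a::field ring)"
proof -
  have "subring E (Ksep :: 'a ring)"
    by (rule ring.subringI[OF ring_Ksep]) (unfold Ksep_simps Ksep_a_inv, rule subset_UNIV, (fact assms)+)
  moreover have "inv\<^bsub>(Ksep :: 'a ring)\<^esub> x \<in> E" if "x \<in> E - {\<zero>\<^bsub>(Ksep :: 'a ring)\<^esub>}" for x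
    using assms(5)[of x] that by simp
  ultimately show ?thesis by (rule field.subfieldI'[OF field_Ksep])
qed

lemma adjoin_props:
  shows "subfield (adjoin K S) (Ksep :: 'a::field ring)" "K \<subseteq> adjoin K S" "S \<subseteq> adjoin K S"
    "subfield E Ksep \<Longrightarrow> K \<subseteq> E \<Longrightarrow> S \<subseteq> E \<Longrightarrow> adjoin K S \<subseteq> E"
  unfolding adjoin_def
  using field.generate_field_is_subfield[OF field_Ksep, of "K \<union> S"] generate_field.incl[of _ "K \<union> S" "Ksep :: 'a ring"]
    field.generate_field_min_subfield1[OF field_Ksep, of "K \<union> S" E] by (simp_all add: subset_iff)

section \<open>Separable polynomials\<close>

lemma separable_poly_dvd:
  assumes "separable_poly f" "g dvd f"
  shows "separable_poly g"
  unfolding separable_poly_def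
proof (rule coprimeI)
  fix d assume d: "d dvd g" "d dvd pderiv g"
  obtain q where q: "f = g * q" using assms(2) by auto
  have "d dvd f" "d dvd pderiv f" using d by (auto simp: q pderiv_mult)
  then show "is_unit d" using assms(1) unfolding separable_poly_def by (meson coprime_common_divisor)
qed

lemma separable_poly_nonzero: "separable_poly f \<Longrightarrow> f \<noteq> 0"
  by (auto simp: separable_poly_def)

lemma separable_poly_simple_root:
  assumes "separable_poly ([:-x, 1:] * g)"
  shows "poly g x \<noteq> 0"
proof
  assume "poly g x = 0"
  then have "[:-x, 1:] dvd g" by (simp add: poly_eq_0_iff_dvd)
  then have "[:-x, 1:] dvd pderiv ([:-x, 1:] * g)" by (auto simp: pderiv_mult simp del: mult_pCons_left)
  then have "is_unit [:-x, 1:]" using assms unfolding separable_poly_def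
    by (meson coprime_common_divisor dvd_triv_left)
  then show False by (simp add: is_unit_iff_degree)
qed

lemma separable_polyI_pderiv_const:
  fixes f :: "'a::field poly"
  assumes "pderiv f = [:c:]" "c \<noteq> 0" shows "separable_poly f"
  unfolding separable_poly_def assms(1)
proof (rule coprimeI)
  fix d assume "d dvd [:c:]"
  then show "is_unit d" using assms(2) dvd_trans[of d "[:c:]" 1] by (simp add: is_unit_const_poly_iff dvd_field_iff)
qed

text \<open>The hypothesis provides only one root at a time, and only for separable polynomials.
  Splitting off a linear factor keeps the quotient separable, and the removed root is simple, so
  each step accounts for exactly one new root.\<close>

lemma card_roots_separable:
  fixes f :: "'a::field poly"
  assumes closed: "\<forall>f::'a poly. separable_poly f \<and> Polynomial.degree f > 0 \<longrightarrow> (\<exists>x. poly f x = 0)"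
    and "separable_poly f"
  shows "card {x. poly f x = 0} = Polynomial.degree f"
  using assms(2)
proof (induction "Polynomial.degree f" arbitrary: f)
  case 0
  then obtain c where c: "f = [:c:]" by (metis degree_eq_zeroE)
  then show ?case using separable_poly_nonzero[OF 0(2)] by auto
next
  case (Suc n)
  then obtain x where x: "poly f x = 0" using closed by fastforce
  then obtain g where g: "f = [:-x, 1:] * g" by (auto simp: poly_eq_0_iff_dvd)
  have sg: "separable_poly g" using Suc(3) g separable_poly_dvd by (metis dvd_triv_right)
  have ng: "g \<noteq> 0" using sg separable_poly_nonzero by blast
  have dg: "Polynomial.degree f = Suc (Polynomial.degree g)" unfolding g using ng
    by (subst degree_mult_eq) auto
  have "poly g x \<noteq> 0" using separable_poly_simple_root Suc(3) g by blast
  have "{y. poly f y = 0} = insert x {y. poly g y = 0}" unfolding g by auto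
  then have "card {y. poly f y = 0} = Suc (card {y. poly g y = 0})"
    using \<open>poly g x \<noteq> 0\<close> poly_roots_finite[OF ng] by simp
  then show ?case using Suc(1)[OF _ sg] Suc(2) dg by simp
qed

section \<open>Polynomials over a subring relation\<close>

text \<open>
  A partial ring homomorphism is represented by its graph, so that polynomials with coefficients
  in a subring and their images under a homomorphism are treated at once.
\<close>

definition subring_rel :: "('a::field \<times> 'a) set \<Rightarrow> bool"
  where "subring_rel G \<longleftrightarrow> (0, 0) \<in> G \<and> (1, 1) \<in> G \<and>
    (\<forall>a b c d. (a, b) \<in> G \<longrightarrow> (c, d) \<in> G \<longrightarrow> (a + c, b + d) \<in> G \<and> (a - c, b - d) \<in> G \<and> (a * c, b * d) \<in> G)"

definition poly_rel :: "('a::field \<times> 'a) set \<Rightarrow> 'a poly \<Rightarrow> 'a poly \<Rightarrow> bool"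
  where "poly_rel G f g \<longleftrightarrow> (\<forall>i. (coeff f i, coeff g i) \<in> G)"

definition polys_in :: "'a::field set \<Rightarrow> 'a poly set"
  where "polys_in E = {f. \<forall>i. coeff f i \<in> E}"

lemma polys_in_iff:
  assumes "0 \<in> E" shows "set (coeffs f) \<subseteq> E \<longleftrightarrow> f \<in> polys_in E"
proof
  assume "set (coeffs f) \<subseteq> E"
  then show "f \<in> polys_in E" unfolding polys_in_def using range_coeff[of f] assms by (simp add: set_eq_iff subset_iff) (metis insert_iff rangeI)
next
  assume "f \<in> polys_in E"
  then show "set (coeffs f) \<subseteq> E" unfolding polys_in_def using range_coeff[of f] by (simp add: set_eq_iff subset_iff) (metis insert_iff rangeE)
qed

lemma poly_rel_Id_on: "poly_rel (Id_on E) f g \<longleftrightarrow> f = g \<and> f \<in> polys_in E"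
proof
  assume a: "poly_rel (Id_on E) f g"
  then have *: "coeff f i = coeff g i" "coeff f i \<in> E" for i unfolding poly_rel_def Id_on_iff by blast+
  have "f = g" by (rule poly_eqI) (rule *(1))
  moreover have "f \<in> polys_in E" unfolding polys_in_def using *(2) by blast
  ultimately show "f = g \<and> f \<in> polys_in E" ..
next
  assume a: "f = g \<and> f \<in> polys_in E"
  have fg: "f = g" using a by (rule conjunct1)
  have "coeff f i \<in> E" for i using a[THEN conjunct2] unfolding polys_in_def by blast
  then show "poly_rel (Id_on E) f g" unfolding poly_rel_def fg Id_on_iff by (simp add: fg)
qed

lemma subring_rel_Id_on: "subfield E Ksep \<Longrightarrow> subring_rel (Id_on E)"
  unfolding subring_rel_def by (auto intro: subfieldD)

lemma subring_relD:
  assumes "subring_rel G"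
  shows "(0, 0) \<in> G" "(1, 1) \<in> G" "(a, b) \<in> G \<Longrightarrow> (c, d) \<in> G \<Longrightarrow> (a + c, b + d) \<in> G"
    "(a, b) \<in> G \<Longrightarrow> (c, d) \<in> G \<Longrightarrow> (a - c, b - d) \<in> G"
    "(a, b) \<in> G \<Longrightarrow> (c, d) \<in> G \<Longrightarrow> (a * c, b * d) \<in> G"
  using assms unfolding subring_rel_def by auto

lemma subring_rel_sum:
  assumes "subring_rel G" "\<And>i. i \<in> A \<Longrightarrow> (f i, g i) \<in> G"
  shows "(sum f A, sum g A) \<in> G"
  using assms(2) by (induction A rule: infinite_finite_induct) (auto intro: subring_relD[OF assms(1)])

lemma subring_rel_power:
  assumes "subring_rel G" "(a, b) \<in> G" shows "(a ^ n, b ^ n) \<in> G"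
  by (induction n) (auto intro: subring_relD[OF assms(1)] assms(2))

lemma poly_rel_closed:
  assumes G: "subring_rel G"
  shows "poly_rel G 0 0" "(a, b) \<in> G \<Longrightarrow> poly_rel G (monom a n) (monom b n)"
    "poly_rel G f g \<Longrightarrow> poly_rel G f' g' \<Longrightarrow> poly_rel G (f + f') (g + g')"
    "poly_rel G f g \<Longrightarrow> poly_rel G f' g' \<Longrightarrow> poly_rel G (f - f') (g - g')"
    "poly_rel G f g \<Longrightarrow> poly_rel G f' g' \<Longrightarrow> poly_rel G (f * f') (g * g')"
    "(a, b) \<in> G \<Longrightarrow> poly_rel G f g \<Longrightarrow> poly_rel G (pCons a f) (pCons b g)"
  using subring_relD[OF G] unfolding poly_rel_def
  by (auto simp: coeff_mult coeff_pCons split: nat.split intro!: subring_rel_sum[OF G])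

lemma poly_eq_sum_coeff:
  fixes f :: "'a::comm_semiring_1 poly"
  assumes "Polynomial.degree f \<le> n" shows "poly f x = (\<Sum>i\<le>n. coeff f i * x ^ i)"
  unfolding poly_altdef by (rule sum.mono_neutral_left) (use assms in \<open>auto simp: coeff_eq_0\<close>)

lemma poly_rel_eval:
  assumes G: "subring_rel G" and "poly_rel G f g" "(x, y) \<in> G"
  shows "(poly f x, poly g y) \<in> G"
proof -
  let ?n = "max (Polynomial.degree f) (Polynomial.degree g)"
  have "poly f x = (\<Sum>i\<le>?n. coeff f i * x ^ i)" "poly g y = (\<Sum>i\<le>?n. coeff g i * y ^ i)"
    by (rule poly_eq_sum_coeff, simp)+
  then show ?thesis using assms
    by (auto simp: poly_rel_def intro!: subring_rel_sum[OF G] subring_relD[OF G] subring_rel_power[OF G])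
qed

text \<open>Long division of \<open>f\<close> by \<open>m\<close> and of \<open>f'\<close> by
  \<open>m'\<close> is run in parallel, subtracting related multiples so that quotients and
  remainders stay related. Degree bounds are phrased as vanishing coefficients because for a general
  \<open>G\<close> related polynomials need not have the same degree.\<close>

lemma poly_rel_division:
  assumes G: "subring_rel G" and m: "poly_rel G m m'" "coeff m d = 1" "coeff m' d = 1"
    "\<forall>i>d. coeff m i = 0 \<and> coeff m' i = 0"
    and "poly_rel G f f'" "\<And>i. i \<ge> n \<Longrightarrow> coeff f i = 0 \<and> coeff f' i = 0"
  shows "\<exists>q q' r r'. poly_rel G q q' \<and> poly_rel G r r' \<and> f = m * q + r \<and> f' = m' * q' + r' \<and>
    (\<forall>i\<ge>d. coeff r i = 0 \<and> coeff r' i = 0)"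
  using assms(6,7)
proof (induction n arbitrary: f f')
  case 0
  then have "f = 0" "f' = 0" by (auto simp: poly_eq_iff)
  then show ?case using poly_rel_closed(1)[OF G] by (intro exI[of _ 0]) auto
next
  case (Suc n)
  show ?case
  proof (cases "n < d")
    case True
    then show ?thesis using poly_rel_closed(1)[OF G] Suc.prems by (intro exI[of _ 0] exI[of _ f] exI[of _ f']) auto
  next
    case False
    define s where "s = monom (coeff f n) (n - d)"
    define s' where "s' = monom (coeff f' n) (n - d)"
    have rs: "poly_rel G s s'" using Suc.prems(1) unfolding s_def s'_def
      by (intro poly_rel_closed(2)[OF G]) (auto simp: poly_rel_def)
    have cf: "coeff (s * m) i = (if n - d \<le> i then coeff f n * coeff m (i - (n - d)) else 0)"
      "coeff (s' * m') i = (if n - d \<le> i then coeff f' n * coeff m' (i - (n - d)) else 0)" for i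
      by (auto simp: s_def s'_def coeff_monom_mult)
    have z: "coeff (f - s * m) i = 0 \<and> coeff (f' - s' * m') i = 0" if "i \<ge> n" for i
    proof (cases "i = n")
      case True
      then show ?thesis using False m(2,3) by (simp add: cf)
    next
      case F: False
      then have "i - (n - d) > d" using that False by auto
      then show ?thesis using Suc.prems(2)[of i] m(4) F that by (simp add: cf)
    qed
    obtain q q' r r' where *: "poly_rel G q q'" "poly_rel G r r'" "f - s * m = m * q + r"
        "f' - s' * m' = m' * q' + r'" "\<forall>i\<ge>d. coeff r i = 0 \<and> coeff r' i = 0"
      using Suc.IH[OF poly_rel_closed(4)[OF G Suc.prems(1) poly_rel_closed(5)[OF G rs m(1)]] z] by blast
    have e: "f = m * (q + s) + r" "f' = m' * (q' + s') + r'" using *(3,4) by (auto simp: algebra_simps)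
    show ?thesis
      by (rule exI[of _ "q + s"], rule exI[of _ "q' + s'"], rule exI[of _ r], rule exI[of _ r'])
        (use e * rs poly_rel_closed(3)[OF G] in auto)
  qed
qed

lemma polys_in_closed:
  assumes E: "subfield E Ksep"
  shows "0 \<in> polys_in E" "a \<in> E \<Longrightarrow> monom a n \<in> polys_in E" "f \<in> polys_in E \<Longrightarrow> g \<in> polys_in E \<Longrightarrow> f + g \<in> polys_in E"
    "f \<in> polys_in E \<Longrightarrow> g \<in> polys_in E \<Longrightarrow> f - g \<in> polys_in E"
    "f \<in> polys_in E \<Longrightarrow> g \<in> polys_in E \<Longrightarrow> f * g \<in> polys_in E"
    "a \<in> E \<Longrightarrow> f \<in> polys_in E \<Longrightarrow> pCons a f \<in> polys_in E" "a \<in> E \<Longrightarrow> f \<in> polys_in E \<Longrightarrow> smult a f \<in> polys_in E"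
    "1 \<in> polys_in E" "f \<in> polys_in E \<Longrightarrow> x \<in> E \<Longrightarrow> poly f x \<in> E"
proof -
  have G: "subring_rel (Id_on E)" by (rule subring_rel_Id_on[OF E])
  have i: "f \<in> polys_in E \<longleftrightarrow> poly_rel (Id_on E) f f" for f by (simp add: poly_rel_Id_on)
  show 0: "0 \<in> polys_in E" unfolding i by (rule poly_rel_closed(1)[OF G])
  show "a \<in> E \<Longrightarrow> monom a n \<in> polys_in E" unfolding i by (rule poly_rel_closed(2)[OF G]) (rule Id_onI)
  show "f \<in> polys_in E \<Longrightarrow> g \<in> polys_in E \<Longrightarrow> f + g \<in> polys_in E" unfolding i by (rule poly_rel_closed(3)[OF G])
  show "f \<in> polys_in E \<Longrightarrow> g \<in> polys_in E \<Longrightarrow> f - g \<in> polys_in E" unfolding i by (rule poly_rel_closed(4)[OF G])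
  show "f \<in> polys_in E \<Longrightarrow> g \<in> polys_in E \<Longrightarrow> f * g \<in> polys_in E" unfolding i by (rule poly_rel_closed(5)[OF G])
  show p: "a \<in> E \<Longrightarrow> f \<in> polys_in E \<Longrightarrow> pCons a f \<in> polys_in E" for a f
    unfolding i by (rule poly_rel_closed(6)[OF G]) (rule Id_onI)
  show "a \<in> E \<Longrightarrow> f \<in> polys_in E \<Longrightarrow> smult a f \<in> polys_in E"
    unfolding polys_in_def by (simp add: subfieldD(4)[OF E])
  show "1 \<in> polys_in E" using p[OF subfieldD(1)[OF E] 0] by (simp add: one_pCons)
  show "f \<in> polys_in E \<Longrightarrow> x \<in> E \<Longrightarrow> poly f x \<in> E"
    using poly_rel_eval[OF G, of f f x x] unfolding i[symmetric] by (simp add: Id_on_iff)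
qed

lemma polys_in_division:
  assumes E: "subfield E Ksep" and m: "m \<in> polys_in E" "lead_coeff m = 1" and f: "f \<in> polys_in E"
  shows "\<exists>q r. q \<in> polys_in E \<and> r \<in> polys_in E \<and> f = m * q + r \<and> (\<forall>i\<ge>Polynomial.degree m. coeff r i = 0)"
  using poly_rel_division[OF subring_rel_Id_on[OF E], of m m "Polynomial.degree m" f f "Suc (Polynomial.degree f)"] m f
  unfolding poly_rel_Id_on by (auto simp: coeff_eq_0)

section \<open>Extension of partial automorphisms\<close>

text \<open>The condition on pairs \<open>(0, b)\<close> makes \<open>G\<close> single-valued, by
  subtracting two pairs with the same first entry. Injectivity and compatibility with inverses
  follow from algebraicity over \<open>K\<close> in \<open>partial_aut_inverse\<close>; the
  definition itself stays stable under unions of chains.\<close>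

definition partial_aut :: "'a::field set \<Rightarrow> ('a \<times> 'a) set \<Rightarrow> bool"
  where "partial_aut K G \<longleftrightarrow> subring_rel G \<and> (\<forall>b. (0, b) \<in> G \<longrightarrow> b = 0) \<and> Id_on K \<subseteq> G"

text \<open>Automorphisms are taken on the whole separable closure, as total functions, so that
  composition needs no domains. The Galois group of \<open>L\<close> is recovered by restriction in
  \<open>carrier_galois_group\<close>.\<close>

definition auts :: "'a::field set \<Rightarrow> ('a \<Rightarrow> 'a) set"
  where "auts T = {\<sigma>. bij \<sigma> \<and> (\<forall>x y. \<sigma> (x + y) = \<sigma> x + \<sigma> y) \<and> (\<forall>x y. \<sigma> (x * y) = \<sigma> x * \<sigma> y) \<and> (\<forall>x\<in>T. \<sigma> x = x)}"

lemma sep_closure_mono: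
  assumes "UNIV_is_separable_closure_of K" "K \<subseteq> T"
  shows "UNIV_is_separable_closure_of T"
  using assms unfolding UNIV_is_separable_closure_of_def by blast

lemma sep_closure_root:
  fixes f :: "'a::field poly"
  assumes "UNIV_is_separable_closure_of (K :: 'a set)"
  shows "separable_poly f \<Longrightarrow> Polynomial.degree f > 0 \<Longrightarrow> \<exists>x. poly f x = 0"
  using assms unfolding UNIV_is_separable_closure_of_def by simp

lemma sep_closure_card_roots:
  fixes f :: "'a::field poly"
  assumes "UNIV_is_separable_closure_of (K :: 'a set)"
  shows "separable_poly f \<Longrightarrow> card {x. poly f x = 0} = Polynomial.degree f"
  using assms by (intro card_roots_separable) (simp_all add: UNIV_is_separable_closure_of_def)

lemma sep_closure_algebraic:
  assumes "UNIV_is_separable_closure_of K" "0 \<in> (K :: 'a::field set)"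
  obtains f where "f \<in> polys_in K" "separable_poly f" "poly f (x :: 'a) = 0"
  using assms polys_in_iff[OF assms(2)] unfolding UNIV_is_separable_closure_of_def by blast

lemma partial_aut_unique:
  assumes "partial_aut K G" "(x, y) \<in> G" "(x, y') \<in> G" shows "y = y'"
proof -
  have "(0, y - y') \<in> G" using assms subring_relD(4)[of G x y x y'] unfolding partial_aut_def by simp
  then have "y - y' = 0" using assms(1) unfolding partial_aut_def by blast
  then show ?thesis by simp
qed

text \<open>A polynomial \<open>c + X g\<close> over \<open>K\<close> of least degree vanishing at
  \<open>x\<close> has \<open>c \<noteq> 0\<close>, so the inverse of \<open>x\<close> is
  \<open>- g(x) / c\<close>, a polynomial in \<open>x\<close> over \<open>K\<close>. Such
  polynomials are respected by \<open>G\<close>, hence so is the inverse.\<close>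

lemma partial_aut_inverse:
  assumes K: "UNIV_is_separable_closure_of K" "subfield K (Ksep :: 'a::field ring)"
    and G: "partial_aut K G" and xy: "(x, y) \<in> G" "x \<noteq> (0::'a)"
  shows "(inverse x, inverse y) \<in> G" "y \<noteq> 0"
proof -
  have sG: "subring_rel G" using G by (simp add: partial_aut_def)
  define P where "P = (\<lambda>n. \<exists>f. f \<in> polys_in K \<and> f \<noteq> 0 \<and> poly f x = 0 \<and> Polynomial.degree f = n)"
  obtain f0 where "f0 \<in> polys_in K" "separable_poly f0" "poly f0 x = 0"
    using sep_closure_algebraic[OF K(1) subfieldD(2)[OF K(2)]] .
  then have "P (Polynomial.degree f0)" unfolding P_def using separable_poly_nonzero by blast
  then have "P (LEAST n. P n)" by (rule LeastI)
  then obtain f where f: "f \<in> polys_in K" "f \<noteq> 0" "poly f x = 0" "Polynomial.degree f = (LEAST n. P n)"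
    unfolding P_def by blast
  obtain c g where cg: "f = pCons c g" by (cases f)
  have c: "c \<noteq> 0"
  proof
    assume "c = 0"
    then have "g \<noteq> 0" "poly g x = 0" using f xy by (auto simp: cg)
    moreover have "g \<in> polys_in K" using f(1) unfolding polys_in_def cg
      by (auto simp: coeff_pCons split: nat.splits)
    ultimately have "P (Polynomial.degree g)" unfolding P_def by blast
    then have "Polynomial.degree f \<le> Polynomial.degree g" using f(4) by (simp add: Least_le)
    then show False using \<open>g \<noteq> 0\<close> by (simp add: cg)
  qed
  define h where "h = smult (- inverse c) g"
  have cK: "c \<in> K" and gK: "coeff g i \<in> K" for i
    using f(1) unfolding polys_in_def cg by (auto simp: coeff_pCons split: nat.splits)
  have h: "h \<in> polys_in K" unfolding h_def polys_in_def using cK gK by (auto intro!: subfieldD[OF K(2)])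
  have hx: "poly h x = inverse x"
    using f(3) c xy(2) unfolding cg h_def by (auto simp: field_simps) (metis add.inverse_inverse eq_neg_iff_add_eq_0)
  have "poly_rel G h h" using h G unfolding poly_rel_def polys_in_def partial_aut_def by auto
  then have i: "(inverse x, poly h y) \<in> G" using poly_rel_eval[OF sG _ xy(1)] hx by metis
  then have "(inverse x * x, poly h y * y) \<in> G" using subring_relD(5)[OF sG] xy by blast
  then have "(1, poly h y * y) \<in> G" using xy by simp
  then have "poly h y * y = 1" using partial_aut_unique[OF G] subring_relD(2)[OF sG] by blast
  then show "y \<noteq> 0" by auto
  then have "poly h y = inverse y" using \<open>poly h y * y = 1\<close> by (simp add: field_simps)
  then show "(inverse x, inverse y) \<in> G" using i by simp
qed

text \<open>The extension sends \<open>poly g x\<close> to \<open>poly h y\<close> for related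
  \<open>g\<close> and \<open>h\<close>. It is well defined: if \<open>poly g x = 0\<close>,
  division by \<open>m\<close> leaves a remainder vanishing at \<open>x\<close>, which is
  \<open>0\<close> by minimality; the remainder of \<open>h\<close> is related to it, hence
  \<open>0\<close> as well, and so \<open>poly h y = 0\<close>.\<close>

lemma partial_aut_adjoin:
  assumes G: "partial_aut K G"
    and m: "poly_rel G m m'" "coeff m d = 1" "coeff m' d = 1" "\<forall>i>d. coeff m i = 0 \<and> coeff m' i = 0"
    and xy: "poly m x = 0" "poly m' y = 0"
    and minimal: "\<forall>r r'. poly_rel G r r' \<longrightarrow> (\<forall>i\<ge>d. coeff r i = 0) \<longrightarrow> poly r x = 0 \<longrightarrow> r = 0"
  shows "\<exists>G'. partial_aut K G' \<and> G \<subseteq> G' \<and> (x, y) \<in> G'"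
proof -
  have sG: "subring_rel G" using G by (simp add: partial_aut_def)
  define G' where "G' = {(poly g x, poly h y) | g h. poly_rel G g h}"
  have 1: "G \<subseteq> G'"
  proof safe
    fix a b assume "(a, b) \<in> G"
    then have "poly_rel G [:a:] [:b:]" using poly_rel_closed(6)[OF sG _ poly_rel_closed(1)[OF sG]] by blast
    then show "(a, b) \<in> G'" unfolding G'_def by force
  qed
  have "poly_rel G [:0, 1:] [:0, 1:]"
    using poly_rel_closed(1,6)[OF sG] subring_relD(1,2)[OF sG] by metis
  then have 2: "(x, y) \<in> G'" unfolding G'_def by force
  have 3: "subring_rel G'"
    unfolding subring_rel_def
  proof (intro conjI allI impI)
    show "(0, 0) \<in> G'" "(1, 1) \<in> G'" using 1 subring_relD[OF sG] by auto
    fix a b c e assume "(a, b) \<in> G'" "(c, e) \<in> G'"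
    then obtain g h g' h' where *: "a = poly g x" "b = poly h y" "poly_rel G g h"
        "c = poly g' x" "e = poly h' y" "poly_rel G g' h'" unfolding G'_def by blast
    show "(a + c, b + e) \<in> G'" unfolding G'_def using * poly_rel_closed(3)[OF sG]
      by (metis (mono_tags, lifting) mem_Collect_eq poly_add)
    show "(a - c, b - e) \<in> G'" unfolding G'_def using * poly_rel_closed(4)[OF sG]
      by (metis (mono_tags, lifting) mem_Collect_eq poly_diff)
    show "(a * c, b * e) \<in> G'" unfolding G'_def using * poly_rel_closed(5)[OF sG]
      by (metis (mono_tags, lifting) mem_Collect_eq poly_mult)
  qed
  have 4: "b = 0" if b: "(0, b) \<in> G'" for b
  proof -
    obtain g h where gh: "0 = poly g x" "b = poly h y" "poly_rel G g h" using b unfolding G'_def by auto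
    let ?n = "Suc (max (Polynomial.degree g) (Polynomial.degree h))"
    obtain q q' r r' where *: "poly_rel G q q'" "poly_rel G r r'" "g = m * q + r" "h = m' * q' + r'"
        "\<forall>i\<ge>d. coeff r i = 0 \<and> coeff r' i = 0"
      using poly_rel_division[OF sG m gh(3), of ?n] by (auto simp: coeff_eq_0)
    have "poly r x = 0" using gh(1) xy(1) *(3) by simp
    then have "r = 0" using minimal *(2,5) by blast
    then have "r' = 0" using *(2) G unfolding poly_rel_def partial_aut_def by (auto simp: poly_eq_iff)
    then show "b = 0" using *(4) gh(2) xy(2) by simp
  qed
  show ?thesis using 1 2 3 4 G unfolding partial_aut_def by blast
qed

text \<open>\<open>m\<close> is the minimal polynomial of \<open>x\<close> over the domain of
  \<open>G\<close> and \<open>m'\<close> its image. A separable polynomial over \<open>K\<close>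
  that kills \<open>x\<close> is related to itself, so parallel division shows that
  \<open>m'\<close> divides it; this is where separability of \<open>m'\<close> comes from.\<close>

lemma partial_aut_minimal_poly:
  assumes K: "UNIV_is_separable_closure_of K" "subfield K (Ksep :: 'a::field ring)" and G: "partial_aut K G"
  obtains m m' d where "poly_rel G m m'" "coeff m d = 1" "coeff m' d = 1"
    "\<forall>i>d. coeff m i = 0 \<and> coeff m' i = 0" "poly m (x::'a) = 0" "separable_poly m'" "d > 0"
    "\<forall>r r'. poly_rel G r r' \<longrightarrow> (\<forall>i\<ge>d. coeff r i = 0) \<longrightarrow> poly r x = 0 \<longrightarrow> r = 0"
proof -
  have sG: "subring_rel G" and KG: "Id_on K \<subseteq> G" using G by (auto simp: partial_aut_def)
  define P where "P = (\<lambda>n. \<exists>f f'. poly_rel G f f' \<and> f \<noteq> 0 \<and> poly f x = 0 \<and> Polynomial.degree f = n)"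
  obtain f0 where f0: "f0 \<in> polys_in K" "separable_poly f0" "poly f0 x = 0"
    using sep_closure_algebraic[OF K(1) subfieldD(2)[OF K(2)]] .
  have r0: "poly_rel G f0 f0" using f0 KG unfolding poly_rel_def polys_in_def by auto
  then have "P (Polynomial.degree f0)" unfolding P_def using f0 separable_poly_nonzero by blast
  then have "P (LEAST n. P n)" by (rule LeastI)
  then obtain f f' where f: "poly_rel G f f'" "f \<noteq> 0" "poly f x = 0" "Polynomial.degree f = (LEAST n. P n)"
    unfolding P_def by blast
  define d where "d = Polynomial.degree f"
  have minimal: "r = 0" if "poly_rel G r r'" "\<forall>i\<ge>d. coeff r i = 0" "poly r x = 0" for r r'
  proof (rule ccontr)
    assume "r \<noteq> 0"
    then have "P (Polynomial.degree r)" unfolding P_def using that by blast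
    then have "d \<le> Polynomial.degree r" unfolding d_def f(4) by (rule Least_le)
    then show False using that(2) \<open>r \<noteq> 0\<close> by auto
  qed
  have lc: "(coeff f d, coeff f' d) \<in> G" "coeff f d \<noteq> 0" using f(1,2) unfolding poly_rel_def by (simp_all add: d_def)
  note inv = partial_aut_inverse[OF K G lc]
  define m where "m = smult (inverse (coeff f d)) f"
  define m' where "m' = smult (inverse (coeff f' d)) f'"
  have m1: "poly_rel G m m'" using f(1) inv(1) unfolding poly_rel_def m_def m'_def by (auto intro: subring_relD[OF sG])
  have m2: "coeff m d = 1" "coeff m' d = 1" unfolding m_def m'_def using lc inv by auto
  have m3: "\<forall>i>d. coeff m i = 0 \<and> coeff m' i = 0"
  proof (intro allI impI)
    fix i assume that: "i > d"
    have "coeff m i = 0" using that unfolding m_def d_def by (simp add: coeff_eq_0)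
    moreover have "(coeff m i, coeff m' i) \<in> G" using m1 by (simp add: poly_rel_def)
    ultimately show "coeff m i = 0 \<and> coeff m' i = 0" using G unfolding partial_aut_def by auto
  qed
  have m4: "poly m x = 0" using f(3) by (simp add: m_def)
  have d0: "d > 0"
  proof (rule ccontr)
    assume "\<not> d > 0"
    then have "Polynomial.degree f = 0" by (simp add: d_def)
    then obtain c where "f = [:c:]" by (metis degree_eq_zeroE)
    then show False using f by auto
  qed
  obtain q q' r r' where *: "poly_rel G q q'" "poly_rel G r r'" "f0 = m * q + r" "f0 = m' * q' + r'"
        "\<forall>i\<ge>d. coeff r i = 0 \<and> coeff r' i = 0"
    using poly_rel_division[OF sG m1 m2 m3 r0, of "Suc (Polynomial.degree f0)"] by (auto simp: coeff_eq_0)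
  have "poly r x = 0" using f0(3) m4 *(3) by simp
  then have "r = 0" using minimal[OF *(2)] *(5) by blast
  then have "r' = 0" using *(2) G unfolding poly_rel_def partial_aut_def by (auto simp: poly_eq_iff)
  then have "m' dvd f0" using *(4) by simp
  then have "separable_poly m'" using f0(2) separable_poly_dvd by blast
  moreover have "\<forall>r r'. poly_rel G r r' \<longrightarrow> (\<forall>i\<ge>d. coeff r i = 0) \<longrightarrow> poly r x = 0 \<longrightarrow> r = 0"
    using minimal by blast
  ultimately show ?thesis using that[OF m1 m2 m3 m4 _ d0] by blast
qed


text \<open>A maximal extension exists by Zorn. It is total, since the image of a minimal polynomial
  is separable and so has a root to map to. The resulting map is onto because it is injective and
  preserves the finite root set of any nonzero polynomial over \<open>K\<close>.\<close>

theorem partial_aut_extends: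
  assumes K: "UNIV_is_separable_closure_of K" "subfield K (Ksep :: 'a::field ring)" and G0: "partial_aut K G0"
  shows "\<exists>\<sigma>\<in>auts K. \<forall>(x, y)\<in>G0. \<sigma> x = y"
proof -
  define AA where "AA = {G. partial_aut K G \<and> G0 \<subseteq> G}"
  have "\<exists>M\<in>AA. \<forall>Y\<in>AA. M \<subseteq> Y \<longrightarrow> Y = M"
  proof (rule subset_Zorn_nonempty)
    show "AA \<noteq> {}" using G0 by (auto simp: AA_def)
    fix C assume C: "C \<noteq> {}" "subset.chain AA C"
    have CA: "G \<in> AA" if "G \<in> C" for G using C(2) that by (auto simp: subset.chain_def)
    obtain G1 where G1: "G1 \<in> C" using C(1) by blast
    have pair: "\<exists>G\<in>C. u \<in> G \<and> w \<in> G" if uw: "u \<in> \<Union>C" "w \<in> \<Union>C" for u w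
    proof -
      from uw obtain A B where "A \<in> C" "u \<in> A" "B \<in> C" "w \<in> B" by blast
      moreover have "A \<subseteq> B \<or> B \<subseteq> A" using C(2) \<open>A \<in> C\<close> \<open>B \<in> C\<close> by (auto simp: subset_chain_def)
      ultimately show ?thesis by blast
    qed
    have "subring_rel (\<Union>C)" unfolding subring_rel_def
    proof (intro conjI allI impI)
      show "(0, 0) \<in> \<Union>C" "(1, 1) \<in> \<Union>C" using G1 CA[OF G1] subring_relD(1,2)
        by (auto simp: AA_def partial_aut_def)
      fix a b c d assume "(a, b) \<in> \<Union>C" "(c, d) \<in> \<Union>C"
      then obtain G where G: "G \<in> C" "(a, b) \<in> G" "(c, d) \<in> G" using pair by blast
      then have "subring_rel G" using CA by (auto simp: AA_def partial_aut_def)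
      then show "(a + c, b + d) \<in> \<Union>C" "(a - c, b - d) \<in> \<Union>C" "(a * c, b * d) \<in> \<Union>C"
        using G subring_relD[of G] by blast+
    qed
    moreover have "b = 0" if "(0, b) \<in> \<Union>C" for b using that CA by (auto simp: AA_def partial_aut_def)
    moreover have "Id_on K \<subseteq> \<Union>C" "G0 \<subseteq> \<Union>C" using CA[OF G1] G1 by (auto simp: AA_def partial_aut_def)
    ultimately show "\<Union>C \<in> AA" by (auto simp: AA_def partial_aut_def)
  qed
  then obtain M where M: "partial_aut K M" "G0 \<subseteq> M" and maxi: "\<And>Y. partial_aut K Y \<Longrightarrow> M \<subseteq> Y \<Longrightarrow> Y = M"
    unfolding AA_def by (metis (mono_tags, lifting) dual_order.trans mem_Collect_eq)
  have sM: "subring_rel M" using M by (simp add: partial_aut_def)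
  have total: "\<exists>y. (x, y) \<in> M" for x
  proof -
    obtain m m' d where m: "poly_rel M m m'" "coeff m d = 1" "coeff m' d = 1"
      "\<forall>i>d. coeff m i = 0 \<and> coeff m' i = 0" "poly m x = 0" "separable_poly m'" "d > 0"
      "\<forall>r r'. poly_rel M r r' \<longrightarrow> (\<forall>i\<ge>d. coeff r i = 0) \<longrightarrow> poly r x = 0 \<longrightarrow> r = 0"
      using partial_aut_minimal_poly[OF K M(1), of x] by blast
    have "d \<le> Polynomial.degree m'" using m(3) by (intro le_degree) simp
    then have "Polynomial.degree m' > 0" using m(7) by linarith
    then obtain y where y: "poly m' y = 0" using sep_closure_root[OF K(1) m(6)] by blast
    obtain G' where G': "partial_aut K G'" "M \<subseteq> G'" "(x, y) \<in> G'"
      using partial_aut_adjoin[OF M(1) m(1-5) y m(8)] by (elim exE conjE)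
    have "G' = M" by (rule maxi[OF G'(1,2)])
    show ?thesis using G'(3) unfolding \<open>G' = M\<close> by (rule exI)
  qed
  define \<sigma> where "\<sigma> x = (THE y. (x, y) \<in> M)" for x
  have \<sigma>: "(x, \<sigma> x) \<in> M" for x
    unfolding \<sigma>_def using total[of x] partial_aut_unique[OF M(1)] by (metis theI)
  have eq: "\<sigma> x = y" if "(x, y) \<in> M" for x y using partial_aut_unique[OF M(1) \<sigma> that] .
  have add: "\<sigma> (x + y) = \<sigma> x + \<sigma> y" and mul: "\<sigma> (x * y) = \<sigma> x * \<sigma> y" and sub: "\<sigma> (x - y) = \<sigma> x - \<sigma> y" for x y
    by (rule eq[OF subring_relD(3)[OF sM \<sigma> \<sigma>]], rule eq[OF subring_relD(5)[OF sM \<sigma> \<sigma>]],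
        rule eq[OF subring_relD(4)[OF sM \<sigma> \<sigma>]])
  have fixK: "\<sigma> x = x" if "x \<in> K" for x using M(1) that by (intro eq) (auto simp: partial_aut_def)
  have inj: "inj \<sigma>"
  proof (rule injI)
    fix x y assume "\<sigma> x = \<sigma> y"
    then have "(x - y, 0) \<in> M" using \<sigma>[of "x - y"] sub by simp
    then show "x = y" using partial_aut_inverse(2)[OF K M(1), of "x - y" 0] by auto
  qed
  have "surj \<sigma>"
  proof -
    have "\<exists>x. \<sigma> x = y" for y
    proof -
      obtain f where f: "f \<in> polys_in K" "separable_poly f" "poly f y = 0"
        using sep_closure_algebraic[OF K(1) subfieldD(2)[OF K(2)]] .
      let ?R = "{x. poly f x = 0}"
      have fin: "finite ?R" using poly_roots_finite separable_poly_nonzero f(2) by blast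
      have "poly_rel M f f" using f(1) M(1) unfolding poly_rel_def polys_in_def partial_aut_def by auto
      then have "poly f (\<sigma> x) = \<sigma> (poly f x)" for x using poly_rel_eval[OF sM _ \<sigma>] eq by metis
      moreover have "\<sigma> 0 = 0" using fixK subfieldD(2)[OF K(2)] by blast
      ultimately have "\<sigma> ` ?R \<subseteq> ?R" by auto
      then have "\<sigma> ` ?R = ?R" using endo_inj_surj[OF fin] inj by (meson inj_on_subset subset_UNIV)
      moreover have "y \<in> ?R" using f(3) by simp
      ultimately have "y \<in> \<sigma> ` ?R" by simp
      then obtain x where "y = \<sigma> x" by (rule imageE)
      then show ?thesis by (intro exI[of _ x]) simp
    qed
    then show ?thesis by (intro surjI[of \<sigma> "\<lambda>y. SOME x. \<sigma> x = y"]) (rule someI_ex)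
  qed
  then have "\<sigma> \<in> auts K" using inj add mul fixK unfolding auts_def by (auto simp: bij_def)
  moreover have "\<forall>(x, y)\<in>G0. \<sigma> x = y" using M(2) eq by auto
  ultimately show ?thesis by (intro bexI[of _ \<sigma>])
qed


text \<open>An element outside \<open>T\<close> has a minimal polynomial of degree at least 2, which
  by separability has another root \<open>y\<close>; the partial automorphism sending
  \<open>x\<close> to \<open>y\<close> extends to an automorphism that moves
  \<open>x\<close>.\<close>

theorem auts_fixed_field:
  assumes K: "UNIV_is_separable_closure_of T" "subfield T (Ksep :: 'a::field ring)"
    and fixed: "\<And>\<sigma>. \<sigma> \<in> auts T \<Longrightarrow> \<sigma> x = (x::'a)"
  shows "x \<in> T"
proof (rule ccontr)
  assume x: "x \<notin> T"
  have G: "partial_aut T (Id_on T)"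
    unfolding partial_aut_def using subring_rel_Id_on[OF K(2)] by auto
  obtain m m' d where m: "poly_rel (Id_on T) m m'" "coeff m d = 1" "coeff m' d = 1"
      "\<forall>i>d. coeff m i = 0 \<and> coeff m' i = 0" "poly m x = 0" "separable_poly m'" "d > 0"
      "\<forall>r r'. poly_rel (Id_on T) r r' \<longrightarrow> (\<forall>i\<ge>d. coeff r i = 0) \<longrightarrow> poly r x = 0 \<longrightarrow> r = 0"
    using partial_aut_minimal_poly[OF K G, of x] by blast
  have mm: "m' = m" "m \<in> polys_in T" using m(1) by (auto simp: poly_rel_Id_on)
  obtain g where g: "m = [:-x, 1:] * g" using m(5) by (auto simp: poly_eq_0_iff_dvd)
  have "poly g x \<noteq> 0" using m(6) separable_poly_simple_root unfolding mm g by blast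
  have g0: "g \<noteq> 0" using \<open>poly g x \<noteq> 0\<close> by auto
  have dm: "Polynomial.degree m = Suc (Polynomial.degree g)" unfolding g using g0
    by (subst degree_mult_eq) auto
  have "Polynomial.degree g > 0"
  proof (rule ccontr)
    assume "\<not> ?thesis"
    then obtain c where c: "g = [:c:]" by (metis degree_eq_zeroE neq0_conv)
    have "Polynomial.degree m = d" using m(2,4) by (metis coeff_0 degree_le le_antisym le_degree mm(1) zero_neq_one)
    then have "c = 1" using m(2) dm unfolding g c by (auto simp: coeff_pCons)
    then have "coeff m 0 = - x" unfolding g c by simp
    then have "- x \<in> T" using mm(2) by (metis mem_Collect_eq polys_in_def)
    then show False using x subfieldD(5)[OF K(2)] by force
  qed
  moreover have "separable_poly g" using m(6) separable_poly_dvd unfolding mm g by (metis dvd_triv_right)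
  ultimately obtain y where y: "poly g y = 0" using sep_closure_root[OF K(1)] by blast
  then have "poly m' y = 0" unfolding mm g by simp
  then obtain G' where G': "partial_aut T G'" "(x, y) \<in> G'"
    using partial_aut_adjoin[of T "Id_on T" m m' d x y] G m by blast
  obtain \<sigma> where \<sigma>: "\<sigma> \<in> auts T" "\<forall>(x, y)\<in>G'. \<sigma> x = y" using partial_aut_extends[OF K G'(1)] ..
  have "\<sigma> x = y" using bspec[OF \<sigma>(2) G'(2)] by simp
  then have "y = x" using fixed[OF \<sigma>(1)] by simp
  then show False using y \<open>poly g x \<noteq> 0\<close> by simp
qed

lemma autsD:
  assumes "\<sigma> \<in> auts T" "subfield T (Ksep :: 'a::field ring)"
  shows "\<sigma> (x + y) = \<sigma> x + \<sigma> y" "\<sigma> (x * y) = \<sigma> x * \<sigma> y" "x \<in> T \<Longrightarrow> \<sigma> x = x" "\<sigma> 0 = 0" "\<sigma> 1 = 1"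
    "\<sigma> (x - y) = \<sigma> x - \<sigma> y" "\<sigma> (- x) = - \<sigma> x" "\<sigma> (x ^ n) = \<sigma> x ^ n" "inj \<sigma>" "\<sigma> x = 0 \<longleftrightarrow> x = 0"
    "\<sigma> (inverse x) = inverse (\<sigma> x)" "\<sigma> (x / y) = \<sigma> x / \<sigma> y"
proof -
  have *: "\<And>x y. \<sigma> (x + y) = \<sigma> x + \<sigma> y" "\<And>x y. \<sigma> (x * y) = \<sigma> x * \<sigma> y" "\<And>x. x \<in> T \<Longrightarrow> \<sigma> x = x" "inj \<sigma>"
    using assms(1) by (auto simp: auts_def bij_def)
  have **: "\<sigma> 0 = 0" "\<sigma> 1 = 1" using *(3) subfieldD[OF assms(2)] by auto
  have m: "\<sigma> (- x) = - \<sigma> x" for x using *(1)[of x "- x"] ** by (simp add: eq_neg_iff_add_eq_0 add.commute)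
  have z: "\<sigma> x = 0 \<longleftrightarrow> x = 0" for x using *(4) **(1) by (metis injD)
  have i: "\<sigma> (inverse x) = inverse (\<sigma> x)" for x
  proof (cases "x = 0")
    case False
    then have "\<sigma> x * \<sigma> (inverse x) = 1" using *(2)[of x "inverse x"] **(2) by simp
    then show ?thesis by (metis inverse_unique)
  qed (simp add: **)
  show "\<sigma> (x + y) = \<sigma> x + \<sigma> y" "\<sigma> (x * y) = \<sigma> x * \<sigma> y" "x \<in> T \<Longrightarrow> \<sigma> x = x" "\<sigma> 0 = 0" "\<sigma> 1 = 1" "\<sigma> (- x) = - \<sigma> x" "inj \<sigma>"
    "\<sigma> x = 0 \<longleftrightarrow> x = 0" "\<sigma> (inverse x) = inverse (\<sigma> x)"
    using * ** m z i by auto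
  show "\<sigma> (x - y) = \<sigma> x - \<sigma> y" using *(1)[of x "- y"] m by simp
  show "\<sigma> (x / y) = \<sigma> x / \<sigma> y" using *(2)[of x "inverse y"] i by (simp add: divide_inverse)
  show "\<sigma> (x ^ n) = \<sigma> x ^ n" by (induction n) (auto simp: ** *)
qed

lemma auts_sum:
  assumes "\<sigma> \<in> auts T" "subfield T (Ksep :: 'a::field ring)"
  shows "\<sigma> (sum f A) = (\<Sum>i\<in>A. \<sigma> (f i))"
  by (induction A rule: infinite_finite_induct) (auto simp: autsD[OF assms])

lemma auts_prod:
  assumes "\<sigma> \<in> auts T" "subfield T (Ksep :: 'a::field ring)"
  shows "\<sigma> (prod f A) = (\<Prod>i\<in>A. \<sigma> (f i))"
  by (induction A rule: infinite_finite_induct) (auto simp: autsD[OF assms])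

lemma auts_poly:
  assumes "\<sigma> \<in> auts T" "subfield T (Ksep :: 'a::field ring)" "f \<in> polys_in T"
  shows "\<sigma> (poly f x) = poly f (\<sigma> x)"
  using assms(3) by (simp add: poly_altdef auts_sum[OF assms(1,2)] autsD[OF assms(1,2)] polys_in_def)

lemma auts_comp: "\<sigma> \<in> auts T \<Longrightarrow> \<tau> \<in> auts T \<Longrightarrow> \<sigma> \<circ> \<tau> \<in> auts T"
  unfolding auts_def by (auto intro: bij_comp)

lemma id_auts: "id \<in> auts T"
  by (auto simp: auts_def)

lemma auts_mono: "T \<subseteq> T' \<Longrightarrow> auts T' \<subseteq> auts T"
  by (auto simp: auts_def)

section \<open>Conjugates, their traces and norms\<close>

definition conjugates :: "'a::field set \<Rightarrow> 'a \<Rightarrow> 'a set"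
  where "conjugates T x = (\<lambda>\<sigma>. \<sigma> x) ` auts T"

lemma conjugates_self: "x \<in> conjugates T x"
  unfolding conjugates_def using id_auts[of T] by (metis id_apply image_eqI)

lemma conjugates_finite:
  assumes K: "UNIV_is_separable_closure_of T" "subfield T (Ksep :: 'a::field ring)"
  shows "finite (conjugates T (x::'a))"
proof -
  obtain f where f: "f \<in> polys_in T" "separable_poly f" "poly f x = 0"
    using sep_closure_algebraic[OF K(1) subfieldD(2)[OF K(2)]] .
  have "poly f (\<sigma> x) = 0" if "\<sigma> \<in> auts T" for \<sigma>
    using auts_poly[OF that K(2) f(1), of x] f(3) autsD(4)[OF that K(2)] by simp
  then have "conjugates T x \<subseteq> {x. poly f x = 0}" by (auto simp: conjugates_def)
  then show ?thesis using poly_roots_finite[of f] separable_poly_nonzero[OF f(2)] finite_subset by blast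
qed

lemma auts_permute_conjugates:
  assumes K: "UNIV_is_separable_closure_of T" "subfield T (Ksep :: 'a::field ring)" and \<sigma>: "\<sigma> \<in> auts T"
  shows "bij_betw \<sigma> (conjugates T (x::'a)) (conjugates T x)"
proof -
  have "\<sigma> ` conjugates T x \<subseteq> conjugates T x"
    unfolding conjugates_def using auts_comp[OF \<sigma>] by (auto simp: image_iff) (metis comp_apply)
  moreover have i: "inj_on \<sigma> (conjugates T x)" using autsD(9)[OF \<sigma> K(2)] inj_on_subset by blast
  ultimately have "\<sigma> ` conjugates T x = conjugates T x"
    using endo_inj_surj[OF conjugates_finite[OF K]] by blast
  then show ?thesis using i by (simp add: bij_betw_def)
qed

text \<open>This is the trace of \<open>poly f x\<close> from \<open>T(x)\<close> to
  \<open>T\<close>: automorphisms over \<open>T\<close> permute the conjugates of \<open>x\<close>,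
  so the sum is fixed and \<open>auts_fixed_field\<close> applies.\<close>

lemma conjugates_sum_in:
  assumes K: "UNIV_is_separable_closure_of T" "subfield T (Ksep :: 'a::field ring)" and f: "f \<in> polys_in T"
  shows "(\<Sum>z\<in>conjugates T (x::'a). poly f z) \<in> T"
proof (rule auts_fixed_field[OF K])
  fix \<sigma> assume \<sigma>: "\<sigma> \<in> auts T"
  have "\<sigma> (\<Sum>z\<in>conjugates T x. poly f z) = (\<Sum>z\<in>conjugates T x. poly f (\<sigma> z))"
    by (simp add: auts_sum[OF \<sigma> K(2)] auts_poly[OF \<sigma> K(2) f])
  also have "\<dots> = (\<Sum>z\<in>conjugates T x. poly f z)"
    by (rule sum.reindex_bij_betw[OF auts_permute_conjugates[OF K \<sigma>]])
  finally show "\<sigma> (\<Sum>z\<in>conjugates T x. poly f z) = (\<Sum>z\<in>conjugates T x. poly f z)" .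
qed

lemma conjugates_prod_in:
  assumes K: "UNIV_is_separable_closure_of T" "subfield T (Ksep :: 'a::field ring)"
  shows "(\<Prod>z\<in>conjugates T (x::'a). z) \<in> T"
proof (rule auts_fixed_field[OF K])
  fix \<sigma> assume \<sigma>: "\<sigma> \<in> auts T"
  have "\<sigma> (\<Prod>z\<in>conjugates T x. z) = (\<Prod>z\<in>conjugates T x. \<sigma> z)"
    by (simp add: auts_prod[OF \<sigma> K(2)])
  also have "\<dots> = (\<Prod>z\<in>conjugates T x. z)"
    by (rule prod.reindex_bij_betw[OF auts_permute_conjugates[OF K \<sigma>]])
  finally show "\<sigma> (\<Prod>z\<in>conjugates T x. z) = (\<Prod>z\<in>conjugates T x. z)" .
qed

section \<open>Valuations\<close>

lemma finite_set_minimum: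
  fixes g :: "'b \<Rightarrow> 'c::linorder"
  assumes "finite A" "A \<noteq> {}"
  obtains i where "i \<in> A" "\<And>l. l \<in> A \<Longrightarrow> g i \<le> g l"
proof -
  have "Min (g ` A) \<in> g ` A" using assms by (intro Min_in) auto
  then obtain i where i: "i \<in> A" "Min (g ` A) = g i" by blast
  have "g i \<le> g l" if "l \<in> A" for l
    unfolding i(2)[symmetric] using that assms(1) by (intro Min_le) auto
  then show ?thesis using that i(1) by blast
qed

locale valued =
  fixes v :: "'a::field \<Rightarrow> ereal"
  assumes val: "valuation v"
begin

text \<open>Real-valued copy of \<open>v\<close>, convenient for linear arithmetic. It sends
  \<open>0\<close> to the default value \<open>0\<close>, so its laws ask for nonzero
  arguments.\<close>

definition nu :: "'a \<Rightarrow> real" where "nu x = real_of_ereal (v x)"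

lemma v_inf_iff [simp]: "v x = \<infinity> \<longleftrightarrow> x = 0"
  using val unfolding valuation_def by blast

lemma v_inf_iff' [simp]: "\<infinity> = v x \<longleftrightarrow> x = 0"
  using v_inf_iff[of x] by metis

lemma v_zero [simp]: "v 0 = \<infinity>"
  by simp

lemma v_nu: "x \<noteq> 0 \<Longrightarrow> v x = ereal (nu x)"
  using val v_inf_iff[of x] unfolding valuation_def nu_def by (cases "v x") auto

lemma v_mult: "v (x * y) = v x + v y"
  using val unfolding valuation_def by blast

lemma v_add: "min (v x) (v y) \<le> v (x + y)"
  using val unfolding valuation_def by blast

lemma nu_mult: "x \<noteq> 0 \<Longrightarrow> y \<noteq> 0 \<Longrightarrow> nu (x * y) = nu x + nu y"
  using v_mult[of x y] v_nu[of x] v_nu[of y] v_nu[of "x * y"] by simp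

lemma nu_one [simp]: "nu 1 = 0"
  using nu_mult[of 1 1] by simp

lemma v_one [simp]: "v 1 = 0"
  using v_nu[of 1] by (simp add: zero_ereal_def)

lemma nu_minus [simp]: "nu (- x) = nu x"
proof (cases "x = 0")
  case False
  have "nu (- 1) + nu (- 1) = 0" using nu_mult[of "- 1" "- 1"] by simp
  then have "nu (- 1) = 0" by simp
  then show ?thesis using nu_mult[of "- 1" x] False by simp
qed simp

lemma v_minus [simp]: "v (- x) = v x"
  by (cases "x = 0") (simp_all add: v_nu)

lemma v_diff: "min (v x) (v y) \<le> v (x - y)"
  using v_add[of x "- y"] by simp

lemma v_diff_commute: "v (x - y) = v (y - x)"
  using v_minus[of "x - y"] by simp

lemma nu_inverse: "x \<noteq> 0 \<Longrightarrow> nu (inverse x) = - nu x"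
  using nu_mult[of x "inverse x"] by simp

lemma nu_divide: "x \<noteq> 0 \<Longrightarrow> y \<noteq> 0 \<Longrightarrow> nu (x / y) = nu x - nu y"
  using nu_mult[of x "inverse y"] nu_inverse[of y] by (simp add: divide_inverse)

lemma nu_power: "x \<noteq> 0 \<Longrightarrow> nu (x ^ n) = real n * nu x"
  by (induction n) (simp_all add: nu_mult algebra_simps)

lemma nu_prod: "(\<And>i. i \<in> A \<Longrightarrow> f i \<noteq> 0) \<Longrightarrow> nu (prod f A) = (\<Sum>i\<in>A. nu (f i))"
proof (induction A rule: infinite_finite_induct)
  case (insert a A)
  then have "prod f A \<noteq> 0" by (cases "finite A") auto
  then show ?case using insert by (simp add: nu_mult)
qed auto

lemma v_le_nu: "x \<noteq> 0 \<Longrightarrow> ereal r \<le> v x \<longleftrightarrow> r \<le> nu x" "x \<noteq> 0 \<Longrightarrow> ereal r < v x \<longleftrightarrow> r < nu x"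
  by (simp_all add: v_nu)

lemma v_pos_nu: "x \<noteq> 0 \<Longrightarrow> 0 \<le> v x \<longleftrightarrow> 0 \<le> nu x" "x \<noteq> 0 \<Longrightarrow> 0 < v x \<longleftrightarrow> 0 < nu x"
  by (simp_all add: v_nu zero_ereal_def)

lemma v_add_ge: "r \<le> v x \<Longrightarrow> r \<le> v y \<Longrightarrow> r \<le> v (x + y)"
  using v_add[of x y] by (meson min.bounded_iff order_trans)

lemma v_diff_ge: "r \<le> v x \<Longrightarrow> r \<le> v y \<Longrightarrow> r \<le> v (x - y)"
  using v_diff[of x y] by (meson min.bounded_iff order_trans)

lemma v_add_gt: "r < v x \<Longrightarrow> r < v y \<Longrightarrow> r < v (x + y)"
  using v_add[of x y] by (meson min_less_iff_conj less_le_trans)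

lemma v_diff_gt: "r < v x \<Longrightarrow> r < v y \<Longrightarrow> r < v (x - y)"
  using v_diff[of x y] by (meson min_less_iff_conj less_le_trans)

lemma v_sum_ge: "(\<And>i. i \<in> A \<Longrightarrow> r \<le> v (f i)) \<Longrightarrow> r \<le> v (sum f A)"
  by (induction A rule: infinite_finite_induct) (auto intro: v_add_ge)

lemma v_sum_gt: "(\<And>i. i \<in> A \<Longrightarrow> ereal r < v (f i)) \<Longrightarrow> ereal r < v (sum f A)"
  by (induction A rule: infinite_finite_induct) (auto intro: v_add_gt)

lemma v_add_eq: "v x < v y \<Longrightarrow> v (x + y) = v x"
proof -
  assume l: "v x < v y"
  have "v x \<le> v (x + y)" using v_add[of x y] l by (simp add: min_def split: if_splits)
  moreover have "min (v (x + y)) (v y) \<le> v x" using v_diff[of "x + y" y] by simp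
  then have "v (x + y) \<le> v x" using l by (simp add: min_def split: if_splits)
  ultimately show ?thesis by simp
qed

lemma v_eq_of_diff: "v x < v (x - y) \<Longrightarrow> v y = v x"
  using v_add_eq[of x "- (x - y)"] by (simp del: minus_diff_eq)

lemma v_mult_ge: "0 \<le> v x \<Longrightarrow> 0 \<le> v y \<Longrightarrow> 0 \<le> v (x * y)"
  by (simp add: v_mult)

lemma v_mult_gt: "0 < v x \<Longrightarrow> 0 \<le> v y \<Longrightarrow> 0 < v (x * y)"
  by (metis add.right_neutral add_mono add_pos_nonneg ereal_add_strict_mono2 less_le_trans order.strict_iff_order v_mult add_nonneg_nonneg)

lemma v_power_ge: "0 \<le> v x \<Longrightarrow> 0 \<le> v (x ^ n)"
  by (induction n) (auto intro: v_mult_ge)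

lemma v_poly_ge: "(\<And>i. 0 \<le> v (coeff f i)) \<Longrightarrow> 0 \<le> v x \<Longrightarrow> 0 \<le> v (poly f x)"
  unfolding poly_altdef by (intro v_sum_ge v_mult_ge v_power_ge)

lemma v_sum_unique_min:
  assumes "finite A" "a \<in> A" "\<And>i. i \<in> A \<Longrightarrow> i \<noteq> a \<Longrightarrow> v (f a) < v (f i)"
  shows "v (sum f A) = v (f a)"
proof (cases "f a = 0")
  case True
  have "i = a" if "i \<in> A" for i using assms(3)[OF that] True by auto
  then have "A = {a}" using assms(2) by blast
  then show ?thesis by simp
next
  case False
  have "ereal (nu (f a)) < v (sum f (A - {a}))"
    using assms(3) v_nu[OF False] by (intro v_sum_gt) auto
  then have "v (f a + sum f (A - {a})) = v (f a)" using v_nu[OF False] by (intro v_add_eq) simp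
  then show ?thesis using assms(1,2) by (simp add: sum.remove)
qed

text \<open>The least valuation among the terms cannot be attained only once, for then the sum would
  have that valuation and could not vanish. This takes the place of Newton polygon slopes when
  valuations of roots are read off.\<close>

lemma v_zero_sum_two_min:
  assumes "finite A" "sum f A = 0" "a \<in> A" "f a \<noteq> 0"
  shows "\<exists>i\<in>A. \<exists>j\<in>A. i \<noteq> j \<and> f i \<noteq> 0 \<and> f j \<noteq> 0 \<and> nu (f i) = nu (f j) \<and> (\<forall>l\<in>A. v (f i) \<le> v (f l))"
proof -
  obtain i where i: "i \<in> A" "\<And>l. l \<in> A \<Longrightarrow> v (f i) \<le> v (f l)"
    using finite_set_minimum[OF assms(1), of "\<lambda>i. v (f i)"] assms(3) by blast
  have fi: "f i \<noteq> 0"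
  proof
    assume "f i = 0"
    then show False using i(2)[OF assms(3)] assms(4) by simp
  qed
  have "\<exists>j\<in>A. j \<noteq> i \<and> v (f j) \<le> v (f i)"
  proof (rule ccontr)
    assume "\<not> ?thesis"
    then have "v (sum f A) = v (f i)" using i(1) assms(1) by (intro v_sum_unique_min) auto
    then show False using assms(2) fi by simp
  qed
  then obtain j where j: "j \<in> A" "j \<noteq> i" "v (f j) \<le> v (f i)" by blast
  have fj: "f j \<noteq> 0"
  proof
    assume "f j = 0"
    then show False using j(3) fi by simp
  qed
  have "v (f i) = v (f j)" using i(2)[OF j(1)] j(3) by simp
  then have "nu (f i) = nu (f j)" by (simp add: nu_def)
  then have "i \<noteq> j \<and> f i \<noteq> 0 \<and> f j \<noteq> 0 \<and> nu (f i) = nu (f j) \<and> (\<forall>l\<in>A. v (f i) \<le> v (f l))"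
    using i(2) j(2) fi fj by simp
  then show ?thesis by (rule bexI[OF bexI[OF _ j(1)] i(1)])
qed

lemma v_distinct_sum:
  assumes "finite A" "inj_on (\<lambda>i. v (f i)) {i\<in>A. f i \<noteq> 0}" "sum f A \<noteq> 0"
  shows "\<exists>i\<in>A. f i \<noteq> 0 \<and> v (sum f A) = v (f i)"
proof -
  let ?B = "{i\<in>A. f i \<noteq> 0}"
  have s: "sum f A = sum f ?B" using assms(1) by (intro sum.mono_neutral_right) auto
  have fin: "finite ?B" using assms(1) by simp
  have "?B \<noteq> {}"
  proof
    assume "?B = {}"
    then show False using s assms(3) by simp
  qed
  obtain i where i: "i \<in> ?B" "\<And>l. l \<in> ?B \<Longrightarrow> v (f i) \<le> v (f l)"
    using finite_set_minimum[OF fin \<open>?B \<noteq> {}\<close>, of "\<lambda>i. v (f i)"] by blast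
  have "v (f i) < v (f l)" if "l \<in> ?B" "l \<noteq> i" for l
  proof -
    have "v (f i) \<noteq> v (f l)" using inj_onD[OF assms(2) _ i(1) that(1)] that(2) by blast
    then show ?thesis using i(2)[OF that(1)] by simp
  qed
  then have "v (sum f ?B) = v (f i)" using assms(1) i(1) by (intro v_sum_unique_min) auto
  then show ?thesis using i(1) s by auto
qed

end

section \<open>Uniqueness of extensions of a complete valuation\<close>

locale complete_valued = valued v for v :: "'a::field \<Rightarrow> ereal" +
  fixes K :: "'a set"
  assumes sfK: "subfield K Ksep" and sepK: "UNIV_is_separable_closure_of K"
    and complete: "\<And>c::nat \<Rightarrow> 'a. (\<forall>i. c i \<in> K) \<Longrightarrow> (\<forall>N::real. \<exists>M. \<forall>i\<ge>M. \<forall>j\<ge>M. v (c i - c j) > ereal N) \<Longrightarrow>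
       \<exists>x\<in>K. \<forall>N::real. \<exists>M. \<forall>i\<ge>M. v (c i - x) > ereal N"
begin

text \<open>If values of polynomials of degree below \<open>j\<close> approximated
  \<open>x ^ j\<close> arbitrarily well, the bound \<open>C\<close> would make their coefficients
  Cauchy sequences. Completeness yields limits in \<open>K\<close>, and with them a monic polynomial
  of degree \<open>j\<close> vanishing at \<open>x\<close>, against \<open>ind\<close>.\<close>

lemma distance_bounded:
  assumes x: "x \<noteq> 0"
    and ind: "\<forall>g\<in>polys_in K. (\<forall>i\<ge>Suc j. coeff g i = 0) \<longrightarrow> poly g x = 0 \<longrightarrow> g = 0"
    and C: "\<forall>g\<in>polys_in K. (\<forall>i\<ge>j. coeff g i = 0) \<longrightarrow> (\<forall>i. coeff g i \<noteq> 0 \<longrightarrow> nu (poly g x) \<le> nu (coeff g i) + C)"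
  shows "\<exists>C'. \<forall>g\<in>polys_in K. (\<forall>i\<ge>j. coeff g i = 0) \<longrightarrow> v (x ^ j + poly g x) \<le> ereal C'"
proof (rule ccontr)
  assume "\<not> ?thesis"
  then have "\<forall>n::nat. \<exists>g\<in>polys_in K. (\<forall>i\<ge>j. coeff g i = 0) \<and> ereal (real n) < v (x ^ j + poly g x)"
    by (metis not_le)
  then obtain g where g: "\<And>n::nat. g n \<in> polys_in K" "\<And>n i. i \<ge> j \<Longrightarrow> coeff (g n) i = 0"
    "\<And>n. ereal (real n) < v (x ^ j + poly (g n) x)" by metis
  have cauchy: "\<exists>M. \<forall>m\<ge>M. \<forall>n\<ge>M. ereal N < v (coeff (g m) i - coeff (g n) i)" for i N
  proof -
    obtain M :: nat where M: "N + \<bar>C\<bar> \<le> real M" using real_arch_simple by blast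
    have "ereal N < v (coeff (g m) i - coeff (g n) i)" if "m \<ge> M" "n \<ge> M" for m n
    proof (cases "coeff (g m) i - coeff (g n) i = 0")
      case False
      let ?d = "g m - g n"
      have d: "?d \<in> polys_in K" by (rule polys_in_closed(4)[OF sfK g(1) g(1)])
      have dz: "\<forall>i\<ge>j. coeff ?d i = 0" using g(2) by simp
      have "?d \<noteq> 0" using False by (metis coeff_0 coeff_diff)
      then have ne: "poly ?d x \<noteq> 0" using ind d dz by (meson Suc_leD)
      have pd: "poly ?d x = (x ^ j + poly (g m) x) - (x ^ j + poly (g n) x)" by simp
      have "ereal (real M) < v (x ^ j + poly (g m) x)" "ereal (real M) < v (x ^ j + poly (g n) x)"
        using g(3)[of m] g(3)[of n] that by (meson ereal_less_eq(3) le_less_trans of_nat_mono)+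
      then have "ereal (real M) < v (poly ?d x)" unfolding pd by (rule v_diff_gt)
      then have "real M < nu (poly ?d x)" using v_le_nu(2)[OF ne] by blast
      also have "nu (poly ?d x) \<le> nu (coeff ?d i) + C" using C d dz False by (metis coeff_diff)
      finally have "N < nu (coeff ?d i)" using M by linarith
      then show ?thesis using v_le_nu(2)[of "coeff ?d i" N] False by simp
    qed simp
    then show ?thesis by blast
  qed
  have "\<forall>i. \<exists>a\<in>K. \<forall>N::real. \<exists>M. \<forall>n\<ge>M. ereal N < v (coeff (g n) i - a)"
  proof
    fix i
    have "\<forall>n. coeff (g n) i \<in> K" using g(1) by (simp add: polys_in_def)
    then show "\<exists>a\<in>K. \<forall>N::real. \<exists>M. \<forall>n\<ge>M. ereal N < v (coeff (g n) i - a)"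
      using complete[of "\<lambda>n. coeff (g n) i"] cauchy by blast
  qed
  then obtain a where a: "\<And>i. a i \<in> K" "\<And>i N. \<exists>M. \<forall>n\<ge>M. ereal N < v (coeff (g n) i - a i)" by metis
  define G where "G = (\<Sum>i<j. monom (a i) i) + monom 1 j"
  have cG: "coeff G i = (if i < j then a i else if i = j then 1 else 0)" for i
  proof -
    have "coeff (\<Sum>i<j. monom (a i) i) i = (if i < j then a i else 0)"
      by (simp add: coeff_sum coeff_monom if_distrib cong: if_cong)
    then show ?thesis by (simp add: G_def coeff_monom)
  qed
  have GK: "G \<in> polys_in K" unfolding polys_in_def by (simp add: cG a(1) subfieldD(1,2)[OF sfK])
  have pG: "poly G x = x ^ j + (\<Sum>i<j. a i * x ^ i)" by (simp add: G_def poly_sum poly_monom)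
  have pg: "poly (g n) x = (\<Sum>i<j. coeff (g n) i * x ^ i)" for n
  proof (cases j)
    case 0
    then have "g n = 0" using g(2) by (auto simp: poly_eq_iff)
    then show ?thesis using 0 by simp
  next
    case (Suc l)
    have "Polynomial.degree (g n) \<le> l" using g(2)[of _ n] Suc by (intro degree_le) auto
    then show ?thesis using poly_eq_sum_coeff[of "g n" l x] Suc by (simp add: lessThan_Suc_atMost)
  qed
  have "ereal N < v (poly G x)" for N
  proof -
    define B where "B = real j * \<bar>nu x\<bar>"
    have "\<forall>i. \<exists>M. \<forall>n\<ge>M. ereal (N + B) < v (coeff (g n) i - a i)" using a(2) by blast
    then obtain M where M: "\<And>i n. n \<ge> M i \<Longrightarrow> ereal (N + B) < v (coeff (g n) i - a i)" by metis
    obtain n0 :: nat where n0: "N \<le> real n0" using real_arch_simple by blast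
    define n where "n = n0 + (\<Sum>i<j. M i)"
    have nM: "n \<ge> M i" if "i < j" for i
      using member_le_sum[of i "{..<j}" M] that by (simp add: n_def)
    have t: "ereal N < v ((coeff (g n) i - a i) * x ^ i)" if i: "i < j" for i
    proof (cases "coeff (g n) i - a i = 0")
      case True
      then show ?thesis by (simp only: mult_zero_left v_zero) simp
    next
      case False
      have "N + B < nu (coeff (g n) i - a i)" using M[OF nM[OF i]] v_le_nu(2)[OF False] by blast
      moreover have "real i * nu x \<ge> - B"
      proof -
        have "real i * \<bar>nu x\<bar> \<le> B" unfolding B_def using i by (intro mult_right_mono) auto
        moreover have "- (real i * \<bar>nu x\<bar>) \<le> real i * nu x"
          by (metis abs_ge_minus_self abs_mult abs_of_nat minus_le_iff)
        ultimately show ?thesis by linarith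
      qed
      ultimately have "N < nu ((coeff (g n) i - a i) * x ^ i)"
        using False x by (subst nu_mult) (auto simp: nu_power)
      then show ?thesis using False x v_le_nu(2)[of "(coeff (g n) i - a i) * x ^ i" N] by simp
    qed
    have 1: "ereal N < v (\<Sum>i<j. (coeff (g n) i - a i) * x ^ i)" by (rule v_sum_gt) (use t in auto)
    have "n0 \<le> n" by (simp add: n_def)
    then have "ereal N \<le> ereal (real n)" using n0 by simp
    then have 2: "ereal N < v (x ^ j + poly (g n) x)" using g(3)[of n] by (rule le_less_trans)
    have pG': "poly G x = (x ^ j + poly (g n) x) - (\<Sum>i<j. (coeff (g n) i - a i) * x ^ i)"
      unfolding pG pg by (simp add: left_diff_distrib sum_subtractf)
    show ?thesis unfolding pG' using 2 1 by (rule v_diff_gt)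
  qed
  \<comment> \<open>The bound holds for every \<open>N\<close>, in particular for the valuation of
    the element itself, which is possible only for zero.\<close>
  then have "ereal (nu (poly G x)) < v (poly G x)" .
  then have "poly G x = 0" using v_nu[of "poly G x"] by (intro notI ccontr[of "poly G x = 0"]) simp
  moreover have "\<forall>i\<ge>Suc j. coeff G i = 0" by (simp add: cG)
  ultimately have "G = 0" using ind GK by blast
  then show False using cG[of j] by simp
qed

text \<open>Coordinates with respect to the powers of \<open>x\<close> are bounded functions, proved
  by adding one power at a time. Dividing by the top coefficient reduces its bound to the distance
  of \<open>x ^ j\<close> from the previous subspace; subtracting the top term then leaves the other
  coefficients to the induction hypothesis.\<close>

lemma coeff_bounded:
  assumes x: "x \<noteq> 0"
    and "\<forall>g\<in>polys_in K. (\<forall>i\<ge>d. coeff g i = 0) \<longrightarrow> poly g x = 0 \<longrightarrow> g = 0"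
  shows "\<exists>C. \<forall>g\<in>polys_in K. (\<forall>i\<ge>d. coeff g i = 0) \<longrightarrow> (\<forall>i. coeff g i \<noteq> 0 \<longrightarrow> nu (poly g x) \<le> nu (coeff g i) + C)"
  using assms(2)
proof (induction d)
  case 0
  then show ?case by auto
next
  case (Suc j)
  have "\<forall>g\<in>polys_in K. (\<forall>i\<ge>j. coeff g i = 0) \<longrightarrow> poly g x = 0 \<longrightarrow> g = 0"
    using Suc.prems by (meson Suc_leD)
  then obtain C where C: "\<forall>g\<in>polys_in K. (\<forall>i\<ge>j. coeff g i = 0) \<longrightarrow> (\<forall>i. coeff g i \<noteq> 0 \<longrightarrow> nu (poly g x) \<le> nu (coeff g i) + C)"
    using Suc.IH by blast
  obtain C' where C': "\<forall>g\<in>polys_in K. (\<forall>i\<ge>j. coeff g i = 0) \<longrightarrow> v (x ^ j + poly g x) \<le> ereal C'"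
    using distance_bounded[OF x Suc.prems C] by blast
  define D where "D = \<bar>C\<bar> + \<bar>C'\<bar> + \<bar>real j * nu x\<bar>"
  have "nu (poly h x) \<le> nu (coeff h i) + D"
    if h: "h \<in> polys_in K" "\<forall>i\<ge>Suc j. coeff h i = 0" "coeff h i \<noteq> 0" for h i
  proof (cases "coeff h j = 0")
    case True
    then have "\<forall>i\<ge>j. coeff h i = 0" using h(2) by (metis Suc_leI order.order_iff_strict)
    then show ?thesis using C h unfolding D_def by fastforce
  next
    case False
    define c where "c = coeff h j"
    define g where "g = h - monom c j"
    have cK: "c \<in> K" using h(1) by (simp add: c_def polys_in_def)
    have cne: "c \<noteq> 0" using False by (simp add: c_def)
    have gK: "g \<in> polys_in K" unfolding g_def using h(1) polys_in_closed(2,4)[OF sfK] cK by blast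
    have gz: "\<forall>i\<ge>j. coeff g i = 0" using h(2) by (auto simp: g_def c_def coeff_monom Suc_le_eq)
    define g' where "g' = smult (inverse c) g"
    have g'K: "g' \<in> polys_in K" "\<forall>i\<ge>j. coeff g' i = 0"
      using polys_in_closed(7)[OF sfK subfieldD(6)[OF sfK cK] gK] gz by (auto simp: g'_def)
    have hx: "poly h x = c * (x ^ j + poly g' x)" using cne by (simp add: g_def g'_def poly_monom field_simps)
    have hne: "poly h x \<noteq> 0" using Suc.prems h by force
    then have ne: "x ^ j + poly g' x \<noteq> 0" using hx by auto
    have "nu (x ^ j + poly g' x) \<le> C'" using C' g'K v_nu[OF ne] by force
    then have 1: "nu (poly h x) \<le> nu c + C'" unfolding hx using cne ne by (simp add: nu_mult)
    show ?thesis
    proof (cases "i = j")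
      case True
      show ?thesis using 1 unfolding D_def c_def True by linarith
    next
      case F: False
      then have ci: "coeff g i = coeff h i" by (simp add: g_def coeff_monom)
      have "g \<noteq> 0" using h(3) ci by auto
      moreover have "\<forall>i\<ge>Suc j. coeff g i = 0" using gz by simp
      ultimately have gne: "poly g x \<noteq> 0" using Suc.prems gK by blast
      have gx: "poly g x = poly h x - c * x ^ j" by (simp add: g_def poly_monom)
      have "ereal (nu (poly h x) - \<bar>C'\<bar> - \<bar>real j * nu x\<bar>) \<le> v (poly h x)"
        unfolding v_nu[OF hne] by simp
      moreover have "ereal (nu (poly h x) - \<bar>C'\<bar> - \<bar>real j * nu x\<bar>) \<le> v (c * x ^ j)"
        using cne x 1 by (subst v_le_nu) (auto simp: nu_mult nu_power)
      ultimately have "ereal (nu (poly h x) - \<bar>C'\<bar> - \<bar>real j * nu x\<bar>) \<le> v (poly g x)"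
        unfolding gx by (rule v_diff_ge)
      then have "nu (poly h x) - \<bar>C'\<bar> - \<bar>real j * nu x\<bar> \<le> nu (poly g x)" unfolding v_nu[OF gne] by simp
      moreover have "nu (poly g x) \<le> nu (coeff g i) + C" using C gK gz h(3) ci by metis
      ultimately show ?thesis unfolding ci D_def by linarith
    qed
  qed
  then show ?case by blast
qed

text \<open>Written in the basis of powers of \<open>x\<close> below \<open>d\<close>, the element
  \<open>x ^ n\<close> has coefficients of valuation at least \<open>n * nu x - C\<close>, and on
  \<open>K\<close> the two valuations agree. So \<open>w (x ^ n)\<close> is at least
  \<open>n * nu x\<close> up to a constant independent of \<open>n\<close>; letting \<open>n\<close>
  grow removes the constant.\<close>

lemma valuation_extension_le:
  assumes w: "valuation w" "\<And>y. y \<in> K \<Longrightarrow> w y = v y" and x: "x \<noteq> 0"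
  shows "nu x \<le> valued.nu w x"
proof -
  interpret w: valued w by unfold_locales (rule w)
  have P: "partial_aut K (Id_on K)"
    unfolding partial_aut_def using subring_rel_Id_on[OF sfK] by (simp add: Id_on_iff)
  obtain m m' d where m: "poly_rel (Id_on K) m m'" "coeff m d = 1" "coeff m' d = 1"
      "\<forall>i>d. coeff m i = 0 \<and> coeff m' i = 0" "poly m x = 0" "separable_poly m'" "d > 0"
      "\<forall>r r'. poly_rel (Id_on K) r r' \<longrightarrow> (\<forall>i\<ge>d. coeff r i = 0) \<longrightarrow> poly r x = 0 \<longrightarrow> r = 0"
    using partial_aut_minimal_poly[OF sepK sfK P, of x] by blast
  have ind: "\<forall>g\<in>polys_in K. (\<forall>i\<ge>d. coeff g i = 0) \<longrightarrow> poly g x = 0 \<longrightarrow> g = 0"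
    using m(8) unfolding poly_rel_Id_on by blast
  obtain C where C: "\<forall>g\<in>polys_in K. (\<forall>i\<ge>d. coeff g i = 0) \<longrightarrow> (\<forall>i. coeff g i \<noteq> 0 \<longrightarrow> nu (poly g x) \<le> nu (coeff g i) + C)"
    using coeff_bounded[OF x ind] by blast
  have mK: "m \<in> polys_in K" using m(1) unfolding poly_rel_Id_on by blast
  have dm: "Polynomial.degree m = d"
  proof (rule antisym)
    show "Polynomial.degree m \<le> d" using m(4) by (intro degree_le) simp
    show "d \<le> Polynomial.degree m" using m(2) by (intro le_degree) simp
  qed
  define D where "D = \<bar>C\<bar> + real d * \<bar>w.nu x\<bar>"
  have main: "real n * nu x - D \<le> real n * w.nu x" for n
  proof -
    have "monom 1 n \<in> polys_in K" using polys_in_closed(2)[OF sfK subfieldD(1)[OF sfK]] .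
    then obtain q r where qr: "r \<in> polys_in K" "monom 1 n = m * q + r" "\<forall>i\<ge>d. coeff r i = 0"
      using polys_in_division[OF sfK mK, of "monom 1 n"] m(2) unfolding dm by blast
    have rx: "poly r x = x ^ n" using arg_cong[OF qr(2), of "\<lambda>f. poly f x"] m(5) by (simp add: poly_monom)
    have "ereal (real n * nu x - D) \<le> w (coeff r i * x ^ i)" if "i < d" for i
    proof (cases "coeff r i = 0")
      case False
      have "w (coeff r i) = v (coeff r i)" using w(2) qr(1) by (simp add: polys_in_def)
      then have e: "w.nu (coeff r i) = nu (coeff r i)" by (simp add: w.nu_def nu_def)
      have "real n * nu x \<le> nu (coeff r i) + C" using C qr(1,3) False rx nu_power[OF x] by metis
      moreover have "- (real d * \<bar>w.nu x\<bar>) \<le> real i * w.nu x"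
      proof -
        have "real i * \<bar>w.nu x\<bar> \<le> real d * \<bar>w.nu x\<bar>" using that by (intro mult_right_mono) auto
        moreover have "- (real i * \<bar>w.nu x\<bar>) \<le> real i * w.nu x"
          by (metis abs_ge_minus_self abs_mult abs_of_nat minus_le_iff)
        ultimately show ?thesis by linarith
      qed
      ultimately show ?thesis using False x
        by (subst w.v_le_nu) (auto simp: w.nu_mult w.nu_power e D_def)
    qed simp
    then have "ereal (real n * nu x - D) \<le> w (\<Sum>i<d. coeff r i * x ^ i)" by (intro w.v_sum_ge) auto
    moreover have "poly r x = (\<Sum>i<d. coeff r i * x ^ i)"
    proof -
      obtain l where l: "d = Suc l" using m(7) gr0_conv_Suc by blast
      have "Polynomial.degree r \<le> l" using qr(3) l by (intro degree_le) auto
      then show ?thesis using poly_eq_sum_coeff[of r l x] l by (simp add: lessThan_Suc_atMost)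
    qed
    ultimately have "ereal (real n * nu x - D) \<le> w (x ^ n)" using rx by simp
    then show ?thesis using x w.v_le_nu(1)[of "x ^ n"] w.nu_power[OF x] by simp
  qed
  show ?thesis
  proof (rule ccontr)
    assume "\<not> ?thesis"
    then have "0 < nu x - w.nu x" by simp
    then obtain n :: nat where "D < real n * (nu x - w.nu x)" using reals_Archimedean3 by blast
    then show False using main[of n] by (simp add: algebra_simps)
  qed
qed

text \<open>Applying the inequality to \<open>x\<close> and to its inverse gives both
  directions.\<close>

theorem valuation_extension_unique:
  assumes w: "valuation w" "\<And>y. y \<in> K \<Longrightarrow> w y = v y"
  shows "w x = v x"
proof (cases "x = 0")
  case True
  interpret w: valued w by unfold_locales (rule w)
  show ?thesis using True by simp
next
  case False
  interpret w: valued w by unfold_locales (rule w)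
  have "nu x \<le> w.nu x" "nu (inverse x) \<le> w.nu (inverse x)"
    using valuation_extension_le[OF w] False by auto
  then have "nu x = w.nu x" using False by (simp add: nu_inverse w.nu_inverse)
  then show ?thesis using v_nu[OF False] w.v_nu[OF False] by simp
qed

text \<open>Composing \<open>v\<close> with \<sigma> gives another valuation that agrees with
  \<open>v\<close> on \<open>K\<close>, and there is only one.\<close>

lemma v_aut:
  assumes "\<sigma> \<in> auts K" shows "v (\<sigma> x) = v x"
proof -
  note s = autsD[OF assms sfK]
  have "valuation (\<lambda>x. v (\<sigma> x))" using val s unfolding valuation_def by simp
  then show ?thesis using valuation_extension_unique[of "\<lambda>x. v (\<sigma> x)" x] s(3) by simp
qed

end

section \<open>Residues\<close>

lemma separable_splits:
  fixes f :: "'a::field poly"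
  assumes closed: "\<forall>f::'a poly. separable_poly f \<and> Polynomial.degree f > 0 \<longrightarrow> (\<exists>x. poly f x = 0)"
    and "separable_poly f"
  shows "poly f y = lead_coeff f * (\<Prod>z\<in>{z. poly f z = 0}. y - z)"
  using assms(2)
proof (induction "Polynomial.degree f" arbitrary: f)
  case 0
  then obtain c where c: "f = [:c:]" by (metis degree_eq_zeroE)
  then show ?case using separable_poly_nonzero[OF 0(2)] by simp
next
  case (Suc n)
  then obtain x where x: "poly f x = 0" using closed by fastforce
  then obtain g where g: "f = [:-x, 1:] * g" by (auto simp: poly_eq_0_iff_dvd)
  have sg: "separable_poly g" using Suc(3) g separable_poly_dvd by (metis dvd_triv_right)
  have ng: "g \<noteq> 0" using sg separable_poly_nonzero by blast
  have dg: "Polynomial.degree f = Suc (Polynomial.degree g)" unfolding g using ng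
    by (subst degree_mult_eq) auto
  have "poly g x \<noteq> 0" using separable_poly_simple_root Suc(3) g by blast
  have r: "{z. poly f z = 0} = insert x {z. poly g z = 0}" unfolding g by auto
  have "(\<Prod>z\<in>{z. poly f z = 0}. y - z) = (y - x) * (\<Prod>z\<in>{z. poly g z = 0}. y - z)"
    unfolding r using \<open>poly g x \<noteq> 0\<close> poly_roots_finite[OF ng] by (subst prod.insert) auto
  moreover have "lead_coeff f = lead_coeff g" unfolding g lead_coeff_mult by simp
  moreover have "poly g y = lead_coeff g * (\<Prod>z\<in>{z. poly g z = 0}. y - z)"
    using Suc(1)[OF _ sg] Suc(2) dg by simp
  moreover have "poly f y = (y - x) * poly g y" unfolding g by (simp add: algebra_simps)
  ultimately show ?case by simp
qed

locale local_field = complete_valued v K for v :: "'a::field \<Rightarrow> ereal" and K +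
  fixes p s :: nat and k F :: "'a set" and t :: 'a
  assumes prime_p: "Factorial_Ring.prime p" and s_pos: "0 < s" and card_k: "card k = p ^ s"
    and ff: "function_field k t F" and normF: "normalized_on v F" and FK: "F \<subseteq> K"
    and dense: "\<forall>x\<in>K. \<forall>N::real. \<exists>y\<in>F. v (x - y) > ereal N"
begin

lemma sfk: "subfield k Ksep" and sfF: "subfield F Ksep" and kF: "k \<subseteq> F" and tF: "t \<in> F"
proof -
  show "subfield k Ksep" "subfield F Ksep" using ff by (auto simp: function_field_def)
  have "insert t k \<subseteq> F" using ff generate_field.incl[of _ "insert t k" "Ksep :: 'a ring"]
    unfolding function_field_def by blast
  then show "k \<subseteq> F" "t \<in> F" by auto
qed

lemma kK: "k \<subseteq> K" and tK: "t \<in> K"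
  using kF tF FK by auto

lemma p_gt1: "1 < p" and p_pos: "0 < p"
  using prime_p prime_gt_1_nat prime_gt_0_nat by auto

lemma finite_k: "finite k"
  using card_k p_pos by (metis card.infinite power_eq_0_iff not_less0)

text \<open>Translation by 1 permutes the finite set \<open>k\<close>; comparing the sums over
  \<open>k\<close> yields \<open>p ^ s = 0\<close> in the field, hence \<open>p = 0\<close>.\<close>

lemma CHAR_p: "CHAR('a) = p"
proof -
  have "bij_betw (\<lambda>x. x + 1) k k"
  proof -
    have "(\<lambda>x. x + 1) ` k \<subseteq> k" using subfieldD(1,3)[OF sfk] by blast
    moreover have "inj_on (\<lambda>x. x + 1) k" by (simp add: inj_on_def)
    ultimately show ?thesis using endo_inj_surj[OF finite_k] by (simp add: bij_betw_def)
  qed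
  then have "(\<Sum>x\<in>k. x + 1) = (\<Sum>x\<in>k. x)" by (rule sum.reindex_bij_betw)
  then have "of_nat (p ^ s) = (0 :: 'a)" by (simp add: sum.distrib card_k)
  then have "CHAR('a) dvd p ^ s" using of_nat_eq_0_iff_char_dvd by blast
  have "of_nat p ^ s = (0 :: 'a)" using \<open>of_nat (p ^ s) = (0 :: 'a)\<close> by simp
  then have "of_nat p = (0 :: 'a)" by simp
  then have "CHAR('a) dvd p" using of_nat_eq_0_iff_char_dvd by blast
  then have "CHAR('a) = 1 \<or> CHAR('a) = p" using prime_p unfolding prime_nat_iff by blast
  moreover have "CHAR('a) \<noteq> 1" using of_nat_eq_0_iff_char_dvd[of 1, where 'a = 'a] by (metis dvd_refl of_nat_1 zero_neq_one)
  ultimately show ?thesis by blast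
qed

lemma frobenius_add: "(x + y :: 'a) ^ (p ^ n) = x ^ (p ^ n) + y ^ (p ^ n)"
  by (rule freshmans_dream') (simp_all add: CHAR_p prime_p)

lemma frobenius_diff: "(x - y :: 'a) ^ (p ^ n) = x ^ (p ^ n) - y ^ (p ^ n)"
  using frobenius_add[of "x - y" y n] by simp

lemma k_power: "x \<in> k \<Longrightarrow> x ^ (p ^ s) = x"
proof (cases "x = 0")
  case True
  then show ?thesis using p_pos by simp
next
  case False
  assume x: "x \<in> k"
  have "bij_betw ((*) x) (k - {0}) (k - {0})"
  proof -
    have "(*) x ` (k - {0}) \<subseteq> k - {0}" using subfieldD(4)[OF sfk x] False by auto
    moreover have "inj_on ((*) x) (k - {0})" using False by (simp add: inj_on_def)
    ultimately show ?thesis using endo_inj_surj[of "k - {0}"] finite_k by (simp add: bij_betw_def)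
  qed
  then have "(\<Prod>y\<in>k - {0}. x * y) = (\<Prod>y\<in>k - {0}. y)" by (rule prod.reindex_bij_betw)
  then have "x ^ card (k - {0}) * (\<Prod>y\<in>k - {0}. y) = (\<Prod>y\<in>k - {0}. y)" by (simp add: prod.distrib)
  moreover have "(\<Prod>y\<in>k - {0}. y) \<noteq> 0" using finite_k by simp
  ultimately have "x ^ card (k - {0}) = 1" by simp
  moreover have "p ^ s = Suc (card (k - {0}))"
    using card_k finite_k subfieldD(2)[OF sfk] card_Suc_Diff1[of k 0] by simp
  ultimately show ?thesis by simp
qed

section \<open>Finite fields inside the separable closure\<close>

definition frob_fixed :: "nat \<Rightarrow> 'a set" where "frob_fixed N = {z. z ^ (p ^ N) = z}"

text \<open>The algebraic closure of the prime field; its elements serve as Teichmueller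
  representatives. The index starts at 1 because \<open>frob_fixed 0\<close> is the whole
  type.\<close>

definition teich :: "'a set" where "teich = (\<Union>N\<in>{1..}. frob_fixed N)"

lemma k_frob_fixed: "k \<subseteq> frob_fixed s"
  using k_power by (auto simp: frob_fixed_def)

lemma k_teich: "k \<subseteq> teich"
proof -
  have "s \<in> {1..}" using s_pos by simp
  then show ?thesis using k_frob_fixed unfolding teich_def by blast
qed

lemma subfield_frob_fixed: "subfield (frob_fixed N) Ksep"
proof (rule subfield_KsepI)
  show "1 \<in> frob_fixed N" by (simp add: frob_fixed_def)
  show "x + y \<in> frob_fixed N" if "x \<in> frob_fixed N" "y \<in> frob_fixed N" for x y
    using that by (simp add: frob_fixed_def frobenius_add)
  show "x * y \<in> frob_fixed N" if "x \<in> frob_fixed N" "y \<in> frob_fixed N" for x y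
    using that by (simp add: frob_fixed_def power_mult_distrib)
  show "- x \<in> frob_fixed N" if "x \<in> frob_fixed N" for x
    using that frobenius_diff[of 0 x N] p_pos by (simp add: frob_fixed_def power_0_left)
  show "inverse x \<in> frob_fixed N" if "x \<in> frob_fixed N" for x
    using that by (simp add: frob_fixed_def power_inverse)
qed

lemma frob_fixed_roots: "frob_fixed N = {z. poly (monom 1 (p ^ N) - monom 1 1) z = 0}"
  by (simp add: frob_fixed_def poly_monom)

lemma of_nat_p: "of_nat p = (0 :: 'a)"
  using of_nat_eq_0_iff_char_dvd[of p, where 'a = 'a] CHAR_p by simp

lemma separable_frob: "N \<ge> 1 \<Longrightarrow> separable_poly (monom 1 (p ^ N) - monom 1 1 :: 'a poly)"
proof (rule separable_polyI_pderiv_const)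
  assume "N \<ge> 1"
  then have z: "of_nat (p ^ N) = (0 :: 'a)" using of_nat_p by simp
  show "pderiv (monom 1 (p ^ N) - monom 1 1 :: 'a poly) = [:-1:]"
    by (simp only: pderiv_diff pderiv_monom z) (simp add: monom_0)
qed simp

lemma finite_frob_fixed: "N \<ge> 1 \<Longrightarrow> finite (frob_fixed N)"
  unfolding frob_fixed_roots using separable_poly_nonzero[OF separable_frob] by (rule poly_roots_finite)

lemma degree_frob: "N \<ge> 1 \<Longrightarrow> Polynomial.degree (monom 1 (p ^ N) - monom 1 1 :: 'a poly) = p ^ N"
    "N \<ge> 1 \<Longrightarrow> lead_coeff (monom 1 (p ^ N) - monom 1 1 :: 'a poly) = 1"
proof -
  assume N: "N \<ge> 1"
  have g: "p ^ N > 1" using one_less_power[OF p_gt1, of N] N by linarith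
  have "Polynomial.degree (monom 1 1 :: 'a poly) < Polynomial.degree (monom 1 (p ^ N) :: 'a poly)"
    using g by (simp add: degree_monom_eq)
  then show d: "Polynomial.degree (monom 1 (p ^ N) - monom 1 1 :: 'a poly) = p ^ N"
    using degree_add_eq_left[of "- monom 1 1" "monom 1 (p ^ N) :: 'a poly"] by (simp add: degree_monom_eq)
  show "lead_coeff (monom 1 (p ^ N) - monom 1 1 :: 'a poly) = 1"
    unfolding d using g by (simp add: coeff_monom)
qed

lemma sep_closed: "\<forall>f::'a poly. separable_poly f \<and> Polynomial.degree f > 0 \<longrightarrow> (\<exists>x. poly f x = 0)"
  using sepK by (simp add: UNIV_is_separable_closure_of_def)

lemma frob_product: "N \<ge> 1 \<Longrightarrow> x ^ (p ^ N) - x = (\<Prod>z\<in>frob_fixed N. x - z)"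
proof -
  assume N: "N \<ge> 1"
  have "poly (monom 1 (p ^ N) - monom 1 1) x = 1 * (\<Prod>z\<in>frob_fixed N. x - z)"
    using separable_splits[OF sep_closed separable_frob[OF N], of x]
    unfolding degree_frob(2)[OF N] frob_fixed_roots[symmetric] .
  then show ?thesis by (simp add: poly_monom)
qed

lemma frob_fixed_mult: "z \<in> frob_fixed N \<Longrightarrow> z \<in> frob_fixed (N * M)"
  unfolding frob_fixed_def by (induction M) (simp_all add: power_add power_mult)

lemma v_frob_fixed: "N \<ge> 1 \<Longrightarrow> z \<in> frob_fixed N \<Longrightarrow> z \<noteq> 0 \<Longrightarrow> v z = 0"
proof -
  assume a: "N \<ge> 1" "z \<in> frob_fixed N" "z \<noteq> 0"
  have "z ^ (p ^ N) = z" using a(2) by (simp add: frob_fixed_def)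
  then have "real (p ^ N) * nu z = nu z" using nu_power[OF a(3), of "p ^ N"] by simp
  moreover have "p ^ N > 1" using one_less_power[OF p_gt1, of N] a(1) by linarith
  then have "real (p ^ N) \<noteq> 1" by (metis less_irrefl of_nat_1 of_nat_eq_iff)
  ultimately have "nu z = 0" by simp
  then show ?thesis using v_nu[OF a(3)] by (simp add: zero_ereal_def)
qed

lemma v_frob_fixed_ge: "N \<ge> 1 \<Longrightarrow> z \<in> frob_fixed N \<Longrightarrow> 0 \<le> v z"
  using v_frob_fixed by (cases "z = 0") auto

lemma teichD: "z \<in> teich \<Longrightarrow> z \<noteq> 0 \<Longrightarrow> v z = 0" "z \<in> teich \<Longrightarrow> 0 \<le> v z"
  unfolding teich_def using v_frob_fixed v_frob_fixed_ge by auto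

lemma teich_common:
  assumes "finite A" "A \<subseteq> teich"
  obtains N where "N \<ge> 1" "A \<subseteq> frob_fixed N"
proof -
  have "\<exists>N\<ge>1. A \<subseteq> frob_fixed N"
    using assms
  proof (induction A rule: finite_induct)
    case empty
    then show ?case by (intro exI[of _ 1]) simp
  next
    case (insert a A)
    then obtain N where N: "N \<ge> 1" "A \<subseteq> frob_fixed N" by blast
    obtain M where M: "M \<ge> 1" "a \<in> frob_fixed M" using insert(4) unfolding teich_def by auto
    have "a \<in> frob_fixed (N * M)" using frob_fixed_mult[OF M(2), of N] by (simp add: mult.commute)
    moreover have "A \<subseteq> frob_fixed (N * M)" using N(2) frob_fixed_mult by blast
    moreover have "N * M \<ge> 1" using N M by simp
    ultimately show ?case by blast
  qed
  then show ?thesis using that by blast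
qed

lemma subfield_teich: "subfield teich Ksep"
proof (rule subfield_KsepI)
  have two: "\<exists>N\<ge>1. x \<in> frob_fixed N \<and> y \<in> frob_fixed N" if "x \<in> teich" "y \<in> teich" for x y
    using teich_common[of "{x, y}"] that by auto
  have up: "x \<in> teich" if "N \<ge> 1" "x \<in> frob_fixed N" for x N using that unfolding teich_def by auto
  show "1 \<in> teich" using up[of 1 1] subfieldD(1)[OF subfield_frob_fixed] by simp
  show "x + y \<in> teich" "x * y \<in> teich" if "x \<in> teich" "y \<in> teich" for x y
    using two[OF that] up subfieldD(3,4)[OF subfield_frob_fixed] by meson+
  show "- x \<in> teich" "inverse x \<in> teich" if "x \<in> teich" for x
    using two[OF that that] up subfieldD(5,6)[OF subfield_frob_fixed] by meson+
qed

text \<open>Elements whose residue class has a representative in \<open>teich\<close>, that is, is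
  algebraic over the prime field. The aim, reached in \<open>residue_algebraic\<close>, is that
  every integral element is of this kind.\<close>

definition resid :: "'a set" where "resid = {x. \<exists>z\<in>teich. 0 < v (x - z)}"

lemma resid_ge: "x \<in> resid \<Longrightarrow> 0 \<le> v x"
proof -
  assume "x \<in> resid"
  then obtain z where z: "z \<in> teich" "0 < v (x - z)" by (auto simp: resid_def)
  have "0 \<le> v ((x - z) + z)" using z(2) teichD(2)[OF z(1)] by (intro v_add_ge) auto
  then show ?thesis by simp
qed

lemma resid_add: "x \<in> resid \<Longrightarrow> y \<in> resid \<Longrightarrow> x + y \<in> resid"
proof -
  assume "x \<in> resid" "y \<in> resid"
  then obtain z w where z: "z \<in> teich" "0 < v (x - z)" and w: "w \<in> teich" "0 < v (y - w)" by (auto simp: resid_def)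
  have "0 < v ((x - z) + (y - w))" using z(2) w(2) by (rule v_add_gt)
  then have "0 < v ((x + y) - (z + w))" by (simp add: algebra_simps)
  then show ?thesis unfolding resid_def using subfieldD(3)[OF subfield_teich z(1) w(1)] by blast
qed

lemma resid_mult: "x \<in> resid \<Longrightarrow> y \<in> resid \<Longrightarrow> x * y \<in> resid"
proof -
  assume xy: "x \<in> resid" "y \<in> resid"
  then obtain z w where z: "z \<in> teich" "0 < v (x - z)" and w: "w \<in> teich" "0 < v (y - w)" by (auto simp: resid_def)
  have "0 < v ((x - z) * y + (y - w) * z)"
    using z(2) w(2) resid_ge[OF xy(2)] teichD(2)[OF z(1)] by (intro v_add_gt v_mult_gt)
  then have "0 < v (x * y - z * w)" by (simp add: algebra_simps)
  then show ?thesis unfolding resid_def using subfieldD(4)[OF subfield_teich z(1) w(1)] by blast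
qed

lemma teich_resid: "z \<in> teich \<Longrightarrow> z \<in> resid"
  unfolding resid_def by (auto intro!: bexI[of _ z])

lemma resid_close: "x \<in> resid \<Longrightarrow> 0 < v (y - x) \<Longrightarrow> y \<in> resid"
proof -
  assume a: "x \<in> resid" "0 < v (y - x)"
  then obtain z where z: "z \<in> teich" "0 < v (x - z)" by (auto simp: resid_def)
  have "0 < v ((y - x) + (x - z))" using a(2) z(2) by (rule v_add_gt)
  then show ?thesis using z(1) unfolding resid_def by auto
qed

lemma resid_poly:
  assumes "\<And>i. coeff f i \<in> resid" "x \<in> resid" shows "poly f x \<in> resid"
proof -
  have z: "0 \<in> resid" "1 \<in> resid" using teich_resid subfieldD(1,2)[OF subfield_teich] by auto
  have pw: "x ^ i \<in> resid" for i by (induction i) (auto intro: resid_mult z assms)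
  have sm: "sum h A \<in> resid" if "\<And>i. i \<in> A \<Longrightarrow> h i \<in> resid" for h and A :: "nat set"
    using that by (induction A rule: infinite_finite_induct) (auto intro: resid_add z)
  show ?thesis unfolding poly_altdef by (intro sm resid_mult pw assms)
qed

lemma v_power_pos_iff: "n > 0 \<Longrightarrow> 0 < v (x ^ n) \<longleftrightarrow> 0 < v x"
proof (cases "x = 0")
  case False
  assume "n > 0"
  then show ?thesis using False v_pos_nu(2)[of x] v_pos_nu(2)[of "x ^ n"] by (simp add: nu_power zero_less_mult_iff)
qed (simp add: power_0_left)

text \<open>\<open>x ^ (p ^ N) - x\<close> is the product of all \<open>x - z\<close> with
  \<open>z\<close> in \<open>frob_fixed N\<close>, and a product of positive valuation has a factor
  of positive valuation.\<close>

lemma resid_of_power: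
  assumes "N \<ge> 1" "0 < v (x ^ (p ^ N) - x)" shows "x \<in> resid"
proof (rule ccontr)
  assume n: "x \<notin> resid"
  have le: "v (x - z) \<le> 0" if "z \<in> frob_fixed N" for z
    using n that assms(1) unfolding resid_def teich_def by (auto simp: not_less)
  have ne: "x - z \<noteq> 0" if "z \<in> frob_fixed N" for z using le[OF that] by auto
  have "nu (x - z) \<le> 0" if "z \<in> frob_fixed N" for z
    using le[OF that] v_pos_nu(2)[OF ne[OF that]] by (simp add: not_less[symmetric])
  then have "(\<Sum>z\<in>frob_fixed N. nu (x - z)) \<le> 0" by (intro sum_nonpos)
  moreover have "nu (x ^ (p ^ N) - x) = (\<Sum>z\<in>frob_fixed N. nu (x - z))"
    unfolding frob_product[OF assms(1)] by (rule nu_prod) (rule ne)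
  moreover have "x ^ (p ^ N) - x \<noteq> 0"
    unfolding frob_product[OF assms(1)] using ne finite_frob_fixed[OF assms(1)] by simp
  ultimately show False using assms(2) v_pos_nu(2) by fastforce
qed

lemma finite_bounded_polys:
  assumes "finite B" shows "finite {r \<in> polys_in B. \<forall>i\<ge>d. coeff r i = 0}"
proof (rule finite_subset)
  show "finite (Poly ` {xs. set xs \<subseteq> B \<and> length xs = d})"
    using finite_lists_length_eq[OF assms] by blast
  show "{r \<in> polys_in B. \<forall>i\<ge>d. coeff r i = 0} \<subseteq> Poly ` {xs. set xs \<subseteq> B \<and> length xs = d}"
  proof
    fix r assume r: "r \<in> {r \<in> polys_in B. \<forall>i\<ge>d. coeff r i = 0}"
    let ?xs = "map (coeff r) [0..<d]"
    have "r = Poly ?xs" using r by (intro poly_eqI) (simp add: nth_default_def)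
    moreover have "?xs \<in> {xs. set xs \<subseteq> B \<and> length xs = d}" using r by (auto simp: polys_in_def)
    ultimately show "r \<in> Poly ` {xs. set xs \<subseteq> B \<and> length xs = d}" by (rule image_eqI)
  qed
qed

text \<open>
  Modulo the maximal ideal the powers of \<open>x\<close> lie in a finite set, so two Frobenius powers of \<open>x\<close>
  are congruent.
\<close>

lemma resid_monic:
  assumes N: "N \<ge> 1" and h: "h \<in> polys_in (frob_fixed N)" "lead_coeff h = 1"
    and x: "0 \<le> v x" "0 < v (poly h x)"
  shows "x \<in> resid"
proof -
  note sf = subfield_frob_fixed[of N]
  let ?d = "Polynomial.degree h"
  let ?S = "{r \<in> polys_in (frob_fixed N). \<forall>i\<ge>?d. coeff r i = 0}"
  have "\<forall>n. \<exists>r. r \<in> ?S \<and> 0 < v (x ^ n - poly r x)"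
  proof
    fix n
    have "monom 1 n \<in> polys_in (frob_fixed N)" using polys_in_closed(2)[OF sf subfieldD(1)[OF sf]] .
    then obtain q r where qr: "q \<in> polys_in (frob_fixed N)" "r \<in> polys_in (frob_fixed N)" "monom 1 n = h * q + r"
      "\<forall>i\<ge>?d. coeff r i = 0"
      using polys_in_division[OF sf h, of "monom 1 n"] by blast
    have e: "x ^ n - poly r x = poly h x * poly q x"
      using arg_cong[OF qr(3), of "\<lambda>f. poly f x"] by (simp add: poly_monom)
    have "0 \<le> v (poly q x)"
    proof (rule v_poly_ge[OF _ x(1)])
      fix i show "0 \<le> v (coeff q i)" using qr(1) v_frob_fixed_ge[OF N] by (simp add: polys_in_def)
    qed
    then have "0 < v (x ^ n - poly r x)" unfolding e by (rule v_mult_gt[OF x(2)])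
    then show "\<exists>r. r \<in> ?S \<and> 0 < v (x ^ n - poly r x)" using qr(2,4) by blast
  qed
  from choice[OF this] obtain r where "\<forall>n. r n \<in> ?S \<and> 0 < v (x ^ n - poly (r n) x)" by blast
  then have r: "\<And>n. r n \<in> ?S" "\<And>n. 0 < v (x ^ n - poly (r n) x)" by blast+
  have fin: "finite ?S" by (rule finite_bounded_polys[OF finite_frob_fixed[OF N]])
  have "\<not> inj (\<lambda>n. r (p ^ n))"
  proof
    assume "inj (\<lambda>n. r (p ^ n))"
    moreover have "range (\<lambda>n. r (p ^ n)) \<subseteq> ?S" using r(1) by blast
    then have "finite (range (\<lambda>n. r (p ^ n)))" by (rule finite_subset[OF _ fin])
    ultimately have "finite (UNIV :: nat set)" by (intro finite_imageD[of "\<lambda>n. r (p ^ n)"])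
    then show False by simp
  qed
  then obtain i j where ij: "i < j" "r (p ^ i) = r (p ^ j)"
    unfolding inj_def using linorder_neqE_nat by (metis (no_types))
  have "0 < v ((x ^ (p ^ j) - poly (r (p ^ j)) x) - (x ^ (p ^ i) - poly (r (p ^ i)) x))"
    by (rule v_diff_gt[OF r(2) r(2)])
  then have *: "0 < v (x ^ (p ^ j) - x ^ (p ^ i))" unfolding ij(2) by simp
  have "x ^ (p ^ j) = (x ^ (p ^ (j - i))) ^ (p ^ i)"
    using ij(1) by (simp add: power_mult[symmetric] power_add[symmetric])
  then have "0 < v ((x ^ (p ^ (j - i)) - x) ^ (p ^ i))" using * by (simp add: frobenius_diff)
  then have "0 < v (x ^ (p ^ (j - i)) - x)" using v_power_pos_iff[of "p ^ i"] p_pos by simp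
  then show ?thesis using resid_of_power[of "j - i" x] ij(1) by simp
qed

text \<open>Replacing each coefficient by its representative changes the value at \<open>x\<close>
  only by something of positive valuation. The unit coefficient at \<open>i0\<close> keeps the new
  polynomial nonzero, and dividing by its leading coefficient, again a unit, reduces to the monic
  case over a finite field.\<close>

lemma resid_algebraic_step:
  assumes f: "\<And>i. coeff f i \<in> resid" "v (coeff f i0) = 0" and x: "0 \<le> v x" "0 < v (poly f x)"
  shows "x \<in> resid"
proof -
  have "\<forall>i. \<exists>z\<in>teich. 0 < v (coeff f i - z)" using f(1) unfolding resid_def by blast
  then obtain z where z: "\<And>i. z i \<in> teich" "\<And>i. 0 < v (coeff f i - z i)" by metis
  let ?d = "Polynomial.degree f"
  obtain N where N: "N \<ge> 1" "z ` {..?d} \<subseteq> frob_fixed N"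
    using teich_common[of "z ` {..?d}"] z(1) by blast
  note sf = subfield_frob_fixed[of N]
  define g where "g = (\<Sum>i\<le>?d. monom (z i) i)"
  have cg: "coeff g i = (if i \<le> ?d then z i else 0)" for i
    unfolding g_def by (simp add: coeff_sum coeff_monom if_distrib cong: if_cong)
  have gN: "g \<in> polys_in (frob_fixed N)"
    unfolding polys_in_def using N(2) subfieldD(2)[OF sf] by (auto simp: cg)
  have "i0 \<le> ?d"
  proof (rule ccontr)
    assume "\<not> i0 \<le> ?d"
    then have "coeff f i0 = 0" by (simp add: coeff_eq_0)
    then show False using f(2) by simp
  qed
  have "z i0 \<noteq> 0" using z(2)[of i0] f(2) by auto
  then have "coeff g i0 \<noteq> 0" using \<open>i0 \<le> ?d\<close> by (simp add: cg)
  then have g0: "g \<noteq> 0" by auto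
  have "poly f x - poly g x = (\<Sum>i\<le>?d. (coeff f i - z i) * x ^ i)"
    by (simp add: poly_altdef[of f] g_def poly_sum poly_monom left_diff_distrib sum_subtractf)
  moreover have "0 < v (\<Sum>i\<le>?d. (coeff f i - z i) * x ^ i)"
    unfolding zero_ereal_def
  proof (rule v_sum_gt)
    fix i show "ereal 0 < v ((coeff f i - z i) * x ^ i)"
      unfolding zero_ereal_def[symmetric] by (intro v_mult_gt v_power_ge z(2) x(1))
  qed
  ultimately have "0 < v (poly f x - poly g x)" by simp
  with x(2) have "0 < v (poly f x - (poly f x - poly g x))" by (rule v_diff_gt)
  then have gx: "0 < v (poly g x)" by simp
  define c where "c = lead_coeff g"
  have c: "c \<in> frob_fixed N" "c \<noteq> 0" using gN g0 by (simp_all add: c_def polys_in_def)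
  define h where "h = smult (inverse c) g"
  have hN: "h \<in> polys_in (frob_fixed N)" unfolding h_def by (rule polys_in_closed(7)[OF sf subfieldD(6)[OF sf c(1)] gN])
  have hl: "lead_coeff h = 1" using c(2) by (simp add: h_def c_def)
  have "v (inverse c) = 0" using v_frob_fixed[OF N(1) subfieldD(6)[OF sf c(1)]] c(2) by simp
  then have "0 < v (poly h x)" using gx by (simp add: h_def v_mult)
  then show ?thesis using resid_monic[OF N(1) hN hl x(1)] by blast
qed

section \<open>Algebraic relations over the rational function field\<close>

lemma kt_fractions:
  "generate_field Ksep (insert t k) \<subseteq> {poly f t / poly g t | f g. f \<in> polys_in k \<and> g \<in> polys_in k \<and> poly g t \<noteq> 0}"
    (is "_ \<subseteq> ?S")
proof -
  have mem: "a \<in> ?S" if "f \<in> polys_in k" "g \<in> polys_in k" "poly g t \<noteq> 0" "a = poly f t / poly g t" for a f g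
    using that by blast
  note cl = polys_in_closed[OF sfk]
  have sub: "subfield ?S Ksep"
  proof (rule subfield_KsepI)
    show "1 \<in> ?S" by (rule mem[of 1 1]) (simp_all add: cl)
    fix x y assume "x \<in> ?S" "y \<in> ?S"
    then obtain f g f' g' where x: "f \<in> polys_in k" "g \<in> polys_in k" "poly g t \<noteq> 0" "x = poly f t / poly g t"
      and y: "f' \<in> polys_in k" "g' \<in> polys_in k" "poly g' t \<noteq> 0" "y = poly f' t / poly g' t" by blast
    show "x + y \<in> ?S"
      by (rule mem[of "f * g' + f' * g" "g * g'"]) (use x y in \<open>simp_all add: cl add_frac_eq mult.commute\<close>)
    show "x * y \<in> ?S" by (rule mem[of "f * f'" "g * g'"]) (use x y cl in simp_all)
  next
    fix x assume "x \<in> ?S"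
    then obtain f g where x: "f \<in> polys_in k" "g \<in> polys_in k" "poly g t \<noteq> 0" "x = poly f t / poly g t" by blast
    have "0 - f \<in> polys_in k" by (rule cl(4)[OF cl(1) x(1)])
    then show "- x \<in> ?S" by (rule mem[OF _ x(2,3)]) (simp add: x(4))
    show "inverse x \<in> ?S" if "x \<noteq> 0" by (rule mem[of g f]) (use x that in simp_all)
  qed
  have "insert t k \<subseteq> ?S"
  proof
    fix a assume "a \<in> insert t k"
    then show "a \<in> ?S"
    proof
      assume "a = t"
      then show ?thesis by (intro mem[of "monom 1 1" 1]) (simp_all add: cl subfieldD(1)[OF sfk] poly_monom)
    next
      assume "a \<in> k"
      then show ?thesis by (intro mem[of "monom a 0" 1]) (simp_all add: cl poly_monom)
    qed
  qed
  then show ?thesis using field.generate_field_min_subfield1[OF field_Ksep _ sub] by simp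
qed

text \<open>Coefficient lists of HOL-Algebra start with the leading coefficient, those of
  \<open>Poly\<close> with the constant term, hence \<open>rev\<close>.\<close>

lemma Ksep_eval: "ring.eval Ksep as x = poly (Poly (rev as)) (x :: 'a)"
proof (induction as)
  case Nil
  then show ?case by (simp add: ring.eval.simps[OF ring_Ksep])
next
  case (Cons a as)
  have pw: "x [^]\<^bsub>(Ksep :: 'a ring)\<^esub> n = x ^ n" for n :: nat
    by (induction n) (simp_all add: nat_pow_def mult.commute)
  have "Poly (rev as @ [a]) = Poly (rev as) + monom a (length as)"
    by (simp add: Poly_append smult_monom)
  then show ?case using Cons by (simp add: ring.eval.simps[OF ring_Ksep] pw poly_monom add.commute)
qed

text \<open>Finite dimension over \<open>k(t)\<close> gives an algebraic equation with coefficients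
  in \<open>k(t)\<close>; multiplying by the product \<open>B\<close> of all denominators moves them
  into \<open>k[t]\<close>.\<close>

lemma F_algebraic:
  assumes x: "x \<in> F"
  shows "\<exists>d f. (\<forall>i. f i \<in> polys_in k) \<and> (\<exists>i\<le>d. poly (f i) t \<noteq> 0) \<and> (\<Sum>i\<le>d. poly (f i) t * x ^ i) = 0"
proof -
  let ?E = "generate_field Ksep (insert t k)"
  have sE: "subfield ?E Ksep" by (rule field.generate_field_is_subfield[OF field_Ksep]) simp
  have dm: "domain (Ksep :: 'a ring)" using field_Ksep by (rule field.axioms)
  have fd: "ring.finite_dimension Ksep ?E F" using ff by (simp add: function_field_def)
  have "ring.algebraic Ksep ?E x"
    using ring.finite_dimension_imp_algebraic[OF ring_Ksep sE subfieldE(1)[OF sfF] fd x] by (simp add: over_def)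
  then obtain as where as: "as \<in> carrier (univ_poly Ksep ?E)" "as \<noteq> []" "ring.eval Ksep as x = 0"
    using domain.algebraicE[OF dm subfieldE(1)[OF sE], of x] by (auto simp: over_def)
  have pol: "set as \<subseteq> ?E" "hd as \<noteq> 0"
    using as(1,2) by (auto simp: univ_poly_def polynomial_def)
  define c where "c i = rev as ! i" for i
  define d where "d = length as - 1"
  have ld: "length as = Suc d" using as(2) by (simp add: d_def)
  have cd: "c d \<noteq> 0" using pol(2) as(2) ld by (simp add: c_def rev_nth hd_conv_nth)
  have cE: "c i \<in> ?E" if "i \<le> d" for i
  proof -
    have "rev as ! i \<in> set (rev as)" using that ld by (intro nth_mem) simp
    then show ?thesis using pol(1) by (auto simp: c_def)
  qed
  have dP: "Polynomial.degree (Poly (rev as)) \<le> d" using ld by (intro degree_le) (simp add: nth_default_def)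
  have "poly (Poly (rev as)) x = (\<Sum>i\<le>d. c i * x ^ i)"
    unfolding poly_eq_sum_coeff[OF dP] using ld by (intro sum.cong) (auto simp: nth_default_def c_def)
  then have sum0: "(\<Sum>i\<le>d. c i * x ^ i) = 0" using as(3) by (simp add: Ksep_eval)
  have "\<forall>i. \<exists>a b. i \<le> d \<longrightarrow> a \<in> polys_in k \<and> b \<in> polys_in k \<and> poly b t \<noteq> 0 \<and> c i = poly a t / poly b t"
    using cE kt_fractions by blast
  then obtain a b where ab: "\<And>i. i \<le> d \<Longrightarrow> a i \<in> polys_in k" "\<And>i. i \<le> d \<Longrightarrow> b i \<in> polys_in k"
    "\<And>i. i \<le> d \<Longrightarrow> poly (b i) t \<noteq> 0" "\<And>i. i \<le> d \<Longrightarrow> c i = poly (a i) t / poly (b i) t" by metis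
  define B where "B = (\<Prod>i\<le>d. poly (b i) t)"
  have B0: "B \<noteq> 0" using ab(3) by (simp add: B_def)
  define f where "f i = (if i \<le> d then a i * (\<Prod>j\<in>{..d} - {i}. b j) else 0)" for i
  have prodk: "(\<Prod>j\<in>A. b j) \<in> polys_in k" if "A \<subseteq> {..d}" for A
    using that by (induction A rule: infinite_finite_induct) (auto intro: polys_in_closed[OF sfk] ab)
  have fk: "f i \<in> polys_in k" for i
    using prodk[of "{..d} - {i}"] ab(1) polys_in_closed(1,5)[OF sfk] by (auto simp: f_def)
  have ft: "poly (f i) t = B * c i" if i: "i \<le> d" for i
  proof -
    have "B = poly (b i) t * (\<Prod>j\<in>{..d} - {i}. poly (b j) t)" unfolding B_def using i by (simp add: prod.remove)
    then show ?thesis using ab(3,4)[OF i] i by (simp add: f_def poly_prod)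
  qed
  have "(\<Sum>i\<le>d. poly (f i) t * x ^ i) = B * (\<Sum>i\<le>d. c i * x ^ i)"
    unfolding sum_distrib_left by (intro sum.cong) (auto simp: ft)
  then have "(\<Sum>i\<le>d. poly (f i) t * x ^ i) = 0" using sum0 by simp
  moreover have "poly (f d) t \<noteq> 0" using ft[of d] B0 cd by simp
  ultimately show ?thesis using fk by blast
qed

lemma F_resid_of_coeffs:
  assumes b: "\<And>i. i \<le> d \<Longrightarrow> b i \<in> resid" "i0 \<le> d" "v (b i0) = 0" "(\<Sum>i\<le>d. b i * x ^ i) = 0" "0 \<le> v x"
  shows "x \<in> resid"
proof -
  define f where "f = (\<Sum>i\<le>d. monom (b i) i)"
  have cf: "coeff f i = (if i \<le> d then b i else 0)" for i
    unfolding f_def by (simp add: coeff_sum coeff_monom if_distrib cong: if_cong)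
  have "0 \<in> resid" using teich_resid subfieldD(2)[OF subfield_teich] by blast
  then have 1: "coeff f i \<in> resid" for i using b(1) by (simp add: cf)
  have 2: "v (coeff f i0) = 0" using b(2,3) by (simp add: cf)
  have "poly f x = 0" using b(4) by (simp add: f_def poly_sum poly_monom)
  then show ?thesis using resid_algebraic_step[OF 1 2 b(5)] by simp
qed

lemma k_v: "c \<in> k \<Longrightarrow> c \<noteq> 0 \<Longrightarrow> v c = 0" "c \<in> k \<Longrightarrow> 0 \<le> v c"
  using k_teich teichD by auto

text \<open>With \<open>e\<close> the largest degree among the coefficients,
  \<open>poly (f i) t / t ^ e\<close> is congruent to the coefficient of \<open>t ^ e\<close>,
  because negative powers of \<open>t\<close> have positive valuation. These constants are not all
  zero, so the equation for \<open>x\<close> stays nontrivial modulo the maximal ideal.\<close>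

lemma F_resid_infinite:
  assumes t: "v t < 0" and x: "x \<in> F" "0 \<le> v x"
  shows "x \<in> resid"
proof -
  have t0: "t \<noteq> 0" using t by auto
  have nt: "nu t < 0" using t v_nu[OF t0] by (simp add: zero_ereal_def)
  obtain d f where f: "\<And>i. f i \<in> polys_in k" "\<exists>i\<le>d. poly (f i) t \<noteq> 0" "(\<Sum>i\<le>d. poly (f i) t * x ^ i) = 0"
    using F_algebraic[OF x(1)] by blast
  let ?I = "{i\<in>{..d}. f i \<noteq> 0}"
  have fin: "finite ?I" by simp
  have ne: "?I \<noteq> {}" using f(2) by force
  define e where "e = Max ((\<lambda>i. Polynomial.degree (f i)) ` ?I)"
  have "e \<in> (\<lambda>i. Polynomial.degree (f i)) ` ?I" unfolding e_def using fin ne by (intro Max_in) auto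
  then obtain i0 where i0: "i0 \<le> d" "f i0 \<noteq> 0" "Polynomial.degree (f i0) = e" by auto
  have de: "Polynomial.degree (f i) \<le> e" if "i \<le> d" for i
  proof (cases "f i = 0")
    case False
    then show ?thesis unfolding e_def using that fin by (intro Max_ge) auto
  qed simp
  define b where "b i = poly (f i) t / t ^ e" for i
  have bc: "0 < v (b i - coeff (f i) e)" if i: "i \<le> d" for i
  proof -
    have "poly (f i) t = (\<Sum>j\<le>e. coeff (f i) j * t ^ j)" by (rule poly_eq_sum_coeff[OF de[OF i]])
    also have "\<dots> = (\<Sum>j<e. coeff (f i) j * t ^ j) + coeff (f i) e * t ^ e"
      by (simp add: lessThan_Suc_atMost[symmetric])
    finally have bi: "poly (f i) t = (\<Sum>j<e. coeff (f i) j * t ^ j) + coeff (f i) e * t ^ e" .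
    have "b i - coeff (f i) e = (\<Sum>j<e. coeff (f i) j * t ^ j / t ^ e)"
      unfolding b_def bi using t0 by (simp add: add_divide_distrib sum_divide_distrib)
    moreover have "ereal 0 < v (\<Sum>j<e. coeff (f i) j * t ^ j / t ^ e)"
    proof (rule v_sum_gt)
      fix j assume j: "j \<in> {..<e}"
      show "ereal 0 < v (coeff (f i) j * t ^ j / t ^ e)"
      proof (cases "coeff (f i) j = 0")
        case False
        have "coeff (f i) j \<in> k" using f(1) by (simp add: polys_in_def)
        then have "nu (coeff (f i) j) = 0" using k_v(1) False v_nu[OF False] by (simp add: zero_ereal_def)
        then have "nu (coeff (f i) j * t ^ j / t ^ e) = (real j - real e) * nu t"
          using False t0 by (simp add: nu_mult nu_divide nu_power algebra_simps)
        moreover have "0 < (real j - real e) * nu t" using j nt by (intro mult_neg_neg) auto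
        ultimately show ?thesis using False t0 by (subst v_le_nu) auto
      qed simp
    qed
    ultimately show ?thesis by (simp add: zero_ereal_def)
  qed
  have ck: "coeff (f i) e \<in> teich" for i using f(1) k_teich by (auto simp: polys_in_def)
  have br: "b i \<in> resid" if "i \<le> d" for i by (rule resid_close[OF teich_resid[OF ck] bc[OF that]])
  have c0: "coeff (f i0) e \<noteq> 0" using i0 by auto
  have "v (coeff (f i0) e) = 0" using teichD(1)[OF ck c0] .
  then have "v (b i0) = 0" using v_eq_of_diff[of "coeff (f i0) e" "b i0"] bc[OF i0(1)] v_diff_commute by metis
  moreover have "(\<Sum>i\<le>d. b i * x ^ i) = 0"
  proof -
    have "(\<Sum>i\<le>d. b i * x ^ i) = (\<Sum>i\<le>d. poly (f i) t * x ^ i) / t ^ e"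
      by (simp add: b_def sum_divide_distrib)
    then show ?thesis using f(3) by simp
  qed
  ultimately show ?thesis using F_resid_of_coeffs[of d b i0 x] br i0(1) x(2) by blast
qed

text \<open>Here \<open>k[t]\<close> consists of integral elements, and a monic \<open>h\<close> of
  least degree with \<open>poly h t\<close> of positive valuation generates the prime below
  \<open>v\<close>. Common factors \<open>h\<close> are removed from an equation for
  \<open>x\<close> until some coefficient is a unit; then the equation is nontrivial over the
  residue field.\<close>

lemma F_resid_finite:
  assumes t: "0 \<le> v t" and x: "x \<in> F" "0 \<le> v x"
  shows "x \<in> resid"
proof -
  have ge: "0 \<le> v (poly f t)" if "f \<in> polys_in k" for f
    using that k_v(2) by (intro v_poly_ge[OF _ t]) (simp add: polys_in_def)
  \<comment> \<open>Otherwise every nonzero polynomial in \<open>t\<close> would have valuation 0.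
    In an equation for an element \<open>y\<close> of valuation 1 the term with \<open>y ^ i\<close>
    then has valuation \<open>i\<close>, so no two terms could share the least valuation.\<close>
  have "\<exists>f\<in>polys_in k. f \<noteq> 0 \<and> 0 < v (poly f t)"
  proof (rule ccontr)
    assume "\<not> ?thesis"
    then have z: "v (poly f t) = 0" if "f \<in> polys_in k" "f \<noteq> 0" for f using ge[OF that(1)] that by force
    have "ereal 1 \<in> range (\<lambda>k::int. ereal (of_int k))" by (rule range_eqI[of _ _ 1]) simp
    then obtain y where y: "y \<in> F - {0}" "v y = ereal 1"
      using normF unfolding normalized_on_def by (metis imageE)
    have y0: "y \<noteq> 0" using y(1) by simp
    obtain d f where f: "\<And>i. f i \<in> polys_in k" "\<exists>i\<le>d. poly (f i) t \<noteq> 0" "(\<Sum>i\<le>d. poly (f i) t * y ^ i) = 0"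
      using F_algebraic[of y] y(1) by blast
    obtain i1 where i1: "i1 \<le> d" "poly (f i1) t \<noteq> 0" using f(2) by blast
    obtain i j where ij: "i \<noteq> j" "poly (f i) t * y ^ i \<noteq> 0" "poly (f j) t * y ^ j \<noteq> 0"
        "nu (poly (f i) t * y ^ i) = nu (poly (f j) t * y ^ j)"
      using v_zero_sum_two_min[of "{..d}" "\<lambda>i. poly (f i) t * y ^ i" i1] f(3) i1 y0 by auto
    have n0: "nu (poly (f i) t) = 0" if "poly (f i) t \<noteq> 0" for i
      using z[OF f(1)[of i]] that v_nu[OF that] by (cases "f i = 0") (auto simp: zero_ereal_def)
    have "real i * nu y = real j * nu y"
      using ij(2-4) y0 n0 by (simp add: nu_mult nu_power)
    moreover have "nu y = 1" using y(2) by (simp add: nu_def)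
    ultimately show False using ij(1) by simp
  qed
  then obtain f0 where f0: "f0 \<in> polys_in k \<and> f0 \<noteq> 0 \<and> 0 < v (poly f0 t)" by blast
  from ex_has_least_nat[of "\<lambda>f. f \<in> polys_in k \<and> f \<noteq> 0 \<and> 0 < v (poly f t)", OF f0, of Polynomial.degree]
  obtain g where g: "g \<in> polys_in k" "g \<noteq> 0" "0 < v (poly g t)"
      and gmin: "\<And>f. f \<in> polys_in k \<Longrightarrow> f \<noteq> 0 \<Longrightarrow> 0 < v (poly f t) \<Longrightarrow> Polynomial.degree g \<le> Polynomial.degree f"
    by blast
  define c where "c = lead_coeff g"
  have c: "c \<in> k" "c \<noteq> 0" using g(1,2) by (simp_all add: c_def polys_in_def)
  define h where "h = smult (inverse c) g"
  have ck: "inverse c \<in> k" by (rule subfieldD(6)[OF sfk c(1)])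
  have h: "h \<in> polys_in k" "lead_coeff h = 1" "Polynomial.degree h = Polynomial.degree g"
    using polys_in_closed(7)[OF sfk ck g(1)] c(2) by (simp_all add: h_def c_def)
  have "v (inverse c) = 0" using k_v(1)[OF ck] c(2) by simp
  then have hv: "0 < v (poly h t)" using g(3) by (simp add: h_def v_mult)
  have dvdh: "\<exists>q\<in>polys_in k. f = h * q" if f: "f \<in> polys_in k" "0 < v (poly f t)" for f
  proof -
    obtain q r where qr: "q \<in> polys_in k" "r \<in> polys_in k" "f = h * q + r" "\<forall>i\<ge>Polynomial.degree h. coeff r i = 0"
      using polys_in_division[OF sfk h(1,2) f(1)] by blast
    have "poly r t = poly f t - poly h t * poly q t" using qr(3) by simp
    moreover have "0 < v (poly f t - poly h t * poly q t)"
      using f(2) v_mult_gt[OF hv ge[OF qr(1)]] by (rule v_diff_gt)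
    ultimately have "0 < v (poly r t)" by simp
    then have "r = 0" using gmin[OF qr(2)] qr(4) h(3) by (metis leading_coeff_0_iff)
    then show ?thesis using qr(1,3) by auto
  qed
  have tr: "t \<in> resid"
    using resid_algebraic_step[of h "Polynomial.degree h" t] h(1,2) k_teich teich_resid t hv
    by (auto simp: polys_in_def)
  have fr: "poly f t \<in> resid" if "f \<in> polys_in k" for f
    using that k_teich teich_resid by (intro resid_poly[OF _ tr]) (auto simp: polys_in_def)
  obtain d f where f: "\<And>i. f i \<in> polys_in k" "\<exists>i\<le>d. poly (f i) t \<noteq> 0" "(\<Sum>i\<le>d. poly (f i) t * x ^ i) = 0"
    using F_algebraic[OF x(1)] by blast
  obtain i1 where i1: "i1 \<le> d" "poly (f i1) t \<noteq> 0" using f(2) by blast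
  \<comment> \<open>Induction on the degree of one coefficient known to be nonzero: dividing all
    coefficients by \<open>h\<close> lowers this degree, so the process ends.\<close>
  have "x \<in> resid" if "\<forall>i. f i \<in> polys_in k" "poly (f i1) t \<noteq> 0" "(\<Sum>i\<le>d. poly (f i) t * x ^ i) = 0" for f
    using that
  proof (induction "Polynomial.degree (f i1)" arbitrary: f rule: less_induct)
    case less
    show ?case
    proof (cases "\<exists>i\<le>d. v (poly (f i) t) = 0")
      case True
      then obtain i0 where i0: "i0 \<le> d" "v (poly (f i0) t) = 0" by blast
      show ?thesis
        using F_resid_of_coeffs[of d "\<lambda>i. poly (f i) t" i0 x] fr less.prems(1,3) i0 x(2) by blast
    next
      case False
      then have pos: "0 < v (poly (f i) t)" if "i \<le> d" for i using ge[of "f i"] less.prems(1) that by (metis order.not_eq_order_implies_strict)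
      have "\<forall>i. \<exists>q\<in>polys_in k. i \<le> d \<longrightarrow> f i = h * q" using dvdh pos less.prems(1) by (metis h(1))
      then obtain f' where f': "\<And>i. f' i \<in> polys_in k" "\<And>i. i \<le> d \<Longrightarrow> f i = h * f' i" by metis
      have ht0: "poly h t \<noteq> 0" and f'1: "poly (f' i1) t \<noteq> 0" using less.prems(2) f'(2)[OF i1(1)] by auto
      have f'0: "f' i1 \<noteq> 0" using f'1 by auto
      have h0: "h \<noteq> 0" using ht0 by auto
      have "Polynomial.degree h > 0"
      proof (rule ccontr)
        assume "\<not> ?thesis"
        then have "h = [:1:]" using h(2) by (metis degree_eq_zeroE lead_coeff_pCons(2) neq0_conv)
        then show False using hv by simp
      qed
      then have "Polynomial.degree (f' i1) < Polynomial.degree (f i1)"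
        unfolding f'(2)[OF i1(1)] using f'0 h0 by (simp add: degree_mult_eq)
      moreover have "(\<Sum>i\<le>d. poly (f' i) t * x ^ i) = 0"
      proof -
        have "(\<Sum>i\<le>d. poly (f i) t * x ^ i) = poly h t * (\<Sum>i\<le>d. poly (f' i) t * x ^ i)"
          unfolding sum_distrib_left by (intro sum.cong) (auto simp: f'(2))
        then show ?thesis using less.prems(3) ht0 by simp
      qed
      ultimately show ?thesis using less.hyps[of f'] f'(1) f'1 by blast
    qed
  qed
  then show ?thesis using f(1,3) i1(2) by blast
qed

text \<open>By density, integral elements of \<open>K\<close> are congruent to elements of
  \<open>F\<close>. For general \<open>x\<close>, an equation over \<open>K\<close> divided by a
  coefficient of least valuation has integral coefficients, one of them equal to 1, so the algebraic
  step applies.\<close>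

theorem residue_algebraic:
  assumes x: "0 \<le> v x" shows "x \<in> resid"
proof -
  have F: "y \<in> resid" if "y \<in> F" "0 \<le> v y" for y
    using F_resid_infinite[OF _ that] F_resid_finite[OF _ that] by (cases "v t < 0") (auto simp: not_less)
  have KR: "y \<in> resid" if y: "y \<in> K" "0 \<le> v y" for y
  proof -
    obtain z where z: "z \<in> F" "ereal 0 < v (y - z)" using dense y(1) by blast
    have z2: "0 < v (y - z)" using z(2) by (simp add: zero_ereal_def)
    have "0 \<le> v (y - (y - z))" by (rule v_diff_ge[OF y(2) less_imp_le[OF z2]])
    then have "0 \<le> v z" by simp
    then have "z \<in> resid" using F[OF z(1)] by simp
    then show ?thesis using resid_close z(2) by (simp add: zero_ereal_def)
  qed
  obtain f where f: "f \<in> polys_in K" "separable_poly f" "poly f x = 0"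
    using sep_closure_algebraic[OF sepK subfieldD(2)[OF sfK]] .
  have f0: "f \<noteq> 0" by (rule separable_poly_nonzero[OF f(2)])
  let ?d = "Polynomial.degree f"
  obtain i0 where i0: "i0 \<in> {..?d}" "\<And>l. l \<in> {..?d} \<Longrightarrow> v (coeff f i0) \<le> v (coeff f l)"
    using finite_set_minimum[of "{..?d}" "\<lambda>i. v (coeff f i)"] by blast
  have c0: "coeff f i0 \<noteq> 0" using i0(2)[of ?d] f0 by force
  define g where "g = smult (inverse (coeff f i0)) f"
  have cK: "coeff f i \<in> K" for i using f(1) by (simp add: polys_in_def)
  have gv: "0 \<le> v (coeff g i)" for i
  proof (cases "coeff f i = 0")
    case False
    then have "i \<le> ?d" by (rule le_degree)
    then have "v (coeff f i0) \<le> v (coeff f i)" using i0(2) by simp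
    then have "nu (coeff f i0) \<le> nu (coeff f i)" using v_nu[OF c0] v_nu[OF False] by simp
    then show ?thesis using c0 False by (subst v_pos_nu) (auto simp: g_def nu_mult nu_inverse)
  qed (simp add: g_def)
  have "coeff g i \<in> resid" for i
  proof (rule KR[OF _ gv])
    show "coeff g i \<in> K" using cK subfieldD(4,6)[OF sfK] by (simp add: g_def)
  qed
  moreover have "v (coeff g i0) = 0" using c0 by (simp add: g_def)
  moreover have "0 < v (poly g x)" using f(3) by (simp add: g_def)
  ultimately show ?thesis using resid_algebraic_step[of g i0 x] x by blast
qed

end

section \<open>A tame extension\<close>

context local_field
begin

lemma nu_K_int: "y \<in> K \<Longrightarrow> y \<noteq> 0 \<Longrightarrow> \<exists>z::int. nu y = of_int z"
proof -
  assume y: "y \<in> K" "y \<noteq> 0"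
  obtain z where z: "z \<in> F" "ereal (nu y) < v (y - z)" using dense y(1) by blast
  have vz: "v z = v y" by (rule v_eq_of_diff) (use z(2) v_nu[OF y(2)] in simp)
  have "z \<noteq> 0"
  proof
    assume "z = 0"
    then show False using vz y(2) by simp
  qed
  then have "v z \<in> v ` (F - {0})" using z(1) by blast
  then have "v z \<in> range (\<lambda>k::int. ereal (of_int k))" using normF by (simp add: normalized_on_def)
  then obtain k :: int where "v z = ereal (of_int k)" by blast
  then have "nu y = of_int k" using vz by (simp add: nu_def)
  then show ?thesis ..
qed

lemma uniformizer: "\<exists>w\<in>K. w \<noteq> 0 \<and> nu w = 1"
proof -
  have "ereal (of_int 1) \<in> range (\<lambda>k::int. ereal (of_int k))" by (rule rangeI)
  then have "ereal (of_int 1) \<in> v ` (F - {0})" using normF by (simp add: normalized_on_def)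
  then obtain w where w: "ereal (of_int 1) = v w" "w \<in> F - {0}" by (rule imageE)
  have "nu w = 1" using w(1)[symmetric] by (simp add: nu_def)
  moreover have "w \<in> K" "w \<noteq> 0" using w(2) FK by auto
  ultimately show ?thesis by blast
qed

text \<open>Inverses come from algebraicity: the inverse of an element is a polynomial in it over
  \<open>K\<close>. To use \<open>partial_aut_inverse\<close> for this, the identity on
  \<open>S\<close> is regarded as a partial automorphism.\<close>

lemma subring_subfield:
  assumes "K \<subseteq> S" "\<And>x y. x \<in> S \<Longrightarrow> y \<in> S \<Longrightarrow> x + y \<in> S" "\<And>x y. x \<in> S \<Longrightarrow> y \<in> S \<Longrightarrow> x * y \<in> S"
  shows "subfield S Ksep"
proof -
  have m: "- x \<in> S" if "x \<in> S" for x
  proof -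
    have "- 1 \<in> S" using assms(1) subfieldD(1,5)[OF sfK] by blast
    then have "- 1 * x \<in> S" using that by (rule assms(3))
    then show ?thesis by simp
  qed
  have d: "x - y \<in> S" if "x \<in> S" "y \<in> S" for x y using assms(2)[OF that(1) m[OF that(2)]] by simp
  have 01: "0 \<in> S" "1 \<in> S" using assms(1) subfieldD(1,2)[OF sfK] by blast+
  have "subring_rel (Id_on S)"
    unfolding subring_rel_def Id_on_iff using 01 assms(2,3) d by simp
  then have P: "partial_aut K (Id_on S)"
    unfolding partial_aut_def Id_on_iff using assms(1) by auto
  have "inverse x \<in> S" if "x \<in> S" "x \<noteq> 0" for x
    using partial_aut_inverse(1)[OF sepK sfK P, of x x] that by (simp add: Id_on_iff)
  then show ?thesis using 01 assms(2,3) m by (intro subfield_KsepI)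
qed

text \<open>The simple extension of \<open>E\<close> by \<open>x\<close> in polynomial form; for a
  field \<open>E\<close> above \<open>K\<close> it is a field because \<open>x\<close> is algebraic.
  This form permits division with remainder when valuations of its elements are computed.\<close>

definition adj_poly :: "'a set \<Rightarrow> 'a \<Rightarrow> 'a set"
  where "adj_poly E x = {poly h x | h. h \<in> polys_in E}"

lemma adj_poly_props:
  assumes E: "subfield E Ksep" "K \<subseteq> E"
  shows "subfield (adj_poly E x) Ksep" "E \<subseteq> adj_poly E x" "x \<in> adj_poly E x"
proof -
  note cl = polys_in_closed[OF E(1)]
  have mem: "y \<in> adj_poly E x" if "h \<in> polys_in E" "y = poly h x" for h y
    using that unfolding adj_poly_def by blast
  show i: "E \<subseteq> adj_poly E x"
  proof
    fix a assume "a \<in> E"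
    then show "a \<in> adj_poly E x" by (intro mem[OF cl(2)[of a 0]]) (simp_all add: poly_monom)
  qed
  show "x \<in> adj_poly E x"
    by (rule mem[OF cl(2)[OF subfieldD(1)[OF E(1)], of 1]]) (simp add: poly_monom)
  show "subfield (adj_poly E x) Ksep"
  proof (rule subring_subfield)
    show "K \<subseteq> adj_poly E x" using E(2) i by blast
    fix a b assume "a \<in> adj_poly E x" "b \<in> adj_poly E x"
    then obtain f g where fg: "f \<in> polys_in E" "a = poly f x" "g \<in> polys_in E" "b = poly g x"
      unfolding adj_poly_def by blast
    show "a + b \<in> adj_poly E x" by (rule mem[OF cl(3)[OF fg(1,3)]]) (simp add: fg)
    show "a * b \<in> adj_poly E x" by (rule mem[OF cl(5)[OF fg(1,3)]]) (simp add: fg)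
  qed
qed

lemma v_aut_over: "K \<subseteq> E \<Longrightarrow> \<sigma> \<in> auts E \<Longrightarrow> v (\<sigma> x) = v x"
  using v_aut auts_mono by blast

text \<open>
  The extension \<open>E(\<zeta>)/E\<close> is unramified: the differences of the conjugates of \<open>\<zeta>\<close> are units, so the
  traces of the \<open>\<zeta>\<^sup>j y\<close> cannot all have valuation larger than \<open>v(y)\<close>.
\<close>

lemma teich_unramified:
  assumes E: "subfield E Ksep" "K \<subseteq> E" and z: "\<zeta> \<in> teich" and h: "h \<in> polys_in E" and y: "poly h \<zeta> \<noteq> 0"
  shows "\<exists>e\<in>E. e \<noteq> 0 \<and> nu e = nu (poly h \<zeta>)"
proof -
  have sepE: "UNIV_is_separable_closure_of E" by (rule sep_closure_mono[OF sepK E(2)])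
  obtain N where N: "N \<ge> 1" "\<zeta> \<in> frob_fixed N" using z unfolding teich_def by auto
  note sfN = subfield_frob_fixed[of N]
  let ?Z = "conjugates E \<zeta>"
  have finZ: "finite ?Z" by (rule conjugates_finite[OF sepE E(1)])
  have ZN: "?Z \<subseteq> frob_fixed N"
  proof
    fix x assume "x \<in> ?Z"
    then obtain \<sigma> where \<sigma>: "\<sigma> \<in> auts E" "x = \<sigma> \<zeta>" by (auto simp: conjugates_def)
    have "\<sigma> (\<zeta> ^ (p ^ N)) = \<sigma> \<zeta>" using N(2) by (simp add: frob_fixed_def)
    then show "x \<in> frob_fixed N" using autsD(8)[OF \<sigma>(1) E(1)] \<sigma>(2) by (simp add: frob_fixed_def)
  qed
  have vh: "v (poly h x) = v (poly h \<zeta>)" if x: "x \<in> ?Z" for x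
  proof -
    obtain \<sigma> where \<sigma>: "\<sigma> \<in> auts E" "x = \<sigma> \<zeta>" using x by (auto simp: conjugates_def)
    then show ?thesis using auts_poly[OF \<sigma>(1) E(1) h, of \<zeta>] v_aut_over[OF E(2) \<sigma>(1), of "poly h \<zeta>"] by simp
  qed
  \<comment> \<open>\<open>g\<close> vanishes at every conjugate except \<zeta>, so combining the
    traces \<open>S j\<close> with its coefficients isolates
    \<open>poly g \<zeta> * poly h \<zeta>\<close>. All conjugates lie in the finite field
    \<open>frob_fixed N\<close>, hence the coefficients of \<open>g\<close> are integral and
    \<open>poly g \<zeta>\<close> is a unit.\<close>
  define g where "g = (\<Prod>x\<in>?Z - {\<zeta>}. [:- x, 1:])"
  have gN: "g \<in> polys_in (frob_fixed N)"
  proof -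
    have "(\<Prod>x\<in>A. [:- x, 1:]) \<in> polys_in (frob_fixed N)" if "A \<subseteq> frob_fixed N" for A
      using that
    proof (induction A rule: infinite_finite_induct)
      case (insert a A)
      have "[:- a, 1:] \<in> polys_in (frob_fixed N)"
        using insert.prems by (intro polys_in_closed(1,6)[OF sfN] subfieldD(1,5)[OF sfN]) auto
      then have "[:- a, 1:] * (\<Prod>x\<in>A. [:- x, 1:]) \<in> polys_in (frob_fixed N)"
        by (rule polys_in_closed(5)[OF sfN]) (use insert in blast)
      then show ?case unfolding prod.insert[OF insert.hyps(1,2)] .
    qed (simp_all add: polys_in_closed[OF sfN])
    then show ?thesis unfolding g_def using ZN by blast
  qed
  have pg: "poly g x = (\<Prod>z\<in>?Z - {\<zeta>}. x - z)" for x by (simp add: g_def poly_prod)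
  have g0: "poly g x = 0" if "x \<in> ?Z - {\<zeta>}" for x unfolding pg using finZ that by (intro prod_zero) auto
  have g\<zeta>: "poly g \<zeta> \<noteq> 0" unfolding pg using finZ by (auto simp: prod_zero_iff)
  have g\<zeta>N: "poly g \<zeta> \<in> frob_fixed N" by (rule polys_in_closed(9)[OF sfN gN N(2)])
  define S where "S j = (\<Sum>z\<in>?Z. z ^ j * poly h z)" for j
  have SE: "S j \<in> E" for j
  proof -
    have "monom 1 j * h \<in> polys_in E"
      by (rule polys_in_closed(5)[OF E(1) polys_in_closed(2)[OF E(1) subfieldD(1)[OF E(1)]] h])
    then show ?thesis unfolding S_def using conjugates_sum_in[OF sepE E(1), of "monom 1 j * h" \<zeta>]
      by (simp add: poly_monom)
  qed
  have Sv: "v (poly h \<zeta>) \<le> v (S j)" for j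
    unfolding S_def
  proof (rule v_sum_ge)
    fix x assume x: "x \<in> ?Z"
    have "0 \<le> v (x ^ j)" using x ZN v_frob_fixed_ge[OF N(1)] by (intro v_power_ge) auto
    then show "v (poly h \<zeta>) \<le> v (x ^ j * poly h x)" using vh[OF x] by (simp add: v_mult add_increasing)
  qed
  have "\<exists>j. v (S j) \<le> v (poly h \<zeta>)"
  proof (rule ccontr)
    assume "\<nexists>j. v (S j) \<le> v (poly h \<zeta>)"
    then have gt: "ereal (nu (poly h \<zeta>)) < v (S j)" for j using v_nu[OF y] by (simp add: not_le)
    have "(\<Sum>j\<le>Polynomial.degree g. coeff g j * S j) = (\<Sum>z\<in>?Z. poly g z * poly h z)"
      unfolding S_def sum_distrib_left poly_altdef[of g] sum_distrib_right
      by (subst sum.swap) (simp add: mult.assoc)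
    also have "\<dots> = poly g \<zeta> * poly h \<zeta> + (\<Sum>z\<in>?Z - {\<zeta>}. poly g z * poly h z)"
      by (rule sum.remove[OF finZ conjugates_self])
    also have "(\<Sum>z\<in>?Z - {\<zeta>}. poly g z * poly h z) = 0" by (rule sum.neutral) (use g0 in simp)
    finally have e: "(\<Sum>j\<le>Polynomial.degree g. coeff g j * S j) = poly g \<zeta> * poly h \<zeta>" by simp
    have "ereal (nu (poly h \<zeta>)) < v (\<Sum>j\<le>Polynomial.degree g. coeff g j * S j)"
    proof (rule v_sum_gt)
      fix j
      have "0 \<le> v (coeff g j)" using gN v_frob_fixed_ge[OF N(1)] by (simp add: polys_in_def)
      then have "v (S j) \<le> v (coeff g j * S j)" by (simp add: v_mult add_increasing)
      then show "ereal (nu (poly h \<zeta>)) < v (coeff g j * S j)" using gt[of j] by simp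
    qed
    then have "ereal (nu (poly h \<zeta>)) < v (poly g \<zeta> * poly h \<zeta>)" using e by simp
    then show False using v_frob_fixed[OF N(1) g\<zeta>N g\<zeta>] v_nu[OF y] by (simp add: v_mult)
  qed
  then obtain j where j: "v (S j) = v (poly h \<zeta>)" using Sv by (meson antisym)
  then have "S j \<noteq> 0" using y by auto
  moreover have "nu (S j) = nu (poly h \<zeta>)" using j by (simp add: nu_def)
  ultimately show ?thesis using SE by blast
qed

text \<open>For \<open>P = X ^ N - w\<close> one has \<open>X * P' - N * P = N * w\<close>, a
  nonzero constant since \<open>p\<close> does not divide \<open>N\<close>; so a common divisor of
  \<open>P\<close> and \<open>P'\<close> is a unit.\<close>

lemma separable_radical:
  assumes "\<not> p dvd N" "w \<noteq> (0::'a)" shows "separable_poly (monom 1 N - [:w:])" "N \<ge> 1"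
proof -
  show N: "N \<ge> 1" using assms(1) by (cases N) auto
  have n: "of_nat N \<noteq> (0::'a)" using assms(1) CHAR_p of_nat_eq_0_iff_char_dvd[of N, where 'a = 'a] by simp
  show "separable_poly (monom 1 N - [:w:])"
    unfolding separable_poly_def
  proof (rule coprimeI)
    fix d assume d: "d dvd monom 1 N - [:w:]" "d dvd pderiv (monom 1 N - [:w:])"
    have pd: "pderiv (monom 1 N - [:w:]) = monom (of_nat N) (N - 1)" by (simp add: pderiv_diff pderiv_monom pderiv_pCons)
    have "d dvd monom 1 1 * monom (of_nat N) (N - 1) - smult (of_nat N) (monom 1 N - [:w:])"
      by (rule dvd_diff[OF dvd_mult dvd_smult]) (use d in \<open>simp_all only: pd\<close>)
    moreover have "monom 1 1 * monom (of_nat N) (N - 1) - smult (of_nat N) (monom 1 N - [:w:]) = [:of_nat N * w:]"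
      using N by (simp add: mult_monom smult_diff_right smult_monom)
    ultimately have "d dvd [:of_nat N * w:]" by simp
    moreover have "is_unit [:of_nat N * w:]" using n assms(2) by (simp add: is_unit_const_poly_iff dvd_field_iff)
    ultimately show "is_unit d" by (rule dvd_trans)
  qed
qed

text \<open>For \<open>w ^ N\<close> a uniformizer, the terms \<open>c * w ^ i\<close> with
  \<open>i < N\<close> and nonzero \<open>c\<close> in \<open>K\<close> have valuations in different
  classes modulo the integers. Nothing cancels, so every nonzero element has the valuation of one
  such term, a multiple of \<open>1 / N\<close>.\<close>

lemma tame_radical:
  assumes N: "\<not> p dvd N"
  shows "\<exists>w. w \<noteq> 0 \<and> nu w = 1 / real N \<and> (\<forall>y\<in>adj_poly K w. y \<noteq> 0 \<longrightarrow> (\<exists>z::int. real N * nu y = of_int z))"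
proof -
  obtain u where u: "u \<in> K" "u \<noteq> 0" "nu u = 1" using uniformizer by blast
  note sep = separable_radical[OF N u(2)]
  have N1: "N \<ge> 1" by (rule sep(2))
  have cm: "coeff (monom 1 N - [:u:]) i = (if i = N then 1 else if i = 0 then - u else 0)" for i
    using N1 by (auto simp: coeff_monom coeff_pCons split: nat.split)
  have dm: "Polynomial.degree (monom 1 N - [:u:]) = N"
  proof (rule antisym)
    show "Polynomial.degree (monom 1 N - [:u:]) \<le> N" using N1 by (intro degree_le allI impI) (simp only: cm, simp)
    show "N \<le> Polynomial.degree (monom 1 N - [:u:])" by (intro le_degree) (simp only: cm, simp)
  qed
  have lm: "lead_coeff (monom 1 N - [:u:]) = 1" unfolding dm by (simp only: cm) simp
  obtain w where w: "poly (monom 1 N - [:u:]) w = 0" using sep_closed sep dm by fastforce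
  then have wN: "w ^ N = u" by (simp add: poly_monom)
  have w0: "w \<noteq> 0" using wN u(2) N1 by (auto simp: power_0_left)
  have nw: "nu w = 1 / real N" using nu_power[OF w0, of N] wN u(3) N1 by (simp add: field_simps)
  have mK: "monom 1 N - [:u:] \<in> polys_in K"
    using subfieldD(1,2,5)[OF sfK] u(1) by (simp only: polys_in_def mem_Collect_eq cm) simp
  have "\<exists>z::int. real N * nu y = of_int z" if y: "y \<in> adj_poly K w" "y \<noteq> 0" for y
  proof -
    obtain h where h: "h \<in> polys_in K" "y = poly h w" using y(1) unfolding adj_poly_def by blast
    obtain q r where qr: "r \<in> polys_in K" "h = (monom 1 N - [:u:]) * q + r" "\<forall>i\<ge>N. coeff r i = 0"
      using polys_in_division[OF sfK mK lm h(1)] unfolding dm by blast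
    have yr: "y = poly r w" unfolding h(2) qr(2) using w by simp
    have dr: "Polynomial.degree r \<le> N - 1" using qr(3) N1 by (intro degree_le) auto
    have ys: "y = (\<Sum>i\<le>N - 1. coeff r i * w ^ i)" unfolding yr by (rule poly_eq_sum_coeff[OF dr])
    have nt: "\<exists>z::int. nu (coeff r i * w ^ i) = of_int z + real i / real N" if c: "coeff r i \<noteq> 0" for i
    proof -
      have "coeff r i \<in> K" using qr(1) by (simp add: polys_in_def)
      then obtain z :: int where "nu (coeff r i) = of_int z" using nu_K_int c by blast
      then show ?thesis using c w0 by (simp add: nu_mult nu_power nw)
    qed
    have inj: "inj_on (\<lambda>i. v (coeff r i * w ^ i)) {i \<in> {..N - 1}. coeff r i * w ^ i \<noteq> 0}"
    proof (rule inj_onI)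
      fix i j assume i: "i \<in> {i \<in> {..N - 1}. coeff r i * w ^ i \<noteq> 0}" and j: "j \<in> {i \<in> {..N - 1}. coeff r i * w ^ i \<noteq> 0}"
        and e: "v (coeff r i * w ^ i) = v (coeff r j * w ^ j)"
      have "nu (coeff r i * w ^ i) = nu (coeff r j * w ^ j)" using e unfolding nu_def by simp
      moreover obtain a b :: int where "nu (coeff r i * w ^ i) = of_int a + real i / real N"
        "nu (coeff r j * w ^ j) = of_int b + real j / real N" using nt[of i] nt[of j] i j by auto
      ultimately have "of_int a + real i / real N = of_int b + real j / real N" by simp
      then have "real N * (of_int a + real i / real N) = real N * (of_int b + real j / real N)" by (rule arg_cong)
      then have "real_of_int (a * int N + int i) = real_of_int (b * int N + int j)"
        using N1 by (simp add: distrib_left mult.commute)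
      then have ab: "a * int N + int i = b * int N + int j" by (simp only: of_int_eq_iff)
      have "int i < int N" "int j < int N" using i j N1 by auto
      then have "(a * int N + int i) mod int N = int i" "(b * int N + int j) mod int N = int j" by simp_all
      then show "i = j" using ab by simp
    qed
    have ys0: "(\<Sum>i\<le>N - 1. coeff r i * w ^ i) \<noteq> 0" using y(2) ys by simp
    obtain i where i: "coeff r i * w ^ i \<noteq> 0" "v y = v (coeff r i * w ^ i)"
      using v_distinct_sum[OF finite_atMost inj ys0] unfolding ys by blast
    obtain z :: int where z: "nu (coeff r i * w ^ i) = of_int z + real i / real N" using nt[of i] i(1) by auto
    have "nu y = of_int z + real i / real N" using i(2) z by (simp add: nu_def)
    then have "real N * nu y = of_int (z * int N + int i)" using N1 by (simp add: distrib_left mult.commute)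
    then show ?thesis by blast
  qed
  then show ?thesis using w0 nw by blast
qed

text \<open>Zorn gives a maximal field above \<open>K(w)\<close> whose valuations are multiples of
  \<open>1 / N\<close>. It contains \<open>teich\<close>, since adjoining one \<zeta> from there
  creates no new valuations by \<open>teich_unramified\<close>.\<close>

theorem tame_field:
  assumes N: "\<not> p dvd N"
  obtains T w where "subfield T Ksep" "K \<subseteq> T" "teich \<subseteq> T" "w \<in> T" "w \<noteq> 0" "nu w = 1 / real N"
    "\<And>y. y \<in> T \<Longrightarrow> y \<noteq> 0 \<Longrightarrow> \<exists>z::int. real N * nu y = of_int z"
proof -
  obtain w where w: "w \<noteq> 0" "nu w = 1 / real N" "\<forall>y\<in>adj_poly K w. y \<noteq> 0 \<longrightarrow> (\<exists>z::int. real N * nu y = of_int z)"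
    using tame_radical[OF N] by blast
  note K0 = adj_poly_props[OF sfK subset_refl, of w]
  define AA where "AA = {T. subfield T Ksep \<and> adj_poly K w \<subseteq> T \<and> (\<forall>y\<in>T. y \<noteq> 0 \<longrightarrow> (\<exists>z::int. real N * nu y = of_int z))}"
  have "\<exists>M\<in>AA. \<forall>Y\<in>AA. M \<subseteq> Y \<longrightarrow> Y = M"
  proof (rule subset_Zorn_nonempty)
    have "adj_poly K w \<in> AA" unfolding AA_def using K0(1) w(3) by simp
    then show "AA \<noteq> {}" by blast
    fix C assume C: "C \<noteq> {}" "subset.chain AA C"
    have CA: "G \<in> AA" if "G \<in> C" for G using C(2) that by (auto simp: subset.chain_def)
    then have sub: "subfield G Ksep" if "G \<in> C" for G using that by (simp add: AA_def)
    obtain G1 where G1: "G1 \<in> C" using C(1) by blast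
    have pair: "\<exists>G\<in>C. u \<in> G \<and> w \<in> G" if uw: "u \<in> \<Union>C" "w \<in> \<Union>C" for u w
    proof -
      from uw obtain A B where AB: "A \<in> C" "u \<in> A" "B \<in> C" "w \<in> B" by blast
      have "A \<subseteq> B \<or> B \<subseteq> A" using C(2) AB by (auto simp: subset_chain_def)
      then show ?thesis using AB by blast
    qed
    have "subfield (\<Union>C) Ksep"
    proof (rule subring_subfield)
      show "K \<subseteq> \<Union>C" using CA[OF G1] K0(2) G1 by (auto simp: AA_def)
      fix x y assume "x \<in> \<Union>C" "y \<in> \<Union>C"
      then obtain G where G: "G \<in> C" "x \<in> G" "y \<in> G" using pair by blast
      show "x + y \<in> \<Union>C" using subfieldD(3)[OF sub[OF G(1)] G(2,3)] G(1) by blast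
      show "x * y \<in> \<Union>C" using subfieldD(4)[OF sub[OF G(1)] G(2,3)] G(1) by blast
    qed
    moreover have "adj_poly K w \<subseteq> \<Union>C" using CA[OF G1] G1 by (auto simp: AA_def)
    moreover have "\<forall>y\<in>\<Union>C. y \<noteq> 0 \<longrightarrow> (\<exists>z::int. real N * nu y = of_int z)"
    proof (intro ballI impI)
      fix y assume "y \<in> \<Union>C" "y \<noteq> 0"
      then obtain G where "G \<in> C" "y \<in> G" by blast
      then show "\<exists>z::int. real N * nu y = of_int z" using CA[of G] \<open>y \<noteq> 0\<close> unfolding AA_def by blast
    qed
    ultimately show "\<Union>C \<in> AA" unfolding AA_def by blast
  qed
  then obtain T where T: "T \<in> AA" "\<And>Y. Y \<in> AA \<Longrightarrow> T \<subseteq> Y \<Longrightarrow> Y = T" by blast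
  have sT: "subfield T Ksep" and wT: "adj_poly K w \<subseteq> T"
    and vT: "\<And>y. y \<in> T \<Longrightarrow> y \<noteq> 0 \<Longrightarrow> \<exists>z::int. real N * nu y = of_int z"
    using T(1) unfolding AA_def by blast+
  have KT: "K \<subseteq> T" using K0(2) wT by blast
  have "\<zeta> \<in> T" if z: "\<zeta> \<in> teich" for \<zeta>
  proof -
    note P = adj_poly_props[OF sT KT, of \<zeta>]
    have "\<exists>z::int. real N * nu y = of_int z" if y: "y \<in> adj_poly T \<zeta>" "y \<noteq> 0" for y
    proof -
      obtain h where h: "h \<in> polys_in T" "y = poly h \<zeta>" using y(1) unfolding adj_poly_def by blast
      obtain e where e: "e \<in> T" "e \<noteq> 0" "nu e = nu (poly h \<zeta>)"
        using teich_unramified[OF sT KT z h(1)] y(2) h(2) by blast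
      show ?thesis using vT[OF e(1,2)] e(3) h(2) by simp
    qed
    then have "adj_poly T \<zeta> \<in> AA" unfolding AA_def using P wT by blast
    then have "adj_poly T \<zeta> = T" using T(2) P(2) by blast
    then show ?thesis using P(3) by simp
  qed
  then have "teich \<subseteq> T" by blast
  moreover have "w \<in> T" using K0(3) wT by blast
  ultimately show ?thesis using that[OF sT KT _ _ w(1,2) vT] by blast
qed

lemma v_quotient_gt: "x \<noteq> 0 \<Longrightarrow> v x < v (y - x) \<longleftrightarrow> 0 < v (y / x - 1)"
proof -
  assume x: "x \<noteq> 0"
  have e: "y - x = x * (y / x - 1)" using x by (simp add: field_simps)
  show ?thesis unfolding e v_mult v_nu[OF x]
    by (cases "v (y / x - 1)") (auto simp: zero_ereal_def)
qed

text \<open>The unit \<open>u = x ^ (p ^ a) / y\<close> is congruent to some \<open>z\<close> in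
  \<open>teich\<close>, which \<sigma> fixes, so \<open>\<sigma> u / u\<close> is congruent to 1. As
  \<open>y\<close> is fixed too, this quotient is the \<open>p ^ a\<close>-th power of
  \<open>\<sigma> x / x\<close>, and Frobenius is additive and reflects positive valuation.\<close>

lemma wild_of_tame:
  assumes T: "subfield T Ksep" "K \<subseteq> T" "teich \<subseteq> T" and \<sigma>: "\<sigma> \<in> auts T"
    and y: "y \<in> T" "y \<noteq> 0" and x: "x \<noteq> 0" "real (p ^ a) * nu x = nu y"
  shows "v x < v (\<sigma> x - x)"
proof -
  note s = autsD[OF \<sigma> T(1)]
  have inv: "v (\<sigma> z) = v z" for z by (rule v_aut_over[OF T(2) \<sigma>])
  define u where "u = x ^ (p ^ a) / y"
  have u0: "u \<noteq> 0" using x(1) y(2) by (simp add: u_def)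
  have "nu u = 0" using x y(2) by (simp add: u_def nu_divide nu_power)
  then have vu: "v u = 0" using v_nu[OF u0] by (simp add: zero_ereal_def)
  then obtain z where z: "z \<in> teich" "0 < v (u - z)" using residue_algebraic[of u] by (auto simp: resid_def)
  have sz: "\<sigma> z = z" using z(1) T(3) s(3) by blast
  have e: "\<sigma> u - u = \<sigma> (u - z) - (u - z)" using sz by (simp add: s(6))
  have "0 < v (\<sigma> u - u)" unfolding e by (rule v_diff_gt) (simp_all only: inv z(2))
  then have 1: "0 < v (\<sigma> u / u - 1)" using v_quotient_gt[OF u0] vu by simp
  have "\<sigma> u / u = (\<sigma> x / x) ^ (p ^ a)"
    using s(3)[OF y(1)] y(2) by (simp add: u_def s(12) s(8) power_divide)
  then have "\<sigma> u / u - 1 = (\<sigma> x / x - 1) ^ (p ^ a)" by (simp add: frobenius_diff)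
  then have "0 < v (\<sigma> x / x - 1)" using 1 v_power_pos_iff[of "p ^ a"] p_pos by simp
  then show ?thesis using v_quotient_gt[OF x(1)] by simp
qed

end

section \<open>The wild ramification subgroup\<close>

text \<open>A finite set stable under all automorphisms over \<open>K\<close> makes
  \<open>K(W)\<close> a finite normal extension; the proofs work with \<open>W\<close> instead of
  degrees.\<close>

locale finite_galois = local_field v K p s k F t for v :: "'a::field \<Rightarrow> ereal" and K p s k F t +
  fixes W :: "'a set"
  assumes finW: "finite W" and stableW: "\<And>\<sigma>. \<sigma> \<in> auts K \<Longrightarrow> \<sigma> ` W \<subseteq> W"
begin

definition L :: "'a set" where "L = adjoin K W"

lemma sfL: "subfield L Ksep" and KL: "K \<subseteq> L" and WL: "W \<subseteq> L"
  unfolding L_def by (rule adjoin_props)+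

lemma L_least: "subfield E Ksep \<Longrightarrow> K \<subseteq> E \<Longrightarrow> W \<subseteq> E \<Longrightarrow> L \<subseteq> E"
  unfolding L_def by (rule adjoin_props)

lemma auts_L: "\<sigma> \<in> auts K \<Longrightarrow> x \<in> L \<Longrightarrow> \<sigma> x \<in> L"
proof -
  assume \<sigma>: "\<sigma> \<in> auts K" and x: "x \<in> L"
  note s = autsD[OF \<sigma> sfK]
  have "subfield {x. \<sigma> x \<in> L} Ksep"
    by (rule subfield_KsepI) (simp_all add: s(1,2,5,7,11) subfieldD[OF sfL])
  moreover have "K \<subseteq> {x. \<sigma> x \<in> L}" using s(3) KL by auto
  moreover have "W \<subseteq> {x. \<sigma> x \<in> L}" using stableW[OF \<sigma>] WL by blast
  ultimately have "L \<subseteq> {x. \<sigma> x \<in> L}" by (rule L_least)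
  then show ?thesis using x by blast
qed

lemma auts_eq_on_L:
  assumes "\<sigma> \<in> auts K" "\<tau> \<in> auts K" "\<And>x. x \<in> W \<Longrightarrow> \<sigma> x = \<tau> x" "x \<in> L" shows "\<sigma> x = \<tau> x"
proof -
  note s = autsD[OF assms(1) sfK] and u = autsD[OF assms(2) sfK]
  have "subfield {x. \<sigma> x = \<tau> x} Ksep"
    by (rule subfield_KsepI) (simp_all add: s(1,2,5,7,11) u(1,2,5,7,11))
  moreover have "K \<subseteq> {x. \<sigma> x = \<tau> x}" using s(3) u(3) by auto
  ultimately have "L \<subseteq> {x. \<sigma> x = \<tau> x}" using assms(3) by (intro L_least) auto
  then show ?thesis using assms(4) by blast
qed

lemma auts_bij_L: "\<sigma> \<in> auts K \<Longrightarrow> bij_betw \<sigma> L L"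
proof -
  assume \<sigma>: "\<sigma> \<in> auts K"
  have "\<sigma> ` L \<subseteq> L" using auts_L[OF \<sigma>] by blast
  moreover have "L \<subseteq> \<sigma> ` L"
  proof
    fix y assume y: "y \<in> L"
    have c: "conjugates K y \<subseteq> L" unfolding conjugates_def using auts_L y by blast
    have "\<sigma> ` conjugates K y = conjugates K y"
      using auts_permute_conjugates[OF sepK sfK \<sigma>] by (simp add: bij_betw_def)
    then have "y \<in> \<sigma> ` conjugates K y" using conjugates_self by blast
    then show "y \<in> \<sigma> ` L" using c by blast
  qed
  moreover have "inj_on \<sigma> L" using autsD(9)[OF \<sigma> sfK] subset_UNIV by (rule inj_on_subset)
  ultimately show ?thesis unfolding bij_betw_def by blast
qed

text \<open>Automorphisms of \<open>L\<close> over \<open>K\<close> extend to the separable closure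
  by \<open>partial_aut_extends\<close>, and automorphisms of the closure map \<open>L\<close> onto
  itself. Group elements can hence be studied through total automorphisms.\<close>

lemma carrier_galois_group: "carrier (galois_group L K) = (\<lambda>\<sigma>. restrict \<sigma> L) ` auts K"
proof
  show "(\<lambda>\<sigma>. restrict \<sigma> L) ` auts K \<subseteq> carrier (galois_group L K)"
  proof
    fix \<tau> assume "\<tau> \<in> (\<lambda>\<sigma>. restrict \<sigma> L) ` auts K"
    then obtain \<sigma> where \<sigma>: "\<sigma> \<in> auts K" "\<tau> = restrict \<sigma> L" by blast
    note s = autsD[OF \<sigma>(1) sfK]
    have "\<tau> \<in> Bij L" unfolding \<sigma>(2) Bij_def using auts_bij_L[OF \<sigma>(1)] by (simp add: bij_betw_restrict_eq)
    moreover have "\<tau> \<in> Ring.ring_hom (Ksep\<lparr>carrier := L\<rparr>) (Ksep\<lparr>carrier := L\<rparr>)"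
      by (rule ring_hom_memI) (simp_all add: \<sigma>(2) s(1,2,5) auts_L[OF \<sigma>(1)] subfieldD(1,3,4)[OF sfL])
    moreover have "\<forall>x\<in>K. \<tau> x = x" unfolding \<sigma>(2) using s(3) KL by auto
    ultimately show "\<tau> \<in> carrier (galois_group L K)" by (simp add: galois_group_def)
  qed
  show "carrier (galois_group L K) \<subseteq> (\<lambda>\<sigma>. restrict \<sigma> L) ` auts K"
  proof
    fix \<tau> assume "\<tau> \<in> carrier (galois_group L K)"
    then have t: "\<tau> \<in> Bij L" "\<tau> \<in> Ring.ring_hom (Ksep\<lparr>carrier := L\<rparr>) (Ksep\<lparr>carrier := L\<rparr>)" "\<forall>x\<in>K. \<tau> x = x"
      by (simp_all add: galois_group_def)
    have h: "\<tau> (x + y) = \<tau> x + \<tau> y" "\<tau> (x * y) = \<tau> x * \<tau> y" if "x \<in> L" "y \<in> L" for x y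
      using ring_hom_add[OF t(2), of x y] ring_hom_mult[OF t(2), of x y] that by simp_all
    have h1: "\<tau> 1 = 1" "\<tau> 0 = 0" using t(3) subfieldD(1,2)[OF sfK] by blast+
    have hd: "\<tau> (x - y) = \<tau> x - \<tau> y" if "x \<in> L" "y \<in> L" for x y
      using h(1)[of "x - y" y] that subfieldD(7)[OF sfL] by simp
    define G where "G = {(x, \<tau> x) | x. x \<in> L}"
    have Giff: "(a, b) \<in> G \<longleftrightarrow> a \<in> L \<and> b = \<tau> a" for a b by (auto simp: G_def)
    have "subring_rel G" unfolding subring_rel_def Giff using h h1 hd subfieldD[OF sfL] by simp
    moreover have "Id_on K \<subseteq> G"
    proof
      fix u assume "u \<in> Id_on K"
      then obtain a where "u = (a, a)" "a \<in> K" by (rule Id_onE)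
      then show "u \<in> G" using t(3) KL Giff by auto
    qed
    ultimately have "partial_aut K G" unfolding partial_aut_def using h1 Giff by simp
    from partial_aut_extends[OF sepK sfK this] obtain \<sigma> where \<sigma>: "\<sigma> \<in> auts K" "\<forall>(x, y)\<in>G. \<sigma> x = y" ..
    have "\<sigma> x = \<tau> x" if "x \<in> L" for x using bspec[OF \<sigma>(2), of "(x, \<tau> x)"] that Giff by simp
    then have "\<tau> = restrict \<sigma> L" using t(1) unfolding Bij_def
      by (intro extensionalityI[of _ L]) auto
    then show "\<tau> \<in> (\<lambda>\<sigma>. restrict \<sigma> L) ` auts K" using \<sigma>(1) by blast
  qed
qed

text \<open>An automorphism is determined on \<open>L\<close> by its action on \<open>W\<close>, so
  \<open>x\<close> has at most \<open>M\<close> conjugates, with \<open>M\<close> the number of maps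
  from \<open>W\<close> to itself. If there are \<open>c\<close> of them, their product lies in
  \<open>K\<close> and has the integral valuation \<open>c * nu x\<close>; moreover \<open>c\<close>
  divides \<open>M!\<close>.\<close>

lemma bounded_denominators: "\<exists>D::nat. D \<ge> 1 \<and> (\<forall>x\<in>L. x \<noteq> 0 \<longrightarrow> (\<exists>z::int. real D * nu x = of_int z))"
proof -
  define M where "M = card (W \<rightarrow>\<^sub>E W)"
  have finM: "finite (W \<rightarrow>\<^sub>E W)" using finW by (intro finite_PiE) auto
  have "\<exists>z::int. real (fact M) * nu x = of_int z" if x: "x \<in> L" "x \<noteq> 0" for x
  proof -
    let ?C = "conjugates K x"
    define c where "c = card ?C"
    have fin: "finite ?C" by (rule conjugates_finite[OF sepK sfK])
    define g where "g f = (SOME y. \<exists>\<sigma>\<in>auts K. restrict \<sigma> W = f \<and> y = \<sigma> x)" for f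
    have "?C \<subseteq> g ` (W \<rightarrow>\<^sub>E W)"
    proof
      fix y assume "y \<in> ?C"
      then obtain \<sigma> where \<sigma>: "\<sigma> \<in> auts K" "y = \<sigma> x" by (auto simp: conjugates_def)
      have "restrict \<sigma> W \<in> W \<rightarrow>\<^sub>E W" using stableW[OF \<sigma>(1)] by auto
      moreover have "g (restrict \<sigma> W) = y"
        unfolding g_def
      proof (rule some_equality)
        show "\<exists>\<sigma>'\<in>auts K. restrict \<sigma>' W = restrict \<sigma> W \<and> y = \<sigma>' x" using \<sigma> by blast
        fix y' assume "\<exists>\<sigma>'\<in>auts K. restrict \<sigma>' W = restrict \<sigma> W \<and> y' = \<sigma>' x"
        then obtain \<sigma>' where \<sigma>': "\<sigma>' \<in> auts K" "restrict \<sigma>' W = restrict \<sigma> W" "y' = \<sigma>' x" by blast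
        have "\<sigma>' w = \<sigma> w" if "w \<in> W" for w using fun_cong[OF \<sigma>'(2), of w] that by simp
        then show "y' = y" using auts_eq_on_L[OF \<sigma>'(1) \<sigma>(1) _ x(1)] \<sigma>(2) \<sigma>'(3) by simp
      qed
      ultimately show "y \<in> g ` (W \<rightarrow>\<^sub>E W)" by blast
    qed
    then have "card ?C \<le> card (g ` (W \<rightarrow>\<^sub>E W))" using finM by (intro card_mono) auto
    then have cM: "c \<le> M" unfolding c_def M_def using card_image_le[OF finM] by (rule order_trans)
    have "c \<noteq> 0" using conjugates_self fin by (auto simp: c_def)
    have nz: "y \<noteq> 0 \<and> nu y = nu x" if y: "y \<in> ?C" for y
    proof -
      obtain \<sigma> where \<sigma>: "\<sigma> \<in> auts K" "y = \<sigma> x" using y by (auto simp: conjugates_def)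
      then show ?thesis using autsD(10)[OF \<sigma>(1) sfK] x(2) v_aut[OF \<sigma>(1), of x] by (simp add: nu_def)
    qed
    have "nu (\<Prod>y\<in>?C. y) = (\<Sum>y\<in>?C. nu y)" using nz by (intro nu_prod) blast
    also have "\<dots> = real c * nu x" using nz by (simp add: c_def)
    finally have np: "nu (\<Prod>y\<in>?C. y) = real c * nu x" .
    have "(\<Prod>y\<in>?C. y) \<noteq> 0" using nz fin by (auto simp: prod_zero_iff)
    then obtain z :: int where z: "real c * nu x = of_int z"
      using nu_K_int[OF conjugates_prod_in[OF sepK sfK, of x]] np by auto
    have "c dvd fact M" using cM \<open>c \<noteq> 0\<close> by (intro dvd_fact) auto
    then obtain m where "fact M = c * m" by (rule dvdE)
    then have "real (fact M) = real c * real m" by (metis of_nat_mult)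
    then have "real (fact M) * nu x = of_int (z * int m)" using z by (simp add: algebra_simps)
    then show ?thesis by blast
  qed
  then show ?thesis by (intro exI[of _ "fact M"]) (auto simp: fact_ge_1)
qed

lemma int_subgroup_generator:
  fixes S :: "int set"
  assumes "\<And>a b. a \<in> S \<Longrightarrow> b \<in> S \<Longrightarrow> a - b \<in> S" "d \<in> S" "d > 0"
  obtains g where "g > 0" "S = range (\<lambda>i. g * i)"
proof -
  have z: "0 \<in> S" using assms(1)[OF assms(2,2)] by simp
  have n: "- a \<in> S" if "a \<in> S" for a using assms(1)[OF z that] by simp
  have ad: "a + b \<in> S" if "a \<in> S" "b \<in> S" for a b using assms(1)[OF that(1) n[OF that(2)]] by simp
  have mn: "a * int m \<in> S" if "a \<in> S" for a m
    by (induction m) (auto simp: z algebra_simps intro: ad that)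
  have mi: "a * i \<in> S" if "a \<in> S" for a i
  proof (cases "i \<ge> 0")
    case True
    then show ?thesis using mn[OF that, of "nat i"] by simp
  next
    case False
    then show ?thesis using n[OF mn[OF that, of "nat (- i)"]] by simp
  qed
  have ex: "0 < d \<and> d \<in> S" using assms by blast
  from ex_has_least_nat[of "\<lambda>x. 0 < x \<and> x \<in> S", OF ex, of nat]
  obtain g where g: "0 < g" "g \<in> S" "\<And>y. 0 < y \<Longrightarrow> y \<in> S \<Longrightarrow> nat g \<le> nat y" by blast
  have "S \<subseteq> range (\<lambda>i. g * i)"
  proof
    fix a assume a: "a \<in> S"
    have "a mod g = a - g * (a div g)" by (simp add: minus_mult_div_eq_mod)
    then have r: "a mod g \<in> S" using assms(1)[OF a mi[OF g(2)]] by simp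
    have "a mod g = 0"
    proof (rule ccontr)
      assume "a mod g \<noteq> 0"
      then have "0 < a mod g" using pos_mod_sign[OF g(1), of a] by linarith
      then have "nat g \<le> nat (a mod g)" using g(3) r by blast
      then show False using pos_mod_bound[OF g(1), of a] pos_mod_sign[OF g(1), of a] by linarith
    qed
    then have "a = g * (a div g)" by (metis add.right_neutral mult_div_mod_eq)
    then show "a \<in> range (\<lambda>i. g * i)" by blast
  qed
  moreover have "range (\<lambda>i. g * i) \<subseteq> S" using mi[OF g(2)] by blast
  ultimately show ?thesis using that[OF g(1)] by blast
qed

text \<open>The valuations on \<open>L\<close>, multiplied by a common denominator \<open>D\<close>,
  form a subgroup of the integers with generator \<open>g\<close>. It contains \<open>D\<close>
  through the uniformizer of \<open>K\<close>, and \<open>e = D / g\<close>. The comparison with a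
  second index \<open>e2\<close> settles the uniqueness hidden in \<open>THE\<close>.\<close>

lemma ramification_index:
  "\<exists>e. e \<ge> 1 \<and> ramification_index v L = e \<and> (\<forall>x\<in>L. x \<noteq> 0 \<longrightarrow> (\<exists>z::int. real e * nu x = of_int z)) \<and>
    (\<exists>x\<in>L. x \<noteq> 0 \<and> real e * nu x = 1)"
proof -
  obtain D :: nat where D: "D \<ge> 1" "\<And>x. x \<in> L \<Longrightarrow> x \<noteq> 0 \<Longrightarrow> \<exists>z::int. real D * nu x = of_int z"
    using bounded_denominators by blast
  define S where "S = {z::int. \<exists>x\<in>L. x \<noteq> 0 \<and> real D * nu x = of_int z}"
  have 1: "a - b \<in> S" if "a \<in> S" "b \<in> S" for a b
  proof -
    obtain x y where xy: "x \<in> L" "x \<noteq> 0" "real D * nu x = of_int a" "y \<in> L" "y \<noteq> 0" "real D * nu y = of_int b"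
      using \<open>a \<in> S\<close> \<open>b \<in> S\<close> unfolding S_def by blast
    have "x / y \<in> L" "x / y \<noteq> 0" "real D * nu (x / y) = of_int (a - b)"
      using subfieldD(8)[OF sfL xy(1,4)] xy by (simp_all add: nu_divide right_diff_distrib)
    then show ?thesis unfolding S_def by blast
  qed
  obtain u where u: "u \<in> K" "u \<noteq> 0" "nu u = 1" using uniformizer by blast
  have "u \<in> L" using u(1) KL by blast
  then have 2: "int D \<in> S" using u unfolding S_def by force
  have "int D > 0" using D(1) by simp
  with int_subgroup_generator[of S "int D"] 1 2
  obtain g where g: "g > 0" "S = range (\<lambda>i. g * i)" by metis
  obtain e' where e': "int D = g * e'" using 2 g(2) by blast
  have e'0: "e' > 0" using e' g(1) \<open>int D > 0\<close> by (metis zero_less_mult_pos)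
  define e where "e = nat e'"
  have e1: "e \<ge> 1" using e'0 by (simp add: e_def)
  have De: "real D = of_int g * real e"
  proof -
    have "int D = g * int e" using e' e'0 by (simp add: e_def)
    then have "real_of_int (int D) = real_of_int (g * int e)" by (rule arg_cong)
    then show ?thesis by simp
  qed
  have A: "\<exists>z::int. real e * nu x = of_int z" if x: "x \<in> L" "x \<noteq> 0" for x
  proof -
    obtain z :: int where z: "real D * nu x = of_int z" using D(2)[OF x] by blast
    then have "z \<in> S" using x unfolding S_def by blast
    then obtain i where "z = g * i" using g(2) by blast
    then have "of_int g * (real e * nu x) = of_int g * of_int i" using z De by simp
    then have "real e * nu x = of_int i" using g(1) by simp
    then show ?thesis ..
  qed
  have B: "\<exists>x\<in>L. x \<noteq> 0 \<and> real e * nu x = 1"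
  proof -
    have "g * 1 \<in> S" unfolding g(2) by (rule rangeI)
    then obtain x where x: "x \<in> L" "x \<noteq> 0" "real D * nu x = of_int (g * 1)" unfolding S_def by blast
    then have "of_int g * (real e * nu x) = of_int g * 1" using De by simp
    then have "real e * nu x = 1" using g(1) by simp
    then show ?thesis using x by blast
  qed
  have norm_iff: "normalized_on (\<lambda>x. ereal (real e) * v x) L"
    unfolding normalized_on_def
  proof
    show "(\<lambda>x. ereal (real e) * v x) ` (L - {0}) \<subseteq> range (\<lambda>k::int. ereal (of_int k))"
    proof
      fix y assume "y \<in> (\<lambda>x. ereal (real e) * v x) ` (L - {0})"
      then obtain x where x: "x \<in> L" "x \<noteq> 0" "y = ereal (real e) * v x" by blast
      obtain z :: int where "real e * nu x = of_int z" using A x by blast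
      then have "y = ereal (of_int z)" using x(3) v_nu[OF x(2)] by simp
      then show "y \<in> range (\<lambda>k::int. ereal (of_int k))" by blast
    qed
    show "range (\<lambda>k::int. ereal (of_int k)) \<subseteq> (\<lambda>x. ereal (real e) * v x) ` (L - {0})"
    proof
      fix y assume "y \<in> range (\<lambda>k::int. ereal (of_int k))"
      then obtain z :: int where z: "y = ereal (of_int z)" by blast
      obtain x where x: "x \<in> L" "x \<noteq> 0" "real e * nu x = 1" using B by blast
      define x' where "x' = (if z \<ge> 0 then x ^ nat z else inverse (x ^ nat (- z)))"
      have x': "x' \<in> L" "x' \<noteq> 0" using x subfieldD(6,9)[OF sfL] by (auto simp: x'_def)
      have "nu x' = of_int z * nu x"
        using x(2) by (auto simp: x'_def nu_power nu_inverse)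
      then have "real e * nu x' = of_int z" using x(3) by (simp add: algebra_simps)
      then have "y = ereal (real e) * v x'" using z v_nu[OF x'(2)] by simp
      then show "y \<in> (\<lambda>x. ereal (real e) * v x) ` (L - {0})" using x' by blast
    qed
  qed
  have uniq: "e2 = e" if e2: "0 < e2 \<and> normalized_on (\<lambda>x. ereal (real e2) * v x) L" for e2 :: nat
  proof -
    have A2: "\<exists>z::int. real e2 * nu x = of_int z" if x: "x \<in> L" "x \<noteq> 0" for x
    proof -
      have "ereal (real e2) * v x \<in> (\<lambda>x. ereal (real e2) * v x) ` (L - {0})" using x by blast
      then have "ereal (real e2) * v x \<in> range (\<lambda>k::int. ereal (of_int k))" using e2 by (simp add: normalized_on_def)
      then obtain z :: int where "ereal (real e2) * v x = ereal (of_int z)" by blast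
      then have "real e2 * nu x = of_int z" using v_nu[OF x(2)] by simp
      then show ?thesis ..
    qed
    have "ereal (of_int 1) \<in> range (\<lambda>k::int. ereal (of_int k))" by (rule rangeI)
    then have "ereal (of_int 1) \<in> (\<lambda>x. ereal (real e2) * v x) ` (L - {0})" using e2 by (simp add: normalized_on_def)
    then obtain x2 where x2: "ereal (of_int 1) = ereal (real e2) * v x2" "x2 \<in> L - {0}" by (rule imageE)
    have x20: "x2 \<noteq> 0" using x2(2) by simp
    have x2': "real e2 * nu x2 = 1" using x2(1) v_nu[OF x20] by simp
    obtain x1 where x1: "x1 \<in> L" "x1 \<noteq> 0" "real e * nu x1 = 1" using B by blast
    obtain a b :: int where a: "real e * nu x2 = of_int a" and b: "real e2 * nu x1 = of_int b"
      using A[of x2] A2[of x1] x2(2) x1 by auto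
    have "real e = real e2 * of_int a"
    proof -
      have "real e * (real e2 * nu x2) = real e2 * of_int a" using a by (simp add: algebra_simps)
      then show ?thesis using x2' by simp
    qed
    moreover have "real e2 = real e * of_int b"
    proof -
      have "real e2 * (real e * nu x1) = real e * of_int b" using b by (simp add: algebra_simps)
      then show ?thesis using x1(3) by simp
    qed
    ultimately have "real_of_int (int e) = real_of_int (int e2 * a)" "real_of_int (int e2) = real_of_int (int e * b)" by simp_all
    then have "int e = int e2 * a" "int e2 = int e * b" by (simp_all only: of_int_eq_iff)
    then have "int e2 dvd int e" "int e dvd int e2" by (metis dvd_triv_left)+
    then have "e2 dvd e" "e dvd e2" by (simp_all only: int_dvd_int_iff)
    then show "e2 = e" by (rule dvd_antisym)
  qed
  have "ramification_index v L = e"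
    unfolding ramification_index_def using norm_iff e1 uniq by (intro the_equality) auto
  then show ?thesis using e1 A B by blast
qed

text \<open>The first ramification group in multiplicative form: \<open>\<sigma> x / x\<close> is
  congruent to 1 for all nonzero \<open>x\<close> in \<open>L\<close>. The ramification index does
  not enter, and the condition can be applied directly to basis elements.\<close>

definition wildly :: "('a \<Rightarrow> 'a) \<Rightarrow> bool"
  where "wildly \<sigma> \<longleftrightarrow> (\<forall>x\<in>L. x \<noteq> 0 \<longrightarrow> v x < v (\<sigma> x - x))"

text \<open>The \<open>x\<close> with \<open>\<sigma> x / x\<close> congruent to 1 form a
  multiplicative group \<open>H\<close>. It contains the units and a uniformizer of
  \<open>L\<close>, because 2 exceeds their normalized valuations 0 and 1, and these generate all
  nonzero elements.\<close>

lemma wildly_of_ramification: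
  assumes \<sigma>: "\<sigma> \<in> auts K" and e: "e \<ge> 1" "\<And>x. x \<in> L \<Longrightarrow> x \<noteq> 0 \<Longrightarrow> \<exists>z::int. real e * nu x = of_int z"
    "\<exists>x\<in>L. x \<noteq> 0 \<and> real e * nu x = 1"
    and r: "\<And>x. x \<in> L \<Longrightarrow> 0 \<le> v x \<Longrightarrow> ereal 2 \<le> ereal (real e) * v (\<sigma> x - x)"
  shows "wildly \<sigma>"
proof -
  note s = autsD[OF \<sigma> sfK]
  define H where "H = {x. x \<noteq> 0 \<and> 0 < v (\<sigma> x / x - 1)}"
  have unit: "v (\<sigma> x / x) = 0" if "x \<noteq> 0" for x
  proof -
    have "\<sigma> x \<noteq> 0" using that s(10) by simp
    moreover have "nu (\<sigma> x) = nu x" using v_aut[OF \<sigma>, of x] by (simp add: nu_def)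
    ultimately have "nu (\<sigma> x / x) = 0" using that by (simp add: nu_divide)
    moreover have "\<sigma> x / x \<noteq> 0" using that s(10) by simp
    ultimately show ?thesis using v_nu[of "\<sigma> x / x"] by (simp add: zero_ereal_def)
  qed
  have Hm: "x * y \<in> H" if "x \<in> H" "y \<in> H" for x y
  proof -
    have xy: "x \<noteq> 0" "y \<noteq> 0" "0 < v (\<sigma> x / x - 1)" "0 < v (\<sigma> y / y - 1)" using that by (simp_all add: H_def)
    have "0 < v ((\<sigma> x / x - 1) * (\<sigma> y / y) + (\<sigma> y / y - 1))"
      using xy unit[of y] by (intro v_add_gt v_mult_gt) simp_all
    moreover have e: "(\<sigma> x / x - 1) * (\<sigma> y / y) + (\<sigma> y / y - 1) = \<sigma> (x * y) / (x * y) - 1"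
      using xy(1,2) by (simp add: s(2) field_simps)
    ultimately have "0 < v (\<sigma> (x * y) / (x * y) - 1)" by (simp only: e)
    then show ?thesis using xy(1,2) by (simp add: H_def)
  qed
  have Hi: "inverse x \<in> H" if "x \<in> H" for x
  proof -
    have x: "x \<noteq> 0" "0 < v (\<sigma> x / x - 1)" using that by (simp_all add: H_def)
    have ix: "inverse x \<noteq> 0" using x(1) by simp
    have sx: "\<sigma> x \<noteq> 0" using x(1) s(10) by simp
    have "\<sigma> (inverse x) / inverse x - 1 = - ((\<sigma> x / x - 1) * (\<sigma> (inverse x) / inverse x))"
      unfolding s(11) using x(1) sx by (simp add: field_simps)
    moreover have "0 < v ((\<sigma> x / x - 1) * (\<sigma> (inverse x) / inverse x))"
      using x(2) unit[OF ix] by (intro v_mult_gt) simp_all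
    ultimately show ?thesis using ix by (simp add: H_def)
  qed
  have H1: "1 \<in> H" by (simp add: H_def s(5))
  have Hp: "x ^ n \<in> H" if "x \<in> H" for x n by (induction n) (auto intro: Hm H1 that)
  have HI: "x \<in> H" if x: "x \<in> L" "x \<noteq> 0" "0 \<le> nu x" "real e * nu x \<le> 1" for x
  proof -
    have "ereal 2 \<le> ereal (real e) * v (\<sigma> x - x)" using r[OF x(1)] x(2,3) by (simp add: v_pos_nu)
    then have "v x < v (\<sigma> x - x)"
    proof (cases "\<sigma> x - x = 0")
      case True
      then show ?thesis using v_nu[OF x(2)] by simp
    next
      case False
      assume "ereal 2 \<le> ereal (real e) * v (\<sigma> x - x)"
      then have "2 \<le> real e * nu (\<sigma> x - x)" using v_nu[OF False] by simp
      then have "real e * nu x < real e * nu (\<sigma> x - x)" using x(4) by simp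
      then have "nu x < nu (\<sigma> x - x)" using e(1) by (simp add: mult_less_cancel_left)
      then show ?thesis using v_nu[OF False] v_nu[OF x(2)] by simp
    qed
    then show ?thesis using v_quotient_gt[OF x(2)] x(2) by (simp add: H_def)
  qed
  obtain w where w: "w \<in> L" "w \<noteq> 0" "real e * nu w = 1" using e(3) by blast
  have nw: "nu w = 1 / real e" using w(3) e(1) by (simp add: field_simps)
  have wH: "w \<in> H" by (rule HI[OF w(1,2)]) (use nw w(3) in simp_all)
  have "x \<in> H" if x: "x \<in> L" "x \<noteq> 0" for x
  proof -
    obtain c :: int where c: "real e * nu x = of_int c" using e(2)[OF x] by blast
    define y where "y = (if c \<ge> 0 then w ^ nat c else inverse (w ^ nat (- c)))"
    have yH: "y \<in> H" unfolding y_def using Hp[OF wH] Hi by simp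
    have y: "y \<in> L" "y \<noteq> 0" using w subfieldD(6,9)[OF sfL] by (auto simp: y_def)
    have "nu y = of_int c * nu w" using w(2) by (auto simp: y_def nu_power nu_inverse)
    then have "real e * nu y = of_int c" using w(3) by (simp add: algebra_simps)
    then have "real e * nu y = real e * nu x" using c by simp
    then have "nu y = nu x" using e(1) by (simp only: mult_cancel_left) simp
    then have "nu (x / y) = 0" using x(2) y(2) by (simp add: nu_divide)
    then have "x / y \<in> H" using subfieldD(8)[OF sfL x(1) y(1)] x(2) y(2) by (intro HI) simp_all
    then have "(x / y) * y \<in> H" using yH by (rule Hm)
    then show ?thesis using y(2) by simp
  qed
  then show ?thesis unfolding wildly_def using v_quotient_gt by (simp add: H_def)
qed

text \<open>If \<open>v x\<close> is positive, the normalized valuation is at least 1 and increases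
  by an integer, so it reaches 2. A unit is split as \<open>x = (x - x ^ (p ^ N)) + y ^ p\<close>
  with first summand of positive valuation; the second contributes
  \<open>(\<sigma> y - y) ^ p\<close>, of normalized valuation at least \<open>p\<close>.\<close>

lemma ramification_of_wildly:
  assumes \<sigma>: "\<sigma> \<in> auts K" and e: "e \<ge> 1" "\<And>x. x \<in> L \<Longrightarrow> x \<noteq> 0 \<Longrightarrow> \<exists>z::int. real e * nu x = of_int z"
    and w: "wildly \<sigma>" and x: "x \<in> L" "0 \<le> v x"
  shows "ereal 2 \<le> ereal (real e) * v (\<sigma> x - x)"
proof -
  note s = autsD[OF \<sigma> sfK]
  have dL: "\<sigma> y - y \<in> L" if "y \<in> L" for y using auts_L[OF \<sigma> that] that by (rule subfieldD(7)[OF sfL])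
  have conv: "ereal 2 \<le> ereal (real e) * v y \<longleftrightarrow> ereal (2 / real e) \<le> v y" for y
  proof (cases "y = 0")
    case True
    then show ?thesis using e(1) by simp
  next
    case False
    then show ?thesis using e(1) by (simp add: v_nu field_simps)
  qed
  have step: "ereal (2 / real e) \<le> v (\<sigma> y - y)" if y: "y \<in> L" "0 < v y" for y
  proof (cases "\<sigma> y - y = 0")
    case False
    have y0: "y \<noteq> 0" using False s(4) by auto
    obtain a b :: int where a: "real e * nu y = of_int a" and b: "real e * nu (\<sigma> y - y) = of_int b"
      using e(2)[OF y(1) y0] e(2)[OF dL[OF y(1)] False] by blast
    have "0 < nu y" using y(2) v_pos_nu(2)[OF y0] by simp
    then have "0 < real e * nu y" using e(1) by simp
    then have "0 < real_of_int a" unfolding a .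
    moreover have "nu y < nu (\<sigma> y - y)" using w y(1) y0 v_nu[OF y0] v_nu[OF False] unfolding wildly_def by fastforce
    then have "real e * nu y < real e * nu (\<sigma> y - y)" using e(1) by simp
    then have "real_of_int a < real_of_int b" unfolding a b .
    ultimately have "2 \<le> b" by simp
    then have "2 \<le> real e * nu (\<sigma> y - y)" using b by simp
    then show ?thesis using e(1) by (subst v_le_nu(1)[OF False]) (simp add: field_simps)
  qed (simp only: v_zero, simp)
  show ?thesis unfolding conv
  proof (cases "0 < v x")
    case True
    then show "ereal (2 / real e) \<le> v (\<sigma> x - x)" by (rule step[OF x(1)])
  next
    case False
    then have vx: "v x = 0" using x(2) by simp
    have x0: "x \<noteq> 0" using vx by auto
    obtain z where z: "z \<in> teich" "0 < v (x - z)" using residue_algebraic[OF x(2)] by (auto simp: resid_def)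
    obtain N where N: "N \<ge> 1" "z \<in> frob_fixed N" using z(1) unfolding teich_def by auto
    have "0 < v ((x - z) ^ (p ^ N))" using v_power_pos_iff[of "p ^ N"] p_pos z(2) by simp
    then have "0 < v (x ^ (p ^ N) - z)" using N(2) by (simp add: frobenius_diff frob_fixed_def)
    with z(2) have "0 < v ((x - z) - (x ^ (p ^ N) - z))" by (rule v_diff_gt)
    then have x': "0 < v (x - x ^ (p ^ N))" by simp
    define y where "y = x ^ (p ^ (N - 1))"
    have yp: "y ^ p = x ^ (p ^ N)"
      unfolding y_def power_mult[symmetric] using N(1) by (simp add: power_Suc[symmetric] mult.commute)
    have yL: "y \<in> L" unfolding y_def by (rule subfieldD(9)[OF sfL x(1)])
    have y0: "y \<noteq> 0" using x0 by (simp add: y_def)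
    have ny: "nu y = 0" using x0 vx v_nu[OF x0] by (simp add: y_def nu_power zero_ereal_def)
    have "ereal (2 / real e) \<le> v ((\<sigma> y - y) ^ p)"
    proof (cases "\<sigma> y - y = 0")
      case True
      then show ?thesis using p_pos by (simp add: power_0_left)
    next
      case False
      have "v y < v (\<sigma> y - y)" using w yL y0 unfolding wildly_def by blast
      then have pos: "0 < nu (\<sigma> y - y)" using v_nu[OF y0] v_nu[OF False] ny by simp
      obtain b :: int where b: "real e * nu (\<sigma> y - y) = of_int b" using e(2)[OF dL[OF yL] False] by blast
      have "0 < real e * nu (\<sigma> y - y)" using pos e(1) by simp
      then have "1 \<le> b" using b by simp
      then have "1 \<le> real e * nu (\<sigma> y - y)" using b by simp
      then have "1 / real e \<le> nu (\<sigma> y - y)" using e(1) by (simp add: field_simps)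
      moreover have "2 \<le> real p" using p_gt1 by simp
      ultimately have "2 * (1 / real e) \<le> real p * nu (\<sigma> y - y)" by (intro mult_mono) simp_all
      then show ?thesis using False by (subst v_le_nu(1)) (simp_all add: nu_power)
    qed
    moreover have "ereal (2 / real e) \<le> v (\<sigma> (x - x ^ (p ^ N)) - (x - x ^ (p ^ N)))"
      using subfieldD(7,9)[OF sfL] x(1) x' by (intro step) auto
    moreover have "\<sigma> x - x = (\<sigma> (x - x ^ (p ^ N)) - (x - x ^ (p ^ N))) + (\<sigma> y - y) ^ p"
    proof -
      have "(\<sigma> y - y) ^ p = \<sigma> (x ^ (p ^ N)) - x ^ (p ^ N)"
        using frobenius_diff[of "\<sigma> y" y 1] yp by (simp add: s(8)[symmetric])
      then show ?thesis by (simp add: s(6))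
    qed
    ultimately show "ereal (2 / real e) \<le> v (\<sigma> x - x)" by (metis v_add_ge)
  qed
qed

theorem carrier_wild_group:
  "carrier (wild_group v L K) = (\<lambda>\<sigma>. restrict \<sigma> L) ` {\<sigma>\<in>auts K. wildly \<sigma>}"
proof -
  obtain e where e: "e \<ge> 1" "ramification_index v L = e" "\<And>x. x \<in> L \<Longrightarrow> x \<noteq> 0 \<Longrightarrow> \<exists>z::int. real e * nu x = of_int z"
    "\<exists>x\<in>L. x \<noteq> 0 \<and> real e * nu x = 1"
    using ramification_index by blast
  have c: "restrict \<sigma> L \<in> ramification_subgroup v L K 1 \<longleftrightarrow> wildly \<sigma>" if \<sigma>: "\<sigma> \<in> auts K" for \<sigma>
  proof -
    have "restrict \<sigma> L \<in> carrier (galois_group L K)" unfolding carrier_galois_group using \<sigma> by blast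
    then have "restrict \<sigma> L \<in> ramification_subgroup v L K 1 \<longleftrightarrow>
      (\<forall>x\<in>L. 0 \<le> v x \<longrightarrow> ereal 2 \<le> ereal (real e) * v (\<sigma> x - x))"
      by (simp add: ramification_subgroup_def e(2))
    then show ?thesis
      using wildly_of_ramification[OF \<sigma> e(1,3,4)] ramification_of_wildly[OF \<sigma> e(1,3)] by blast
  qed
  have "carrier (wild_group v L K) = ramification_subgroup v L K 1" by (simp add: wild_group_def)
  also have "\<dots> = (\<lambda>\<sigma>. restrict \<sigma> L) ` {\<sigma>\<in>auts K. wildly \<sigma>}"
  proof
    show "ramification_subgroup v L K 1 \<subseteq> (\<lambda>\<sigma>. restrict \<sigma> L) ` {\<sigma>\<in>auts K. wildly \<sigma>}"
    proof
      fix \<tau> assume t: "\<tau> \<in> ramification_subgroup v L K 1"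
      then have "\<tau> \<in> carrier (galois_group L K)" by (simp add: ramification_subgroup_def)
      then obtain \<sigma> where "\<sigma> \<in> auts K" "\<tau> = restrict \<sigma> L" unfolding carrier_galois_group by blast
      then show "\<tau> \<in> (\<lambda>\<sigma>. restrict \<sigma> L) ` {\<sigma>\<in>auts K. wildly \<sigma>}" using c t by blast
    qed
    show "(\<lambda>\<sigma>. restrict \<sigma> L) ` {\<sigma>\<in>auts K. wildly \<sigma>} \<subseteq> ramification_subgroup v L K 1" using c by blast
  qed
  finally show ?thesis .
qed

text \<open>Let \<open>e = p ^ a * N\<close> be the ramification index with \<open>N\<close> prime
  to \<open>p\<close>. For nonzero \<open>x\<close> in \<open>L\<close> the number
  \<open>p ^ a * nu x\<close> is a multiple of \<open>1 / N\<close>, hence the valuation of a power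
  of \<open>w\<close> in \<open>T\<close>, and \<open>wild_of_tame\<close> applies.\<close>

theorem tame_field_for_L:
  obtains T N where "subfield T Ksep" "K \<subseteq> T" "\<not> p dvd N" "auts T \<subseteq> {\<sigma>\<in>auts K. wildly \<sigma>}"
    "\<And>y. y \<in> T \<Longrightarrow> y \<noteq> 0 \<Longrightarrow> \<exists>z::int. real N * nu y = of_int z"
proof -
  obtain e where e: "e \<ge> 1" "\<And>x. x \<in> L \<Longrightarrow> x \<noteq> 0 \<Longrightarrow> \<exists>z::int. real e * nu x = of_int z"
    using ramification_index by blast
  obtain N where N: "e = p ^ multiplicity p e * N" "\<not> p dvd N"
    using multiplicity_decompose'[of e p] e(1) p_gt1 by (metis One_nat_def less_irrefl nat_dvd_1_iff_1 not_one_le_zero)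
  define a where "a = multiplicity p e"
  have N0: "N \<noteq> 0" using N e(1) by (metis dvd_0_right)
  obtain T w where T: "subfield T Ksep" "K \<subseteq> T" "teich \<subseteq> T" "w \<in> T" "w \<noteq> 0" "nu w = 1 / real N"
    "\<And>y. y \<in> T \<Longrightarrow> y \<noteq> 0 \<Longrightarrow> \<exists>z::int. real N * nu y = of_int z"
    using tame_field[OF N(2)] by blast
  have "wildly \<sigma>" if \<sigma>: "\<sigma> \<in> auts T" for \<sigma>
    unfolding wildly_def
  proof (intro ballI impI)
    fix x assume x: "x \<in> L" "x \<noteq> 0"
    obtain c :: int where c: "real e * nu x = of_int c" using e(2)[OF x] by blast
    define y where "y = (if c \<ge> 0 then w ^ nat c else inverse (w ^ nat (- c)))"
    have y: "y \<in> T" "y \<noteq> 0" using T(4,5) subfieldD(6,9)[OF T(1)] by (auto simp: y_def)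
    have ny: "nu y = of_int c * nu w" using T(5) by (auto simp: y_def nu_power nu_inverse)
    have "real e = real (p ^ a) * real N" using arg_cong[OF N(1), of real] unfolding a_def by simp
    then have "real N * (real (p ^ a) * nu x) = of_int c" using c by (simp add: algebra_simps)
    moreover have "real N * nu y = of_int c" using ny T(6) N0 by simp
    ultimately have "real N * (real (p ^ a) * nu x) = real N * nu y" by simp
    then have "real (p ^ a) * nu x = nu y" using N0 by (simp only: mult_cancel_left) simp
    then show "v x < v (\<sigma> x - x)" by (rule wild_of_tame[OF T(1-3) \<sigma> y x(2)])
  qed
  then have "auts T \<subseteq> {\<sigma>\<in>auts K. wildly \<sigma>}" using auts_mono[OF T(2)] by blast
  then show ?thesis using that[OF T(1,2) N(2) _ T(7)] by blast
qed

end

section \<open>The polynomial of a degree one element\<close>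

text \<open>The setting for \<phi>_\<pi> with \<pi> = c t + d, where \<open>b1 = c * a1\<close> and
  \<open>b2 = c * a2\<close>; constants have valuation 0, so the combination of \<open>nu b1\<close>
  and \<open>nu b2\<close> is v(j). The condition \<open>nu \<pi> \<le> 0\<close> joins both cases:
  negative for infinite \<open>v\<close>, zero for finite \<open>v\<close>.\<close>

locale drinfeld = local_field v K p s k F t for v :: "'a::field \<Rightarrow> ereal" and K p s k F t +
  fixes \<pi> b1 b2 :: 'a and q :: nat
  assumes q_def: "q = p ^ s" and piK: "\<pi> \<in> K" "\<pi> \<noteq> 0" and b1K: "b1 \<in> K" "b1 \<noteq> 0" and b2K: "b2 \<in> K" "b2 \<noteq> 0"
    and al_le: "nu \<pi> \<le> 0"
    and jv_less: "(real q + 1) * nu b1 - nu b2 < real q * nu \<pi>"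
    and jv_int: "\<exists>z::int. (real q + 1) * nu b1 - nu b2 = of_int z \<and> \<not> int p dvd z"
begin

definition f :: "'a \<Rightarrow> 'a" where "f x = \<pi> * x + b1 * x ^ q + b2 * x ^ q\<^sup>2"

definition fpoly :: "'a poly" where "fpoly = monom \<pi> 1 + monom b1 q + monom b2 (q\<^sup>2)"

abbreviation jv :: real where "jv \<equiv> (real q + 1) * nu b1 - nu b2"

text \<open>The valuations of \<open>\<xi>\<^bsub>-1\<^esub>\<close> and \<open>\<xi>\<^sub>1\<close>.\<close>

definition lm :: real where "lm = (nu \<pi> - nu b1) / (real q - 1)"
definition l1 :: real where "l1 = (nu b1 - nu b2) / (real q * (real q - 1))"

lemma q_ge2: "2 \<le> q"
proof -
  have "1 < p ^ s" using one_less_power[OF p_gt1] s_pos by blast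
  then show ?thesis by (simp add: q_def)
qed

lemma Q_ge2: "2 \<le> real q"
  using q_ge2 by simp

lemma lm_eq: "(real q - 1) * lm = nu \<pi> - nu b1"
  using Q_ge2 by (simp add: lm_def)

lemma l1_eq: "real q * (real q - 1) * l1 = nu b1 - nu b2"
  using Q_ge2 by (simp add: l1_def)

text \<open>Since \<open>q * (q - 1) * (lm - l1) = q * nu \<pi> - jv\<close>, this is the upper
  bound on v(j) in another form.\<close>

lemma l1_less_lm: "l1 < lm"
proof -
  have "real q * (real q - 1) * lm = real q * (nu \<pi> - nu b1)" using lm_eq by (simp add: mult.assoc)
  then have "real q * (real q - 1) * (lm - l1) = real q * nu \<pi> - jv"
    using l1_eq by (simp add: algebra_simps)
  then have "0 < real q * (real q - 1) * (lm - l1)" using jv_less by simp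
  moreover have "0 < real q * (real q - 1)" using Q_ge2 by simp
  ultimately have "0 < lm - l1" by (rule zero_less_mult_pos)
  then show ?thesis by simp
qed

lemma poly_fpoly: "poly fpoly x = f x"
  by (simp add: fpoly_def f_def poly_monom)

lemma f_add: "f (x + y) = f x + f y"
proof -
  have "(x + y) ^ q = x ^ q + y ^ q" unfolding q_def by (rule frobenius_add)
  moreover have "(x + y) ^ q\<^sup>2 = x ^ q\<^sup>2 + y ^ q\<^sup>2"
    unfolding q_def power_mult[symmetric] by (rule frobenius_add)
  ultimately show ?thesis by (simp add: f_def algebra_simps)
qed

lemma f_zero [simp]: "f 0 = 0"
  using q_ge2 by (simp add: f_def power_0_left)

lemma f_scale: "c \<in> k \<Longrightarrow> f (c * x) = c * f x"
proof -
  assume c: "c \<in> k"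
  have 1: "c ^ q = c" using k_power[OF c] by (simp add: q_def)
  then have "c ^ q\<^sup>2 = c" by (simp add: power2_eq_square power_mult)
  then show ?thesis using 1 by (simp add: f_def algebra_simps power_mult_distrib)
qed

lemma f_minus: "f (- x) = - f x"
  using f_add[of x "- x"] by (simp add: eq_neg_iff_add_eq_0 add.commute)

lemma f_diff: "f (x - y) = f x - f y"
  using f_add[of x "- y"] f_minus by simp

lemma f_sum: "f (sum g A) = (\<Sum>i\<in>A. f (g i))"
  by (induction A rule: infinite_finite_induct) (auto simp: f_add)

lemma f_aut: "\<sigma> \<in> auts K \<Longrightarrow> \<sigma> (f x) = f (\<sigma> x)"
  unfolding f_def using piK(1) b1K(1) b2K(1) by (simp add: autsD[OF _ sfK])

lemma aut_k: "\<sigma> \<in> auts K \<Longrightarrow> c \<in> k \<Longrightarrow> \<sigma> c = c"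
  using autsD(3)[OF _ sfK] kK by blast

lemma q_less_q2: "1 < q" "q < q\<^sup>2"
  using q_ge2 by (simp_all add: power2_eq_square)

lemma degree_fpoly_diff: "Polynomial.degree (fpoly - [:y:]) = q\<^sup>2" "lead_coeff (fpoly - [:y:]) = b2"
proof -
  have c: "coeff (fpoly - [:y:]) i = (if i = q\<^sup>2 then b2 else if i = q then b1 else if i = 1 then \<pi> else if i = 0 then - y else 0)" for i
    using q_less_q2 by (cases i) (auto simp: fpoly_def coeff_pCons)
  show d: "Polynomial.degree (fpoly - [:y:]) = q\<^sup>2"
  proof (rule antisym)
    show "Polynomial.degree (fpoly - [:y:]) \<le> q\<^sup>2"
      using q_less_q2 by (intro degree_le allI impI) (simp only: c, simp)
    show "q\<^sup>2 \<le> Polynomial.degree (fpoly - [:y:])" using b2K(2) by (intro le_degree) (simp only: c, simp)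
  qed
  show "lead_coeff (fpoly - [:y:]) = b2" unfolding d by (simp only: c) simp
qed

lemma separable_fpoly_diff: "separable_poly (fpoly - [:y:])"
proof (rule separable_polyI_pderiv_const[OF _ piK(2)])
  have "of_nat p = (0 :: 'a)" by (rule of_nat_p)
  then have q0: "of_nat q = (0 :: 'a)" using s_pos by (simp add: q_def)
  then have q20: "of_nat (q\<^sup>2) = (0 :: 'a)" by simp
  show "pderiv (fpoly - [:y:]) = [:\<pi>:]"
    unfolding fpoly_def pderiv_diff pderiv_add pderiv_monom q0 q20 by (simp add: pderiv_pCons monom_0)
qed

lemma roots_fpoly_diff: "{x. f x = y} = {x. poly (fpoly - [:y:]) x = 0}"
  by (simp add: poly_fpoly)

lemma card_f_roots: "card {x. f x = y} = q\<^sup>2"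
  unfolding roots_fpoly_diff sep_closure_card_roots[OF sepK separable_fpoly_diff] degree_fpoly_diff(1) ..

lemma finite_f_roots: "finite {x. f x = y}"
  unfolding roots_fpoly_diff using separable_poly_nonzero[OF separable_fpoly_diff] by (rule poly_roots_finite)

lemma f_surj: "\<exists>x. f x = y"
proof (rule ccontr)
  assume "\<nexists>x. f x = y"
  then have "{x. f x = y} = {}" by blast
  then have "card {x. f x = y} = 0" by simp
  then show False using card_f_roots[of y] q_ge2 by simp
qed

section \<open>The roots of f and their valuations\<close>

abbreviation Vf :: "'a set" where "Vf \<equiv> {w. f w = 0}"

lemma f_product: "f x = b2 * (\<Prod>w\<in>Vf. x - w)"
proof -
  have "poly (fpoly - [:0:]) x = lead_coeff (fpoly - [:0:]) * (\<Prod>w\<in>{z. poly (fpoly - [:0:]) z = 0}. x - w)"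
    by (rule separable_splits[OF sep_closed separable_fpoly_diff])
  then show ?thesis unfolding degree_fpoly_diff(2) roots_fpoly_diff[symmetric] by (simp add: poly_fpoly)
qed

text \<open>Two of the three terms of \<open>f w\<close> share the least valuation. Terms 0 and 1
  give \<open>lm\<close>, terms 1 and 2 give \<open>l1\<close>; terms 0 and 2 could lie jointly at
  or below the middle one only if \<open>jv \<ge> q * nu \<pi>\<close>.\<close>

lemma Vf_values:
  assumes w: "f w = 0" "w \<noteq> 0" shows "nu w = lm \<or> nu w = l1"
proof -
  define r where "r = nu w"
  define g where "g i = (if i = (0::nat) then \<pi> * w else if i = 1 then b1 * w ^ q else b2 * w ^ q\<^sup>2)" for i
  have n: "nu (g 0) = nu \<pi> + r" "nu (g 1) = nu b1 + real q * r" "nu (g 2) = nu b2 + real q * real q * r"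
    using w(2) piK b1K b2K by (simp_all add: g_def r_def nu_mult nu_power power2_eq_square)
  have g0: "g i \<noteq> 0" for i using w(2) piK b1K b2K by (simp add: g_def)
  have "sum g {0, 1, 2} = 0" using w(1) by (simp add: g_def f_def add.assoc)
  then have "\<exists>i\<in>{0,1,2}. \<exists>j\<in>{0,1,2}. i \<noteq> j \<and> g i \<noteq> 0 \<and> g j \<noteq> 0 \<and> nu (g i) = nu (g j) \<and> (\<forall>l\<in>{0,1,2}. v (g i) \<le> v (g l))"
    by (intro v_zero_sum_two_min[where a = 0]) (simp_all add: g0)
  then obtain i j where ij: "i \<in> {0, 1, 2}" "j \<in> {0, 1, 2}" "i \<noteq> j"
    "nu (g i) = nu (g j)" "\<forall>l\<in>{0,1,2}. v (g i) \<le> v (g l)" by blast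
  have le1: "nu (g i) \<le> nu (g 1)" using ij(5) v_nu[OF g0] by simp
  have q1: "0 < real q - 1" using Q_ge2 by simp
  consider "nu (g 0) = nu (g 1)" | "nu (g 1) = nu (g 2)" | "nu (g 0) = nu (g 2)" "nu (g 0) \<le> nu (g 1)"
    using ij le1 by auto
  then show ?thesis
  proof cases
    case 1
    then have "(real q - 1) * r = (real q - 1) * lm" unfolding n lm_eq by (simp add: algebra_simps)
    then show ?thesis using q1 by (simp add: r_def)
  next
    case 2
    then have "real q * (real q - 1) * r = real q * (real q - 1) * l1" unfolding n l1_eq by (simp add: algebra_simps)
    then show ?thesis using q1 by (simp add: r_def)
  next
    case 3
    have a: "(real q + 1) * ((real q - 1) * r) = nu \<pi> - nu b2" using 3(1) unfolding n by (simp add: algebra_simps)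
    have "nu \<pi> - nu b1 \<le> (real q - 1) * r" using 3(2) unfolding n by (simp add: algebra_simps)
    then have "(real q + 1) * (nu \<pi> - nu b1) \<le> (real q + 1) * ((real q - 1) * r)" by (rule mult_left_mono) simp
    then have "(real q + 1) * (nu \<pi> - nu b1) \<le> nu \<pi> - nu b2" unfolding a .
    then have "real q * nu \<pi> \<le> jv" by (simp add: algebra_simps)
    then show ?thesis using jv_less by simp
  qed
qed

lemma Vf_nu_le: "f w = 0 \<Longrightarrow> w \<noteq> 0 \<Longrightarrow> nu w \<le> lm"
  using Vf_values[of w] l1_less_lm by auto

lemma large_element: "\<exists>x\<in>K. x \<noteq> 0 \<and> B < nu x"
proof -
  obtain u where u: "u \<in> K" "u \<noteq> 0" "nu u = 1" using uniformizer by blast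
  obtain n :: nat where "B < real n" using reals_Archimedean2 by blast
  then show ?thesis using u subfieldD(9)[OF sfK u(1), of n] by (intro bexI[of _ "u ^ n"]) (simp_all add: nu_power)
qed

text \<open>
  Comparing the two expressions of \<open>v(f(x))\<close> for \<open>v(x)\<close> large counts the elements of \<open>Vf\<close> of each
  valuation; this replaces the Newton polygon.
\<close>

lemma card_Vf_values:
  "card {w\<in>Vf. w \<noteq> 0 \<and> nu w = lm} = q - 1" "card {w\<in>Vf. w \<noteq> 0 \<and> nu w = l1} = q\<^sup>2 - q"
proof -
  let ?A = "{w\<in>Vf. w \<noteq> 0 \<and> nu w = lm}" and ?B = "{w\<in>Vf. w \<noteq> 0 \<and> nu w = l1}"
  have fin: "finite Vf" by (rule finite_f_roots)
  have finAB: "finite ?A" "finite ?B" using fin by simp_all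
  have V: "Vf = insert 0 (?A \<union> ?B)" using Vf_values by auto
  have disj: "?A \<inter> ?B = {}" using l1_less_lm by auto
  have "card Vf = Suc (card (?A \<union> ?B))" by (subst V, rule card_insert_disjoint) (use finAB in simp_all)
  moreover have "card (?A \<union> ?B) = card ?A + card ?B" by (rule card_Un_disjoint[OF finAB disj])
  ultimately have cc: "Suc (card ?A + card ?B) = q\<^sup>2" using card_f_roots[of 0] by simp
  \<comment> \<open>Large enough to exceed 0 and the valuations of all nonzero roots, and to make
    \<open>\<pi> * x\<close> the strictly dominant term of \<open>f x\<close>.\<close>
  obtain x where x: "x \<noteq> 0" "max lm (max ((nu \<pi> - nu b1)) ((nu \<pi> - nu b2))) + \<bar>lm\<bar> < nu x" using large_element by blast
  have xl: "lm < nu x" "l1 < nu x" "0 < nu x" using x(2) l1_less_lm by linarith+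
  have xne: "x - w \<noteq> 0" if "w \<in> Vf" for w
  proof
    assume "x - w = 0"
    then have "x = w" by simp
    then show False using Vf_nu_le[of w] that x(1) xl(1) by simp
  qed
  have nw: "nu (x - w) = (if w = 0 then nu x else nu w)" if "w \<in> Vf" for w
  proof (cases "w = 0")
    case False
    have "nu w < nu x" using Vf_nu_le[of w] that False xl(1) by simp
    then have "v (- w) < v x" using v_nu[OF x(1)] v_nu[OF False] by simp
    then have "v (- w + x) = v (- w)" by (rule v_add_eq)
    then show ?thesis using False by (simp add: nu_def)
  qed simp
  have prod: "nu (f x) = nu b2 + (\<Sum>w\<in>Vf. nu (x - w))"
  proof -
    have ne: "(\<Prod>w\<in>Vf. x - w) \<noteq> 0" using xne fin by (simp add: prod_zero_iff)
    have np: "nu (\<Prod>w\<in>Vf. x - w) = (\<Sum>w\<in>Vf. nu (x - w))" by (rule nu_prod[OF xne])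
    show ?thesis by (simp only: f_product[of x] nu_mult[OF b2K(2) ne] np)
  qed
  have "(\<Sum>w\<in>Vf. nu (x - w)) = (\<Sum>w\<in>Vf. if w = 0 then nu x else nu w)"
    by (rule sum.cong[OF refl]) (rule nw)
  also have "\<dots> = (\<Sum>w\<in>insert 0 (?A \<union> ?B). if w = 0 then nu x else nu w)"
    by (rule sum.cong[OF V refl])
  also have "\<dots> = nu x + (\<Sum>w\<in>?A \<union> ?B. nu w)"
    using finAB by (subst sum.insert) (auto intro!: sum.cong)
  also have "(\<Sum>w\<in>?A \<union> ?B. nu w) = (\<Sum>w\<in>?A. nu w) + (\<Sum>w\<in>?B. nu w)"
    by (rule sum.union_disjoint[OF finAB disj])
  also have "(\<Sum>w\<in>?A. nu w) = real (card ?A) * lm" by simp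
  also have "(\<Sum>w\<in>?B. nu w) = real (card ?B) * l1" by simp
  finally have s: "nu (f x) = nu b2 + nu x + real (card ?A) * lm + real (card ?B) * l1" using prod by simp
  have "nu (f x) = nu \<pi> + nu x"
  proof -
    have px: "nu (\<pi> * x) = nu \<pi> + nu x" "nu (b1 * x ^ q) = nu b1 + real q * nu x"
      "nu (b2 * x ^ q\<^sup>2) = nu b2 + real (q\<^sup>2) * nu x" using x(1) piK b1K b2K by (simp_all add: nu_mult nu_power)
    have "2 * nu x \<le> real q * nu x" using Q_ge2 xl(3) by (intro mult_right_mono) simp_all
    moreover have "2 * nu x \<le> real (q\<^sup>2) * nu x"
    proof (rule mult_right_mono)
      have "2 \<le> q\<^sup>2" using q_less_q2 by linarith
      then show "2 \<le> real (q\<^sup>2)" by (metis of_nat_le_iff of_nat_numeral)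
    qed (use xl(3) in simp)
    moreover have "nu \<pi> - nu b1 < nu x" "nu \<pi> - nu b2 < nu x" using x(2) by linarith+
    ultimately have lt: "nu (\<pi> * x) < nu (b1 * x ^ q)" "nu (\<pi> * x) < nu (b2 * x ^ q\<^sup>2)" unfolding px by linarith+
    have ne: "\<pi> * x \<noteq> 0" "b1 * x ^ q \<noteq> 0" "b2 * x ^ q\<^sup>2 \<noteq> 0" using x(1) piK b1K b2K by simp_all
    have "v (\<pi> * x) < v (b1 * x ^ q + b2 * x ^ q\<^sup>2)"
      by (rule v_add_gt) (use lt v_nu[OF ne(1)] v_nu[OF ne(2)] v_nu[OF ne(3)] in simp_all)
    then have "v (\<pi> * x + (b1 * x ^ q + b2 * x ^ q\<^sup>2)) = v (\<pi> * x)" by (rule v_add_eq)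
    then have "v (f x) = v (\<pi> * x)" by (simp add: f_def add.assoc)
    then show ?thesis using px(1) by (simp add: nu_def)
  qed
  then have e: "real (card ?A) * lm + real (card ?B) * l1 = nu \<pi> - nu b2" using s by simp
  have B: "real (card ?B) = real q * real q - 1 - real (card ?A)"
  proof -
    have "real (Suc (card ?A + card ?B)) = real (q\<^sup>2)" using cc by (rule arg_cong)
    then show ?thesis by (simp add: power2_eq_square)
  qed
  \<comment> \<open>Both the number of nonzero roots and the sum of their valuations are known; as
    \<open>lm\<close> and \<open>l1\<close> differ, the two counts are determined.\<close>
  have "(real (card ?A) - (real q - 1)) * (lm - l1) = 0"
  proof -
    have "real (card ?A) * lm + (real q * real q - 1 - real (card ?A)) * l1 = (real q - 1) * lm + real q * (real q - 1) * l1"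
      using e unfolding B lm_eq l1_eq by simp
    then show ?thesis by (simp add: algebra_simps)
  qed
  then have "real (card ?A) = real q - 1" using l1_less_lm by simp
  then have "real (card ?A) = real (q - 1)" using q_ge2 by (simp add: of_nat_diff)
  then show A: "card ?A = q - 1" by (simp only: of_nat_eq_iff)
  show "card ?B = q\<^sup>2 - q" using cc A q_ge2 by linarith
qed

text \<open>Evaluates \<open>v(f(x))\<close> from \<open>v(x)\<close> when \<open>x\<close> has the largest valuation in its coset modulo \<open>Vf\<close>.\<close>

definition h :: "real \<Rightarrow> real"
  where "h r = nu b2 + r + (real q - 1) * min r lm + real q * (real q - 1) * min r l1"

lemma h_strict_mono: "r < r' \<Longrightarrow> h r < h r'"
proof -
  assume r: "r < r'"
  have "(real q - 1) * min r lm \<le> (real q - 1) * min r' lm" using r Q_ge2 by (intro mult_left_mono) auto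
  moreover have "real q * (real q - 1) * min r l1 \<le> real q * (real q - 1) * min r' l1" using r Q_ge2 by (intro mult_left_mono) auto
  ultimately show ?thesis using r unfolding h_def by linarith
qed

lemma h_inj: "h r = h r' \<Longrightarrow> r = r'"
  using h_strict_mono[of r r'] h_strict_mono[of r' r] by (cases r r' rule: linorder_cases) auto

lemma h_less: "h r < h r' \<Longrightarrow> r < r'"
  using h_strict_mono[of r' r] by (cases r r' rule: linorder_cases) auto

text \<open>\<open>h\<close> is piecewise linear with breaks at \<open>l1\<close> and
  \<open>lm\<close>: above \<open>lm\<close> the linear term of \<open>f\<close> dominates, between
  the breaks the term with \<open>b1\<close>.\<close>

lemma h_large: "lm \<le> r \<Longrightarrow> h r = r + nu \<pi>"
  unfolding h_def using l1_less_lm lm_eq l1_eq by (simp add: min_def)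

lemma h_middle: "l1 \<le> r \<Longrightarrow> r \<le> lm \<Longrightarrow> h r = nu b1 + real q * r"
proof -
  assume r: "l1 \<le> r" "r \<le> lm"
  then have "h r = nu b2 + r + (real q - 1) * r + real q * (real q - 1) * l1"
    unfolding h_def by (simp add: min_def)
  then show ?thesis unfolding l1_eq by (simp add: algebra_simps)
qed

text \<open>By maximality, subtracting a nonzero root \<open>w\<close> of \<open>f\<close> cannot
  raise the valuation of \<open>x\<close>, so \<open>nu (x - w)\<close> is exactly the minimum of
  \<open>nu x\<close> and \<open>nu w\<close>. Summing over the factorization of \<open>f\<close>,
  with the known number of roots of each valuation, gives \<open>h\<close>.\<close>

lemma largest_root_value:
  assumes y: "f x = y" "y \<noteq> 0" and large: "\<And>z. f z = y \<Longrightarrow> v z \<le> v x"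
  shows "x \<noteq> 0" "nu y = h (nu x)"
proof -
  show x0: "x \<noteq> 0" using y by auto
  have fin: "finite Vf" by (rule finite_f_roots)
  have xne: "x - w \<noteq> 0" if "w \<in> Vf" for w using that y by auto
  have nw: "nu (x - w) = (if w = 0 then nu x else min (nu x) (nu w))" if w: "w \<in> Vf" for w
  proof (cases "w = 0")
    case False
    have le: "v (x - w) \<le> v x" using large[of "x - w"] w y by (simp add: f_diff)
    show ?thesis
    proof (cases "nu w < nu x")
      case True
      then have "v (- w) < v x" using v_nu[OF x0] v_nu[OF False] by simp
      then have "v (- w + x) = v (- w)" by (rule v_add_eq)
      then show ?thesis using False True by (simp add: nu_def min_def)
    next
      case F: False
      have "v x \<le> v (x - w)" by (rule v_diff_ge) (use F v_nu[OF x0] v_nu[OF False] in simp_all)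
      then have "v (x - w) = v x" using le by simp
      then show ?thesis using False F by (simp add: nu_def min_def)
    qed
  qed simp
  let ?A = "{w\<in>Vf. w \<noteq> 0 \<and> nu w = lm}" and ?B = "{w\<in>Vf. w \<noteq> 0 \<and> nu w = l1}"
  have finAB: "finite ?A" "finite ?B" using fin by simp_all
  have V: "Vf = insert 0 (?A \<union> ?B)" using Vf_values by auto
  have disj: "?A \<inter> ?B = {}" using l1_less_lm by auto
  have ne: "(\<Prod>w\<in>Vf. x - w) \<noteq> 0" using xne fin by (simp add: prod_zero_iff)
  have np: "nu (\<Prod>w\<in>Vf. x - w) = (\<Sum>w\<in>Vf. nu (x - w))" by (rule nu_prod[OF xne])
  have prod: "nu y = nu b2 + (\<Sum>w\<in>Vf. nu (x - w))"
    by (simp only: y(1)[symmetric] f_product[of x] nu_mult[OF b2K(2) ne] np)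
  have "(\<Sum>w\<in>Vf. nu (x - w)) = (\<Sum>w\<in>Vf. if w = 0 then nu x else min (nu x) (nu w))"
    by (rule sum.cong[OF refl]) (rule nw)
  also have "\<dots> = (\<Sum>w\<in>insert 0 (?A \<union> ?B). if w = 0 then nu x else min (nu x) (nu w))"
    by (rule sum.cong[OF V refl])
  also have "\<dots> = nu x + (\<Sum>w\<in>?A \<union> ?B. min (nu x) (nu w))"
    using finAB by (subst sum.insert) (auto intro!: sum.cong)
  also have "(\<Sum>w\<in>?A \<union> ?B. min (nu x) (nu w)) = (\<Sum>w\<in>?A. min (nu x) (nu w)) + (\<Sum>w\<in>?B. min (nu x) (nu w))"
    by (rule sum.union_disjoint[OF finAB disj])
  also have "(\<Sum>w\<in>?A. min (nu x) (nu w)) = (\<Sum>w\<in>?A. min (nu x) lm)" by (rule sum.cong) auto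
  also have "(\<Sum>w\<in>?B. min (nu x) (nu w)) = (\<Sum>w\<in>?B. min (nu x) l1)" by (rule sum.cong) auto
  also have "(\<Sum>w\<in>?A. min (nu x) lm) = real (q - 1) * min (nu x) lm" by (simp only: sum_constant card_Vf_values)
  also have "(\<Sum>w\<in>?B. min (nu x) l1) = real (q\<^sup>2 - q) * min (nu x) l1" by (simp only: sum_constant card_Vf_values)
  finally have "nu y = nu b2 + nu x + real (q - 1) * min (nu x) lm + real (q\<^sup>2 - q) * min (nu x) l1"
    using prod by simp
  moreover have "real (q - 1) = real q - 1" using q_ge2 by (simp add: of_nat_diff)
  moreover have "real (q\<^sup>2 - q) = real q * (real q - 1)"
    using q_less_q2 by (simp add: of_nat_diff power2_eq_square algebra_simps)
  ultimately show "nu y = h (nu x)" unfolding h_def by simp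
qed

end

section \<open>Towers of largest roots\<close>

text \<open>\<open>a i\<close> and \<open>b i\<close> stand for \<open>\<xi>\<^bsub>-i\<^esub>\<close> and \<open>\<xi>\<^bsub>i\<^esub>\<close>.\<close>

locale tower = drinfeld v K p s k F t \<pi> b1 b2 q
  for v :: "'a::field \<Rightarrow> ereal" and K p s k F t \<pi> b1 b2 q +
  fixes a b :: "nat \<Rightarrow> 'a" and n :: nat
  assumes n1: "1 \<le> n" and a1: "a 1 \<noteq> 0" "f (a 1) = 0" and b1': "b 1 \<noteq> 0" "f (b 1) = 0" and ab1: "v (b 1) < v (a 1)"
    and a_root: "\<And>i. 1 \<le> i \<Longrightarrow> i < n \<Longrightarrow> f (a (Suc i)) = a i"
    and b_root: "\<And>i. 1 \<le> i \<Longrightarrow> i < n \<Longrightarrow> f (b (Suc i)) = b i"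
    and a_largest: "\<And>i x. 1 \<le> i \<Longrightarrow> i < n \<Longrightarrow> f x = a i \<Longrightarrow> v x \<le> v (a (Suc i))"
    and b_largest: "\<And>i x. 1 \<le> i \<Longrightarrow> i < n \<Longrightarrow> f x = b i \<Longrightarrow> v x \<le> v (b (Suc i))"
begin

lemma nu_ab1: "nu (a 1) = lm" "nu (b 1) = l1"
proof -
  have "nu (b 1) < nu (a 1)" using ab1 v_nu[OF a1(1)] v_nu[OF b1'(1)] by simp
  then show "nu (a 1) = lm" "nu (b 1) = l1"
    using Vf_values[OF a1(2,1)] Vf_values[OF b1'(2,1)] l1_less_lm by auto
qed

text \<open>Since \<open>nu \<pi> \<le> 0\<close>, the valuations never drop below
  \<open>lm\<close>; so \<open>h\<close> stays in its last linear piece and each step subtracts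
  \<open>nu \<pi>\<close>.\<close>

lemma nu_a: "1 \<le> i \<Longrightarrow> i \<le> n \<Longrightarrow> a i \<noteq> 0 \<and> nu (a i) = lm - (real i - 1) * nu \<pi>"
proof (induction i rule: dec_induct)
  case base
  then show ?case using a1 nu_ab1 by simp
next
  case (step i)
  then have i: "1 \<le> i" "i < n" "a i \<noteq> 0" "nu (a i) = lm - (real i - 1) * nu \<pi>" by auto
  note L = largest_root_value[OF a_root[OF i(1,2)] i(3) a_largest[OF i(1,2)]]
  define R where "R = lm - (real i - 1) * nu \<pi>"
  have "(real i - 1) * nu \<pi> \<le> 0" using i(1) al_le by (intro mult_nonneg_nonpos) auto
  then have "lm \<le> R - nu \<pi>" using al_le by (simp add: R_def)
  then have "h (R - nu \<pi>) = R" using h_large by simp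
  then have "h (nu (a (Suc i))) = h (R - nu \<pi>)" using L(2) i(4) by (simp add: R_def)
  then have "nu (a (Suc i)) = R - nu \<pi>" by (rule h_inj)
  then show ?case using L(1) by (simp add: R_def algebra_simps)
qed

lemma nu_a_ge: "1 \<le> i \<Longrightarrow> i \<le> n \<Longrightarrow> lm \<le> nu (a i)"
proof -
  assume i: "1 \<le> i" "i \<le> n"
  have "(real i - 1) * nu \<pi> \<le> 0" using i(1) al_le by (intro mult_nonneg_nonpos) auto
  then show ?thesis using nu_a[OF i] by simp
qed

lemma nu_a_gt: "2 \<le> i \<Longrightarrow> i \<le> n \<Longrightarrow> nu \<pi> < 0 \<Longrightarrow> lm < nu (a i)"
proof -
  assume i: "2 \<le> i" "i \<le> n" "nu \<pi> < 0"
  have "(real i - 1) * nu \<pi> < 0" using i(1,3) by (intro mult_pos_neg) auto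
  then show ?thesis using nu_a[of i] i by simp
qed

lemma jv_neg: "jv < 0"
proof -
  have "real q * nu \<pi> \<le> 0" using al_le by (intro mult_nonneg_nonpos) auto
  then show ?thesis using jv_less by simp
qed

text \<open>Up to index \<open>m\<close> the middle piece of \<open>h\<close> applies, giving
  \<open>nu (b i) = nu b1 + q * nu (b (Suc i))\<close>; after scaling by \<open>q - 1\<close>, each
  step divides the deviation from \<open>- nu b1\<close> by \<open>q\<close>. The candidate
  \<open>R\<close> stays below \<open>lm\<close> because
  \<open>jv / q ^ Suc i \<le> nu \<pi>\<close>, and injectivity of \<open>h\<close> identifies
  it.\<close>

lemma nu_b:
  assumes "jv < nu \<pi> * real q ^ m" "m \<le> n"
  shows "1 \<le> i \<Longrightarrow> i \<le> m \<Longrightarrow> b i \<noteq> 0 \<and> (real q - 1) * nu (b i) = - nu b1 + jv / real q ^ i"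
proof (induction i rule: dec_induct)
  case base
  have "real q * ((real q - 1) * l1) = real q * (- nu b1 + jv / real q)"
    using l1_eq Q_ge2 by (simp add: algebra_simps)
  then have "(real q - 1) * l1 = - nu b1 + jv / real q" using Q_ge2 by simp
  then show ?case using b1'(1) nu_ab1 by simp
next
  case (step i)
  then have i: "1 \<le> i" "i < n" "i < m" "b i \<noteq> 0" "(real q - 1) * nu (b i) = - nu b1 + jv / real q ^ i" using assms(2) by auto
  note L = largest_root_value[OF b_root[OF i(1,2)] i(4) b_largest[OF i(1,2)]]
  have q1: "0 < real q - 1" using Q_ge2 by simp
  define R where "R = (- nu b1 + jv / real q ^ Suc i) / (real q - 1)"
  have RE: "(real q - 1) * R = - nu b1 + jv / real q ^ Suc i" using q1 by (simp add: R_def)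
  have q0: "0 < real q ^ Suc i" using Q_ge2 by simp
  have "jv / real q ^ Suc i \<le> nu \<pi>"
  proof -
    have "real q ^ Suc i \<le> real q ^ m" using Q_ge2 i(3) by (intro power_increasing) simp_all
    then have "nu \<pi> * real q ^ m \<le> nu \<pi> * real q ^ Suc i" using al_le by (intro mult_left_mono_neg)
    then have "jv \<le> nu \<pi> * real q ^ Suc i" using assms(1) by simp
    then show ?thesis using q0 by (simp only: pos_divide_le_eq)
  qed
  then have "(real q - 1) * R \<le> (real q - 1) * lm" unfolding RE lm_eq by simp
  then have 1: "R \<le> lm" using q1 by simp
  have "jv / real q \<le> jv / real q ^ Suc i"
  proof -
    have "real q ^ 1 \<le> real q ^ Suc i" using Q_ge2 by (intro power_increasing) simp_all
    then show ?thesis using jv_neg Q_ge2 by (intro divide_left_mono_neg) simp_all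
  qed
  moreover have "(real q - 1) * l1 = - nu b1 + jv / real q"
  proof -
    have "real q * ((real q - 1) * l1) = real q * (- nu b1 + jv / real q)"
      using l1_eq Q_ge2 by (simp add: algebra_simps)
    then show ?thesis using Q_ge2 by simp
  qed
  ultimately have "(real q - 1) * l1 \<le> (real q - 1) * R" unfolding RE by simp
  then have 2: "l1 \<le> R" using q1 by simp
  have "(real q - 1) * h R = (real q - 1) * nu b1 + real q * ((real q - 1) * R)"
    unfolding h_middle[OF 2 1] by (simp add: algebra_simps)
  also have "\<dots> = - nu b1 + real q * (jv / real q ^ Suc i)" unfolding RE by (simp add: algebra_simps)
  also have "real q * (jv / real q ^ Suc i) = jv / real q ^ i" using Q_ge2 by simp
  finally have "(real q - 1) * h R = (real q - 1) * nu (b i)" using i(5) by simp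
  then have "h R = nu (b i)" using q1 by simp
  then have "h (nu (b (Suc i))) = h R" using L(2) by simp
  then have "nu (b (Suc i)) = R" by (rule h_inj)
  then show ?case using L(1) RE by simp
qed

text \<open>The inequality \<open>nu \<pi> * q ^ Suc m < jv\<close> says precisely that
  \<open>h lm < nu (b m)\<close>, so the next valuation exceeds \<open>lm\<close>. From then on
  \<open>h lm = lm + nu \<pi> \<le> lm\<close> keeps the valuations above \<open>lm\<close>.\<close>

lemma nu_b_large:
  assumes m: "jv < nu \<pi> * real q ^ m" "nu \<pi> * real q ^ Suc m < jv" "1 \<le> m"
  shows "Suc m \<le> i \<Longrightarrow> i \<le> n \<Longrightarrow> b i \<noteq> 0 \<and> lm < nu (b i)"
proof (induction i rule: dec_induct)
  case base
  then have mn: "m < n" by simp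
  have q1: "0 < real q - 1" using Q_ge2 by simp
  have bm: "b m \<noteq> 0" "(real q - 1) * nu (b m) = - nu b1 + jv / real q ^ m" using nu_b[OF m(1), of m] mn m(3) by auto
  note L = largest_root_value[OF b_root[OF m(3) mn] bm(1) b_largest[OF m(3) mn]]
  have "real q * nu \<pi> < jv / real q ^ m"
  proof -
    have "0 < real q ^ m" using Q_ge2 by simp
    then show ?thesis using m(2) by (simp add: pos_less_divide_eq mult.commute mult.left_commute)
  qed
  then have "(real q - 1) * h lm < (real q - 1) * nu (b m)"
    unfolding bm(2) h_large[OF order_refl] distrib_left lm_eq by (simp add: algebra_simps)
  then have "h lm < h (nu (b (Suc m)))" using q1 L(2) by simp
  then show ?case using L(1) h_less by blast
next
  case (step i)
  then have i: "1 \<le> i" "i < n" "b i \<noteq> 0" "lm < nu (b i)" by auto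
  note L = largest_root_value[OF b_root[OF i(1,2)] i(3) b_largest[OF i(1,2)]]
  have "h lm < h (nu (b (Suc i)))" using L(2) i(4) al_le h_large[OF order_refl] by simp
  then show ?case using L(1) h_less by blast
qed

lemma ab1_independent:
  assumes "c \<in> k" "d \<in> k" "c * a 1 + d * b 1 = 0" shows "c = 0 \<and> d = 0"
proof -
  have v0: "nu x = 0" if "x \<in> k" "x \<noteq> 0" for x
    using k_v(1)[OF that] v_nu[OF that(2)] by (simp add: zero_ereal_def)
  have e: "c * a 1 = - (d * b 1)" using assms(3) by (simp add: eq_neg_iff_add_eq_0)
  have "d = 0"
  proof (rule ccontr)
    assume d: "d \<noteq> 0"
    then have "c \<noteq> 0" using e a1(1) b1'(1) by auto
    have "nu (c * a 1) = nu (d * b 1)" using e by simp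
    then have "lm = l1" using d \<open>c \<noteq> 0\<close> a1(1) b1'(1) v0 assms(1,2) nu_ab1 by (simp add: nu_mult)
    then show False using l1_less_lm by simp
  qed
  then show ?thesis using e a1(1) by simp
qed

text \<open>The \<open>k\<close>-combinations of \<open>a 1\<close> and \<open>b 1\<close> are
  pairwise distinct roots of \<open>f\<close>, and there are \<open>q\<^sup>2\<close> of them, as
  many as there are roots.\<close>

lemma Vf_span: "f x = 0 \<Longrightarrow> \<exists>c\<in>k. \<exists>d\<in>k. x = c * a 1 + d * b 1"
proof -
  assume x: "f x = 0"
  let ?g = "\<lambda>(c, d). c * a 1 + d * b 1"
  have inj: "inj_on ?g (k \<times> k)"
  proof (rule inj_onI, clarify)
    fix c d c' d' assume k: "c \<in> k" "d \<in> k" "c' \<in> k" "d' \<in> k" and e: "c * a 1 + d * b 1 = c' * a 1 + d' * b 1"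
    have "(c - c') * a 1 + (d - d') * b 1 = 0" using e by (simp add: algebra_simps)
    then have "c - c' = 0 \<and> d - d' = 0" using k by (intro ab1_independent subfieldD(7)[OF sfk])
    then show "c = c' \<and> d = d'" by simp
  qed
  have sub: "?g ` (k \<times> k) \<subseteq> Vf" using a1(2) b1'(2) by (auto simp: f_add f_scale)
  have "card (?g ` (k \<times> k)) = card Vf"
    unfolding card_image[OF inj] card_f_roots[of 0] by (simp add: card_cartesian_product card_k q_def power2_eq_square)
  then have "?g ` (k \<times> k) = Vf" using card_subset_eq[OF finite_f_roots sub] by blast
  then have "x \<in> ?g ` (k \<times> k)" using x by blast
  then show ?thesis by auto
qed

section \<open>Coordinates of torsion points\<close>

definition comb :: "nat \<Rightarrow> (nat \<Rightarrow> 'a) \<Rightarrow> (nat \<Rightarrow> 'a) \<Rightarrow> 'a"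
  where "comb m c d = (\<Sum>i=1..m. c i * a i + d i * b i)"

lemma comb_Suc: "comb (Suc m) c d = (c 1 * a 1 + d 1 * b 1) + (\<Sum>i=1..m. c (Suc i) * a (Suc i) + d (Suc i) * b (Suc i))"
  unfolding comb_def by (subst sum.atLeast_Suc_atMost) (auto simp: sum.shift_bounds_cl_Suc_ivl simp del: sum.cl_ivl_Suc)

text \<open>In coordinates \<open>f\<close> is the shift that kills \<open>a 1\<close> and
  \<open>b 1\<close>; the inductions over the torsion level rest on this.\<close>

lemma f_comb:
  assumes "\<And>i. c i \<in> k" "\<And>i. d i \<in> k" "Suc m \<le> n"
  shows "f (comb (Suc m) c d) = comb m (\<lambda>i. c (Suc i)) (\<lambda>i. d (Suc i))"
proof -
  have "f (comb (Suc m) c d) = (\<Sum>i=1..m. f (c (Suc i) * a (Suc i) + d (Suc i) * b (Suc i)))"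
    unfolding comb_Suc using a1(2) b1'(2) by (simp add: f_add f_scale assms f_sum)
  also have "\<dots> = comb m (\<lambda>i. c (Suc i)) (\<lambda>i. d (Suc i))"
    unfolding comb_def
  proof (rule sum.cong[OF refl])
    fix i assume "i \<in> {1..m}"
    then have i: "1 \<le> i" "i < n" using assms(3) by auto
    show "f (c (Suc i) * a (Suc i) + d (Suc i) * b (Suc i)) = c (Suc i) * a i + d (Suc i) * b i"
      by (simp add: f_add f_scale assms(1,2) a_root[OF i] b_root[OF i])
  qed
  finally show ?thesis .
qed

lemma comb_independent:
  assumes "\<And>i. c i \<in> k" "\<And>i. d i \<in> k" "m \<le> n" "comb m c d = 0" "1 \<le> i" "i \<le> m"
  shows "c i = 0 \<and> d i = 0"
  using assms
proof (induction m arbitrary: c d i)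
  case (Suc m)
  have "comb m (\<lambda>i. c (Suc i)) (\<lambda>i. d (Suc i)) = 0" using f_comb[of c d m] Suc.prems by simp
  then have IH: "c (Suc i) = 0 \<and> d (Suc i) = 0" if "1 \<le> i" "i \<le> m" for i
    using Suc.IH[of "\<lambda>i. c (Suc i)" "\<lambda>i. d (Suc i)" i] Suc.prems that by simp
  have "comb (Suc m) c d = c 1 * a 1 + d 1 * b 1" unfolding comb_Suc using IH by simp
  then have "c 1 * a 1 + d 1 * b 1 = 0" using Suc.prems(4) by simp
  then have "c 1 = 0 \<and> d 1 = 0" by (rule ab1_independent[OF Suc.prems(1,2)])
  then show ?case using IH[of "i - 1"] Suc.prems(5,6) by (cases "i = 1") auto
qed simp

text \<open>To find coordinates of \<open>x\<close>, those of \<open>f x\<close> are raised by one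
  index to give \<open>y\<close> with \<open>f y = f x\<close>; the difference \<open>x - y\<close>
  is a root of \<open>f\<close> and is absorbed into the coordinates at \<open>a 1\<close> and
  \<open>b 1\<close>.\<close>

lemma comb_span: "m \<le> n \<Longrightarrow> (f ^^ m) x = 0 \<longleftrightarrow> (\<exists>c d. (\<forall>i. c i \<in> k) \<and> (\<forall>i. d i \<in> k) \<and> x = comb m c d)"
proof (induction m arbitrary: x)
  case 0
  have "0 \<in> k" by (rule subfieldD(2)[OF sfk])
  then show ?case by (auto simp: comb_def)
next
  case (Suc m)
  have step: "(f ^^ Suc m) x = (f ^^ m) (f x)" by (simp add: funpow_swap1)
  show ?case
  proof
    assume "(f ^^ Suc m) x = 0"
    then obtain c d where cd: "\<forall>i. c i \<in> k" "\<forall>i. d i \<in> k" "f x = comb m c d"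
      using Suc.IH[of "f x"] Suc.prems unfolding step by auto
    \<comment> \<open>Here \<open>c' 1 = c 0\<close> is an arbitrary element of \<open>k\<close>,
      which is harmless because \<open>f\<close> kills \<open>a 1\<close>; the value at index 0 only
      has to lie in \<open>k\<close>.\<close>
    define c' where "c' i = (if i = 0 then 0 else c (i - 1))" for i
    define d' where "d' i = (if i = 0 then 0 else d (i - 1))" for i
    have ck: "c' i \<in> k" "d' i \<in> k" for i using cd subfieldD(2)[OF sfk] by (auto simp: c'_def d'_def)
    define y where "y = comb (Suc m) c' d'"
    have "f y = f x"
      unfolding y_def using f_comb[of c' d' m, OF ck Suc.prems] cd(3) by (simp add: c'_def d'_def)
    then have "f (x - y) = 0" by (simp add: f_diff)
    then obtain e g where eg: "e \<in> k" "g \<in> k" "x - y = e * a 1 + g * b 1" using Vf_span by blast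
    define c2 where "c2 i = (if i = 1 then c' 1 + e else c' i)" for i
    define d2 where "d2 i = (if i = 1 then d' 1 + g else d' i)" for i
    have k2: "c2 i \<in> k" "d2 i \<in> k" for i using ck eg subfieldD(3)[OF sfk] by (auto simp: c2_def d2_def)
    have "comb (Suc m) c2 d2 = y + (e * a 1 + g * b 1)"
      unfolding y_def comb_Suc by (simp add: c2_def d2_def algebra_simps)
    then have "x = comb (Suc m) c2 d2" using eg(3) by (simp add: algebra_simps)
    then show "\<exists>c d. (\<forall>i. c i \<in> k) \<and> (\<forall>i. d i \<in> k) \<and> x = comb (Suc m) c d" using k2 by blast
  next
    assume "\<exists>c d. (\<forall>i. c i \<in> k) \<and> (\<forall>i. d i \<in> k) \<and> x = comb (Suc m) c d"
    then obtain c d where cd: "\<forall>i. c i \<in> k" "\<forall>i. d i \<in> k" "x = comb (Suc m) c d" by blast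
    have fx: "f x = comb m (\<lambda>i. c (Suc i)) (\<lambda>i. d (Suc i))" unfolding cd(3) using cd Suc.prems by (intro f_comb) auto
    have "\<exists>c d. (\<forall>i. c i \<in> k) \<and> (\<forall>i. d i \<in> k) \<and> f x = comb m c d"
      by (intro exI[of _ "\<lambda>i. c (Suc i)"] exI[of _ "\<lambda>i. d (Suc i)"] conjI fx) (simp_all add: cd(1,2))
    then have "(f ^^ m) (f x) = 0" using Suc.IH[of "f x"] Suc.prems by simp
    then show "(f ^^ Suc m) x = 0" unfolding step .
  qed
qed

end

section \<open>The wild subgroup as a group\<close>

context finite_galois
begin

lemma inv_auts: "\<sigma> \<in> auts K \<Longrightarrow> inv_into UNIV \<sigma> \<in> auts K \<and> \<sigma> \<circ> inv_into UNIV \<sigma> = id \<and> inv_into UNIV \<sigma> \<circ> \<sigma> = id"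
proof -
  assume \<sigma>: "\<sigma> \<in> auts K"
  note s = autsD[OF \<sigma> sfK]
  have b: "bij \<sigma>" using \<sigma> by (simp add: auts_def)
  have i: "inv_into UNIV \<sigma> (\<sigma> x) = x" "\<sigma> (inv_into UNIV \<sigma> x) = x" for x
    using b by (simp_all add: bij_is_inj bij_is_surj surj_f_inv_f)
  have "inv_into UNIV \<sigma> (x + y) = inv_into UNIV \<sigma> x + inv_into UNIV \<sigma> y" for x y
    using i(1)[of "inv_into UNIV \<sigma> x + inv_into UNIV \<sigma> y"] by (simp add: s(1) i(2))
  moreover have "inv_into UNIV \<sigma> (x * y) = inv_into UNIV \<sigma> x * inv_into UNIV \<sigma> y" for x y
    using i(1)[of "inv_into UNIV \<sigma> x * inv_into UNIV \<sigma> y"] by (simp add: s(2) i(2))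
  moreover have "inv_into UNIV \<sigma> x = x" if "x \<in> K" for x using i(1)[of x] s(3)[OF that] by simp
  ultimately have "inv_into UNIV \<sigma> \<in> auts K" using b by (simp add: auts_def bij_imp_bij_inv)
  moreover have "\<sigma> \<circ> inv_into UNIV \<sigma> = id" "inv_into UNIV \<sigma> \<circ> \<sigma> = id" using i by (simp_all add: fun_eq_iff)
  ultimately show ?thesis by blast
qed

lemma galois_mult:
  assumes "\<sigma> \<in> auts K" "\<tau> \<in> auts K"
  shows "restrict \<sigma> L \<otimes>\<^bsub>galois_group L K\<^esub> restrict \<tau> L = restrict (\<sigma> \<circ> \<tau>) L"
proof -
  have "restrict \<sigma> L \<in> Bij L" "restrict \<tau> L \<in> Bij L"
    using auts_bij_L[OF assms(1)] auts_bij_L[OF assms(2)] by (simp_all add: Bij_def bij_betw_restrict_eq)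
  then have "restrict \<sigma> L \<otimes>\<^bsub>galois_group L K\<^esub> restrict \<tau> L = compose L (restrict \<sigma> L) (restrict \<tau> L)"
    by (simp add: galois_group_def BijGroup_def)
  also have "\<dots> = restrict (\<sigma> \<circ> \<tau>) L"
    using auts_L[OF assms(2)] by (auto simp: compose_def fun_eq_iff)
  finally show ?thesis .
qed

lemma galois_one: "\<one>\<^bsub>galois_group L K\<^esub> = restrict id L"
  by (simp add: galois_group_def BijGroup_def fun_eq_iff)

lemma group_galois: "group (galois_group L K)"
proof (rule groupI)
  fix x y z assume "x \<in> carrier (galois_group L K)" "y \<in> carrier (galois_group L K)" "z \<in> carrier (galois_group L K)"
  then obtain \<sigma> \<tau> \<rho> where s: "\<sigma> \<in> auts K" "x = restrict \<sigma> L" "\<tau> \<in> auts K" "y = restrict \<tau> L" "\<rho> \<in> auts K" "z = restrict \<rho> L"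
    unfolding carrier_galois_group by blast
  show "x \<otimes>\<^bsub>galois_group L K\<^esub> y \<in> carrier (galois_group L K)"
    unfolding s(2,4) galois_mult[OF s(1,3)] carrier_galois_group using auts_comp[OF s(1,3)] by blast
  show "x \<otimes>\<^bsub>galois_group L K\<^esub> y \<otimes>\<^bsub>galois_group L K\<^esub> z = x \<otimes>\<^bsub>galois_group L K\<^esub> (y \<otimes>\<^bsub>galois_group L K\<^esub> z)"
    unfolding s(2,4,6) galois_mult[OF s(1,3)] galois_mult[OF s(3,5)] galois_mult[OF auts_comp[OF s(1,3)] s(5)]
      galois_mult[OF s(1) auts_comp[OF s(3,5)]] by (simp add: comp_assoc)
next
  show "\<one>\<^bsub>galois_group L K\<^esub> \<in> carrier (galois_group L K)"
    unfolding galois_one carrier_galois_group using id_auts by blast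
  fix x assume "x \<in> carrier (galois_group L K)"
  then obtain \<sigma> where s: "\<sigma> \<in> auts K" "x = restrict \<sigma> L" unfolding carrier_galois_group by blast
  show "\<one>\<^bsub>galois_group L K\<^esub> \<otimes>\<^bsub>galois_group L K\<^esub> x = x"
    unfolding galois_one s(2) galois_mult[OF id_auts s(1)] by simp
  have i: "inv_into UNIV \<sigma> \<in> auts K" "inv_into UNIV \<sigma> \<circ> \<sigma> = id" using inv_auts[OF s(1)] by blast+
  show "\<exists>y\<in>carrier (galois_group L K). y \<otimes>\<^bsub>galois_group L K\<^esub> x = \<one>\<^bsub>galois_group L K\<^esub>"
  proof (rule bexI)
    show "restrict (inv_into UNIV \<sigma>) L \<otimes>\<^bsub>galois_group L K\<^esub> x = \<one>\<^bsub>galois_group L K\<^esub>"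
      unfolding galois_one s(2) galois_mult[OF i(1) s(1)] i(2) ..
    show "restrict (inv_into UNIV \<sigma>) L \<in> carrier (galois_group L K)" unfolding carrier_galois_group using i(1) by blast
  qed
qed

lemma wildly_comp: "\<sigma> \<in> auts K \<Longrightarrow> \<tau> \<in> auts K \<Longrightarrow> wildly \<sigma> \<Longrightarrow> wildly \<tau> \<Longrightarrow> wildly (\<sigma> \<circ> \<tau>)"
  unfolding wildly_def
proof (intro ballI impI)
  fix x assume a: "\<sigma> \<in> auts K" "\<tau> \<in> auts K" "\<forall>x\<in>L. x \<noteq> 0 \<longrightarrow> v x < v (\<sigma> x - x)"
    "\<forall>x\<in>L. x \<noteq> 0 \<longrightarrow> v x < v (\<tau> x - x)" "x \<in> L" "x \<noteq> 0"
  have 1: "v (\<tau> x) < v (\<sigma> (\<tau> x) - \<tau> x)"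
    using a(3) auts_L[OF a(2,5)] autsD(10)[OF a(2) sfK] a(6) by blast
  have 2: "v x < v (\<tau> x - x)" using a(4-6) by blast
  have "v x < v ((\<sigma> (\<tau> x) - \<tau> x) + (\<tau> x - x))"
    by (rule v_add_gt) (use 1 2 v_aut[OF a(2), of x] in simp_all)
  then show "v x < v ((\<sigma> \<circ> \<tau>) x - x)" by simp
qed

lemma wildly_inv: "\<sigma> \<in> auts K \<Longrightarrow> wildly \<sigma> \<Longrightarrow> wildly (inv_into UNIV \<sigma>)"
  unfolding wildly_def
proof (intro ballI impI)
  fix x assume a: "\<sigma> \<in> auts K" "\<forall>x\<in>L. x \<noteq> 0 \<longrightarrow> v x < v (\<sigma> x - x)" "x \<in> L" "x \<noteq> 0"
  have i: "inv_into UNIV \<sigma> \<in> auts K" "\<sigma> \<circ> inv_into UNIV \<sigma> = id" using inv_auts[OF a(1)] by blast+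
  have s: "\<sigma> (inv_into UNIV \<sigma> x) = x" using fun_cong[OF i(2), of x] by simp
  have "v (inv_into UNIV \<sigma> x) < v (\<sigma> (inv_into UNIV \<sigma> x) - inv_into UNIV \<sigma> x)"
    using a(2) auts_L[OF i(1) a(3)] autsD(10)[OF i(1) sfK] a(4) by blast
  then show "v x < v (inv_into UNIV \<sigma> x - x)" unfolding s v_aut[OF i(1)] by (simp only: v_diff_commute)
qed

lemma wildly_id: "wildly id"
  unfolding wildly_def using v_nu by simp

lemma subgroup_wild: "subgroup (carrier (wild_group v L K)) (galois_group L K)"
proof (rule group.subgroupI[OF group_galois])
  show "carrier (wild_group v L K) \<subseteq> carrier (galois_group L K)"
    unfolding carrier_wild_group carrier_galois_group by blast
  show "carrier (wild_group v L K) \<noteq> {}" unfolding carrier_wild_group using wildly_id id_auts by blast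
next
  fix x assume "x \<in> carrier (wild_group v L K)"
  then obtain \<sigma> where s: "\<sigma> \<in> auts K" "wildly \<sigma>" "x = restrict \<sigma> L" unfolding carrier_wild_group by blast
  have i: "inv_into UNIV \<sigma> \<in> auts K" "inv_into UNIV \<sigma> \<circ> \<sigma> = id" using inv_auts[OF s(1)] by blast+
  have "inv\<^bsub>galois_group L K\<^esub> x = restrict (inv_into UNIV \<sigma>) L"
  proof (rule group.inv_equality[OF group_galois])
    show "restrict (inv_into UNIV \<sigma>) L \<otimes>\<^bsub>galois_group L K\<^esub> x = \<one>\<^bsub>galois_group L K\<^esub>"
      unfolding galois_one s(3) galois_mult[OF i(1) s(1)] i(2) ..
    show "x \<in> carrier (galois_group L K)" "restrict (inv_into UNIV \<sigma>) L \<in> carrier (galois_group L K)"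
      unfolding carrier_galois_group s(3) using i(1) s(1) by blast+
  qed
  then show "inv\<^bsub>galois_group L K\<^esub> x \<in> carrier (wild_group v L K)"
    unfolding carrier_wild_group using i(1) wildly_inv[OF s(1,2)] by blast
next
  fix x y assume "x \<in> carrier (wild_group v L K)" "y \<in> carrier (wild_group v L K)"
  then obtain \<sigma> \<tau> where s: "\<sigma> \<in> auts K" "wildly \<sigma>" "x = restrict \<sigma> L" "\<tau> \<in> auts K" "wildly \<tau>" "y = restrict \<tau> L"
    unfolding carrier_wild_group by blast
  show "x \<otimes>\<^bsub>galois_group L K\<^esub> y \<in> carrier (wild_group v L K)"
    unfolding s(3,6) galois_mult[OF s(1,4)] carrier_wild_group
    using auts_comp[OF s(1,4)] wildly_comp[OF s(1,4,2,5)] by blast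
qed

lemma group_wild: "group (wild_group v L K)"
  using subgroup.subgroup_is_group[OF subgroup_wild group_galois] unfolding wild_group_def
  by (simp add: galois_group_def)

lemma wild_mult: "x \<otimes>\<^bsub>wild_group v L K\<^esub> y = x \<otimes>\<^bsub>galois_group L K\<^esub> y"
  and wild_one: "\<one>\<^bsub>wild_group v L K\<^esub> = \<one>\<^bsub>galois_group L K\<^esub>"
  by (simp_all add: wild_group_def)

end

section \<open>The action of the wild subgroup on the basis\<close>

context tower
begin

lemma finite_torsion: "finite {x. (f ^^ m) x = 0}"
proof (induction m)
  case (Suc m)
  have "{x. (f ^^ Suc m) x = 0} = (\<Union>y\<in>{y. (f ^^ m) y = 0}. {x. f x = y})" by (auto simp: funpow_swap1)
  then show ?case using Suc finite_f_roots by simp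
qed simp

lemma funpow_aut: "\<sigma> \<in> auts K \<Longrightarrow> \<sigma> ((f ^^ m) x) = (f ^^ m) (\<sigma> x)"
  by (induction m) (simp_all add: f_aut)

end

text \<open>This makes \<open>L\<close> the field K(\<phi>[\<pi>^n]): the torsion points are the
  zeros of the \<open>n\<close>-th iterate of \<open>f\<close>, and automorphisms over
  \<open>K\<close> permute them because \<open>f\<close> has coefficients in
  \<open>K\<close>.\<close>

sublocale tower \<subseteq> finite_galois v K p s k F t "{x. (f ^^ n) x = 0}"
proof
  show "finite {x. (f ^^ n) x = 0}" by (rule finite_torsion)
  fix \<sigma> assume s: "\<sigma> \<in> auts K"
  show "\<sigma> ` {x. (f ^^ n) x = 0} \<subseteq> {x. (f ^^ n) x = 0}"
  proof
    fix y assume "y \<in> \<sigma> ` {x. (f ^^ n) x = 0}"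
    then obtain x where x: "(f ^^ n) x = 0" "y = \<sigma> x" by blast
    have "(f ^^ n) y = \<sigma> 0" using funpow_aut[OF s, of n x] x by simp
    then show "y \<in> {x. (f ^^ n) x = 0}" using autsD(4)[OF s sfK] by simp
  qed
qed

text \<open>
  The tuple \<open>u\<close> in \<open>acts \<sigma> u\<close> encodes the lower left block \<open>\<Sum>\<^sub>l u\<^sub>l A\<^bsub>n,l\<^esub>\<close> of the matrix of \<open>\<sigma>\<close>; \<open>r\<close> is \<open>m\<close> for
  infinite and \<open>n\<close> for finite \<open>v\<close>.
\<close>

locale wild_tower = tower v K p s k F t \<pi> b1 b2 q a b n
  for v :: "'a::field \<Rightarrow> ereal" and K p s k F t \<pi> b1 b2 q a b n +
  fixes r :: nat
  assumes r: "1 \<le> r" "r \<le> n" and jvr: "(real q + 1) * nu b1 - nu b2 < nu \<pi> * real q ^ r"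
    and jv_next: "r < n \<Longrightarrow> nu \<pi> < 0 \<and> nu \<pi> * real q ^ Suc r < (real q + 1) * nu b1 - nu b2"
begin

text \<open>Parameter tuples for the wild subgroup. Entries outside \<open>{1..r}\<close> are set to
  0 so that equality of functions is equality of tuples and there are exactly \<open>q ^ r\<close>
  of them.\<close>

definition U :: "(nat \<Rightarrow> 'a) set"
  where "U = {u. (\<forall>l. u l \<in> k) \<and> (\<forall>l. l \<notin> {1..r} \<longrightarrow> u l = 0)}"

text \<open>The displacement of \<open>b i\<close> under the matrix with parameters
  \<open>u\<close>: the \<open>l\<close>-th summand comes from the matrix with index
  \<open>l\<close>, which pairs \<open>b i\<close> with the \<open>a\<close>-element of index
  \<open>i - l + 1\<close>.\<close>

definition shift :: "(nat \<Rightarrow> 'a) \<Rightarrow> nat \<Rightarrow> 'a"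
  where "shift u i = (\<Sum>l=1..i. u l * a (Suc i - l))"

definition acts :: "('a \<Rightarrow> 'a) \<Rightarrow> (nat \<Rightarrow> 'a) \<Rightarrow> bool"
  where "acts \<sigma> u \<longleftrightarrow> u \<in> U \<and> (\<forall>i\<in>{1..n}. \<sigma> (a i) = a i \<and> \<sigma> (b i) = b i + shift u i)"

lemma a_in_L: "1 \<le> i \<Longrightarrow> i \<le> n \<Longrightarrow> a i \<in> L" and b_in_L: "1 \<le> i \<Longrightarrow> i \<le> n \<Longrightarrow> b i \<in> L"
proof -
  assume i: "1 \<le> i" "i \<le> n"
  note k01 = subfieldD(1,2)[OF sfk]
  have "comb n (\<lambda>j. if j = i then 1 else 0) (\<lambda>j. 0) = a i"
    unfolding comb_def using i by (simp add: if_distrib[of "\<lambda>x. x * _"] cong: if_cong)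
  then have "\<exists>c d. (\<forall>i. c i \<in> k) \<and> (\<forall>i. d i \<in> k) \<and> a i = comb n c d"
    using k01 by (intro exI[of _ "\<lambda>j. if j = i then 1 else 0"] exI[of _ "\<lambda>j. 0"]) simp
  then have "(f ^^ n) (a i) = 0" by (simp only: comb_span[OF order_refl])
  then show "a i \<in> L" using WL by blast
  have "comb n (\<lambda>j. 0) (\<lambda>j. if j = i then 1 else 0) = b i"
    unfolding comb_def using i by (simp add: if_distrib[of "\<lambda>x. x * _"] cong: if_cong)
  then have "\<exists>c d. (\<forall>i. c i \<in> k) \<and> (\<forall>i. d i \<in> k) \<and> b i = comb n c d"
    using k01 by (intro exI[of _ "\<lambda>j. 0"] exI[of _ "\<lambda>j. if j = i then 1 else 0"]) simp
  then have "(f ^^ n) (b i) = 0" by (simp only: comb_span[OF order_refl])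
  then show "b i \<in> L" using WL by blast
qed

lemma nu_b_ge: "1 \<le> i \<Longrightarrow> i \<le> n \<Longrightarrow> b i \<noteq> 0 \<and> l1 \<le> nu (b i)"
proof (cases "i \<le> r")
  case True
  assume i: "1 \<le> i" "i \<le> n"
  have q1: "0 < real q - 1" using Q_ge2 by simp
  note B = nu_b[OF jvr r(2)]
  have "jv / real q \<le> jv / real q ^ i"
  proof -
    have "real q ^ 1 \<le> real q ^ i" using Q_ge2 i(1) by (intro power_increasing) simp_all
    then show ?thesis using jv_neg Q_ge2 by (intro divide_left_mono_neg) simp_all
  qed
  then have "(real q - 1) * nu (b 1) \<le> (real q - 1) * nu (b i)" using B[of 1] B[of i] i True r by simp
  then have "nu (b 1) \<le> nu (b i)" using q1 by simp
  then show ?thesis using B[of i] i True nu_ab1 by simp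
next
  case False
  assume i: "1 \<le> i" "i \<le> n"
  have "r < n" using False i by simp
  then show ?thesis using nu_b_large[OF jvr _ r(1), of i] jv_next False i l1_less_lm by simp
qed

lemma v_k_mult: "c \<in> k \<Longrightarrow> ereal B < v x \<Longrightarrow> ereal B < v (c * x)"
proof (cases "c = 0")
  case False
  assume "c \<in> k" "ereal B < v x"
  then show ?thesis using k_v(1)[of c] False by (simp add: v_mult)
qed simp

lemma v_shift_gt: "(\<And>l. u l \<in> k) \<Longrightarrow> i \<le> n \<Longrightarrow> ereal l1 < v (shift u i)"
  unfolding shift_def
proof (intro v_sum_gt v_k_mult)
  fix l assume u: "\<And>l. u l \<in> k" and i: "i \<le> n" and l: "l \<in> {1..i}"
  show "u l \<in> k" by (rule u)
  have j: "1 \<le> Suc i - l" "Suc i - l \<le> n" using l i by auto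
  have "l1 < nu (a (Suc i - l))" using nu_a_ge[OF j] l1_less_lm by simp
  then show "ereal l1 < v (a (Suc i - l))" using nu_a[OF j] v_nu by simp
qed

text \<open>Compatibility with \<open>f\<close> ensures that the error of the ansatz
  \<open>\<sigma> (b i) = b i + shift u i\<close> at level \<open>i + 1\<close> is a root of
  \<open>f\<close> once the error at level \<open>i\<close> vanishes.\<close>

lemma shift_Suc:
  assumes "\<And>l. u l \<in> k" "Suc i \<le> n" "1 \<le> i" shows "f (shift u (Suc i)) = shift u i"
proof -
  have "f (shift u (Suc i)) = (\<Sum>l=1..Suc i. u l * f (a (Suc (Suc i) - l)))"
    unfolding shift_def by (simp only: f_sum f_scale[OF assms(1)])
  also have "\<dots> = (\<Sum>l=1..i. u l * f (a (Suc (Suc i) - l)))" using a1(2) by simp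
  also have "\<dots> = shift u i"
    unfolding shift_def
  proof (rule sum.cong[OF refl])
    fix l assume l: "l \<in> {1..i}"
    then have j: "1 \<le> Suc i - l" "Suc i - l < n" using assms(2) by auto
    have "Suc (Suc i) - l = Suc (Suc i - l)" using l by auto
    then show "u l * f (a (Suc (Suc i) - l)) = u l * a (Suc i - l)" using a_root[OF j] by simp
  qed
  finally show ?thesis .
qed

text \<open>In \<open>e = c * a 1 + d * b 1\<close>, a nonzero \<open>d\<close> would give the last
  term valuation exactly \<open>l1\<close>, although \<open>e\<close> and \<open>c * a 1\<close>
  both lie above \<open>l1\<close>.\<close>

lemma Vf_line:
  assumes "f e = 0" "ereal l1 < v e" shows "\<exists>c\<in>k. e = c * a 1"
proof -
  obtain c d where cd: "c \<in> k" "d \<in> k" "e = c * a 1 + d * b 1" using Vf_span[OF assms(1)] by blast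
  have "ereal l1 < v (a 1)" using v_nu[OF a1(1)] nu_ab1 l1_less_lm by simp
  then have "ereal l1 < v (c * a 1)" by (rule v_k_mult[OF cd(1)])
  with assms(2) have "ereal l1 < v (e - c * a 1)" by (rule v_diff_gt)
  then have db: "ereal l1 < v (d * b 1)" using cd(3) by simp
  have "d = 0"
  proof (rule ccontr)
    assume "d \<noteq> 0"
    then have "v (d * b 1) = ereal l1" using k_v(1)[OF cd(2)] v_nu[OF b1'(1)] nu_ab1 by (simp add: v_mult)
    then show False using db by simp
  qed
  then show ?thesis using cd by auto
qed

text \<open>Inductively \<open>\<sigma> (a i) - a i\<close> is a root of \<open>f\<close>. Wildness
  gives it a valuation above \<open>nu (a i) \<ge> lm\<close> if it is nonzero, but no nonzero root
  has valuation above \<open>lm\<close>.\<close>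

lemma wild_fixes_a:
  assumes \<sigma>: "\<sigma> \<in> auts K" "wildly \<sigma>" shows "1 \<le> i \<Longrightarrow> i \<le> n \<Longrightarrow> \<sigma> (a i) = a i"
proof (induction i rule: dec_induct)
  have main: "\<sigma> (a i) = a i" if i: "1 \<le> i" "i \<le> n" "f (\<sigma> (a i) - a i) = 0" for i
  proof (rule ccontr)
    assume "\<sigma> (a i) \<noteq> a i"
    then have ne: "\<sigma> (a i) - a i \<noteq> 0" by simp
    have ai: "a i \<noteq> 0" using nu_a[OF i(1,2)] by blast
    have "v (a i) < v (\<sigma> (a i) - a i)" using \<sigma>(2) a_in_L[OF i(1,2)] ai unfolding wildly_def by blast
    then have "nu (a i) < nu (\<sigma> (a i) - a i)" using v_nu[OF ai] v_nu[OF ne] by simp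
    then show False using Vf_nu_le[OF i(3) ne] nu_a_ge[OF i(1,2)] by simp
  qed
  {
    case base
    then show ?case using main[of 1] a1(2) f_aut[OF \<sigma>(1), of "a 1"] autsD(4)[OF \<sigma>(1) sfK] by (simp add: f_diff)
  next
    case (step i)
    then have i: "1 \<le> i" "i < n" "\<sigma> (a i) = a i" by auto
    have "f (\<sigma> (a (Suc i)) - a (Suc i)) = \<sigma> (f (a (Suc i))) - f (a (Suc i))" by (simp add: f_diff f_aut[OF \<sigma>(1)])
    also have "\<dots> = 0" unfolding a_root[OF i(1,2)] i(3) by simp
    finally show ?case using main[of "Suc i"] i by simp
  }
qed

text \<open>The next entry is found by measuring the error \<open>e\<close> of the tuple extended by
  0. It is a root of \<open>f\<close>, and wildness together with \<open>nu (b i) \<ge> l1\<close>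
  puts its valuation above \<open>l1\<close>; so it is a multiple of \<open>a 1\<close>, and the
  factor becomes the new entry.\<close>

lemma wild_acts_partial:
  assumes \<sigma>: "\<sigma> \<in> auts K" "wildly \<sigma>"
  shows "m \<le> n \<Longrightarrow> \<exists>u. (\<forall>l. u l \<in> k) \<and> (\<forall>l. l \<notin> {1..m} \<longrightarrow> u l = 0) \<and> (\<forall>i\<in>{1..m}. \<sigma> (b i) = b i + shift u i)"
proof (induction m)
  case 0
  have "0 \<in> k" by (rule subfieldD(2)[OF sfk])
  then show ?case by (intro exI[of _ "\<lambda>_. 0"]) simp
next
  case (Suc m)
  then obtain u where u: "\<And>l. u l \<in> k" "\<And>l. l \<notin> {1..m} \<Longrightarrow> u l = 0" "\<And>i. i \<in> {1..m} \<Longrightarrow> \<sigma> (b i) = b i + shift u i"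
    by (metis Suc_leD)
  have bn: "b (Suc m) \<noteq> 0" "l1 \<le> nu (b (Suc m))" using nu_b_ge[of "Suc m"] Suc.prems by auto
  define e where "e = \<sigma> (b (Suc m)) - b (Suc m) - shift u (Suc m)"
  have fe: "f e = \<sigma> (f (b (Suc m))) - f (b (Suc m)) - f (shift u (Suc m))"
    by (simp add: e_def f_diff f_aut[OF \<sigma>(1)])
  have "f e = 0"
  proof (cases "m = 0")
    case True
    have "shift u (Suc m) = 0" using u(2)[of 1] True by (simp add: shift_def)
    then show ?thesis using fe True b1'(2) autsD(4)[OF \<sigma>(1) sfK] by simp
  next
    case False
    then have m: "1 \<le> m" "m < n" using Suc.prems by auto
    have "f e = \<sigma> (b m) - b m - shift u m" unfolding fe b_root[OF m] shift_Suc[OF u(1) Suc.prems m(1)] ..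
    then show ?thesis using u(3)[of m] m by simp
  qed
  moreover have "ereal l1 < v e"
    unfolding e_def
  proof (rule v_diff_gt)
    have "v (b (Suc m)) < v (\<sigma> (b (Suc m)) - b (Suc m))"
      using \<sigma>(2) b_in_L[of "Suc m"] bn(1) Suc.prems unfolding wildly_def by simp
    moreover have "ereal l1 \<le> v (b (Suc m))" using bn v_nu by simp
    ultimately show "ereal l1 < v (\<sigma> (b (Suc m)) - b (Suc m))" by (rule le_less_trans[rotated])
    show "ereal l1 < v (shift u (Suc m))" by (rule v_shift_gt[OF u(1) Suc.prems])
  qed
  ultimately obtain c where c: "c \<in> k" "e = c * a 1" using Vf_line by blast
  define u' where "u' = u(Suc m := c)"
  have "shift u' i = shift u i" if "i \<le> m" for i
    unfolding shift_def u'_def using that by (intro sum.cong) auto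
  then have 1: "\<sigma> (b i) = b i + shift u' i" if "i \<in> {1..m}" for i using u(3)[OF that] that by simp
  have "shift u' (Suc m) = (\<Sum>l=1..m. u' l * a (Suc (Suc m) - l)) + c * a 1" by (simp add: shift_def u'_def)
  also have "(\<Sum>l=1..m. u' l * a (Suc (Suc m) - l)) = (\<Sum>l=1..m. u l * a (Suc (Suc m) - l))"
    unfolding u'_def by (intro sum.cong) auto
  also have "\<dots> = shift u (Suc m)" using u(2)[of "Suc m"] by (simp add: shift_def)
  finally have "\<sigma> (b (Suc m)) = b (Suc m) + shift u' (Suc m)" using c(2) by (simp add: e_def algebra_simps)
  then have "\<forall>i\<in>{1..Suc m}. \<sigma> (b i) = b i + shift u' i" using 1 by (metis atLeastAtMost_iff le_SucE)
  moreover have "\<forall>l. u' l \<in> k" using u(1) c(1) by (simp add: u'_def)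
  moreover have "\<forall>l. l \<notin> {1..Suc m} \<longrightarrow> u' l = 0" using u(2) by (auto simp: u'_def)
  ultimately show ?case by blast
qed

text \<open>Only entries beyond \<open>r\<close> remain to be excluded. There
  \<open>nu (b i) > lm\<close>, so wildness pushes \<open>shift u i\<close> above \<open>lm\<close>.
  Its terms with \<open>a j\<close> for \<open>j \<ge> 2\<close> are above \<open>lm\<close> as
  well, since \<open>nu \<pi> < 0\<close>, whereas a nonzero \<open>u i\<close> would contribute
  \<open>u i * a 1\<close> of valuation exactly \<open>lm\<close>.\<close>

lemma wild_acts:
  assumes \<sigma>: "\<sigma> \<in> auts K" "wildly \<sigma>" shows "\<exists>u. acts \<sigma> u"
proof -
  obtain u where u: "\<And>l. u l \<in> k" "\<And>l. l \<notin> {1..n} \<Longrightarrow> u l = 0" "\<And>i. i \<in> {1..n} \<Longrightarrow> \<sigma> (b i) = b i + shift u i"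
    using wild_acts_partial[OF \<sigma> order_refl] by metis
  have "u i = 0" if i: "r < i" "i \<le> n" for i
  proof (rule ccontr)
    assume ui: "u i \<noteq> 0"
    have rn: "r < n" using i by simp
    have pn: "nu \<pi> < 0" using jv_next[OF rn] by blast
    have bi: "b i \<noteq> 0" "lm < nu (b i)" using nu_b_large[OF jvr _ r(1), of i] jv_next[OF rn] i by auto
    have i1: "1 \<le> i" using i by simp
    have "v (b i) < v (\<sigma> (b i) - b i)" using \<sigma>(2) b_in_L[OF i1 i(2)] bi(1) unfolding wildly_def by blast
    then have "ereal lm < v (\<sigma> (b i) - b i)" using v_nu[OF bi(1)] bi(2) by (metis less_trans less_ereal.simps(1))
    then have lt: "ereal lm < v (shift u i)" using u(3)[of i] i1 i(2) by simp
    obtain i' where i': "i = Suc i'" using i1 by (cases i) auto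
    have "shift u i = (\<Sum>l=1..i'. u l * a (Suc i - l)) + u i * a 1" by (simp add: shift_def i')
    moreover have "ereal lm < v (\<Sum>l=1..i'. u l * a (Suc i - l))"
    proof (intro v_sum_gt v_k_mult u(1))
      fix l assume "l \<in> {1..i'}"
      then have j: "2 \<le> Suc i - l" "Suc i - l \<le> n" using i i' by auto
      have "lm < nu (a (Suc i - l))" by (rule nu_a_gt[OF j pn])
      moreover have "a (Suc i - l) \<noteq> 0" using nu_a[of "Suc i - l"] j by simp
      ultimately show "ereal lm < v (a (Suc i - l))" using v_nu by simp
    qed
    ultimately have "ereal lm < v (shift u i - (\<Sum>l=1..i'. u l * a (Suc i - l)))" using lt by (intro v_diff_gt)
    then have "ereal lm < v (u i * a 1)" using \<open>shift u i = _\<close> by simp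
    moreover have "v (u i * a 1) = ereal lm" using k_v(1)[OF u(1) ui] v_nu[OF a1(1)] nu_ab1 by (simp add: v_mult)
    ultimately show False by simp
  qed
  then have "u l = 0" if "l \<notin> {1..r}" for l using that u(2)[of l] by (cases "l \<in> {1..n}") auto
  then have "u \<in> U" using u(1) by (simp add: U_def)
  then have "acts \<sigma> u" unfolding acts_def using u(3) wild_fixes_a[OF \<sigma>] by simp
  then show ?thesis by blast
qed

text \<open>Every entry occurs exactly once in \<open>shift u r\<close>, as coefficient of a
  different \<open>a j\<close> in reversed order, so independence of the \<open>a j\<close> recovers
  the tuple. In particular the image of \<open>b r\<close> alone distinguishes wild automorphisms of
  \<open>L\<close>.\<close>

lemma shift_inj:
  assumes "u \<in> U" "w \<in> U" "shift u r = shift w r" shows "u = w"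
proof
  fix l
  have uk: "u l \<in> k" "w l \<in> k" for l using assms(1,2) by (simp_all add: U_def)
  show "u l = w l"
  proof (cases "l \<in> {1..r}")
    case True
    define c where "c j = (if j \<in> {1..r} then u (Suc r - j) - w (Suc r - j) else 0)" for j
    have ck: "c j \<in> k" for j using subfieldD(7)[OF sfk uk] subfieldD(2)[OF sfk] by (simp add: c_def)
    have "(\<Sum>j=1..r. c j * a j) = (\<Sum>l=1..r. c (Suc r - l) * a (Suc r - l))"
      by (rule sum.reindex_bij_witness[of _ "\<lambda>l. Suc r - l" "\<lambda>l. Suc r - l"]) auto
    also have "\<dots> = (\<Sum>l=1..r. (u l - w l) * a (Suc r - l))"
      by (intro sum.cong) (auto simp: c_def)
    also have "\<dots> = shift u r - shift w r" by (simp add: shift_def left_diff_distrib sum_subtractf)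
    finally have "comb r c (\<lambda>_. 0) = 0" using assms(3) by (simp add: comb_def)
    then have "c (Suc r - l) = 0"
      using comb_independent[of c "\<lambda>_. 0" r "Suc r - l"] ck subfieldD(2)[OF sfk] r(2) True by auto
    moreover have "Suc r - l \<in> {1..r}" "Suc r - (Suc r - l) = l" using True by auto
    ultimately show ?thesis by (simp add: c_def)
  next
    case False
    then show ?thesis using assms(1,2) by (simp add: U_def)
  qed
qed

lemma acts_unique: "acts \<sigma> u \<Longrightarrow> acts \<sigma> w \<Longrightarrow> u = w"
proof -
  assume a: "acts \<sigma> u" "acts \<sigma> w"
  have "r \<in> {1..n}" using r by simp
  then have "b r + shift u r = b r + shift w r" using a unfolding acts_def by metis
  then show ?thesis using a by (intro shift_inj) (simp_all add: acts_def)
qed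

lemma acts_cong_L: "acts \<sigma> u \<Longrightarrow> (\<And>x. x \<in> L \<Longrightarrow> \<sigma> x = \<tau> x) \<Longrightarrow> acts \<tau> u"
  unfolding acts_def using a_in_L b_in_L by simp

lemma acts_comp:
  assumes "\<sigma> \<in> auts K" "acts \<sigma> u" "acts \<tau> w" shows "acts (\<sigma> \<circ> \<tau>) (\<lambda>l. u l + w l)"
proof -
  note s = autsD[OF assms(1) sfK]
  have uw: "u \<in> U" "w \<in> U" using assms by (auto simp: acts_def)
  then have wk: "w l \<in> k" for l by (simp add: U_def)
  have "(\<lambda>l. u l + w l) \<in> U" using uw subfieldD(3)[OF sfk] by (simp add: U_def)
  moreover have "\<sigma> (\<tau> (b i)) = b i + shift (\<lambda>l. u l + w l) i" if i: "i \<in> {1..n}" for i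
  proof -
    have "\<sigma> (shift w i) = shift w i"
      unfolding shift_def auts_sum[OF assms(1) sfK]
    proof (rule sum.cong[OF refl])
      fix l assume "l \<in> {1..i}"
      then have "Suc i - l \<in> {1..n}" using i by auto
      then show "\<sigma> (w l * a (Suc i - l)) = w l * a (Suc i - l)"
        using assms(2) by (simp add: s(2) aut_k[OF assms(1) wk] acts_def)
    qed
    then have "\<sigma> (\<tau> (b i)) = b i + shift u i + shift w i"
      using assms(2,3) i by (simp add: acts_def s(1))
    then show ?thesis by (simp add: shift_def distrib_right sum.distrib)
  qed
  ultimately show ?thesis using assms(2,3) unfolding acts_def by simp
qed

lemma acts_eq_L:
  assumes "\<sigma> \<in> auts K" "\<tau> \<in> auts K" "acts \<sigma> u" "acts \<tau> u" "x \<in> L" shows "\<sigma> x = \<tau> x"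
proof (rule auts_eq_on_L[OF assms(1,2) _ assms(5)])
  fix x assume "x \<in> {x. (f ^^ n) x = 0}"
  then obtain c d where cd: "\<forall>i. c i \<in> k" "\<forall>i. d i \<in> k" "x = comb n c d" using comb_span[of n x] by auto
  note s = autsD[OF assms(1) sfK] and t = autsD[OF assms(2) sfK]
  have "\<sigma> (c i * a i + d i * b i) = \<tau> (c i * a i + d i * b i)" if "i \<in> {1..n}" for i
    using that assms(3,4) cd(1,2) by (simp add: s(1,2) t(1,2) aut_k[OF assms(1)] aut_k[OF assms(2)] acts_def)
  then show "\<sigma> x = \<tau> x" unfolding cd(3) comb_def auts_sum[OF assms(1) sfK] auts_sum[OF assms(2) sfK]
    by (intro sum.cong) auto
qed

lemma card_U: "card U = q ^ r" and finite_U: "finite U"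
proof -
  have b: "bij_betw (\<lambda>u. restrict u {1..r}) U ({1..r} \<rightarrow>\<^sub>E k)"
  proof (rule bij_betw_byWitness[where f' = "\<lambda>g l. if l \<in> {1..r} then g l else 0"])
    show "\<forall>u\<in>U. (\<lambda>l. if l \<in> {1..r} then restrict u {1..r} l else 0) = u" by (auto simp: U_def fun_eq_iff)
    show "\<forall>g\<in>{1..r} \<rightarrow>\<^sub>E k. restrict (\<lambda>l. if l \<in> {1..r} then g l else 0) {1..r} = g"
      by (auto simp: fun_eq_iff PiE_iff extensional_def)
    show "(\<lambda>u. restrict u {1..r}) ` U \<subseteq> {1..r} \<rightarrow>\<^sub>E k" by (auto simp: U_def)
    show "(\<lambda>g l. if l \<in> {1..r} then g l else 0) ` ({1..r} \<rightarrow>\<^sub>E k) \<subseteq> U"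
      using subfieldD(2)[OF sfk] by (auto simp: U_def PiE_iff)
  qed
  show "card U = q ^ r" using bij_betw_same_card[OF b] by (simp add: card_PiE card_k q_def)
  show "finite U" using bij_betw_finite[OF b] finite_k by (simp add: finite_PiE)
qed

text \<open>
  The product of the conjugates of \<open>b r\<close> over the tame field has valuation in \<open>\<int>[1/N]\<close> with \<open>p \<nmid> N\<close>,
  whereas \<open>v(b r)\<close> has denominator exactly divisible by \<open>q\<^sup>r\<close>; so there are at least \<open>q\<^sup>r\<close> conjugates.
\<close>

theorem acts_surj: "u \<in> U \<Longrightarrow> \<exists>\<sigma>\<in>auts K. wildly \<sigma> \<and> acts \<sigma> u"
proof -
  assume u: "u \<in> U"
  obtain T N where T: "subfield T Ksep" "K \<subseteq> T" "\<not> p dvd N" "auts T \<subseteq> {\<sigma>\<in>auts K. wildly \<sigma>}"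
    "\<And>y. y \<in> T \<Longrightarrow> y \<noteq> 0 \<Longrightarrow> \<exists>z::int. real N * nu y = of_int z"
    using tame_field_for_L by blast
  have sepT: "UNIV_is_separable_closure_of T" by (rule sep_closure_mono[OF sepK T(2)])
  let ?C = "conjugates T (b r)"
  define \<Phi> where "\<Phi> u = b r + shift u r" for u
  have injP: "inj_on \<Phi> U" by (rule inj_onI) (simp add: \<Phi>_def shift_inj)
  have finC: "finite ?C" by (rule conjugates_finite[OF sepT T(1)])
  \<comment> \<open>Automorphisms over \<open>T\<close> are wild, so each conjugate of
    \<open>b r\<close> has the form \<open>b r + shift w r\<close>; this bounds their number by
    \<open>q ^ r\<close> from above.\<close>
  have CU: "?C \<subseteq> \<Phi> ` U"
  proof
    fix x assume "x \<in> ?C"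
    then obtain \<sigma> where s: "\<sigma> \<in> auts T" "x = \<sigma> (b r)" by (auto simp: conjugates_def)
    then have "\<sigma> \<in> auts K" "wildly \<sigma>" using T(4) by auto
    then obtain w where "acts \<sigma> w" using wild_acts by blast
    then have "w \<in> U" "x = \<Phi> w" using r s(2) by (simp_all add: acts_def \<Phi>_def)
    then show "x \<in> \<Phi> ` U" by blast
  qed
  have cardP: "card (\<Phi> ` U) = q ^ r" by (simp add: card_image[OF injP] card_U)
  have br: "b r \<noteq> 0" "(real q - 1) * nu (b r) = - nu b1 + jv / real q ^ r" using nu_b[OF jvr r(2), of r] r by auto
  have nz: "y \<noteq> 0 \<and> nu y = nu (b r)" if y: "y \<in> ?C" for y
  proof -
    obtain \<sigma> where s: "\<sigma> \<in> auts T" "y = \<sigma> (b r)" using y by (auto simp: conjugates_def)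
    then show ?thesis using autsD(10)[OF s(1) T(1)] br(1) v_aut_over[OF T(2) s(1), of "b r"] by (simp add: nu_def)
  qed
  have "nu (\<Prod>y\<in>?C. y) = (\<Sum>y\<in>?C. nu y)" using nz by (intro nu_prod) blast
  also have "\<dots> = real (card ?C) * nu (b r)" using nz by simp
  finally have np: "nu (\<Prod>y\<in>?C. y) = real (card ?C) * nu (b r)" .
  have "(\<Prod>y\<in>?C. y) \<noteq> 0" using nz finC by (auto simp: prod_zero_iff)
  then obtain z :: int where z: "real N * (real (card ?C) * nu (b r)) = of_int z"
    using T(5)[OF conjugates_prod_in[OF sepT T(1), of "b r"]] np by auto
  obtain J :: int where J: "jv = of_int J" "\<not> int p dvd J" using jv_int by blast
  obtain B :: int where B: "nu b1 = of_int B" using nu_K_int[OF b1K] by blast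
  \<comment> \<open>With \<open>J\<close> the value of j and \<open>B\<close> that of
    \<open>b1\<close>, clearing denominators yields
    \<open>N * card C * (J - B * Qr) = Qr * z * (q - 1)\<close>. As \<open>p\<close> divides
    \<open>Qr\<close> but neither \<open>N\<close> nor \<open>J\<close>, the number of conjugates
    must be divisible by \<open>Qr\<close>.\<close>
  define Qr where "Qr = int q ^ r"
  have Qr: "real_of_int Qr = real q ^ r" by (simp add: Qr_def)
  have q0: "real q ^ r \<noteq> 0" using Q_ge2 by simp
  have br2: "(real q - 1) * nu (b r) = - of_int B + of_int J / real q ^ r" using br(2) unfolding J(1) unfolding B .
  have "real q ^ r * ((real q - 1) * nu (b r)) = of_int J - of_int B * of_int Qr"
    unfolding br2 Qr using q0 by (simp add: field_simps)
  then have "real N * real (card ?C) * (of_int J - of_int B * of_int Qr) = real N * real (card ?C) * (real q ^ r * ((real q - 1) * nu (b r)))"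
    by (simp only:)
  also have "\<dots> = of_int z * (real q ^ r * (real q - 1))"
    unfolding z[symmetric] by (simp add: mult_ac)
  finally have "real N * real (card ?C) * (of_int J - of_int B * of_int Qr) = of_int z * (real q ^ r * (real q - 1))" .
  then have "real_of_int (int N * int (card ?C) * (J - B * Qr)) = real_of_int (z * (Qr * (int q - 1)))"
    using Qr by simp
  then have "int N * int (card ?C) * (J - B * Qr) = Qr * (z * (int q - 1))"
    by (simp only: of_int_eq_iff) (simp add: algebra_simps)
  then have "Qr dvd int N * int (card ?C) * (J - B * Qr)" by (rule dvdI)
  then have d: "Qr dvd int (card ?C) * (int N * (J - B * Qr))" by (simp add: mult.commute mult.left_commute)
  have pp: "Factorial_Ring.prime (int p)" using prime_p by simp
  have pQ: "int p dvd Qr"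
  proof -
    have "Qr = int p ^ (s * r)" by (simp add: Qr_def q_def power_mult)
    moreover have "s * r \<noteq> 0" using s_pos r(1) by simp
    ultimately show ?thesis by (simp add: dvd_power)
  qed
  have "\<not> int p dvd int N * (J - B * Qr)"
  proof
    assume "int p dvd int N * (J - B * Qr)"
    then have "int p dvd int N \<or> int p dvd J - B * Qr" using pp by (simp add: prime_dvd_mult_iff)
    then show False
    proof
      assume "int p dvd int N" then show False using T(3) by simp
    next
      assume "int p dvd J - B * Qr"
      then have "int p dvd (J - B * Qr) + B * Qr" using pQ by (intro dvd_add dvd_mult)
      then show False using J(2) by simp
    qed
  qed
  then have "coprime (int p) (int N * (J - B * Qr))" by (rule prime_imp_coprime[OF pp])
  then have "coprime Qr (int N * (J - B * Qr))"
    unfolding Qr_def q_def of_nat_power power_mult[symmetric] by (simp only: coprime_power_left_iff simp_thms)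
  then have "Qr dvd int (card ?C)" using d by (simp only: coprime_dvd_mult_left_iff)
  then have "q ^ r dvd card ?C" unfolding Qr_def by (metis int_dvd_int_iff of_nat_power)
  moreover have "card ?C \<noteq> 0" using conjugates_self finC by auto
  ultimately have "q ^ r \<le> card ?C" by (simp add: dvd_imp_le)
  then have "?C = \<Phi> ` U" using CU cardP finite_U by (intro card_seteq) auto
  then have "\<Phi> u \<in> ?C" using u by blast
  then obtain \<sigma> where s: "\<sigma> \<in> auts T" "\<Phi> u = \<sigma> (b r)" by (auto simp: conjugates_def)
  then have sK: "\<sigma> \<in> auts K" "wildly \<sigma>" using T(4) by auto
  then obtain w where w: "acts \<sigma> w" using wild_acts by blast
  then have "w \<in> U" "\<Phi> w = \<Phi> u" using r s(2) by (simp_all add: acts_def \<Phi>_def)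
  then have "w = u" using injP u by (simp add: inj_on_def)
  then show ?thesis using sK w by blast
qed

section \<open>Parametrization of the wild subgroup by tuples\<close>

definition wild_elt :: "(nat \<Rightarrow> 'a) \<Rightarrow> 'a \<Rightarrow> 'a"
  where "wild_elt u = restrict (SOME \<sigma>. \<sigma> \<in> auts K \<and> wildly \<sigma> \<and> acts \<sigma> u) L"

lemma wild_eltE:
  assumes "u \<in> U"
  obtains \<sigma> where "\<sigma> \<in> auts K" "wildly \<sigma>" "acts \<sigma> u" "wild_elt u = restrict \<sigma> L"
proof -
  have "\<exists>\<sigma>. \<sigma> \<in> auts K \<and> wildly \<sigma> \<and> acts \<sigma> u" using acts_surj[OF assms] by blast
  then have "(SOME \<sigma>. \<sigma> \<in> auts K \<and> wildly \<sigma> \<and> acts \<sigma> u) \<in> auts K \<and> wildly (SOME \<sigma>. \<sigma> \<in> auts K \<and> wildly \<sigma> \<and> acts \<sigma> u) \<and>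
    acts (SOME \<sigma>. \<sigma> \<in> auts K \<and> wildly \<sigma> \<and> acts \<sigma> u) u" by (rule someI_ex)
  then show ?thesis using that unfolding wild_elt_def by blast
qed

text \<open>The choice made in \<open>wild_elt\<close> is immaterial: automorphisms with the same
  tuple agree on the torsion basis, hence on \<open>L\<close>.\<close>

lemma wild_elt_eq:
  assumes "\<sigma> \<in> auts K" "acts \<sigma> u" shows "restrict \<sigma> L = wild_elt u"
proof -
  have "u \<in> U" using assms(2) by (simp add: acts_def)
  then obtain \<tau> where t: "\<tau> \<in> auts K" "wildly \<tau>" "acts \<tau> u" "wild_elt u = restrict \<tau> L" by (rule wild_eltE)
  have "\<sigma> x = \<tau> x" if "x \<in> L" for x by (rule acts_eq_L[OF assms(1) t(1) assms(2) t(3) that])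
  then show ?thesis unfolding t(4) by (intro restrict_ext)
qed

lemma acts_wild_elt: "u \<in> U \<Longrightarrow> acts (wild_elt u) u"
proof -
  assume "u \<in> U"
  then obtain \<sigma> where s: "\<sigma> \<in> auts K" "wildly \<sigma>" "acts \<sigma> u" "wild_elt u = restrict \<sigma> L" by (rule wild_eltE)
  then show ?thesis by (intro acts_cong_L[OF s(3)]) simp
qed

lemma bij_wild_elt: "bij_betw wild_elt U (carrier (wild_group v L K))"
  unfolding bij_betw_def
proof
  show "inj_on wild_elt U"
  proof (rule inj_onI)
    fix u w assume uw: "u \<in> U" "w \<in> U" "wild_elt u = wild_elt w"
    have "acts (wild_elt w) u" using acts_wild_elt[OF uw(1)] unfolding uw(3) .
    then show "u = w" using acts_wild_elt[OF uw(2)] by (rule acts_unique)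
  qed
  show "wild_elt ` U = carrier (wild_group v L K)"
  proof
    show "wild_elt ` U \<subseteq> carrier (wild_group v L K)"
    proof
      fix x assume "x \<in> wild_elt ` U"
      then obtain u where u: "u \<in> U" "x = wild_elt u" by blast
      obtain \<sigma> where s: "\<sigma> \<in> auts K" "wildly \<sigma>" "acts \<sigma> u" "wild_elt u = restrict \<sigma> L" by (rule wild_eltE[OF u(1)])
      then show "x \<in> carrier (wild_group v L K)" unfolding carrier_wild_group u(2) by blast
    qed
    show "carrier (wild_group v L K) \<subseteq> wild_elt ` U"
    proof
      fix x assume "x \<in> carrier (wild_group v L K)"
      then obtain \<sigma> where s: "\<sigma> \<in> auts K" "wildly \<sigma>" "x = restrict \<sigma> L" unfolding carrier_wild_group by blast
      obtain u where u: "acts \<sigma> u" using wild_acts[OF s(1,2)] by blast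
      have "u \<in> U" using u by (simp add: acts_def)
      then show "x \<in> wild_elt ` U" using wild_elt_eq[OF s(1) u] s(3) by blast
    qed
  qed
qed

text \<open>Composition adds tuples because the \<open>a i\<close> occurring in \<open>shift\<close>
  are fixed; with \<open>bij_wild_elt\<close> the wild subgroup becomes the additive group of
  tuples.\<close>

lemma wild_elt_add:
  assumes "u \<in> U" "w \<in> U"
  shows "wild_elt u \<otimes>\<^bsub>wild_group v L K\<^esub> wild_elt w = wild_elt (\<lambda>l. u l + w l)"
proof -
  obtain \<sigma> where s: "\<sigma> \<in> auts K" "wildly \<sigma>" "acts \<sigma> u" "wild_elt u = restrict \<sigma> L" by (rule wild_eltE[OF assms(1)])
  obtain \<tau> where t: "\<tau> \<in> auts K" "wildly \<tau>" "acts \<tau> w" "wild_elt w = restrict \<tau> L" by (rule wild_eltE[OF assms(2)])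
  show ?thesis unfolding wild_mult s(4) t(4) galois_mult[OF s(1) t(1)]
    by (rule wild_elt_eq[OF auts_comp[OF s(1) t(1)] acts_comp[OF s(1,3) t(3)]])
qed

end

section \<open>Elementary abelian groups, matrices and bases\<close>

lemma carrier_elementary_abelian: "p \<noteq> 0 \<Longrightarrow> carrier (elementary_abelian p d) = {..<d} \<rightarrow>\<^sub>E {0..<int p}"
  by (simp add: elementary_abelian_def carrier_integer_mod_group)

lemma group_elementary_abelian: "group (elementary_abelian p d)"
  by (simp add: elementary_abelian_def)

lemma mult_elementary_abelian: "x \<otimes>\<^bsub>elementary_abelian p d\<^esub> y = (\<lambda>i\<in>{..<d}. (x i + y i) mod int p)"
  by (simp add: elementary_abelian_def)

lemma card_elementary_abelian: "p \<noteq> 0 \<Longrightarrow> card (carrier (elementary_abelian p d)) = p ^ d"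
  by (simp add: carrier_elementary_abelian card_PiE)

text \<open>The embedding grows by one cyclic factor at a time, sending the new coordinate to a
  power of some \<open>g\<close> outside the image \<open>H\<close>. If \<open>g\<close> to the
  power \<open>z\<close> lay in \<open>H\<close> for some \<open>z\<close> prime to
  \<open>p\<close>, Bezout would put \<open>g\<close> itself into \<open>H\<close>; this gives
  injectivity.\<close>

lemma (in comm_group) elementary_abelian_embeds:
  assumes p: "Factorial_Ring.prime p" and exp: "\<And>x. x \<in> carrier G \<Longrightarrow> x [^] p = \<one>"
    and card: "card (carrier G) = p ^ d"
  shows "m \<le> d \<Longrightarrow> \<exists>h. h \<in> hom (elementary_abelian p m) G \<and> inj_on h (carrier (elementary_abelian p m))"
proof (induction m)
  case 0
  have p0: "p \<noteq> 0" using p by auto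
  have "(\<lambda>_. \<one>) \<in> hom (elementary_abelian p 0) G" by (auto simp: hom_def)
  moreover have "inj_on (\<lambda>_. \<one>) (carrier (elementary_abelian p 0))"
    by (simp add: carrier_elementary_abelian[OF p0])
  ultimately show ?case by blast
next
  case (Suc m)
  have p1: "1 < p" by (rule prime_gt_1_nat[OF p])
  then have p0: "p \<noteq> 0" by simp
  note cE = carrier_elementary_abelian[OF p0]
  obtain h where h: "h \<in> hom (elementary_abelian p m) G" "inj_on h (carrier (elementary_abelian p m))"
    using Suc by auto
  interpret gh: group_hom "elementary_abelian p m" G h
    using h(1) group_elementary_abelian is_group by (simp add: group_hom_def group_hom_axioms_def)
  define H where "H = h ` carrier (elementary_abelian p m)"
  have sH: "subgroup H G" unfolding H_def by (rule gh.img_is_subgroup)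
  have "card H = p ^ m" unfolding H_def using card_image[OF h(2)] card_elementary_abelian[OF p0] by simp
  then have "card H < card (carrier G)" using card Suc.prems p1 by simp
  then have "H \<noteq> carrier G" by auto
  then obtain g where g: "g \<in> carrier G" "g \<notin> H" using subgroup.subset[OF sH] by blast
  have gp: "g [^] (int p) = \<one>" using exp[OF g(1)] by (simp add: int_pow_int)
  \<comment> \<open>Coordinates are added modulo \<open>p\<close>, so powers of \<open>g\<close>
    must depend only on the exponent modulo \<open>p\<close>.\<close>
  have gmod: "g [^] (z mod int p) = g [^] z" for z :: int
  proof -
    have "g [^] z = g [^] (int p * (z div int p) + z mod int p)" by simp
    also have "\<dots> = (g [^] int p) [^] (z div int p) \<otimes> g [^] (z mod int p)"
      using g(1) by (simp only: int_pow_mult int_pow_pow)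
    also have "\<dots> = g [^] (z mod int p)" using g(1) by (simp add: gp)
    finally show ?thesis by simp
  qed
  define h' where "h' x = h (restrict x {..<m}) \<otimes> g [^] (x m)" for x :: "nat \<Rightarrow> int"
  have rC: "restrict x {..<m} \<in> carrier (elementary_abelian p m)" if "x \<in> carrier (elementary_abelian p (Suc m))" for x
    using that unfolding cE by (auto simp: PiE_iff)
  have hC: "h (restrict x {..<m}) \<in> carrier G" if "x \<in> carrier (elementary_abelian p (Suc m))" for x
    using gh.hom_closed[OF rC[OF that]] .
  have "h' \<in> hom (elementary_abelian p (Suc m)) G"
  proof (rule homI)
    show "h' x \<in> carrier G" if "x \<in> carrier (elementary_abelian p (Suc m))" for x
      using hC[OF that] g(1) by (simp add: h'_def)
    show "h' (x \<otimes>\<^bsub>elementary_abelian p (Suc m)\<^esub> y) = h' x \<otimes> h' y"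
      if x: "x \<in> carrier (elementary_abelian p (Suc m))" and y: "y \<in> carrier (elementary_abelian p (Suc m))" for x y
    proof -
      have "restrict (x \<otimes>\<^bsub>elementary_abelian p (Suc m)\<^esub> y) {..<m} = restrict x {..<m} \<otimes>\<^bsub>elementary_abelian p m\<^esub> restrict y {..<m}"
        by (rule ext) (simp add: mult_elementary_abelian)
      then have 1: "h (restrict (x \<otimes>\<^bsub>elementary_abelian p (Suc m)\<^esub> y) {..<m}) = h (restrict x {..<m}) \<otimes> h (restrict y {..<m})"
        using gh.hom_mult[OF rC[OF x] rC[OF y]] by simp
      have "(x \<otimes>\<^bsub>elementary_abelian p (Suc m)\<^esub> y) m = (x m + y m) mod int p"
        by (simp add: mult_elementary_abelian)
      then have 2: "g [^] ((x \<otimes>\<^bsub>elementary_abelian p (Suc m)\<^esub> y) m) = g [^] (x m) \<otimes> g [^] (y m)"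
        using g(1) by (simp add: gmod int_pow_mult)
      show ?thesis unfolding h'_def 1 2 using hC[OF x] hC[OF y] g(1) by (simp add: m_ac)
    qed
  qed
  moreover have "inj_on h' (carrier (elementary_abelian p (Suc m)))"
  proof (rule inj_onI)
    fix x y assume x: "x \<in> carrier (elementary_abelian p (Suc m))" and y: "y \<in> carrier (elementary_abelian p (Suc m))"
      and e: "h' x = h' y"
    define z where "z = x m - y m"
    have hx: "h (restrict x {..<m}) \<in> H" "h (restrict y {..<m}) \<in> H" using rC x y by (auto simp: H_def)
    have "g [^] (x m) = inv (h (restrict x {..<m})) \<otimes> (h (restrict y {..<m}) \<otimes> g [^] (y m))"
      using e hC[OF x] hC[OF y] g(1) unfolding h'_def by (intro inv_solve_left[THEN iffD2]) simp_all
    then have "g [^] z = inv (h (restrict x {..<m})) \<otimes> h (restrict y {..<m})"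
      unfolding z_def int_pow_diff[OF g(1)] using hC[OF x] hC[OF y] g(1) by (simp add: m_assoc)
    then have gz: "g [^] z \<in> H" using hx sH by (simp add: subgroup.m_closed subgroup.m_inv_closed)
    have "int p dvd z"
    proof (rule ccontr)
      assume "\<not> int p dvd z"
      then have "coprime (int p) z" using p by (intro prime_imp_coprime) simp_all
      then have "coprime z (int p)" by (rule coprime_commute[THEN iffD1])
      then obtain a b where "a * z + b * int p = 1" using bezout_int[of z "int p"] by auto
      then have "g = g [^] (z * a + int p * b)" using g(1) by (simp add: mult.commute)
      also have "\<dots> = (g [^] z) [^] a" using g(1) by (simp add: int_pow_mult gp flip: int_pow_pow)
      also have "\<dots> \<in> H" using gz sH by (simp add: subgroup_int_pow_closed)
      finally show False using g(2) by blast
    qed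
    moreover have "x m \<in> {0..<int p}" "y m \<in> {0..<int p}" using x y unfolding cE by (simp_all add: PiE_iff)
    then have "\<bar>z\<bar> < int p" unfolding z_def by auto
    ultimately have "z = 0" using dvd_imp_le_int[of z "int p"] by (cases "z = 0") simp_all
    then have xm: "x m = y m" by (simp add: z_def)
    then have "h (restrict x {..<m}) = h (restrict y {..<m})"
      using e hC[OF x] hC[OF y] g(1) unfolding h'_def by simp
    then have r: "restrict x {..<m} = restrict y {..<m}" using h(2) rC[OF x] rC[OF y] by (simp add: inj_on_def)
    show "x = y"
    proof (rule PiE_ext[OF x[unfolded cE] y[unfolded cE]])
      fix i assume "i \<in> {..<Suc m}"
      then show "x i = y i" using xm r[THEN fun_cong, of i] by (cases "i = m") auto
    qed
  qed
  ultimately show ?case by blast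
qed

lemma (in comm_group) iso_elementary_abelian:
  assumes p: "Factorial_Ring.prime p" and exp: "\<And>x. x \<in> carrier G \<Longrightarrow> x [^] p = \<one>"
    and card: "card (carrier G) = p ^ d"
  shows "G \<cong> elementary_abelian p d"
proof -
  have p0: "p \<noteq> 0" using p by auto
  obtain h where h: "h \<in> hom (elementary_abelian p d) G" "inj_on h (carrier (elementary_abelian p d))"
    using elementary_abelian_embeds[OF p exp card order_refl] by blast
  have "finite (carrier G)" using card p0 by (intro card_ge_0_finite) simp
  moreover have "h ` carrier (elementary_abelian p d) \<subseteq> carrier G" using h(1) by (auto simp: hom_def)
  moreover have "card (h ` carrier (elementary_abelian p d)) = card (carrier G)"
    using card_image[OF h(2)] card_elementary_abelian[OF p0] card by simp
  ultimately have "h ` carrier (elementary_abelian p d) = carrier G" by (intro card_subset_eq)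
  then have "h \<in> iso (elementary_abelian p d) G" using h by (simp add: iso_def bij_betw_def)
  then have "elementary_abelian p d \<cong> G" by (rule is_isoI)
  then show ?thesis by (rule group.iso_sym[OF group_elementary_abelian])
qed

section \<open>The basis list and the matrices acting on it\<close>

lemma length_xi_list [simp]: "length (xi_list n \<xi>) = n + n"
  by (simp add: xi_list_def)

lemma nth_xi_list:
  "i < n \<Longrightarrow> xi_list n \<xi> ! i = \<xi> (- int (n - i))" "i < n \<Longrightarrow> xi_list n \<xi> ! (n + i) = \<xi> (int (n - i))"
  by (simp_all add: xi_list_def nth_append rev_nth of_nat_diff nth_upto)

text \<open>Counted from 0, position \<open>i\<close> of each half of the list carries the index
  \<open>n - i\<close>. The entry 1 in row \<open>i\<close> of \<open>A_mat n l\<close> sits in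
  column \<open>i + l - 1\<close>, which carries the index \<open>Suc (n - i) - l\<close>, and it
  exists exactly when \<open>l \<le> n - i\<close>.\<close>

lemma acts_via_sigma_mat:
  fixes \<sigma> :: "'a::field \<Rightarrow> 'a"
  assumes l: "1 \<le> l" and neg: "\<And>i. 1 \<le> i \<Longrightarrow> i \<le> n \<Longrightarrow> \<sigma> (\<xi> (- int i)) = \<xi> (- int i)"
    and pos: "\<And>i. 1 \<le> i \<Longrightarrow> i \<le> n \<Longrightarrow> \<sigma> (\<xi> (int i)) = \<xi> (int i) + (if l \<le> i then u * \<xi> (- int (Suc i - l)) else 0)"
  shows "acts_via \<sigma> (xi_list n \<xi>) (sigma_mat n l u)"
proof -
  define va where "va = Matrix.vec n (\<lambda>i. \<xi> (- int (n - i)))"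
  define vb where "vb = Matrix.vec n (\<lambda>i. \<xi> (int (n - i)))"
  have C: "va \<in> carrier_vec n" "vb \<in> carrier_vec n" by (simp_all add: va_def vb_def)
  have A: "A_mat n l \<in> carrier_mat n n" by (simp add: A_mat_def)
  have vl: "vec_of_list (xi_list n \<xi>) = va @\<^sub>v vb"
  proof (rule eq_vecI)
    fix i assume "i < dim_vec (va @\<^sub>v vb)"
    then have i: "i < n + n" using C by simp
    show "vec_of_list (xi_list n \<xi>) $ i = (va @\<^sub>v vb) $ i"
    proof (cases "i < n")
      case True
      then show ?thesis using i by (simp add: vec_of_list_index va_def vb_def nth_xi_list)
    next
      case False
      then obtain j where "i = n + j" "j < n" using i by (metis add_less_cancel_left le_Suc_ex linorder_not_le)
      then show ?thesis by (simp add: vec_of_list_index va_def vb_def nth_xi_list)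
    qed
  qed (use C in simp)
  have row: "(u \<cdot>\<^sub>m A_mat n l *\<^sub>v va) $ i = (if l \<le> n - i then u * \<xi> (- int (Suc (n - i) - l)) else 0)" if i: "i < n" for i
  proof -
    have "(u \<cdot>\<^sub>m A_mat n l *\<^sub>v va) $ i = (\<Sum>j\<in>{0..<n}. u * (if i + l = j + 1 then 1 else 0) * \<xi> (- int (n - j)))"
      using i by (simp add: A_mat_def va_def scalar_prod_def)
    also have "\<dots> = (\<Sum>j\<in>{0..<n}. if j = i + l - 1 then u * \<xi> (- int (n - j)) else 0)"
    proof (rule sum.cong[OF refl])
      fix j
      have "i + l = j + 1 \<longleftrightarrow> j = i + l - 1" using l by arith
      then show "u * (if i + l = j + 1 then 1 else 0) * \<xi> (- int (n - j)) = (if j = i + l - 1 then u * \<xi> (- int (n - j)) else 0)"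
        by (simp only:) simp
    qed
    also have "\<dots> = (if i + l - 1 < n then u * \<xi> (- int (n - (i + l - 1))) else 0)"
      by (simp only: sum.delta finite_atLeastLessThan) simp
    also have "\<dots> = (if l \<le> n - i then u * \<xi> (- int (Suc (n - i) - l)) else 0)"
    proof -
      have "i + l - 1 < n \<longleftrightarrow> l \<le> n - i" using l i by arith
      moreover have "n - (i + l - 1) = Suc (n - i) - l" using l i by arith
      ultimately show ?thesis by (simp only:)
    qed
    finally show ?thesis .
  qed
  have "sigma_mat n l u *\<^sub>v (va @\<^sub>v vb) = (1\<^sub>m n *\<^sub>v va + 0\<^sub>m n n *\<^sub>v vb) @\<^sub>v (u \<cdot>\<^sub>m A_mat n l *\<^sub>v va + 1\<^sub>m n *\<^sub>v vb)"
    unfolding sigma_mat_def using A C by (intro four_block_mat_mult_vec smult_carrier_mat) auto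
  also have "0\<^sub>m n n *\<^sub>v vb = 0\<^sub>v n" using C by (intro eq_vecI) (auto simp: scalar_prod_def)
  also have "(1\<^sub>m n *\<^sub>v va + 0\<^sub>v n) @\<^sub>v (u \<cdot>\<^sub>m A_mat n l *\<^sub>v va + 1\<^sub>m n *\<^sub>v vb) = va @\<^sub>v (u \<cdot>\<^sub>m A_mat n l *\<^sub>v va + vb)"
    using C by simp
  also have "\<dots> = map_vec \<sigma> (va @\<^sub>v vb)"
  proof (rule eq_vecI)
    fix i assume "i < dim_vec (map_vec \<sigma> (va @\<^sub>v vb))"
    then have i: "i < n + n" using C by simp
    show "(va @\<^sub>v (u \<cdot>\<^sub>m A_mat n l *\<^sub>v va + vb)) $ i = map_vec \<sigma> (va @\<^sub>v vb) $ i"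
    proof (cases "i < n")
      case True
      then show ?thesis using i C A neg[of "n - i"] by (simp add: va_def vb_def)
    next
      case False
      then obtain j where j: "i = n + j" "j < n" using i by (metis add_less_cancel_left le_Suc_ex linorder_not_le)
      then have "(va @\<^sub>v (u \<cdot>\<^sub>m A_mat n l *\<^sub>v va + vb)) $ i = (u \<cdot>\<^sub>m A_mat n l *\<^sub>v va) $ j + vb $ j"
        using C A by simp
      moreover have "map_vec \<sigma> (va @\<^sub>v vb) $ i = \<sigma> (vb $ j)" using j C by simp
      ultimately show ?thesis using pos[of "n - j"] j(2) by (simp only: row) (simp add: vb_def)
    qed
  qed (use C A in simp)
  finally show ?thesis unfolding acts_via_def by (simp add: vl)
qed

lemma combine_Ksep:
  "ring.combine Ksep (c # Ks) (u # Us) = c * u + ring.combine Ksep Ks Us"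
  "ring.combine Ksep [] Us = 0" "ring.combine Ksep Ks [] = 0"
proof -
  note s = ring.combine.simps[OF ring_from_type_algebra]
  have o: "(\<otimes>\<^bsub>Ksep\<^esub>) = (*)" "(\<oplus>\<^bsub>Ksep\<^esub>) = (+)" "\<zero>\<^bsub>Ksep\<^esub> = 0"
    by (simp_all add: ring_of_type_algebra_def)
  show "ring.combine Ksep (c # Ks) (u # Us) = c * u + ring.combine Ksep Ks Us" unfolding s o ..
  show "ring.combine Ksep [] Us = 0" unfolding s o ..
  show "ring.combine Ksep Ks [] = 0" by (cases Ks) (simp_all only: s o)
qed

text \<open>\<open>combine\<close> stops at the end of the shorter list, so missing coefficients
  count as 0.\<close>

lemma combine_eq_sum:
  "ring.combine Ksep Ks Us = (\<Sum>i<length Us. (if i < length Ks then Ks ! i else 0) * Us ! i)"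
proof (induction Us arbitrary: Ks)
  case (Cons u Us)
  show ?case
  proof (cases Ks)
    case Nil
    then show ?thesis by (simp add: combine_Ksep)
  next
    case (Cons c Ks')
    show ?thesis unfolding Cons combine_Ksep Cons.IH[of Ks']
      by (simp add: sum.lessThan_Suc_shift del: sum.lessThan_Suc cong: if_cong)
  qed
qed (simp add: combine_Ksep)

section \<open>Structure of the wild subgroup\<close>

context wild_tower
begin

lemma U_zero: "(\<lambda>_. 0) \<in> U"
  using subfieldD(2)[OF sfk] by (simp add: U_def)

lemma U_add: "u \<in> U \<Longrightarrow> w \<in> U \<Longrightarrow> (\<lambda>l. u l + w l) \<in> U"
  using subfieldD(3)[OF sfk] by (simp add: U_def)

lemma wild_elt_surj: "x \<in> carrier (wild_group v L K) \<Longrightarrow> \<exists>u\<in>U. x = wild_elt u"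
  and wild_elt_closed: "u \<in> U \<Longrightarrow> wild_elt u \<in> carrier (wild_group v L K)"
  using bij_wild_elt unfolding bij_betw_def by blast+

lemma comm_group_wild: "comm_group (wild_group v L K)"
proof (rule group.group_comm_groupI[OF group_wild])
  fix x y assume "x \<in> carrier (wild_group v L K)" "y \<in> carrier (wild_group v L K)"
  then obtain u w where u: "u \<in> U" "x = wild_elt u" and w: "w \<in> U" "y = wild_elt w"
    using wild_elt_surj by blast
  show "x \<otimes>\<^bsub>wild_group v L K\<^esub> y = y \<otimes>\<^bsub>wild_group v L K\<^esub> x"
    unfolding u(2) w(2) wild_elt_add[OF u(1) w(1)] wild_elt_add[OF w(1) u(1)] by (simp only: add.commute)
qed

lemma wild_elt_zero: "wild_elt (\<lambda>_. 0) = \<one>\<^bsub>wild_group v L K\<^esub>"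
proof -
  interpret W: comm_group "wild_group v L K" by (rule comm_group_wild)
  have "wild_elt (\<lambda>_. 0) \<otimes>\<^bsub>wild_group v L K\<^esub> wild_elt (\<lambda>_. 0) = wild_elt (\<lambda>_. 0)"
    using wild_elt_add[OF U_zero U_zero] by (simp only: add_0)
  then show ?thesis using W.l_cancel_one[OF wild_elt_closed[OF U_zero] wild_elt_closed[OF U_zero]] by (simp only:)
qed

lemma wild_elt_pow: "u \<in> U \<Longrightarrow> wild_elt u [^]\<^bsub>wild_group v L K\<^esub> m = wild_elt (\<lambda>l. of_nat m * u l)" for m :: nat
proof (induction m)
  interpret W: comm_group "wild_group v L K" by (rule comm_group_wild)
  {
    case 0
    show ?case by (simp only: W.nat_pow_0 of_nat_0 mult_zero_left wild_elt_zero)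
  next
    case (Suc m)
    have "(\<lambda>l. of_nat m * u l) \<in> U"
      by (induction m) (use U_zero U_add[OF _ Suc.prems] in \<open>simp_all add: distrib_right add.commute[of "u _"]\<close>)
    then have "wild_elt (\<lambda>l. of_nat m * u l) \<otimes>\<^bsub>wild_group v L K\<^esub> wild_elt u = wild_elt (\<lambda>l. of_nat m * u l + u l)"
      using Suc.prems by (rule wild_elt_add)
    then show ?case unfolding W.nat_pow_Suc Suc.IH[OF Suc.prems]
      by (simp only: of_nat_Suc distrib_right mult_1_left add.commute)
  }
qed

text \<open>The \<open>p\<close>-th power multiplies a tuple by \<open>of_nat p = 0\<close>, and
  counting tuples gives the order \<open>q ^ r = p ^ (s * r)\<close>; a commutative group with these
  properties is elementary abelian.\<close>

theorem wild_group_iso: "wild_group v L K \<cong> elementary_abelian p (s * r)"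
proof (rule comm_group.iso_elementary_abelian[OF comm_group_wild prime_p])
  fix x assume "x \<in> carrier (wild_group v L K)"
  then obtain u where u: "u \<in> U" "x = wild_elt u" using wild_elt_surj by blast
  show "x [^]\<^bsub>wild_group v L K\<^esub> p = \<one>\<^bsub>wild_group v L K\<^esub>"
    unfolding u(2) wild_elt_pow[OF u(1)] of_nat_p mult_zero_left by (rule wild_elt_zero)
next
  show "card (carrier (wild_group v L K)) = p ^ (s * r)"
    using bij_betw_same_card[OF bij_wild_elt] by (simp add: card_U q_def power_mult)
qed

definition sigma :: "nat \<Rightarrow> 'a \<Rightarrow> 'a \<Rightarrow> 'a"
  where "sigma l u = wild_elt (\<lambda>j. if j = l then u else 0)"

lemma single_U: "l \<in> {1..r} \<Longrightarrow> u \<in> k \<Longrightarrow> (\<lambda>j. if j = l then u else 0) \<in> U"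
  using subfieldD(2)[OF sfk] by (simp add: U_def)

text \<open>A tuple is assembled coordinate by coordinate: \<open>w m\<close> keeps its entries up
  to \<open>m\<close>, and passing to \<open>Suc m\<close> multiplies by a single
  \<open>sigma\<close>.\<close>

lemma generate_sigma:
  "generate (galois_group L K) {sigma l u | l u. l \<in> {1..r} \<and> u \<in> k} = carrier (wild_group v L K)"
proof
  have "{sigma l u | l u. l \<in> {1..r} \<and> u \<in> k} \<subseteq> carrier (wild_group v L K)"
    using wild_elt_closed[OF single_U] unfolding sigma_def by blast
  then show "generate (galois_group L K) {sigma l u | l u. l \<in> {1..r} \<and> u \<in> k} \<subseteq> carrier (wild_group v L K)"
    by (rule group.generate_subgroup_incl[OF group_galois _ subgroup_wild])
  show "carrier (wild_group v L K) \<subseteq> generate (galois_group L K) {sigma l u | l u. l \<in> {1..r} \<and> u \<in> k}"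
  proof
    fix x assume "x \<in> carrier (wild_group v L K)"
    then obtain u where u: "u \<in> U" "x = wild_elt u" using wild_elt_surj by blast
    have uk: "u l \<in> k" "l \<notin> {1..r} \<Longrightarrow> u l = 0" for l using u(1) by (simp_all add: U_def)
    define w where "w m = (\<lambda>j. if j \<le> m then u j else 0)" for m
    have wU: "w m \<in> U" for m using uk subfieldD(2)[OF sfk] by (simp add: w_def U_def)
    have "m \<le> r \<Longrightarrow> wild_elt (w m) \<in> generate (galois_group L K) {sigma l u | l u. l \<in> {1..r} \<and> u \<in> k}" for m
    proof (induction m)
      case 0
      have "w 0 = (\<lambda>_. 0)" using uk(2)[of 0] by (simp add: w_def fun_eq_iff)
      then have "wild_elt (w 0) = \<one>\<^bsub>galois_group L K\<^esub>" using wild_elt_zero wild_one by (simp only:)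
      then show ?case by (simp only: generate.one)
    next
      case (Suc m)
      have l: "Suc m \<in> {1..r}" using Suc.prems by simp
      have "w (Suc m) = (\<lambda>j. w m j + (if j = Suc m then u (Suc m) else 0))"
        by (rule ext) (simp add: w_def le_Suc_eq)
      then have "wild_elt (w (Suc m)) = wild_elt (w m) \<otimes>\<^bsub>galois_group L K\<^esub> sigma (Suc m) (u (Suc m))"
        using wild_elt_add[OF wU single_U[OF l uk(1)], of m "Suc m"] unfolding wild_mult sigma_def by (simp only:)
      moreover have "wild_elt (w m) \<in> generate (galois_group L K) {sigma l u | l u. l \<in> {1..r} \<and> u \<in> k}"
        using Suc by simp
      moreover have "sigma (Suc m) (u (Suc m)) \<in> generate (galois_group L K) {sigma l u | l u. l \<in> {1..r} \<and> u \<in> k}"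
        using l uk(1) by (intro generate.incl) blast
      ultimately show ?case by (simp only: generate.eng)
    qed
    from this[of r] have "wild_elt (w r) \<in> generate (galois_group L K) {sigma l u | l u. l \<in> {1..r} \<and> u \<in> k}" by simp
    moreover have "w r = u" using uk(2) by (rule_tac ext) (simp add: w_def)
    ultimately show "x \<in> generate (galois_group L K) {sigma l u | l u. l \<in> {1..r} \<and> u \<in> k}" using u(2) by (simp only:)
  qed
qed

theorem generated_by_sigmas_wild:
  assumes rn: "r = n" and ab: "\<And>i. 1 \<le> i \<Longrightarrow> i \<le> n \<Longrightarrow> a i = \<xi> (- int i) \<and> b i = \<xi> (int i)"
  shows "generated_by_sigmas k v L K n \<xi>"
proof -
  have "acts_via (sigma l u) (xi_list n \<xi>) (sigma_mat n l u)" if l: "l \<in> {1..n}" and u: "u \<in> k" for l u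
  proof (rule acts_via_sigma_mat)
    have "acts (sigma l u) (\<lambda>j. if j = l then u else 0)"
      unfolding sigma_def using l u rn by (intro acts_wild_elt single_U) simp_all
    then have s: "sigma l u (a i) = a i" "sigma l u (b i) = b i + shift (\<lambda>j. if j = l then u else 0) i"
      if "1 \<le> i" "i \<le> n" for i using that unfolding acts_def by auto
    show "1 \<le> l" using l by simp
    fix i assume i: "1 \<le> i" "i \<le> n"
    show "sigma l u (\<xi> (- int i)) = \<xi> (- int i)" using s(1)[OF i] ab[OF i] by simp
    have "shift (\<lambda>j. if j = l then u else 0) i = (\<Sum>j=1..i. if j = l then u * a (Suc i - j) else 0)"
      unfolding shift_def by (rule sum.cong) auto
    also have "\<dots> = (if l \<le> i then u * a (Suc i - l) else 0)"
      using l by (simp only: sum.delta' sum.delta finite_atLeastAtMost) simp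
    also have "\<dots> = (if l \<le> i then u * \<xi> (- int (Suc i - l)) else 0)"
    proof (cases "l \<le> i")
      case True
      then have "1 \<le> Suc i - l" "Suc i - l \<le> n" using l i by auto
      then show ?thesis using ab[of "Suc i - l"] by (simp only:)
    qed simp
    finally show "sigma l u (\<xi> (int i)) = \<xi> (int i) + (if l \<le> i then u * \<xi> (- int (Suc i - l)) else 0)"
      using s(2)[OF i] ab[OF i] by (simp only:)
  qed
  moreover have "sigma l u \<in> carrier (wild_group v L K)" if "l \<in> {1..n}" "u \<in> k" for l u
    unfolding sigma_def using that rn by (intro wild_elt_closed single_U) simp_all
  moreover have rn': "{1..r} = {1..n}" using rn by simp
  ultimately show ?thesis unfolding generated_by_sigmas_def
    using generate_sigma[unfolded rn'] by (intro exI[of _ sigma] conjI ballI)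
qed

text \<open>The tower is cut at height \<open>r\<close>, where the premise \<open>r < n\<close> of
  \<open>jv_next\<close> fails; this describes the smaller torsion field by the same
  machinery.\<close>

lemma wild_tower_lower: "wild_tower v K p s k F t \<pi> b1 b2 q a b r r"
proof -
  have "tower v K p s k F t \<pi> b1 b2 q a b r"
    using r a1 b1' ab1 a_root b_root a_largest b_largest by unfold_locales auto
  then show ?thesis using r jvr by (simp add: wild_tower_def wild_tower_axioms_def)
qed

text \<open>Both wild subgroups are parametrized by the same \<open>U\<close>, which depends only on
  \<open>k\<close> and \<open>r\<close>, and restriction preserves the tuple of an automorphism. It
  therefore carries one parametrization to the other.\<close>

theorem restrict_wild_iso:
  "(\<lambda>\<sigma>\<in>carrier (wild_group v L K). restrict \<sigma> (adjoin K {x. (f ^^ r) x = 0}))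
    \<in> iso (wild_group v L K) (wild_group v (adjoin K {x. (f ^^ r) x = 0}) K)"
proof -
  interpret T: wild_tower v K p s k F t \<pi> b1 b2 q a b r r by (rule wild_tower_lower)
  have TL: "adjoin K {x. (f ^^ r) x = 0} = T.L" by (simp add: T.L_def)
  have "{x. (f ^^ r) x = 0} \<subseteq> {x. (f ^^ n) x = 0}"
  proof
    fix x assume "x \<in> {x. (f ^^ r) x = 0}"
    moreover have "(f ^^ m) 0 = 0" for m by (induction m) simp_all
    moreover have "(f ^^ n) x = (f ^^ (n - r)) ((f ^^ r) x)"
      using r by (metis comp_apply funpow_add le_add_diff_inverse2)
    ultimately show "x \<in> {x. (f ^^ n) x = 0}" by simp
  qed
  then have sub: "T.L \<subseteq> L"
    unfolding T.L_def L_def by (intro adjoin_props(4) adjoin_props(1) adjoin_props(2) order_trans[OF _ adjoin_props(3)])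
  let ?R = "\<lambda>\<sigma>\<in>carrier (wild_group v L K). restrict \<sigma> T.L"
  have R: "?R (wild_elt u) = T.wild_elt u" if u: "u \<in> U" for u
  proof -
    obtain \<sigma> where s: "\<sigma> \<in> auts K" "wildly \<sigma>" "acts \<sigma> u" "wild_elt u = restrict \<sigma> L" by (rule wild_eltE[OF u])
    have "T.acts \<sigma> u" using s(3) r unfolding acts_def T.acts_def by simp
    then have "restrict \<sigma> T.L = T.wild_elt u" by (rule T.wild_elt_eq[OF s(1)])
    moreover have "restrict (restrict \<sigma> L) T.L = restrict \<sigma> T.L" using sub by (simp add: restrict_restrict Int_absorb1)
    ultimately show ?thesis using wild_elt_closed[OF u] s(4) by simp
  qed
  have "?R \<in> hom (wild_group v L K) (wild_group v T.L K)"
  proof (rule homI)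
    fix x assume "x \<in> carrier (wild_group v L K)"
    then obtain u where u: "u \<in> U" "x = wild_elt u" using wild_elt_surj by blast
    then show "?R x \<in> carrier (wild_group v T.L K)" using R[OF u(1)] T.wild_elt_closed[OF u(1)] by (simp only:)
    fix y assume "y \<in> carrier (wild_group v L K)"
    then obtain w where w: "w \<in> U" "y = wild_elt w" using wild_elt_surj by blast
    show "?R (x \<otimes>\<^bsub>wild_group v L K\<^esub> y) = ?R x \<otimes>\<^bsub>wild_group v T.L K\<^esub> ?R y"
      unfolding u(2) w(2) wild_elt_add[OF u(1) w(1)] R[OF u(1)] R[OF w(1)] R[OF U_add[OF u(1) w(1)]]
      using T.wild_elt_add[OF u(1) w(1)] by (simp only:)
  qed
  moreover have "bij_betw ?R (carrier (wild_group v L K)) (carrier (wild_group v T.L K))"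
  proof (rule bij_betw_imageI)
    show "inj_on ?R (carrier (wild_group v L K))"
    proof (rule inj_onI)
      fix x y assume "x \<in> carrier (wild_group v L K)" "y \<in> carrier (wild_group v L K)" and e: "?R x = ?R y"
      then obtain u w where u: "u \<in> U" "x = wild_elt u" and w: "w \<in> U" "y = wild_elt w"
        using wild_elt_surj by blast
      have "T.wild_elt u = T.wild_elt w" using e R[OF u(1)] R[OF w(1)] unfolding u(2) w(2) by (simp only:)
      moreover have "inj_on T.wild_elt U" using T.bij_wild_elt unfolding bij_betw_def by blast
      ultimately have "u = w" using u(1) w(1) by (simp add: inj_on_def)
      then show "x = y" using u(2) w(2) by (simp only:)
    qed
    show "?R ` carrier (wild_group v L K) = carrier (wild_group v T.L K)"
    proof
      show "?R ` carrier (wild_group v L K) \<subseteq> carrier (wild_group v T.L K)"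
        using \<open>?R \<in> hom _ _\<close> unfolding hom_def by blast
      show "carrier (wild_group v T.L K) \<subseteq> ?R ` carrier (wild_group v L K)"
      proof
        fix x assume "x \<in> carrier (wild_group v T.L K)"
        then obtain u where u: "u \<in> U" "x = T.wild_elt u" using T.wild_elt_surj by blast
        have e: "x = ?R (wild_elt u)" using R[OF u(1)] u(2) by (simp only:)
        show "x \<in> ?R ` carrier (wild_group v L K)" unfolding e by (rule imageI[OF wild_elt_closed[OF u(1)]])
      qed
    qed
  qed
  ultimately show ?thesis unfolding TL by (simp only: iso_def mem_Collect_eq simp_thms)
qed

end

context tower
begin

text \<open>Independence and span are those of \<open>comb\<close>; what remains is to translate
  positions of the list, in each half running from the highest absolute index down, into
  indices.\<close>

theorem xi_list_basis:
  assumes ab: "\<And>i. 1 \<le> i \<Longrightarrow> i \<le> n \<Longrightarrow> a i = \<xi> (- int i) \<and> b i = \<xi> (int i)" and m: "m \<le> n"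
  shows "ring.independent Ksep k (xi_list m \<xi>)" "ring.Span Ksep k (xi_list m \<xi>) = {x. (f ^^ m) x = 0}"
proof -
  have k0: "0 \<in> k" by (rule subfieldD(2)[OF sfk])
  have UC: "set Us \<subseteq> carrier Ksep" for Us :: "'a list" by (simp add: ring_of_type_algebra_def)
  have z: "\<zero>\<^bsub>Ksep\<^esub> = (0::'a)" by (simp add: ring_of_type_algebra_def)
  define cf where "cf Ks j = (if j < length Ks then Ks ! j else 0)" for Ks :: "'a list" and j
  have cfk: "cf Ks j \<in> k" if "set Ks \<subseteq> k" for Ks j using that k0 by (auto simp: cf_def)
  have comb: "ring.combine Ksep Ks (xi_list m \<xi>) = comb m (\<lambda>i. cf Ks (m - i)) (\<lambda>i. cf Ks (m + (m - i)))" for Ks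
  proof -
    have split: "(\<Sum>i<m + l. g i) = (\<Sum>i<m. g i) + (\<Sum>i<l. g (m + i))" for l and g :: "nat \<Rightarrow> 'a"
      by (induction l) (simp_all add: add.assoc)
    have "ring.combine Ksep Ks (xi_list m \<xi>) = (\<Sum>i<m + m. cf Ks i * xi_list m \<xi> ! i)"
      by (simp add: combine_eq_sum cf_def)
    also have "\<dots> = (\<Sum>i<m. cf Ks i * xi_list m \<xi> ! i) + (\<Sum>i<m. cf Ks (m + i) * xi_list m \<xi> ! (m + i))"
      by (rule split)
    also have "(\<Sum>i<m. cf Ks i * xi_list m \<xi> ! i) = (\<Sum>i<m. cf Ks i * a (m - i))"
      using ab m by (intro sum.cong) (simp_all add: nth_xi_list)
    also have "\<dots> = (\<Sum>i=1..m. cf Ks (m - i) * a i)"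
      by (rule sum.reindex_bij_witness[of _ "\<lambda>i. m - i" "\<lambda>i. m - i"]) auto
    also have "(\<Sum>i<m. cf Ks (m + i) * xi_list m \<xi> ! (m + i)) = (\<Sum>i<m. cf Ks (m + i) * b (m - i))"
      using ab m by (intro sum.cong) (simp_all add: nth_xi_list)
    also have "\<dots> = (\<Sum>i=1..m. cf Ks (m + (m - i)) * b i)"
      by (rule sum.reindex_bij_witness[of _ "\<lambda>i. m - i" "\<lambda>i. m - i"]) auto
    finally show ?thesis by (simp add: comb_def sum.distrib)
  qed
  show "ring.independent Ksep k (xi_list m \<xi>)"
  proof (rule ring.trivial_combine_imp_independent[OF ring_from_type_algebra sfk UC])
    fix Ks assume Ks: "set Ks \<subseteq> k" "ring.combine Ksep Ks (xi_list m \<xi>) = \<zero>\<^bsub>Ksep\<^esub>"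
    have c0: "cf Ks (m - i) = 0 \<and> cf Ks (m + (m - i)) = 0" if "1 \<le> i" "i \<le> m" for i
      by (rule comb_independent[OF cfk[OF Ks(1)] cfk[OF Ks(1)] m _ that]) (use Ks(2) comb z in \<open>simp only:\<close>)
    have cf0: "cf Ks j = 0" if j: "j < m + m" for j
    proof (cases "j < m")
      case True
      then show ?thesis using c0[of "m - j"] by simp
    next
      case False
      then show ?thesis using c0[of "m + m - j"] j by simp
    qed
    have "Ks ! j = 0" if "j < m + m" "j < length Ks" for j
      using cf0[OF that(1)] that(2) by (simp add: cf_def)
    then show "set (take (length (xi_list m \<xi>)) Ks) \<subseteq> {\<zero>\<^bsub>Ksep\<^esub>}"
      unfolding z by (auto simp: in_set_conv_nth)
  qed
  show "ring.Span Ksep k (xi_list m \<xi>) = {x. (f ^^ m) x = 0}"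
  proof (rule Set.set_eqI)
    fix x
    have "(x \<in> ring.Span Ksep k (xi_list m \<xi>)) \<longleftrightarrow> (\<exists>Ks. set Ks \<subseteq> k \<and> length Ks = m + m \<and> x = ring.combine Ksep Ks (xi_list m \<xi>))"
      using ring.Span_mem_iff_length_version[OF ring_from_type_algebra sfk UC, of x "xi_list m \<xi>"] by simp
    also have "\<dots> \<longleftrightarrow> (\<exists>c d. (\<forall>i. c i \<in> k) \<and> (\<forall>i. d i \<in> k) \<and> x = comb m c d)"
    proof
      assume "\<exists>Ks. set Ks \<subseteq> k \<and> length Ks = m + m \<and> x = ring.combine Ksep Ks (xi_list m \<xi>)"
      then obtain Ks where "set Ks \<subseteq> k" "x = ring.combine Ksep Ks (xi_list m \<xi>)" by blast
      then show "\<exists>c d. (\<forall>i. c i \<in> k) \<and> (\<forall>i. d i \<in> k) \<and> x = comb m c d" unfolding comb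
        by (intro exI conjI allI) (rule cfk, assumption, rule cfk, assumption, assumption)
    next
      assume "\<exists>c d. (\<forall>i. c i \<in> k) \<and> (\<forall>i. d i \<in> k) \<and> x = comb m c d"
      then obtain c d where cd: "\<forall>i. c i \<in> k" "\<forall>i. d i \<in> k" "x = comb m c d" by blast
      define Ks where "Ks = map (\<lambda>j. if j < m then c (m - j) else d (m + m - j)) [0..<m + m]"
      have "x = ring.combine Ksep Ks (xi_list m \<xi>)" unfolding comb cd(3) comb_def
        by (rule sum.cong) (auto simp: cf_def Ks_def)
      moreover have "set Ks \<subseteq> k" using cd by (auto simp: Ks_def)
      moreover have "length Ks = m + m" by (simp add: Ks_def)
      ultimately show "\<exists>Ks. set Ks \<subseteq> k \<and> length Ks = m + m \<and> x = ring.combine Ksep Ks (xi_list m \<xi>)" by blast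
    qed
    also have "\<dots> \<longleftrightarrow> x \<in> {x. (f ^^ m) x = 0}" using comb_span[OF m, of x] by simp
    finally show "(x \<in> ring.Span Ksep k (xi_list m \<xi>)) \<longleftrightarrow> x \<in> {x. (f ^^ m) x = 0}" .
  qed
qed

end

section \<open>Adapted bases\<close>

locale drinfeld_phi = drinfeld v K p s k F t \<pi> b1 b2 q
  for v :: "'a::field \<Rightarrow> ereal" and K p s k F t \<pi> b1 b2 q +
  fixes \<phi> :: "'a \<Rightarrow> 'a poly"
  assumes phi_pi: "\<phi> \<pi> = fpoly" and torsion_power: "\<And>m. torsion \<phi> (\<pi> ^ m) = {x. (f ^^ m) x = 0}"
begin

lemma largest_root_iff: "largest_root v (\<phi> \<pi> - [:y:]) x \<longleftrightarrow> f x = y \<and> (\<forall>z. f z = y \<longrightarrow> v z \<le> v x)"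
  unfolding largest_root_def phi_pi by (simp add: poly_fpoly)

lemma largest_root_exists: "\<exists>x. largest_root v (\<phi> \<pi> - [:y:]) x"
proof -
  let ?S = "{x. f x = y}"
  have fin: "finite (v ` ?S)" "v ` ?S \<noteq> {}" using finite_f_roots f_surj[of y] by auto
  obtain x where x: "x \<in> ?S" "Max (v ` ?S) = v x" using Max_in[OF fin] by blast
  have "v z \<le> v x" if "f z = y" for z using Max_ge[OF fin(1), of "v z"] that x(2) by simp
  then show ?thesis using x(1) unfolding largest_root_iff by blast
qed

lemma adapted_basis_tower:
  assumes n: "0 < n" and ad: "adapted_basis k v \<phi> \<pi> n \<xi>"
  shows "tower v K p s k F t \<pi> b1 b2 q (\<lambda>i. \<xi> (- int i)) (\<lambda>i. \<xi> (int i)) n"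
proof
  have nz: "\<xi> (-1) \<noteq> 0" "\<xi> 1 \<noteq> 0" and root: "poly (\<phi> \<pi>) (\<xi> (-1)) = 0" "poly (\<phi> \<pi>) (\<xi> 1) = 0"
    and vv: "v (\<xi> 1) < v (\<xi> (-1))"
    and lr: "\<And>i. i \<in> {2..int n} \<Longrightarrow> largest_root v (\<phi> \<pi> - [:\<xi> (- (i - 1)):]) (\<xi> (- i)) \<and> largest_root v (\<phi> \<pi> - [:\<xi> (i - 1):]) (\<xi> i)"
    using ad unfolding adapted_basis_def by blast+
  show "1 \<le> n" "\<xi> (- int 1) \<noteq> 0" "f (\<xi> (- int 1)) = 0" "\<xi> (int 1) \<noteq> 0" "f (\<xi> (int 1)) = 0" "v (\<xi> (int 1)) < v (\<xi> (- int 1))"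
    using n nz root vv unfolding phi_pi poly_fpoly by simp_all
  fix i assume i: "1 \<le> i" "i < n"
  have "int (Suc i) \<in> {2..int n}" using i by simp
  from lr[OF this] have "largest_root v (\<phi> \<pi> - [:\<xi> (- int i):]) (\<xi> (- int (Suc i)))" "largest_root v (\<phi> \<pi> - [:\<xi> (int i):]) (\<xi> (int (Suc i)))"
    by (simp_all add: add.commute)
  note L = this[unfolded largest_root_iff]
  show "f (\<xi> (- int (Suc i))) = \<xi> (- int i)" "f (\<xi> (int (Suc i))) = \<xi> (int i)" using L by blast+
  show "v x \<le> v (\<xi> (- int (Suc i)))" if "f x = \<xi> (- int i)" for x using L(1) that by blast
  show "v x \<le> v (\<xi> (int (Suc i)))" if "f x = \<xi> (int i)" for x using L(2) that by blast
qed

lemma tower_adapted_basis: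
  assumes tw: "tower v K p s k F t \<pi> b1 b2 q (\<lambda>i. \<xi> (- int i)) (\<lambda>i. \<xi> (int i)) n" and m: "m \<le> n"
  shows "adapted_basis k v \<phi> \<pi> m \<xi>"
proof -
  interpret T: tower v K p s k F t \<pi> b1 b2 q "\<lambda>i. \<xi> (- int i)" "\<lambda>i. \<xi> (int i)" n by (rule tw)
  have 1: "ring.independent Ksep k (xi_list m \<xi>)" "ring.Span Ksep k (xi_list m \<xi>) = torsion \<phi> (\<pi> ^ m)"
    unfolding torsion_power by (rule T.xi_list_basis[OF _ m], simp)+
  have 2: "\<xi> (-1) \<noteq> 0" "\<xi> 1 \<noteq> 0" "poly (\<phi> \<pi>) (\<xi> (-1)) = 0" "poly (\<phi> \<pi>) (\<xi> 1) = 0" "v (\<xi> 1) < v (\<xi> (-1))"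
    using T.a1 T.b1' T.ab1 unfolding phi_pi poly_fpoly by simp_all
  have 3: "largest_root v (\<phi> \<pi> - [:\<xi> (- (i - 1)):]) (\<xi> (- i)) \<and> largest_root v (\<phi> \<pi> - [:\<xi> (i - 1):]) (\<xi> i)"
    if i: "i \<in> {2..int m}" for i
  proof -
    define j where "j = nat (i - 1)"
    have j: "1 \<le> j" "j < n" "i - 1 = int j" "i = int (Suc j)" using i m by (auto simp: j_def)
    show ?thesis unfolding largest_root_iff j(3) unfolding j(4)
      using T.a_root[OF j(1,2)] T.b_root[OF j(1,2)] T.a_largest[OF j(1,2)] T.b_largest[OF j(1,2)] by blast
  qed
  show ?thesis unfolding adapted_basis_def using 1 2 3 by blast
qed

lemma tower_exists:
  assumes n: "0 < n"
  shows "\<exists>\<xi>. tower v K p s k F t \<pi> b1 b2 q (\<lambda>i. \<xi> (- int i)) (\<lambda>i. \<xi> (int i)) n"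
proof -
  have "0 < card {w\<in>Vf. w \<noteq> 0 \<and> nu w = lm}" "0 < card {w\<in>Vf. w \<noteq> 0 \<and> nu w = l1}"
    unfolding card_Vf_values using q_less_q2 by simp_all
  note ne = this[unfolded card_gt_0_iff, THEN conjunct1, folded ex_in_conv]
  obtain x where "x \<in> {w\<in>Vf. w \<noteq> 0 \<and> nu w = lm}" using ne(1) by (rule exE)
  then have x: "f x = 0" "x \<noteq> 0" "nu x = lm" by simp_all
  obtain y where "y \<in> {w\<in>Vf. w \<noteq> 0 \<and> nu w = l1}" using ne(2) by (rule exE)
  then have y: "f y = 0" "y \<noteq> 0" "nu y = l1" by simp_all
  define g where "g y = (SOME x. largest_root v (\<phi> \<pi> - [:y:]) x)" for y
  have lr: "largest_root v (\<phi> \<pi> - [:y:]) (g y)" for y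
    unfolding g_def by (rule someI_ex[OF largest_root_exists])
  note gc = lr[unfolded largest_root_iff]
  have g: "f (g y) = y" "f z = y \<Longrightarrow> v z \<le> v (g y)" for y z
    by (rule conjunct1[OF gc]) (rule conjunct2[OF gc, rule_format])
  define \<xi> where "\<xi> i = (if i < 0 then (g ^^ nat (- i - 1)) x else (g ^^ nat (i - 1)) y)" for i :: int
  have xi: "\<xi> (- int (Suc j)) = (g ^^ j) x" "\<xi> (int (Suc j)) = (g ^^ j) y" for j
    unfolding \<xi>_def by simp_all
  have s: "\<xi> (- int (Suc i)) = g (\<xi> (- int i))" "\<xi> (int (Suc i)) = g (\<xi> (int i))" if i1: "1 \<le> i" for i
  proof -
    obtain j where j: "i = Suc j" using i1 by (cases i) auto
    show "\<xi> (- int (Suc i)) = g (\<xi> (- int i))" "\<xi> (int (Suc i)) = g (\<xi> (int i))"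
      unfolding j xi by simp_all
  qed
  have xi1: "\<xi> (-1) = x" "\<xi> 1 = y" by (simp_all add: \<xi>_def)
  have "tower v K p s k F t \<pi> b1 b2 q (\<lambda>i. \<xi> (- int i)) (\<lambda>i. \<xi> (int i)) n"
  proof
    show "1 \<le> n" "\<xi> (- int 1) \<noteq> 0" "f (\<xi> (- int 1)) = 0" "\<xi> (int 1) \<noteq> 0" "f (\<xi> (int 1)) = 0" "v (\<xi> (int 1)) < v (\<xi> (- int 1))"
      using n x y l1_less_lm v_nu[OF x(2)] v_nu[OF y(2)] by (simp_all add: xi1)
    fix i :: nat assume i: "1 \<le> i" "i < n"
    show "f (\<xi> (- int (Suc i))) = \<xi> (- int i)" "f (\<xi> (int (Suc i))) = \<xi> (int i)" unfolding s[OF i(1)] by (rule g(1))+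
    show "v z \<le> v (\<xi> (- int (Suc i)))" if "f z = \<xi> (- int i)" for z unfolding s[OF i(1)] using that by (rule g(2))
    show "v z \<le> v (\<xi> (int (Suc i)))" if "f z = \<xi> (int i)" for z unfolding s[OF i(1)] using that by (rule g(2))
  qed
  then show ?thesis by blast
qed

text \<open>For \<open>nu \<pi> = 0\<close> the bound \<open>jv < nu \<pi> * q ^ n\<close> reads
  \<open>jv < 0\<close> for every \<open>n\<close>, so \<open>r = n\<close> is admissible at every
  level.\<close>

lemma finite_case:
  assumes al0: "nu \<pi> = 0" and n: "0 < n" and ad: "adapted_basis k v \<phi> \<pi> n \<xi>"
  shows "wild_group v (adjoin K (torsion \<phi> (\<pi> ^ n))) K \<cong> elementary_abelian p (s * n)"
    "generated_by_sigmas k v (adjoin K (torsion \<phi> (\<pi> ^ n))) K n \<xi>"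
proof -
  have "wild_tower v K p s k F t \<pi> b1 b2 q (\<lambda>i. \<xi> (- int i)) (\<lambda>i. \<xi> (int i)) n n"
    using adapted_basis_tower[OF n ad] n jv_less al0 by (simp add: wild_tower_def wild_tower_axioms_def)
  then interpret T: wild_tower v K p s k F t \<pi> b1 b2 q "\<lambda>i. \<xi> (- int i)" "\<lambda>i. \<xi> (int i)" n n .
  have L: "adjoin K (torsion \<phi> (\<pi> ^ n)) = T.L" by (simp add: T.L_def torsion_power)
  show "wild_group v (adjoin K (torsion \<phi> (\<pi> ^ n))) K \<cong> elementary_abelian p (s * n)"
    unfolding L by (rule T.wild_group_iso)
  show "generated_by_sigmas k v (adjoin K (torsion \<phi> (\<pi> ^ n))) K n \<xi>"
    unfolding L by (rule T.generated_by_sigmas_wild[OF refl]) simp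
qed

text \<open>The tower of height \<open>n\<close> with \<open>r = m\<close> yields the restriction
  isomorphism, its truncation at height \<open>m\<close> the explicit description.\<close>

lemma infinite_case:
  assumes al: "nu \<pi> < 0" and m: "1 \<le> m" "m \<le> n" and jm: "jv < nu \<pi> * real q ^ m" "nu \<pi> * real q ^ Suc m < jv"
    and ad: "adapted_basis k v \<phi> \<pi> n \<xi>"
  shows "(\<lambda>\<sigma> \<in> carrier (wild_group v (adjoin K (torsion \<phi> (\<pi> ^ n))) K). restrict \<sigma> (adjoin K (torsion \<phi> (\<pi> ^ m))))
      \<in> iso (wild_group v (adjoin K (torsion \<phi> (\<pi> ^ n))) K) (wild_group v (adjoin K (torsion \<phi> (\<pi> ^ m))) K)"
    "wild_group v (adjoin K (torsion \<phi> (\<pi> ^ m))) K \<cong> elementary_abelian p (s * m)"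
    "adapted_basis k v \<phi> \<pi> m \<xi>"
    "generated_by_sigmas k v (adjoin K (torsion \<phi> (\<pi> ^ m))) K m \<xi>"
proof -
  have n: "0 < n" using m by simp
  note tw = adapted_basis_tower[OF n ad]
  have "wild_tower v K p s k F t \<pi> b1 b2 q (\<lambda>i. \<xi> (- int i)) (\<lambda>i. \<xi> (int i)) n m"
    using tw m jm al by (simp add: wild_tower_def wild_tower_axioms_def)
  then interpret T: wild_tower v K p s k F t \<pi> b1 b2 q "\<lambda>i. \<xi> (- int i)" "\<lambda>i. \<xi> (int i)" n m .
  interpret S: wild_tower v K p s k F t \<pi> b1 b2 q "\<lambda>i. \<xi> (- int i)" "\<lambda>i. \<xi> (int i)" m m by (rule T.wild_tower_lower)
  have Lm: "adjoin K (torsion \<phi> (\<pi> ^ m)) = S.L" by (simp add: S.L_def torsion_power)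
  have "(\<lambda>\<sigma> \<in> carrier (wild_group v T.L K). restrict \<sigma> S.L) \<in> iso (wild_group v T.L K) (wild_group v S.L K)"
    using T.restrict_wild_iso unfolding S.L_def .
  then show "(\<lambda>\<sigma> \<in> carrier (wild_group v (adjoin K (torsion \<phi> (\<pi> ^ n))) K). restrict \<sigma> (adjoin K (torsion \<phi> (\<pi> ^ m))))
      \<in> iso (wild_group v (adjoin K (torsion \<phi> (\<pi> ^ n))) K) (wild_group v (adjoin K (torsion \<phi> (\<pi> ^ m))) K)"
    unfolding torsion_power S.L_def T.L_def .
  show "wild_group v (adjoin K (torsion \<phi> (\<pi> ^ m))) K \<cong> elementary_abelian p (s * m)"
    unfolding Lm by (rule S.wild_group_iso)
  show "adapted_basis k v \<phi> \<pi> m \<xi>" by (rule tower_adapted_basis[OF tw m(2)])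
  show "generated_by_sigmas k v (adjoin K (torsion \<phi> (\<pi> ^ m))) K m \<xi>"
    unfolding Lm by (rule S.generated_by_sigmas_wild[OF refl]) simp
qed

text \<open>\<open>m + 1\<close> is the least \<open>M\<close> with
  \<open>nu \<pi> * q ^ M < jv\<close>, and \<open>M \<ge> 2\<close> because
  \<open>jv < q * nu \<pi>\<close>. The boundary case \<open>jv = nu \<pi> * q ^ m\<close> would
  make \<open>p\<close> divide v(j). Monotonicity in the exponent excludes all other integers,
  negative ones included.\<close>

lemma critical_level:
  assumes al: "nu \<pi> < 0"
  shows "\<exists>m\<ge>1. jv < nu \<pi> * real q ^ m \<and> nu \<pi> * real q ^ Suc m < jv \<and>
    {z::int. jv \<in> {nu \<pi> * (real q powi (z + 1)) <..< nu \<pi> * (real q powi z)}} = {int m}"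
proof -
  have q1: "1 < real q" using Q_ge2 by simp
  obtain N where "jv / nu \<pi> < real q ^ N" using real_arch_pow[OF q1] by blast
  then have N: "nu \<pi> * real q ^ N < jv" using al by (simp add: field_simps neg_divide_less_eq)
  define M where "M = (LEAST N. nu \<pi> * real q ^ N < jv)"
  have M: "nu \<pi> * real q ^ M < jv" unfolding M_def by (rule LeastI[of _ N]) (rule N)
  have small: "jv \<le> nu \<pi> * real q ^ N" if "N < M" for N using not_less_Least[of N] that unfolding M_def by force
  have "jv < nu \<pi>"
  proof -
    have "real q * nu \<pi> \<le> 1 * nu \<pi>" using q1 al by (intro mult_right_mono_neg) auto
    then show ?thesis using jv_less by simp
  qed
  then have "M \<noteq> 0" using M by (intro notI) simp
  moreover have "M \<noteq> 1" using M jv_less by (intro notI) (simp add: mult.commute)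
  ultimately obtain m where m: "M = Suc m" "1 \<le> m" by (metis One_nat_def Suc_le_eq neq0_conv not0_implies_Suc)
  have "jv \<noteq> nu \<pi> * real q ^ m"
  proof
    assume e: "jv = nu \<pi> * real q ^ m"
    obtain z :: int where z: "jv = of_int z" "\<not> int p dvd z" using jv_int by blast
    obtain w :: int where w: "nu \<pi> = of_int w" using nu_K_int[OF piK] by blast
    have "real_of_int z = real_of_int (w * int q ^ m)" using e unfolding w z(1)[symmetric] by simp
    then have "z = w * int q ^ m" by (simp only: of_int_eq_iff)
    moreover have "int p dvd int q ^ m"
    proof -
      have "int q ^ m = int p ^ (s * m)" by (simp add: q_def power_mult)
      moreover have "s * m \<noteq> 0" using s_pos m(2) by simp
      ultimately show ?thesis by (simp add: dvd_power)
    qed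
    ultimately show False using z(2) by simp
  qed
  then have jm: "jv < nu \<pi> * real q ^ m" using small[of m] m(1) by simp
  have jm': "nu \<pi> * real q ^ Suc m < jv" using M unfolding m(1) .
  have e: "real q powi (int m + 1) = real q ^ Suc m"
    using power_int_of_nat[of "real q" "Suc m"] by (simp add: add.commute del: power_Suc power_int_of_nat)
  have "{z::int. jv \<in> {nu \<pi> * (real q powi (z + 1)) <..< nu \<pi> * (real q powi z)}} = {int m}"
  proof (rule Set.set_eqI, rule iffI)
    fix z assume "z \<in> {z::int. jv \<in> {nu \<pi> * (real q powi (z + 1)) <..< nu \<pi> * (real q powi z)}}"
    then have z: "nu \<pi> * (real q powi (z + 1)) < jv" "jv < nu \<pi> * (real q powi z)" by simp_all
    have a: "nu \<pi> * (real q powi i') \<le> nu \<pi> * (real q powi i)" if "i \<le> i'" for i i'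
      using power_int_increasing[OF that, of "real q"] q1 al by (intro mult_left_mono_neg) auto
    have "\<not> int m + 1 \<le> z" using a[of "int m + 1" z] z(2) jm' unfolding e by linarith
    moreover have "\<not> z + 1 \<le> int m" using a[of "z + 1" "int m"] z(1) jm by auto
    ultimately show "z \<in> {int m}" by simp
  next
    fix z assume "z \<in> {int m}"
    then show "z \<in> {z::int. jv \<in> {nu \<pi> * (real q powi (z + 1)) <..< nu \<pi> * (real q powi z)}}"
      using jm jm' by (simp add: e del: power_Suc)
  qed
  then show ?thesis using m(2) jm jm' by blast
qed

end

section \<open>Primes of the rational function field\<close>

lemma poly_subringI: "f \<in> polys_in k \<Longrightarrow> subfield k (Ksep :: 'a::field ring) \<Longrightarrow> poly f x \<in> poly_subring k x"
  unfolding poly_subring_def using polys_in_iff[OF subfieldD(2)] by blast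

lemma poly_subringE: "y \<in> poly_subring k x \<Longrightarrow> subfield k (Ksep :: 'a::field ring) \<Longrightarrow> \<exists>f\<in>polys_in k. y = poly f x"
  unfolding poly_subring_def using polys_in_iff[OF subfieldD(2)] by blast

lemma poly_subring_closed:
  assumes k: "subfield k (Ksep :: 'a::field ring)"
  shows "c \<in> k \<Longrightarrow> c \<in> poly_subring k x" "x \<in> poly_subring k x"
    "y \<in> poly_subring k x \<Longrightarrow> z \<in> poly_subring k x \<Longrightarrow> y + z \<in> poly_subring k x"
    "y \<in> poly_subring k x \<Longrightarrow> z \<in> poly_subring k x \<Longrightarrow> y * z \<in> poly_subring k x"
    "y \<in> poly_subring k x \<Longrightarrow> y ^ n \<in> poly_subring k x"
proof -
  note cl = polys_in_closed[OF k]
  show c: "c \<in> poly_subring k x" if "c \<in> k" for c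
    using poly_subringI[OF cl(6)[OF that cl(1)] k, of x] by simp
  show "x \<in> poly_subring k x"
    using poly_subringI[OF cl(6)[OF subfieldD(2)[OF k] cl(8)] k, of x] by simp
  show "y + z \<in> poly_subring k x" if yz: "y \<in> poly_subring k x" "z \<in> poly_subring k x" for y z
    using poly_subringE[OF yz(1) k] poly_subringE[OF yz(2) k] poly_subringI[OF cl(3) k, of _ _ x] by auto
  show m: "y * z \<in> poly_subring k x" if yz: "y \<in> poly_subring k x" "z \<in> poly_subring k x" for y z
    using poly_subringE[OF yz(1) k] poly_subringE[OF yz(2) k] poly_subringI[OF cl(5) k, of _ _ x] by auto
  show "y ^ n \<in> poly_subring k x" if y: "y \<in> poly_subring k x"
    by (induction n) (simp_all add: m y c subfieldD(1)[OF k])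
qed

lemma poly_subring_mono:
  assumes k: "subfield k (Ksep :: 'a::field ring)" and y: "y \<in> poly_subring k x"
  shows "poly_subring k y \<subseteq> poly_subring k x"
proof
  note cl = poly_subring_closed[OF k]
  fix z assume "z \<in> poly_subring k y"
  then obtain f where f: "f \<in> polys_in k" "z = poly f y" using poly_subringE[OF _ k] by blast
  have "f \<in> polys_in k \<Longrightarrow> poly f y \<in> poly_subring k x"
  proof (induction f)
    case 0
    show ?case using cl(1)[OF subfieldD(2)[OF k], of x] by simp
  next
    case (pCons c g)
    have "coeff (pCons c g) 0 \<in> k" "coeff (pCons c g) (Suc i) \<in> k" for i
      using pCons.prems unfolding polys_in_def by blast+
    then have "c \<in> k" "g \<in> polys_in k" by (simp_all add: polys_in_def)
    then show ?case using pCons.IH cl y by simp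
  qed
  then show "z \<in> poly_subring k x" using f by simp
qed

text \<open>Elements of \<open>k[w]\<close> are integral and congruent to their constant terms,
  which are 0 or units; positive valuation therefore means divisibility by \<open>w\<close>.\<close>

lemma lies_above_poly_subring:
  fixes v :: "'a::field \<Rightarrow> ereal"
  assumes val: "valuation v" and k: "subfield k (Ksep :: 'a ring)" and kv: "\<And>c. c \<in> k \<Longrightarrow> c \<noteq> 0 \<Longrightarrow> v c = 0"
    and w: "0 < v w"
  shows "lies_above v (poly_subring k w) w"
proof -
  interpret valued v by unfold_locales (rule val)
  have kv0: "0 \<le> v c" if "c \<in> k" for c using kv[OF that] by (cases "c = 0") auto
  have ge: "0 \<le> v a" if a: "a \<in> poly_subring k w" for a
  proof -
    obtain f where f: "f \<in> polys_in k" "a = poly f w" using poly_subringE[OF a k] by blast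
    show ?thesis unfolding f(2) using f(1) kv0 w by (intro v_poly_ge) (auto simp: polys_in_def)
  qed
  have "{a \<in> poly_subring k w. 0 < v a} = (\<lambda>a. w * a) ` poly_subring k w"
  proof
    show "(\<lambda>a. w * a) ` poly_subring k w \<subseteq> {a \<in> poly_subring k w. 0 < v a}"
      using poly_subring_closed(2,4)[OF k] v_mult_gt[OF w ge] by auto
    show "{a \<in> poly_subring k w. 0 < v a} \<subseteq> (\<lambda>a. w * a) ` poly_subring k w"
    proof
      fix a assume a: "a \<in> {a \<in> poly_subring k w. 0 < v a}"
      then obtain f where f: "f \<in> polys_in k" "a = poly f w" using poly_subringE[OF _ k] by blast
      obtain c g where fc: "f = pCons c g" by (rule pCons_cases)
      have c: "coeff f 0 \<in> k" "coeff f (Suc i) \<in> k" for i using f(1) by (auto simp: polys_in_def)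
      then have ck: "c \<in> k" and gk: "g \<in> polys_in k" unfolding fc by (simp_all add: polys_in_def)
      have g: "poly g w \<in> poly_subring k w" by (rule poly_subringI[OF gk k])
      have "a = c + w * poly g w" by (simp add: f fc)
      moreover have "0 < v (w * poly g w)" using v_mult_gt[OF w ge[OF g]] .
      ultimately have "0 < v c" using a v_diff_gt[of 0 a "w * poly g w"] by simp
      then have "c = 0" using kv[OF ck] by (cases "c = 0") simp_all
      then show "a \<in> (\<lambda>a. w * a) ` poly_subring k w" using g f fc by auto
    qed
  qed
  then show ?thesis using ge unfolding lies_above_def by blast
qed

context local_field
begin

text \<open>For \<open>t = 0\<close> the polynomials 0 and \<open>X\<close>, that is the lists
  \<open>[]\<close> and \<open>[1, 0]\<close>, would have the same value at \<open>t\<close>,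
  against transcendence.\<close>

lemma t_nonzero: "t \<noteq> 0"
proof
  assume t0: "t = 0"
  have inj: "inj_on (\<lambda>p. ring.eval Ksep p t) (carrier (univ_poly Ksep k))"
    using ff unfolding function_field_def ring.transcendental_def[OF ring_from_type_algebra] by blast
  have z: "\<zero>\<^bsub>Ksep\<^esub> = (0 :: 'a)" by (simp add: ring_of_type_algebra_def)
  have "[] \<in> carrier (univ_poly Ksep k)" "[1, 0] \<in> carrier (univ_poly Ksep k)"
    using subfieldD(1,2)[OF sfk] by (simp_all add: univ_poly_carrier[symmetric] polynomial_def z)
  moreover have "ring.eval Ksep [] t = ring.eval Ksep [1, 0] t" by (simp add: Ksep_eval t0)
  ultimately show False using inj_onD[OF inj, of "[]" "[1, 0]"] by simp
qed

lemma infinite_prime_iff: "infinite_prime v k t \<longleftrightarrow> v t < 0"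
proof -
  have w: "0 < v (1 / t) \<longleftrightarrow> v t < 0"
    using t_nonzero by (simp add: v_nu nu_divide)
  have "0 < v (1 / t)" if "infinite_prime v k t"
  proof -
    have "1 / t * 1 \<in> (\<lambda>a. 1 / t * a) ` poly_subring k (1 / t)"
      by (intro imageI poly_subring_closed(1)[OF sfk] subfieldD(1)[OF sfk])
    then show ?thesis using that unfolding infinite_prime_def lies_above_def by auto
  qed
  moreover have "infinite_prime v k t" if "0 < v (1 / t)"
    unfolding infinite_prime_def by (rule lies_above_poly_subring[OF val sfk k_v(1) that])
  ultimately show ?thesis using w by blast
qed

text \<open>For infinite \<open>v\<close> the constant \<open>d\<close> is negligible against
  \<open>c * t\<close>. For finite \<open>v\<close>, the rings generated by \<open>c * t + d\<close>
  and by \<open>t\<close> coincide, so a positive valuation would put \<open>v\<close> above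
  \<open>c * t + d\<close>.\<close>

lemma linear_value:
  assumes cd: "c \<in> k" "c \<noteq> 0" "d \<in> k"
  shows "v t < 0 \<Longrightarrow> v (c * t + d) = v t"
    "0 \<le> v t \<Longrightarrow> \<not> lies_above v (poly_subring k t) (c * t + d) \<Longrightarrow> v (c * t + d) = 0"
proof -
  have ct: "v (c * t) = v t" using k_v(1)[OF cd(1,2)] by (simp add: v_mult)
  show "v (c * t + d) = v t" if t: "v t < 0"
    using v_add_eq[of "c * t" d] k_v(2)[OF cd(3)] t ct by simp
  assume t: "0 \<le> v t" and la: "\<not> lies_above v (poly_subring k t) (c * t + d)"
  note cl = poly_subring_closed[OF sfk]
  have "c * t + d \<in> poly_subring k t" by (rule cl(3)[OF cl(4)[OF cl(1)[OF cd(1)] cl(2)] cl(1)[OF cd(3)]])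
  then have 1: "poly_subring k (c * t + d) \<subseteq> poly_subring k t" by (rule poly_subring_mono[OF sfk])
  have "inverse c * (c * t + d) + (- (inverse c * d)) \<in> poly_subring k (c * t + d)"
    by (rule cl(3)[OF cl(4)[OF cl(1) cl(2)] cl(1)]) (simp_all add: cd subfieldD[OF sfk])
  moreover have "inverse c * (c * t + d) + (- (inverse c * d)) = t" using cd(2) by (simp add: field_simps)
  ultimately have 2: "poly_subring k t \<subseteq> poly_subring k (c * t + d)" by (metis poly_subring_mono[OF sfk])
  have "\<not> 0 < v (c * t + d)"
  proof
    assume pos: "0 < v (c * t + d)"
    have "lies_above v (poly_subring k (c * t + d)) (c * t + d)"
      by (rule lies_above_poly_subring[OF val sfk k_v(1) pos])
    then show False using la 1 2 by (simp add: subset_antisym)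
  qed
  moreover have "0 \<le> v (c * t + d)" using ct t k_v(2)[OF cd(3)] by (intro v_add_ge) simp_all
  ultimately show "v (c * t + d) = 0" by simp
qed

text \<open>Composition with \<open>\<phi> c\<close> merely scales by \<open>c\<close>, and
  \<open>\<phi> d\<close> affects only the linear term; hence the coefficients \<open>c * a1\<close>
  and \<open>c * a2\<close>.\<close>

lemma drinfeld_linear:
  assumes dr: "drinfeld_module_rank2 k t K a1 a2 \<phi>" and cd: "c \<in> k" "d \<in> k"
  shows "\<phi> (c * t + d) = monom (c * t + d) 1 + monom (c * a1) (card k) + monom (c * a2) ((card k)\<^sup>2)"
proof -
  note cl = poly_subring_closed[OF sfk, where x = t]
  have phi: "\<phi> t = monom t 1 + monom a1 (card k) + monom a2 ((card k)\<^sup>2)" "\<phi> c = monom c 1" "\<phi> d = monom d 1"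
    "\<phi> (c * t + d) = \<phi> (c * t) + \<phi> d" "\<phi> (c * t) = pcompose (\<phi> c) (\<phi> t)"
    using dr cd cl(1)[OF cd(1)] cl(1)[OF cd(2)] cl(2) cl(4)[OF cl(1)[OF cd(1)] cl(2)]
    unfolding drinfeld_module_rank2_def by blast+
  have "pcompose (monom c 1) g = smult c g" for g by (simp add: monom_altdef pcompose_pCons)
  then show ?thesis unfolding phi(4,5) unfolding phi(1-3)
    by (simp add: smult_add_right smult_monom add_monom[symmetric])
qed

text \<open>Multiplication in \<open>k[t]\<close> becomes composition, so powers of \<open>w\<close>
  become iterates; torsion is thereby expressed through a single polynomial map.\<close>

lemma drinfeld_torsion_power:
  assumes dr: "drinfeld_module_rank2 k t K a1 a2 \<phi>" and w: "w \<in> poly_subring k t"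
  shows "torsion \<phi> (w ^ m) = {x. (poly (\<phi> w) ^^ m) x = 0}"
proof -
  have "poly (\<phi> (w ^ m)) x = (poly (\<phi> w) ^^ m) x" for x
  proof (induction m)
    case 0
    have "\<phi> 1 = monom 1 1" using dr subfieldD(1)[OF sfk] unfolding drinfeld_module_rank2_def by blast
    then show ?case by (simp add: poly_monom)
  next
    case (Suc m)
    have "\<phi> (w * w ^ m) = pcompose (\<phi> w) (\<phi> (w ^ m))"
      using dr w poly_subring_closed(5)[OF sfk w] unfolding drinfeld_module_rank2_def by blast
    then show ?case using Suc.IH by (simp add: poly_pcompose)
  qed
  then show ?thesis by (simp add: torsion_def)
qed

end

theorem mainTheorem1:
  fixes p s q n :: nat
    and k F K :: "'a::field set"
    and t \<pi> a1 a2 j :: 'a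
    and v :: "'a \<Rightarrow> ereal"
    and \<phi> :: "'a \<Rightarrow> 'a poly"
  assumes "Factorial_Ring.prime p" and "0 < s" and "q = p ^ s" and "card k = q"
    and "function_field k t F"
    and "valuation v" and "normalized_on v F"
    and "is_completion v F K"
    and "UNIV_is_separable_closure_of K"
    and "0 < n"
    and "drinfeld_module_rank2 k t K a1 a2 \<phi>"
    and "j = a1 ^ (q + 1) / a2"
    and "degree_one_in k t \<pi>"
    and "\<not> lies_above v (poly_subring k t) \<pi>"
    and "infinite_prime v k t \<Longrightarrow> int_val_coprime p (v j) \<and> v j < v \<pi> * ereal (real q)"
    and "\<not> infinite_prime v k t \<Longrightarrow> q \<noteq> 2 \<and> int_val_coprime p (v j) \<and> v j < 0"
  shows "(\<exists>\<xi>. adapted_basis k v \<phi> \<pi> n \<xi>) \<and>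
    (\<forall>\<xi>. adapted_basis k v \<phi> \<pi> n \<xi> \<longrightarrow>
      (infinite_prime v k t \<longrightarrow>
        (\<exists>m::nat.
          {z::int. v j \<in> {v \<pi> * ereal (real q powi (z + 1)) <..< v \<pi> * ereal (real q powi z)}}
            = {int m} \<and>
          (m \<le> n \<longrightarrow>
            (let Ln = adjoin K (torsion \<phi> (\<pi> ^ n)); Lm = adjoin K (torsion \<phi> (\<pi> ^ m)) in
              (\<lambda>\<sigma> \<in> carrier (wild_group v Ln K). restrict \<sigma> Lm)
                \<in> iso (wild_group v Ln K) (wild_group v Lm K) \<and>
              wild_group v Lm K \<cong> elementary_abelian p (s * m) \<and>
              adapted_basis k v \<phi> \<pi> m \<xi> \<and>
              generated_by_sigmas k v Lm K m \<xi>)))) \<and>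
      (\<not> infinite_prime v k t \<longrightarrow>
        (let Ln = adjoin K (torsion \<phi> (\<pi> ^ n)) in
          wild_group v Ln K \<cong> elementary_abelian p (s * n) \<and>
          generated_by_sigmas k v Ln K n \<xi>)))"
proof -
  have compl: "subfield K Ksep" "F \<subseteq> K" "\<forall>x\<in>K. \<forall>N::real. \<exists>y\<in>F. v (x - y) > ereal N"
    "\<And>c::nat \<Rightarrow> 'a. (\<forall>i. c i \<in> K) \<Longrightarrow> (\<forall>N::real. \<exists>M. \<forall>i\<ge>M. \<forall>j\<ge>M. v (c i - c j) > ereal N) \<Longrightarrow>
       \<exists>x\<in>K. \<forall>N::real. \<exists>M. \<forall>i\<ge>M. v (c i - x) > ereal N"
    using assms(8) unfolding is_completion_def by blast+
  have cv: "complete_valued v K"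
    by (rule complete_valued.intro[OF valued.intro[OF assms(6)] complete_valued_axioms.intro[OF compl(1) assms(9) compl(4)]])
  have ck: "card k = p ^ s" using assms(3,4) by simp
  interpret local_field v K p s k F t
    by (rule local_field.intro[OF cv local_field_axioms.intro[OF assms(1,2) ck assms(5,7) compl(2,3)]])
  obtain g where g: "set (coeffs g) \<subseteq> k" "Polynomial.degree g = 1" "\<pi> = poly g t"
    using assms(13) unfolding degree_one_in_def by blast
  define c d where "c = coeff g 1" and "d = coeff g 0"
  have gk: "coeff g i \<in> k" for i
    using g(1) polys_in_iff[OF subfieldD(2)[OF sfk], of g] by (simp add: polys_in_def)
  have cd: "c \<in> k" "c \<noteq> 0" "d \<in> k"
    using gk g(2) leading_coeff_0_iff[of g] by (auto simp: c_def d_def)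
  have pi: "\<pi> = c * t + d" unfolding g(3) poly_altdef g(2) by (simp add: c_def d_def)
  have dr: "a1 \<in> K" "a2 \<in> K" "a2 \<noteq> 0" using assms(11) by (auto simp: drinfeld_module_rank2_def)
  have vpi: "infinite_prime v k t \<Longrightarrow> v \<pi> < 0 \<and> \<pi> \<noteq> 0" "\<not> infinite_prime v k t \<Longrightarrow> v \<pi> = 0 \<and> \<pi> \<noteq> 0"
    using linear_value[OF cd] assms(14) unfolding infinite_prime_iff pi[symmetric] by (auto simp: not_less)
  then have pi0: "\<pi> \<noteq> 0" by blast
  have nupi: "infinite_prime v k t \<Longrightarrow> nu \<pi> < 0" "\<not> infinite_prime v k t \<Longrightarrow> nu \<pi> = 0"
    using vpi v_nu[OF pi0] by auto
  obtain J :: int where J: "v j = ereal (of_int J)" "\<not> int p dvd J"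
    using assms(15,16) unfolding int_val_coprime_def by blast
  \<comment> \<open>v(j) is an integer and so finite; hence j and with it \<open>a1\<close> are
    nonzero, and the middle term of \<phi>_\<pi> is really present.\<close>
  have j0: "j \<noteq> 0" using J(1) by auto
  then have a1: "a1 \<noteq> 0" using assms(12) by auto
  \<comment> \<open>The factor \<open>c\<close> from \<pi> = c t + d has valuation 0 and drops out,
    so the expression \<open>jv\<close> of the general setting is v(j).\<close>
  have nuj: "nu j = (real q + 1) * nu (c * a1) - nu (c * a2)"
  proof -
    have "nu c = 0" using k_v(1)[OF cd(1,2)] v_nu[OF cd(2)] by simp
    then show ?thesis unfolding assms(12) using a1 dr(3) cd(2)
      by (simp add: nu_divide nu_power nu_mult del: power_Suc)
  qed
  have vj: "v j = ereal (nu j)" by (rule v_nu[OF j0])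
  have "nu j = of_int J" using J(1) vj by simp
  interpret drinfeld v K p s k F t \<pi> "c * a1" "c * a2" q
  proof
    show "q = p ^ s" by (fact assms(3))
    have cK: "c \<in> K" "d \<in> K" using cd kK by blast+
    show "\<pi> \<in> K" unfolding pi using cK tK subfieldD(3,4)[OF sfK] by blast
    show "\<pi> \<noteq> 0" "c * a1 \<noteq> 0" "c * a2 \<noteq> 0" using pi0 a1 cd(2) dr(3) by simp_all
    show "c * a1 \<in> K" "c * a2 \<in> K" using cK dr subfieldD(4)[OF sfK] by blast+
    show "nu \<pi> \<le> 0" using nupi by fastforce
    show "(real q + 1) * nu (c * a1) - nu (c * a2) < real q * nu \<pi>"
    proof (cases "infinite_prime v k t")
      case True
      then have "v j < v \<pi> * ereal (real q)" using assms(15) by blast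
      then show ?thesis unfolding nuj[symmetric] vj v_nu[OF pi0] by (simp add: mult.commute)
    next
      case False
      then have "v j < 0" using assms(16) by blast
      then show ?thesis unfolding nuj[symmetric] vj nupi(2)[OF False] by simp
    qed
    show "\<exists>z::int. (real q + 1) * nu (c * a1) - nu (c * a2) = of_int z \<and> \<not> int p dvd z"
      using J(2) \<open>nu j = of_int J\<close> unfolding nuj by blast
  qed
  have phi_pi: "\<phi> \<pi> = fpoly"
    using drinfeld_linear[OF assms(11) cd(1,3)] unfolding pi[symmetric] assms(4) fpoly_def .
  interpret drinfeld_phi v K p s k F t \<pi> "c * a1" "c * a2" q \<phi>
  proof
    show "\<phi> \<pi> = fpoly" by (rule phi_pi)
    have "\<pi> \<in> poly_subring k t" unfolding g(3) poly_subring_def using g(1) by blast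
    moreover have "poly (\<phi> \<pi>) = f" by (rule ext) (simp add: phi_pi poly_fpoly)
    ultimately show "torsion \<phi> (\<pi> ^ m) = {x. (f ^^ m) x = 0}" for m
      using drinfeld_torsion_power[OF assms(11), of \<pi> m] by simp
  qed
  have "\<exists>\<xi>. adapted_basis k v \<phi> \<pi> n \<xi>"
    using tower_exists[OF assms(10)] tower_adapted_basis by blast
  moreover have "\<exists>m::nat.
          {z::int. v j \<in> {v \<pi> * ereal (real q powi (z + 1)) <..< v \<pi> * ereal (real q powi z)}}
            = {int m} \<and>
          (m \<le> n \<longrightarrow>
            (let Ln = adjoin K (torsion \<phi> (\<pi> ^ n)); Lm = adjoin K (torsion \<phi> (\<pi> ^ m)) in
              (\<lambda>\<sigma> \<in> carrier (wild_group v Ln K). restrict \<sigma> Lm)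
                \<in> iso (wild_group v Ln K) (wild_group v Lm K) \<and>
              wild_group v Lm K \<cong> elementary_abelian p (s * m) \<and>
              adapted_basis k v \<phi> \<pi> m \<xi> \<and>
              generated_by_sigmas k v Lm K m \<xi>))"
    if ad: "adapted_basis k v \<phi> \<pi> n \<xi>" and inf: "infinite_prime v k t" for \<xi>
  proof -
    obtain m where m: "1 \<le> m" "jv < nu \<pi> * real q ^ m" "nu \<pi> * real q ^ Suc m < jv"
      "{z::int. jv \<in> {nu \<pi> * (real q powi (z + 1)) <..< nu \<pi> * (real q powi z)}} = {int m}"
      using critical_level[OF nupi(1)[OF inf]] by blast
    have "{z::int. v j \<in> {v \<pi> * ereal (real q powi (z + 1)) <..< v \<pi> * ereal (real q powi z)}} = {int m}"
      unfolding m(4)[symmetric] nuj[symmetric] vj v_nu[OF pi0] by simp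
    then show ?thesis
      using infinite_case[OF nupi(1)[OF inf] m(1) _ m(2,3) ad] unfolding Let_def by blast
  qed
  moreover have "let Ln = adjoin K (torsion \<phi> (\<pi> ^ n)) in
          wild_group v Ln K \<cong> elementary_abelian p (s * n) \<and>
          generated_by_sigmas k v Ln K n \<xi>"
    if ad: "adapted_basis k v \<phi> \<pi> n \<xi>" and fin: "\<not> infinite_prime v k t" for \<xi>
    unfolding Let_def using finite_case[OF nupi(2)[OF fin] assms(10) ad] by blast
  ultimately show ?thesis by blast
qed

end
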